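(* Let $1<p\le 2$, let $k\ge 1$, and let $(f,g)\in C_0^3(\mathbb{R}^2)\times C_0^2(\mathbb{R}^2)$ satisfy $\mathrm{supp}(f,g)\subset\{x\in\mathbb{R}^2 : |x|\le k\}$. Then there exist a positive constant $\varepsilon_0=\varepsilon_0(f,g,p,k)$ and a positive constant $c$ independent of $\varepsilon$ such that, for every $0<\varepsilon\le\varepsilon_0$ and every $T>0$ satisfying $$ T\le\begin{cases} c\,\varepsilon^{-(p-1)/(4-2p)} & \text{if } 1<p<2,\\ \exp(c\,\varepsilon^{-1/2}) & \text{if } p=2,\end{cases} $$ the following holds: if $p=2$, the initial value problem (P) admits a unique solution $u\in C^2(\mathbb{R}^2\times[0,T))$; if $1<p<2$, the integral equation (I) associated with (P) admits a unique solution $u\in C^1(\mathbb{R}^2\times[0,T))$.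
   Context: Problem (P) is the two-dimensional initial value problem $$ u_{tt}-\Delta u=\frac{|u|^p}{(1+t)^{p-1}}\ \text{ in }\mathbb{R}^2\times[0,T),\qquad u(x,0)=\varepsilon f(x),\quad u_t(x,0)=\varepsilon\{f(x)+g(x)\},\ x\in\mathbb{R}^2 . $$ (It arises via $u=(1+t)v$ from $v_{tt}-\Delta v+\frac{2}{1+t}v_t=|v|^p$, $v(x,0)=\varepsilon f(x)$, $v_t(x,0)=\varepsilon g(x)$.) The associated integral equation (I) is $$u(x,t)=\varepsilon u_L(x,t)+L(|u|^p)(x,t),\qquad (x,t)\in\mathbb{R}^2\times[0,T),$$ where $$u_L(x,t)=\frac{\partial}{\partial t}R(f|x,t)+R(f+g|x,t),\qquad R(\phi|x,t)=\frac{t}{2\pi}\int_{|\xi|\le1}\frac{\phi(x+t\xi)}{\sqrt{1-|\xi|^2}}\,d\xi,$$ and $$L(F)(x,t)=\frac1{2\pi}\int_0^t\frac{t-\tau}{(1+\tau)^{p-1}}\,d\tau\int_{|\xi|\le1}\frac{F(x+(t-\tau)\xi,\tau)}{\sqrt{1-|\xi|^2}}\,d\xi .$$ *)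

theory Defs
  imports "HOL-Analysis.Analysis"
begin

text \<open>
  Functions of class \<open>C\<^sup>m\<close> on \<open>S\<close>.  The derivatives are taken within \<open>S\<close>, so for
  \<open>S = \<real>\<^sup>2 \<times> [0,T)\<close> they are one-sided in time at \<open>t = 0\<close>.  The definition is meant for sets
  on which the derivative within \<open>S\<close> is unique, such as \<open>UNIV\<close> and \<open>\<real>\<^sup>2 \<times> [0,T)\<close> with \<open>T > 0\<close>.
\<close>

primrec C_on :: "nat \<Rightarrow> 'a::euclidean_space set \<Rightarrow> ('a \<Rightarrow> real) \<Rightarrow> bool" where
  "C_on 0 S f \<longleftrightarrow> continuous_on S f"
| "C_on (Suc m) S f \<longleftrightarrow>
     (\<exists>f'. (\<forall>z\<in>S. (f has_derivative f' z) (at z within S)) \<and>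
           (\<forall>b\<in>Basis. C_on m S (\<lambda>z. f' z b)))"

definition supp :: "('a::topological_space \<Rightarrow> 'b::zero) \<Rightarrow> 'a set" where
  "supp f = closure {x. f x \<noteq> 0}"

definition C0 :: "nat \<Rightarrow> ('a::euclidean_space \<Rightarrow> real) \<Rightarrow> bool" where
  "C0 m f \<longleftrightarrow> C_on m UNIV f \<and> compact (supp f)"

definition spacetime :: "real \<Rightarrow> ((real^2) \<times> real) set" where
  "spacetime T = UNIV \<times> {0..<T}"

definition dt :: "real \<Rightarrow> ((real^2) \<times> real \<Rightarrow> real) \<Rightarrow> (real^2) \<times> real \<Rightarrow> real" where
  "dt T u = (\<lambda>(x, t). vector_derivative (\<lambda>s. u (x, s)) (at t within {0..<T}))"

definition dx :: "2 \<Rightarrow> ((real^2) \<times> real \<Rightarrow> real) \<Rightarrow> (real^2) \<times> real \<Rightarrow> real" where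
  "dx i u = (\<lambda>(x, t). deriv (\<lambda>h. u (x + h *\<^sub>R axis i 1, t)) 0)"

definition laplacian :: "((real^2) \<times> real \<Rightarrow> real) \<Rightarrow> (real^2) \<times> real \<Rightarrow> real" where
  "laplacian u z = (\<Sum>i\<in>UNIV. dx i (dx i u) z)"

definition solves_P ::
  "real \<Rightarrow> real \<Rightarrow> (real^2 \<Rightarrow> real) \<Rightarrow> (real^2 \<Rightarrow> real) \<Rightarrow> real \<Rightarrow> ((real^2) \<times> real \<Rightarrow> real) \<Rightarrow> bool" where
  "solves_P p \<epsilon> f g T u \<longleftrightarrow>
     (\<forall>x. \<forall>t\<in>{0..<T}. dt T (dt T u) (x, t) - laplacian u (x, t)
                        = \<bar>u (x, t)\<bar> powr p / (1 + t) powr (p - 1)) \<and>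
     (\<forall>x. u (x, 0) = \<epsilon> * f x) \<and>
     (\<forall>x. dt T u (x, 0) = \<epsilon> * (f x + g x))"

text \<open>
  On the unit circle the integrands below divide by \<open>sqrt 0\<close>; this null set does not affect
  the integrals.
\<close>

definition wave_R :: "(real^2 \<Rightarrow> real) \<Rightarrow> real^2 \<Rightarrow> real \<Rightarrow> real" where
  "wave_R \<phi> x t = t / (2 * pi) *
     (LINT \<xi>:cball 0 1|lborel. \<phi> (x + t *\<^sub>R \<xi>) / sqrt (1 - (norm \<xi>)\<^sup>2))"

text \<open>
  The formula for \<open>wave_R\<close> makes sense for all real times and is odd in \<open>t\<close>, so for \<open>C\<^sup>1\<close> data the
  two-sided derivative at \<open>t = 0\<close> exists and is the one-sided one.
\<close>

definition u_L :: "(real^2 \<Rightarrow> real) \<Rightarrow> (real^2 \<Rightarrow> real) \<Rightarrow> real^2 \<Rightarrow> real \<Rightarrow> real" where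
  "u_L f g x t = deriv (\<lambda>s. wave_R f x s) t + wave_R (\<lambda>y. f y + g y) x t"

definition wave_L :: "real \<Rightarrow> ((real^2) \<times> real \<Rightarrow> real) \<Rightarrow> real^2 \<Rightarrow> real \<Rightarrow> real" where
  "wave_L p F x t = 1 / (2 * pi) *
     (LINT \<tau>:{0..t}|lborel. (t - \<tau>) / (1 + \<tau>) powr (p - 1) *
        (LINT \<xi>:cball 0 1|lborel. F (x + (t - \<tau>) *\<^sub>R \<xi>, \<tau>) / sqrt (1 - (norm \<xi>)\<^sup>2)))"

definition solves_I ::
  "real \<Rightarrow> real \<Rightarrow> (real^2 \<Rightarrow> real) \<Rightarrow> (real^2 \<Rightarrow> real) \<Rightarrow> real \<Rightarrow> ((real^2) \<times> real \<Rightarrow> real) \<Rightarrow> bool" where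
  "solves_I p \<epsilon> f g T u \<longleftrightarrow>
     (\<forall>x. \<forall>t\<in>{0..<T}. u (x, t) = \<epsilon> * u_L f g x t + wave_L p (\<lambda>z. \<bar>u z\<bar> powr p) x t)"

text \<open>
  Functions on \<open>D\<close> are represented by total functions; uniqueness therefore means equality on \<open>D\<close>.
\<close>

definition ex1_on :: "'a set \<Rightarrow> (('a \<Rightarrow> 'b) \<Rightarrow> bool) \<Rightarrow> bool" where
  "ex1_on D P \<longleftrightarrow> (\<exists>u. P u \<and> (\<forall>v. P v \<longrightarrow> (\<forall>z\<in>D. v z = u z)))"

end

theory Submission
  imports Defs
begin

text \<open>
  Write \<open>\<mu>\<close> for the probability measure on the unit disc with density \<open>1 / (2 \<pi> sqrt (1 - |\<xi>|\<^sup>2))\<close>.  A divergence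
  identity for \<open>\<mu>\<close> (the Euler--Poisson--Darboux equation for disc means) shows that the retarded potential \<open>duh F\<close>
  inverts the wave operator with zero data, and gives the representation formula for \<open>C\<^sup>2\<close> functions; hence
  (P) and (I) agree for \<open>C\<^sup>2\<close> functions.  Explicit supersolutions in \<open>\<tau> = t + k + 2\<close> and \<open>q = \<tau> - |x|\<^sup>2 / \<tau>\<close>,
  together with positivity of the retarded potential, bound \<open>u\<^sub>L\<close> by a multiple of
  \<open>w = (q \<tau>) powr (-1/2)\<close> and show that the Picard iterates of (I) stay below \<open>2 A \<epsilon> w\<close> up to the asserted lifespan.
  On a fixed time interval the iterates and their spatial gradients converge geometrically in a norm weighted by
  \<open>exp (\<gamma> t)\<close>; the same weight on backward cones gives uniqueness.  For \<open>p = 2\<close> the gradient solves a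
  linear integral equation with \<open>C\<^sup>1\<close> coefficients, so it is itself continuously differentiable in space.
\<close>

section \<open>Functions of class C^m\<close>

text \<open>The disc weight blows up on the unit circle. Apart from the regularised computation
  behind the divergence identity it is never differentiated: derivatives fall on the source, and the
  second radial derivatives that then appear are turned into Laplacians. The source time is frozen
  in the integrand, so only space derivatives of sources occur. The nonlinearity limits the
  regularity. For p < 2 its derivative is merely Hoelder continuous of order p - 1. Gradients of
  Picard iterates then converge at the slower ratio \<open>(1/2) powr (p - 1)\<close>, and
  differentiating once more is out of reach; hence C^1 and (I). For p = 2 the derivative is
  \<open>2 * a / (1 + t)\<close>, linear in a. Since q \<tau> = \<tau>^2 - |x|^2, the weight w is
  the Lorentz-invariant free wave. An amplitude E of w produces a nonlinear response of order
  \<open>E powr p * T powr (2 * (2 - p))\<close>; balancing this against E, with E of order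
  \<epsilon>, gives the exponent (p - 1)/(4 - 2p). At p = 2 the power of T degenerates to a squared
  logarithm.\<close>

lemma C_on_SucE:
  assumes "C_on (Suc m) S f"
  obtains f' where "\<And>z. z \<in> S \<Longrightarrow> (f has_derivative f' z) (at z within S)"
    and "\<And>b. b \<in> Basis \<Longrightarrow> C_on m S (\<lambda>z. f' z b)"
proof -
  from assms obtain f' where "\<forall>z\<in>S. (f has_derivative f' z) (at z within S)"
    and "\<forall>b\<in>Basis. C_on m S (\<lambda>z. f' z b)"
    unfolding C_on.simps by (elim exE conjE)
  then show thesis by (intro that[of f']) (erule (1) bspec)+
qed

lemma C_on_SucI:
  assumes "\<And>z. z \<in> S \<Longrightarrow> (f has_derivative f' z) (at z within S)"
    and "\<And>b. b \<in> Basis \<Longrightarrow> C_on m S (\<lambda>z. f' z b)"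
  shows "C_on (Suc m) S f"
  unfolding C_on.simps by (intro exI[of _ f'] conjI ballI assms)

text \<open>On a Euclidean space a linear functional is the inner product with the vector of its
  values on \<open>Basis\<close>. Derivatives are handled from here on through such gradient fields,
  because their components are again scalar functions to which \<open>C_on\<close> applies.\<close>

lemma C_on_Suc_grad:
  assumes "C_on (Suc m) S f"
  obtains G where "\<And>z. z \<in> S \<Longrightarrow> (f has_derivative (\<lambda>h. G z \<bullet> h)) (at z within S)"
    and "\<And>b. b \<in> Basis \<Longrightarrow> C_on m S (\<lambda>z. G z \<bullet> b)"
proof -
  obtain f' where f': "\<And>z. z \<in> S \<Longrightarrow> (f has_derivative f' z) (at z within S)"
    and b: "\<And>b. b \<in> Basis \<Longrightarrow> C_on m S (\<lambda>z. f' z b)"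
    using assms by (rule C_on_SucE) blast
  define G where "G z = (\<Sum>b\<in>Basis. f' z b *\<^sub>R b)" for z
  have Gb: "G z \<bullet> b = f' z b" if "b \<in> Basis" for z b
    using that by (simp add: G_def inner_sum_left inner_Basis if_distrib cong: if_cong)
  have "f' z = (\<lambda>h. G z \<bullet> h)" if "z \<in> S" for z
  proof
    fix h
    have "linear (f' z)" using f'[OF that] has_derivative_linear by blast
    then have "f' z h = (\<Sum>b\<in>Basis. (h \<bullet> b) *\<^sub>R f' z b)"
      by (subst (1) euclidean_representation[of h, symmetric]) (simp only: linear_sum linear_cmul)
    then show "f' z h = G z \<bullet> h"
      by (simp add: G_def inner_sum_left inner_sum_right inner_commute mult.commute)
  qed
  with f' have "\<And>z. z \<in> S \<Longrightarrow> (f has_derivative (\<lambda>h. G z \<bullet> h)) (at z within S)" by simp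
  moreover have "\<And>b. b \<in> Basis \<Longrightarrow> C_on m S (\<lambda>z. G z \<bullet> b)" using b Gb by simp
  ultimately show thesis using that by blast
qed

lemma C_on_cong:
  assumes "C_on m S f" and "\<And>z. z \<in> S \<Longrightarrow> g z = f z"
  shows "C_on m S g"
proof (cases m)
  case 0
  then show ?thesis using assms continuous_on_cong by fastforce
next
  case (Suc n)
  with assms(1) have "C_on (Suc n) S f" by simp
  then obtain f' where f': "\<And>z. z \<in> S \<Longrightarrow> (f has_derivative f' z) (at z within S)"
    and b: "\<And>b. b \<in> Basis \<Longrightarrow> C_on n S (\<lambda>z. f' z b)"
    by (rule C_on_SucE) blast
  have "(g has_derivative f' z) (at z within S)" if "z \<in> S" for z
    by (rule has_derivative_transform[OF that assms(2) f'[OF that]])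
  then show ?thesis unfolding Suc using b by (rule C_on_SucI)
qed

lemma C_on_imp_continuous_on: "C_on m S f \<Longrightarrow> continuous_on S f"
  by (cases m) (auto intro: has_derivative_continuous_on)

lemma C_on_SucD: "C_on (Suc m) S f \<Longrightarrow> C_on m S f"
proof (induction m arbitrary: f)
  case 0
  then show ?case by (metis C_on.simps(1) C_on_imp_continuous_on)
next
  case (Suc m)
  from Suc.prems(1) obtain f' where f': "\<And>z. z \<in> S \<Longrightarrow> (f has_derivative f' z) (at z within S)"
    and b: "\<And>b. b \<in> Basis \<Longrightarrow> C_on (Suc m) S (\<lambda>z. f' z b)"
    by (rule C_on_SucE) blast
  show ?case by (rule C_on_SucI[OF f']) (assumption, rule Suc.IH[OF b])
qed

lemma C_on_mono: "n \<le> m \<Longrightarrow> C_on m S f \<Longrightarrow> C_on n S f"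
proof (induction rule: dec_induct)
  case (step m)
  show ?case by (rule step.IH, rule C_on_SucD, rule step.prems)
qed

lemma C_on_subset: "C_on m S f \<Longrightarrow> T \<subseteq> S \<Longrightarrow> C_on m T f"
proof (induction m arbitrary: f)
  case 0
  then show ?case using continuous_on_subset by auto
next
  case (Suc m)
  from Suc.prems(1) obtain f' where f': "\<And>z. z \<in> S \<Longrightarrow> (f has_derivative f' z) (at z within S)"
    and b: "\<And>b. b \<in> Basis \<Longrightarrow> C_on m S (\<lambda>z. f' z b)"
    by (rule C_on_SucE) blast
  show ?case
  proof (rule C_on_SucI)
    show "(f has_derivative f' z) (at z within T)" if "z \<in> T" for z
      using f'[of z] Suc.prems(2) that has_derivative_subset by blast
    show "C_on m T (\<lambda>z. f' z b)" if "b \<in> Basis" for b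
      by (rule Suc.IH[OF b[OF that] Suc.prems(2)])
  qed
qed

lemma C_on_const: "C_on m S (\<lambda>_. c)"
proof (induction m arbitrary: c)
  case (Suc m)
  show ?case
    by (rule C_on_SucI[where f'="\<lambda>_ _. 0"]) (rule has_derivative_const, rule Suc.IH)
qed simp

lemma C_on_linear:
  assumes "bounded_linear f"
  shows "C_on m S f"
proof (cases m)
  case 0
  then show ?thesis using assms linear_continuous_on by auto
next
  case (Suc n)
  show ?thesis unfolding Suc
    by (rule C_on_SucI[where f'="\<lambda>_. f"]) (use assms bounded_linear_imp_has_derivative in blast, rule C_on_const)
qed

lemma C_on_add: "C_on m S f \<Longrightarrow> C_on m S g \<Longrightarrow> C_on m S (\<lambda>z. f z + g z)"
proof (induction m arbitrary: f g)
  case 0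
  then show ?case by (auto intro: continuous_intros)
next
  case (Suc m)
  from Suc.prems(1) obtain f' where f': "\<And>z. z \<in> S \<Longrightarrow> (f has_derivative f' z) (at z within S)"
    and fb: "\<And>b. b \<in> Basis \<Longrightarrow> C_on m S (\<lambda>z. f' z b)" by (rule C_on_SucE) blast
  from Suc.prems(2) obtain g' where g': "\<And>z. z \<in> S \<Longrightarrow> (g has_derivative g' z) (at z within S)"
    and gb: "\<And>b. b \<in> Basis \<Longrightarrow> C_on m S (\<lambda>z. g' z b)" by (rule C_on_SucE) blast
  show ?case
  proof (rule C_on_SucI)
    show "((\<lambda>z. f z + g z) has_derivative (\<lambda>h. f' z h + g' z h)) (at z within S)" if "z \<in> S" for z
      by (rule has_derivative_add[OF f'[OF that] g'[OF that]])
    show "C_on m S (\<lambda>z. f' z b + g' z b)" if "b \<in> Basis" for b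
      by (rule Suc.IH[OF fb[OF that] gb[OF that]])
  qed
qed

lemma C_on_mult: "C_on m S f \<Longrightarrow> C_on m S g \<Longrightarrow> C_on m S (\<lambda>z. f z * g z)"
proof (induction m arbitrary: f g)
  case 0
  then show ?case by (auto intro: continuous_intros)
next
  case (Suc m)
  from Suc.prems(1) obtain f' where f': "\<And>z. z \<in> S \<Longrightarrow> (f has_derivative f' z) (at z within S)"
    and fb: "\<And>b. b \<in> Basis \<Longrightarrow> C_on m S (\<lambda>z. f' z b)" by (rule C_on_SucE) blast
  from Suc.prems(2) obtain g' where g': "\<And>z. z \<in> S \<Longrightarrow> (g has_derivative g' z) (at z within S)"
    and gb: "\<And>b. b \<in> Basis \<Longrightarrow> C_on m S (\<lambda>z. g' z b)" by (rule C_on_SucE) blast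
  show ?case
  proof (rule C_on_SucI)
    show "((\<lambda>z. f z * g z) has_derivative (\<lambda>h. f z * g' z h + f' z h * g z)) (at z within S)"
      if "z \<in> S" for z
      by (rule has_derivative_mult[OF f'[OF that] g'[OF that]])
    show "C_on m S (\<lambda>z. f z * g' z b + f' z b * g z)" if "b \<in> Basis" for b
      by (intro C_on_add Suc.IH C_on_SucD[OF Suc.prems(1)] C_on_SucD[OF Suc.prems(2)] fb gb that)
  qed
qed

lemma C_on_cmult: "C_on m S f \<Longrightarrow> C_on m S (\<lambda>z. c * f z)"
  by (intro C_on_mult C_on_const)

lemma C_on_minus: "C_on m S f \<Longrightarrow> C_on m S (\<lambda>z. - f z)"
  using C_on_cmult[of m S f "-1"] by simp

lemma C_on_diff: "C_on m S f \<Longrightarrow> C_on m S g \<Longrightarrow> C_on m S (\<lambda>z. f z - g z)"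
  using C_on_add[of m S f "\<lambda>z. - g z"] C_on_minus[of m S g] by simp

lemma C_on_sum: "(\<And>i. i \<in> I \<Longrightarrow> C_on m S (f i)) \<Longrightarrow> C_on m S (\<lambda>z. \<Sum>i\<in>I. f i z)"
proof (induction I rule: infinite_finite_induct)
  case (insert i I)
  then show ?case using C_on_add[of m S "f i"] by simp
qed (auto intro: C_on_const)

text \<open>Induction on m through the chain rule: a partial derivative of the composite is a sum of
  products of partial derivatives of l with components of the gradient of \<phi> at l, and the
  induction hypothesis covers those components. A derivative within Y restricts to one within the
  image of S, so the inclusion of the image is enough at boundary points.\<close>

lemma C_on_compose:
  fixes l :: "'c::euclidean_space \<Rightarrow> 'a::euclidean_space"
  assumes "C_on m Y \<phi>" and "\<And>b. b \<in> Basis \<Longrightarrow> C_on m S (\<lambda>z. l z \<bullet> b)" and "l ` S \<subseteq> Y"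
  shows "C_on m S (\<lambda>z. \<phi> (l z))"
  using assms
proof (induction m arbitrary: \<phi>)
  case 0
  then have "continuous_on S l"
    by (subst continuous_on_componentwise) auto
  then show ?case using 0 continuous_on_compose2[of Y \<phi> S l] by simp
next
  case (Suc m)
  from Suc.prems(1) obtain G where G: "\<And>z. z \<in> Y \<Longrightarrow> (\<phi> has_derivative (\<lambda>h. G z \<bullet> h)) (at z within Y)"
    and Gb: "\<And>b. b \<in> Basis \<Longrightarrow> C_on m Y (\<lambda>z. G z \<bullet> b)"
    by (rule C_on_Suc_grad) blast
  have "\<forall>b\<in>Basis. \<exists>l'. (\<forall>z\<in>S. ((\<lambda>z. l z \<bullet> b) has_derivative l' z) (at z within S)) \<and>
           (\<forall>c\<in>Basis. C_on m S (\<lambda>z. l' z c))"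
    using Suc.prems(2) by simp
  from bchoice[OF this] obtain l' where
    *: "\<forall>b\<in>Basis. (\<forall>z\<in>S. ((\<lambda>z. l z \<bullet> b) has_derivative l' b z) (at z within S)) \<and>
           (\<forall>c\<in>Basis. C_on m S (\<lambda>z. l' b z c))" ..
  then have l': "((\<lambda>z. l z \<bullet> b) has_derivative l' b z) (at z within S)"
    if "b \<in> Basis" "z \<in> S" for b z using that by blast
  from * have lb: "C_on m S (\<lambda>z. l' b z c)" if "b \<in> Basis" "c \<in> Basis" for b c using that by blast
  define L where "L z h = (\<Sum>b\<in>Basis. l' b z h *\<^sub>R b)" for z h
  have Lb: "L z h \<bullet> b = l' b z h" if "b \<in> Basis" for z b h
    using that by (simp add: L_def inner_sum_left inner_Basis if_distrib cong: if_cong)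
  have L: "(l has_derivative L z) (at z within S)" if "z \<in> S" for z
    using l'[OF _ that] by (subst has_derivative_componentwise_within) (simp add: Lb)
  have d: "((\<lambda>z. \<phi> (l z)) has_derivative (\<lambda>h. G (l z) \<bullet> L z h)) (at z within S)" if "z \<in> S" for z
  proof -
    have "(\<phi> has_derivative (\<lambda>h. G (l z) \<bullet> h)) (at (l z) within l ` S)"
      using G[of "l z"] Suc.prems(3) that by (auto intro: has_derivative_subset)
    from has_derivative_in_compose[OF L[OF that] this] show ?thesis by simp
  qed
  show ?case
  proof (rule C_on_SucI[OF d])
    fix c :: 'c assume c: "c \<in> Basis"
    have "C_on m S (\<lambda>z. \<Sum>b\<in>Basis. l' b z c * (G (l z) \<bullet> b))"
      by (intro C_on_sum C_on_mult Suc.IH[OF Gb] lb c C_on_SucD[OF Suc.prems(2)] Suc.prems(3))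
    then show "C_on m S (\<lambda>z. G (l z) \<bullet> L z c)"
      by (simp add: L_def inner_sum_right)
  qed
qed

lemma C_on_compose_real:
  fixes l :: "'c::euclidean_space \<Rightarrow> real"
  assumes "C_on m Y \<phi>" and "C_on m S l" and "l ` S \<subseteq> Y"
  shows "C_on m S (\<lambda>z. \<phi> (l z))"
  by (rule C_on_compose[OF assms(1) _ assms(3)]) (use assms(2) in \<open>simp add: Basis_real_def\<close>)

lemma C_on_real_SucI:
  fixes f :: "real \<Rightarrow> real"
  assumes "\<And>x. x \<in> S \<Longrightarrow> (f has_real_derivative f' x) (at x within S)" and "C_on m S f'"
  shows "C_on (Suc m) S f"
proof (rule C_on_SucI[where f'="\<lambda>x h. h * f' x"])
  show "(f has_derivative (\<lambda>h. h * f' z)) (at z within S)" if "z \<in> S" for z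
    using assms(1)[OF that] by (simp add: has_field_derivative_def mult_commute_abs)
  show "C_on m S (\<lambda>z. b * f' z)" if "b \<in> Basis" for b
    using that assms(2) by (simp add: Basis_real_def)
qed

section \<open>Inverses, powers and truncated powers of a real variable\<close>

lemma C_on_inverse: "C_on m {x::real. 0 < x} inverse"
proof (induction m)
  case 0
  then show ?case by (auto intro!: continuous_intros)
next
  case (Suc m)
  show ?case
    by (rule C_on_real_SucI[where f'="\<lambda>x. - (inverse x * inverse x)"])
      (auto intro!: derivative_eq_intros C_on_minus C_on_mult Suc.IH simp: power2_eq_square)
qed

lemma C_on_powr: "C_on m {x::real. 0 < x} (\<lambda>x. x powr a)"
proof (induction m arbitrary: a)
  case 0
  then show ?case by (auto intro!: continuous_intros)
next
  case (Suc m)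
  show ?case
    by (rule C_on_real_SucI[where f'="\<lambda>x. a * x powr (a - 1)"])
      (auto intro!: C_on_cmult has_field_derivative_at_within has_real_derivative_powr Suc.IH)
qed

text \<open>Truncated powers are the gluing device of the development: \<open>reg\<close>,
  \<open>pw\<close> and \<open>cut\<close> all switch on or off through such a factor. An exponent
  of at least two makes the junction at 0 differentiable, since the difference quotient there is the
  next lower truncated power.\<close>

lemma has_real_derivative_max_power:
  "((\<lambda>x::real. (max 0 x) ^ Suc (Suc n)) has_real_derivative real (Suc (Suc n)) * (max 0 x) ^ Suc n) (at x)"
proof -
  consider "x > 0" | "x < 0" | "x = 0" by linarith
  then show ?thesis
  proof cases
    case 1
    have "((\<lambda>x::real. x ^ Suc (Suc n)) has_real_derivative real (Suc (Suc n)) * x ^ Suc n) (at x)"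
      using DERIV_pow[of "Suc (Suc n)" x] by simp
    moreover have "\<forall>\<^sub>F y in nhds x. (max 0 y) ^ Suc (Suc n) = y ^ Suc (Suc n)"
      using eventually_nhds_in_open[of "{0<..}" x] 1 by (auto elim!: eventually_mono)
    ultimately show ?thesis using 1 by (subst DERIV_cong_ev[OF refl _ refl]) auto
  next
    case 2
    have "\<forall>\<^sub>F y in nhds x. (max 0 y) ^ Suc (Suc n) = 0"
      using eventually_nhds_in_open[of "{..<0}" x] 2 by (auto elim!: eventually_mono simp: max_def)
    then have "((\<lambda>x. (max 0 x) ^ Suc (Suc n)) has_real_derivative 0) (at x)"
      by (subst DERIV_cong_ev[OF refl _ refl, where g="\<lambda>_. 0"]) simp_all
    then show ?thesis using 2 by simp
  next
    case 3
    have "((\<lambda>h::real. (max 0 h) ^ Suc n) \<longlongrightarrow> (max 0 0) ^ Suc n) (at 0)"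
      by (intro tendsto_intros)
    then have *: "((\<lambda>h::real. (max 0 h) ^ Suc n) \<longlongrightarrow> 0) (at 0)" by simp
    have "((\<lambda>h::real. (max 0 h) ^ Suc (Suc n) / h) \<longlongrightarrow> 0) (at 0)"
    proof (rule Lim_transform_eventually[OF *])
      have "(max 0 h) ^ Suc n = (max 0 h) ^ Suc (Suc n) / h" if "h \<noteq> 0" for h :: real
        using that by (cases "h > 0") auto
      then show "\<forall>\<^sub>F h in at (0::real). (max 0 h) ^ Suc n = (max 0 h) ^ Suc (Suc n) / h"
        by (simp only: eventually_at_filter) (auto simp del: power_Suc intro: always_eventually)
    qed
    then show ?thesis unfolding 3 has_field_derivative_iff by simp
  qed
qed

section \<open>The descent measure on the unit disc\<close>

text \<open>The projection to the plane of the uniform probability measure on the unit sphere of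
  three-space, as in the method of descent. The closed disc matches the domain of integration in
  \<open>wave_R\<close> and \<open>wave_L\<close>.\<close>

definition disk :: "(real^2) measure" where
  "disk = density lborel (\<lambda>\<xi>. ennreal (indicator (cball 0 1) \<xi> / (2 * pi * sqrt (1 - (norm \<xi>)\<^sup>2))))"

lemma sets_disk [simp, measurable_cong]: "sets disk = sets borel"
  and space_disk [simp]: "space disk = UNIV"
  by (simp_all add: disk_def)

lemma borel_measurable_disk_weight [measurable]:
  "(\<lambda>\<xi>::real^2. indicator (ball 0 1) \<xi> / sqrt (1 - (norm \<xi>)\<^sup>2) :: real) \<in> borel_measurable borel"
  "(\<lambda>\<xi>::real^2. indicator (cball 0 1) \<xi> / (2 * pi * sqrt (1 - (norm \<xi>)\<^sup>2)) :: real) \<in> borel_measurable borel"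
  by (intro borel_measurable_divide borel_measurable_indicator borel_measurable_continuous_onI continuous_intros; simp)+

text \<open>The weight is radial, increasing and at least 1 in the open disc. Its superlevel sets
  are therefore the whole disc below height 1 and annuli above it, whose areas are explicit.\<close>

lemma inv_sqrt_level:
  fixes \<xi> :: "real^2"
  assumes "0 \<le> y"
  shows "(y < indicator (ball 0 1) \<xi> / sqrt (1 - (norm \<xi>)\<^sup>2)) \<longleftrightarrow>
    \<xi> \<in> ball 0 1 - (if y < 1 then {} else cball 0 (sqrt (1 - 1 / y\<^sup>2)))"
proof (cases "norm \<xi> < 1")
  case True
  then have s: "0 < 1 - (norm \<xi>)\<^sup>2" by (simp add: power_less_one_iff abs_square_less_1)
  have s1: "sqrt (1 - (norm \<xi>)\<^sup>2) \<le> 1" by simp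
  show ?thesis
  proof (cases "y < 1")
    case y: True
    have "1 \<le> 1 / sqrt (1 - (norm \<xi>)\<^sup>2)" using s s1 by (simp add: le_divide_eq)
    then show ?thesis using y True by simp
  next
    case y: False
    have "y < 1 / sqrt (1 - (norm \<xi>)\<^sup>2) \<longleftrightarrow> sqrt (1 - (norm \<xi>)\<^sup>2) < 1 / y"
      using s y by (simp add: field_simps)
    also have "\<dots> \<longleftrightarrow> sqrt (1 - (norm \<xi>)\<^sup>2) < sqrt ((1 / y)\<^sup>2)" using y by (simp add: real_sqrt_abs)
    also have "\<dots> \<longleftrightarrow> 1 - 1 / y\<^sup>2 < (norm \<xi>)\<^sup>2" by (auto simp: power_divide)
    also have "\<dots> \<longleftrightarrow> sqrt (1 - 1 / y\<^sup>2) < sqrt ((norm \<xi>)\<^sup>2)" by (subst real_sqrt_less_iff) (rule refl)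
    also have "\<dots> \<longleftrightarrow> sqrt (1 - 1 / y\<^sup>2) < norm \<xi>" by simp
    finally show ?thesis using True y by auto
  qed
qed (use assms in auto)

text \<open>Layer-cake computation: the superlevel set at height y has area \<pi> for y < 1 and
  \<pi> / y^2 for y \<ge> 1, and each of the two ranges of y contributes \<pi>.\<close>

lemma nn_integral_inv_sqrt_ball:
  "(\<integral>\<^sup>+\<xi>. ennreal (indicator (ball 0 1) (\<xi>::real^2) / sqrt (1 - (norm \<xi>)\<^sup>2)) \<partial>lborel) = ennreal (2 * pi)"
proof -
  define h where "h \<xi> = indicator (ball 0 1) \<xi> / sqrt (1 - (norm \<xi>)\<^sup>2)" for \<xi> :: "real^2"
  have [measurable]: "h \<in> borel_measurable borel" unfolding h_def by (rule borel_measurable_disk_weight)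
  define A where "A y = ball (0::real^2) 1 - (if y < 1 then {} else cball 0 (sqrt (1 - 1 / y\<^sup>2)))" for y :: real
  have vol: "emeasure lborel (A y) = (if y < 1 then ennreal pi else ennreal (pi / y\<^sup>2))" if "0 \<le> y" for y
  proof (cases "y < 1")
    case True
    then show ?thesis by (simp add: A_def emeasure_ball unit_ball_vol_2)
  next
    case False
    have p: "0 \<le> 1 - 1 / y\<^sup>2" "sqrt (1 - 1 / y\<^sup>2) < 1" using False by (auto simp: field_simps)
    have "emeasure lborel (A y) = emeasure lborel (ball (0::real^2) 1) - emeasure lborel (cball (0::real^2) (sqrt (1 - 1 / y\<^sup>2)))"
    proof -
      have "cball (0::real^2) (sqrt (1 - 1 / y\<^sup>2)) \<subseteq> ball 0 1" using p(2) by (auto simp only: mem_cball mem_ball dist_0_norm)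
      then show ?thesis unfolding A_def using False p by (simp add: emeasure_Diff emeasure_cball)
    qed
    also have "\<dots> = ennreal pi - ennreal (pi * (1 - 1 / y\<^sup>2))"
      using p(1) by (simp only: emeasure_ball emeasure_cball real_sqrt_ge_zero) (simp add: unit_ball_vol_2)
    also have "\<dots> = ennreal (pi - pi * (1 - 1 / y\<^sup>2))"
      by (rule ennreal_minus, rule mult_nonneg_nonneg[OF _ p(1)], rule pi_ge_zero)
    also have "pi - pi * (1 - 1 / y\<^sup>2) = pi / y\<^sup>2" by (simp add: algebra_simps)
    finally show ?thesis using False by simp
  qed
  have h0: "0 \<le> h \<xi>" for \<xi> unfolding h_def
    by (auto simp: indicator_def abs_square_le_1 intro!: divide_nonneg_nonneg)
  have "(\<integral>\<^sup>+\<xi>. ennreal (h \<xi>) \<partial>lborel) = (\<integral>\<^sup>+\<xi>. \<integral>\<^sup>+y. indicator {0..<h \<xi>} y \<partial>lborel \<partial>lborel)"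
    using h0 by simp
  also have "\<dots> = (\<integral>\<^sup>+y. \<integral>\<^sup>+\<xi>. indicator {0..<h \<xi>} y \<partial>lborel \<partial>lborel)"
  proof (rule lborel_pair.Fubini'[symmetric])
    have "(\<lambda>(x, y). indicator {0..<h x} y :: ennreal) = indicator {z. 0 \<le> snd z \<and> snd z < h (fst z)}"
      by (auto simp: fun_eq_iff indicator_def)
    also have "\<dots> \<in> borel_measurable (lborel \<Otimes>\<^sub>M lborel)" by measurable
    finally show "(\<lambda>(x, y). indicator {0..<h x} y :: ennreal) \<in> borel_measurable (lborel \<Otimes>\<^sub>M lborel)" .
  qed
  also have "\<dots> = (\<integral>\<^sup>+y. ennreal pi * indicator {0..<1} y + ennreal (pi / y\<^sup>2) * indicator {1..} y \<partial>lborel)"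
  proof (rule nn_integral_cong)
    fix y :: real
    show "(\<integral>\<^sup>+\<xi>. indicator {0..<h \<xi>} y \<partial>lborel) = ennreal pi * indicator {0..<1} y + ennreal (pi / y\<^sup>2) * indicator {1..} y"
    proof (cases "0 \<le> y")
      case True
      then have "y < h \<xi> \<longleftrightarrow> \<xi> \<in> A y" for \<xi> unfolding h_def A_def by (rule inv_sqrt_level)
      with True have "(\<lambda>\<xi>. indicator {0..<h \<xi>} y :: ennreal) = indicator (A y)"
        by (intro ext) (simp add: indicator_def)
      moreover have "A y \<in> sets lborel" by (auto simp: A_def)
      ultimately have "(\<integral>\<^sup>+\<xi>. indicator {0..<h \<xi>} y \<partial>lborel) = emeasure lborel (A y)"
        by (simp only: nn_integral_indicator)
      then show ?thesis using True vol[OF True] by (simp add: indicator_def)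
    qed auto
  qed
  also have "\<dots> = (\<integral>\<^sup>+y. ennreal pi * indicator {0..<1} (y::real) \<partial>lborel) + (\<integral>\<^sup>+y. ennreal (pi / y\<^sup>2) * indicator {1..} (y::real) \<partial>lborel)"
    by (rule nn_integral_add) auto
  also have "(\<integral>\<^sup>+y. ennreal pi * indicator {0..<1} (y::real) \<partial>lborel) = ennreal pi"
    by (simp add: nn_integral_cmult_indicator)
  also have "(\<integral>\<^sup>+y. ennreal (pi / y\<^sup>2) * indicator {1..} (y::real) \<partial>lborel) = ennreal (0 - (- pi / 1))"
  proof (rule nn_integral_FTC_atLeast[where F="\<lambda>y. - pi / y"])
    show "((\<lambda>y. - pi / y) has_real_derivative pi / y\<^sup>2) (at y)" if "1 \<le> y" for y
      using that by (auto intro!: derivative_eq_intros simp: power2_eq_square)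
    show "((\<lambda>y. - pi / y) \<longlongrightarrow> 0) at_top"
      by (intro tendsto_divide_0[OF tendsto_const] filterlim_at_top_imp_at_infinity filterlim_ident)
  qed auto
  also have "ennreal pi + ennreal (0 - (- pi / 1)) = ennreal (2 * pi)"
    by (simp flip: ennreal_plus)
  finally show ?thesis by (simp add: h_def)
qed

text \<open>On the unit circle both sides are 0, because division by zero yields 0.\<close>

lemma disk_weight_eq:
  "indicator (cball 0 1) \<xi> / (2 * pi * sqrt (1 - (norm (\<xi>::real^2))\<^sup>2))
    = 1 / (2 * pi) * (indicator (ball 0 1) \<xi> / sqrt (1 - (norm \<xi>)\<^sup>2))"
  by (cases "norm \<xi> = 1") (auto simp: indicator_def)

lemma emeasure_disk: "emeasure disk UNIV = 1"
proof -
  have nn: "0 \<le> indicator (ball 0 1) \<xi> / sqrt (1 - (norm \<xi>)\<^sup>2)" for \<xi> :: "real^2"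
    by (simp add: indicator_def abs_square_le_1)
  have "emeasure disk UNIV = (\<integral>\<^sup>+\<xi>. ennreal (1 / (2 * pi) * (indicator (ball 0 1) (\<xi>::real^2) / sqrt (1 - (norm \<xi>)\<^sup>2))) \<partial>lborel)"
    using borel_measurable_disk_weight(2)
    by (simp only: disk_def disk_weight_eq) (subst emeasure_density, simp_all)
  also have "\<dots> = (\<integral>\<^sup>+\<xi>. ennreal (1 / (2 * pi)) * ennreal (indicator (ball 0 1) (\<xi>::real^2) / sqrt (1 - (norm \<xi>)\<^sup>2)) \<partial>lborel)"
    by (intro nn_integral_cong ennreal_mult nn) simp
  also have "\<dots> = ennreal (1 / (2 * pi)) * ennreal (2 * pi)"
    by (subst nn_integral_cmult) (auto simp: nn_integral_inv_sqrt_ball)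
  also have "\<dots> = 1" by (simp flip: ennreal_mult)
  finally show ?thesis .
qed

interpretation disk: finite_measure disk
  by (rule finite_measureI) (simp add: emeasure_disk)

lemma measure_disk [simp]: "measure disk UNIV = 1"
  by (simp add: measure_def emeasure_disk)

lemma AE_disk: "AE \<xi> in disk. norm \<xi> \<le> 1"
  unfolding disk_def by (subst AE_density) (auto simp: indicator_def)

lemma disk_integral_density:
  fixes g :: "real^2 \<Rightarrow> 'b::{banach, second_countable_topology}"
  assumes "g \<in> borel_measurable borel"
  shows "(\<integral>\<xi>. g \<xi> \<partial>disk) = (\<integral>\<xi>. (indicator (cball 0 1) \<xi> / (2 * pi * sqrt (1 - (norm \<xi>)\<^sup>2))) *\<^sub>R g \<xi> \<partial>lborel)"
  unfolding disk_def
proof (rule integral_density)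
  show "AE \<xi> in lborel. 0 \<le> indicator (cball 0 1) \<xi> / (2 * pi * sqrt (1 - (norm (\<xi>::real^2))\<^sup>2))"
    by (auto simp: indicator_def abs_square_le_1 intro!: divide_nonneg_nonneg)
qed (use assms borel_measurable_disk_weight(2) in simp_all)

lemma integrable_disk:
  fixes g :: "real^2 \<Rightarrow> 'b::{banach, second_countable_topology}"
  assumes "continuous_on UNIV g"
  shows "integrable disk g"
proof -
  have "compact (g ` cball 0 1)"
    by (rule compact_continuous_image[OF continuous_on_subset[OF assms]]) auto
  from compact_imp_bounded[OF this] obtain B where B: "\<forall>x\<in>g ` cball 0 1. norm x \<le> B"
    unfolding bounded_iff by (elim exE)
  show ?thesis
  proof (rule disk.integrable_const_bound[where B=B])
    show "AE \<xi> in disk. norm (g \<xi>) \<le> B"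
      using AE_disk by eventually_elim (use B in simp)
    show "g \<in> borel_measurable disk"
      using borel_measurable_continuous_onI[OF assms] by (simp cong: measurable_cong_sets)
  qed
qed

lemma disk_integral_mono:
  assumes "continuous_on UNIV f" and "continuous_on UNIV g"
    and "\<And>\<xi>. norm \<xi> \<le> 1 \<Longrightarrow> f \<xi> \<le> (g \<xi> :: real)"
  shows "(\<integral>\<xi>. f \<xi> \<partial>disk) \<le> (\<integral>\<xi>. g \<xi> \<partial>disk)"
proof (rule integral_mono_AE)
  show "AE \<xi> in disk. f \<xi> \<le> g \<xi>" using AE_disk by eventually_elim (rule assms(3))
qed (use assms(1,2)[THEN integrable_disk] in auto)

lemma disk_integral_cong:
  fixes f g :: "real^2 \<Rightarrow> 'b::{banach, second_countable_topology}"
  assumes "continuous_on UNIV f" and "continuous_on UNIV g"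
    and "\<And>\<xi>. norm \<xi> \<le> 1 \<Longrightarrow> f \<xi> = g \<xi>"
  shows "(\<integral>\<xi>. f \<xi> \<partial>disk) = (\<integral>\<xi>. g \<xi> \<partial>disk)"
proof (rule integral_cong_AE)
  show "AE \<xi> in disk. f \<xi> = g \<xi>" using AE_disk by eventually_elim (use assms(3) in auto)
qed (use assms(1,2)[THEN integrable_disk] in auto)

lemma disk_integral_norm_le:
  fixes g :: "real^2 \<Rightarrow> 'b::{banach, second_countable_topology}"
  assumes "continuous_on UNIV g" and "\<And>\<xi>. norm \<xi> \<le> 1 \<Longrightarrow> norm (g \<xi>) \<le> B"
  shows "norm (\<integral>\<xi>. g \<xi> \<partial>disk) \<le> B"
proof -
  have "norm (\<integral>\<xi>. g \<xi> \<partial>disk) \<le> (\<integral>\<xi>. norm (g \<xi>) \<partial>disk)" by (rule integral_norm_bound)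
  also have "\<dots> \<le> (\<integral>\<xi>. B \<partial>disk)"
    by (rule disk_integral_mono) (use assms in \<open>auto intro!: continuous_intros\<close>)
  finally show ?thesis by simp
qed

lemma continuous_on_slice:
  assumes "continuous_on (Z \<times> W) (\<lambda>p. f (fst p) (snd p))" and "z \<in> Z"
  shows "continuous_on W (f z)"
proof -
  have "continuous_on W (\<lambda>x. (\<lambda>p. f (fst p) (snd p)) (z, x))"
    by (rule continuous_on_compose2[OF assms(1)]) (use assms(2) in \<open>auto intro!: continuous_intros\<close>)
  then show ?thesis by simp
qed

section \<open>Disc means depending on a parameter\<close>

text \<open>Compactness of the closed disc plays the part of a dominating function: near z0 the
  values \<open>f z \<xi>\<close> and \<open>f z0 \<xi>\<close> are close uniformly in \<xi>, and
  the measure has mass one.\<close>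

lemma continuous_on_disk_integral:
  fixes f :: "'a::topological_space \<Rightarrow> real^2 \<Rightarrow> 'b::{banach, second_countable_topology}"
  assumes "continuous_on (Z \<times> UNIV) (\<lambda>p. f (fst p) (snd p))"
  shows "continuous_on Z (\<lambda>z. \<integral>\<xi>. f z \<xi> \<partial>disk)"
  unfolding continuous_on_def
proof (intro ballI tendstoI)
  fix z0 and e :: real assume z0: "z0 \<in> Z" and "0 < e"
  have c: "continuous_on (Z \<times> cball 0 1) (\<lambda>p. f (fst p) (snd p))"
    by (rule continuous_on_subset[OF assms]) auto
  obtain X0 where X0: "z0 \<in> X0" "open X0"
    and b: "\<forall>z\<in>X0 \<inter> Z. \<forall>\<xi>\<in>cball 0 1. dist (f (fst (z, \<xi>)) (snd (z, \<xi>))) (f (fst (z0, \<xi>)) (snd (z0, \<xi>))) \<le> e / 2"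
    using continuous_on_prod_compactE[OF c compact_cball z0, of "e / 2"] \<open>0 < e\<close> by auto
  have "\<forall>\<^sub>F z in at z0 within Z. z \<in> X0 \<and> z \<in> Z"
    using X0 by (auto simp: eventually_at_topological)
  then show "\<forall>\<^sub>F z in at z0 within Z. dist (\<integral>\<xi>. f z \<xi> \<partial>disk) (\<integral>\<xi>. f z0 \<xi> \<partial>disk) < e"
  proof eventually_elim
    case (elim z)
    have cz: "continuous_on UNIV (f z)" "continuous_on UNIV (f z0)"
      using assms elim z0 by (auto intro: continuous_on_slice)
    have "dist (\<integral>\<xi>. f z \<xi> \<partial>disk) (\<integral>\<xi>. f z0 \<xi> \<partial>disk) = norm (\<integral>\<xi>. f z \<xi> - f z0 \<xi> \<partial>disk)"
      using cz[THEN integrable_disk] by (simp add: dist_norm)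
    also have "\<dots> \<le> e / 2"
      by (rule disk_integral_norm_le) (use cz b elim in \<open>auto intro!: continuous_intros simp: dist_norm\<close>)
    finally show ?case using \<open>0 < e\<close> by simp
  qed
qed

text \<open>The error of linearising \<open>f z \<xi>\<close> at z0 is bounded by the oscillation of
  g near z0, which is uniform over the compact disc. Convexity keeps the segment from z0 to z inside
  Z, so that derivatives within Z suffice; this is what makes the initial time t = 0
  admissible.\<close>

lemma has_derivative_disk_integral:
  fixes f :: "'a::euclidean_space \<Rightarrow> real^2 \<Rightarrow> real"
  assumes d: "\<And>z \<xi>. z \<in> Z \<Longrightarrow> ((\<lambda>z. f z \<xi>) has_derivative (\<lambda>h. g z \<xi> \<bullet> h)) (at z within Z)"
    and cf: "\<And>z. z \<in> Z \<Longrightarrow> continuous_on UNIV (f z)"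
    and cg: "continuous_on (Z \<times> UNIV) (\<lambda>p. g (fst p) (snd p))"
    and "convex Z" and z0: "z0 \<in> Z"
  shows "((\<lambda>z. \<integral>\<xi>. f z \<xi> \<partial>disk) has_derivative (\<lambda>h. (\<integral>\<xi>. g z0 \<xi> \<partial>disk) \<bullet> h)) (at z0 within Z)"
  unfolding has_derivative_within_alt
proof (intro conjI allI impI)
  show "bounded_linear (\<lambda>h. (\<integral>\<xi>. g z0 \<xi> \<partial>disk) \<bullet> h)" by (rule bounded_linear_inner_right)
  fix e :: real assume "0 < e"
  have c: "continuous_on (Z \<times> cball 0 1) (\<lambda>p. g (fst p) (snd p))"
    by (rule continuous_on_subset[OF cg]) auto
  obtain X0 where X0: "z0 \<in> X0" "open X0"
    and b: "\<forall>z\<in>X0 \<inter> Z. \<forall>\<xi>\<in>cball 0 1. dist (g (fst (z, \<xi>)) (snd (z, \<xi>))) (g (fst (z0, \<xi>)) (snd (z0, \<xi>))) \<le> e"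
    using continuous_on_prod_compactE[OF c compact_cball z0 \<open>0 < e\<close>] by metis
  obtain r where r: "0 < r" "ball z0 r \<subseteq> X0" using X0 open_contains_ball by blast
  have "norm ((\<integral>\<xi>. f z \<xi> \<partial>disk) - (\<integral>\<xi>. f z0 \<xi> \<partial>disk) - (\<integral>\<xi>. g z0 \<xi> \<partial>disk) \<bullet> (z - z0)) \<le> e * norm (z - z0)"
    if z: "z \<in> Z" and near: "norm (z - z0) < r" for z
  proof -
    define S where "S = Z \<inter> ball z0 r"
    have S: "convex S" "z \<in> S" "z0 \<in> S"
      using \<open>convex Z\<close> z z0 near r by (auto simp: S_def dist_norm norm_minus_commute intro: convex_Int)
    have pt: "norm (f z \<xi> - f z0 \<xi> - g z0 \<xi> \<bullet> (z - z0)) \<le> e * norm (z - z0)" if \<xi>: "norm \<xi> \<le> 1" for \<xi>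
    proof -
      have "norm (f z \<xi> - f z0 \<xi> - (\<lambda>h. g z0 \<xi> \<bullet> h) (z - z0)) \<le> norm (z - z0) * e"
      proof (rule differentiable_bound_linearization[where S=S and f'="\<lambda>z h. g z \<xi> \<bullet> h" and f="\<lambda>z. f z \<xi>"])
        show "z0 + t *\<^sub>R (z - z0) \<in> S" if "t \<in> {0..1}" for t
          using convexD[OF S(1) S(3) S(2), of "1 - t" t] that by (simp add: algebra_simps)
        show "((\<lambda>z. f z \<xi>) has_derivative (\<lambda>h. g x \<xi> \<bullet> h)) (at x within S)" if "x \<in> S" for x
          using d[of x \<xi>] that by (auto simp: S_def intro: has_derivative_subset)
        show "onorm ((\<lambda>h. g x \<xi> \<bullet> h) - (\<lambda>h. g z0 \<xi> \<bullet> h)) \<le> e" if "x \<in> S" for x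
        proof -
          have "norm (g x \<xi> - g z0 \<xi>) \<le> e"
            using b that r \<xi> by (auto simp: S_def dist_norm)
          then show ?thesis
            using \<open>0 < e\<close> by (intro onorm_le) (metis fun_diff_def inner_diff_left mult_right_mono norm_ge_zero Cauchy_Schwarz_ineq2 order_trans real_norm_def)
        qed
      qed (use S in auto)
      then show ?thesis by (simp add: mult.commute)
    qed
    have cz: "continuous_on UNIV (f z)" "continuous_on UNIV (f z0)" "continuous_on UNIV (g z0)"
      using cf cg z z0 by (auto intro: continuous_on_slice)
    note i = cz[THEN integrable_disk]
    have "(\<integral>\<xi>. f z \<xi> \<partial>disk) - (\<integral>\<xi>. f z0 \<xi> \<partial>disk) - (\<integral>\<xi>. g z0 \<xi> \<partial>disk) \<bullet> (z - z0)
        = (\<integral>\<xi>. f z \<xi> - f z0 \<xi> - g z0 \<xi> \<bullet> (z - z0) \<partial>disk)"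
      using i by simp
    also have "norm \<dots> \<le> e * norm (z - z0)"
      by (rule disk_integral_norm_le) (use pt cz in \<open>auto intro!: continuous_intros\<close>)
    finally show ?thesis .
  qed
  then show "\<exists>d>0. \<forall>y\<in>Z. norm (y - z0) < d \<longrightarrow> norm ((\<integral>\<xi>. f y \<xi> \<partial>disk) - (\<integral>\<xi>. f z0 \<xi> \<partial>disk) - (\<integral>\<xi>. g z0 \<xi> \<partial>disk) \<bullet> (y - z0)) \<le> e * norm (y - z0)"
    using r by blast
qed

lemma C_on_1_grad:
  assumes "C_on 1 S f"
  obtains G where "\<And>z. z \<in> S \<Longrightarrow> (f has_derivative (\<lambda>h. G z \<bullet> h)) (at z within S)"
    and "continuous_on S G"
proof -
  from assms have "C_on (Suc 0) S f" by simp
  then obtain G where G: "\<And>z. z \<in> S \<Longrightarrow> (f has_derivative (\<lambda>h. G z \<bullet> h)) (at z within S)"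
    and Gb: "\<And>b. b \<in> Basis \<Longrightarrow> C_on 0 S (\<lambda>x. G x \<bullet> b)"
    by (rule C_on_Suc_grad) blast
  have "continuous_on S G"
    by (subst continuous_on_componentwise) (use Gb in simp)
  from that[OF G this] show thesis by blast
qed

lemma C_on_1I:
  assumes "\<And>z. z \<in> S \<Longrightarrow> (f has_derivative (\<lambda>h. G z \<bullet> h)) (at z within S)" and "continuous_on S G"
  shows "C_on 1 S f"
  unfolding One_nat_def
proof (rule C_on_SucI)
  show "(f has_derivative (\<lambda>h. G z \<bullet> h)) (at z within S)" if "z \<in> S" for z by (rule assms(1)[OF that])
  show "C_on 0 S (\<lambda>z. G z \<bullet> b)" for b using assms(2) by (simp add: continuous_on_inner)
qed

lemma C_on_2_grad:
  assumes "C_on 2 S f"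
  obtains G H where "\<And>z. z \<in> S \<Longrightarrow> (f has_derivative (\<lambda>h. G z \<bullet> h)) (at z within S)"
    and "\<And>b z. b \<in> Basis \<Longrightarrow> z \<in> S \<Longrightarrow> ((\<lambda>z. G z \<bullet> b) has_derivative (\<lambda>h. H b z \<bullet> h)) (at z within S)"
    and "continuous_on S G" and "\<And>b. b \<in> Basis \<Longrightarrow> continuous_on S (H b)"
proof -
  from assms have "C_on (Suc 1) S f" by (simp add: numeral_2_eq_2)
  then obtain G where G: "\<And>z. z \<in> S \<Longrightarrow> (f has_derivative (\<lambda>h. G z \<bullet> h)) (at z within S)"
    and Gb: "\<And>b. b \<in> Basis \<Longrightarrow> C_on 1 S (\<lambda>x. G x \<bullet> b)"
    by (rule C_on_Suc_grad) blast
  have cG: "continuous_on S G"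
    by (subst continuous_on_componentwise) (use C_on_imp_continuous_on[OF Gb] in simp)
  have "\<forall>b\<in>Basis. \<exists>H. (\<forall>z\<in>S. ((\<lambda>z. G z \<bullet> b) has_derivative (\<lambda>h. H z \<bullet> h)) (at z within S)) \<and> continuous_on S H"
  proof
    fix b :: 'a assume "b \<in> Basis"
    from Gb[OF this] obtain H where H: "\<And>z. z \<in> S \<Longrightarrow> ((\<lambda>z. G z \<bullet> b) has_derivative (\<lambda>h. H z \<bullet> h)) (at z within S)"
      and "continuous_on S H" by (rule C_on_1_grad) blast
    then show "\<exists>H. (\<forall>z\<in>S. ((\<lambda>z. G z \<bullet> b) has_derivative (\<lambda>h. H z \<bullet> h)) (at z within S)) \<and> continuous_on S H"
      by (intro exI[of _ H] conjI ballI)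
  qed
  from bchoice[OF this] obtain H
    where H: "\<forall>b\<in>Basis. (\<forall>z\<in>S. ((\<lambda>z. G z \<bullet> b) has_derivative (\<lambda>h. H b z \<bullet> h)) (at z within S)) \<and> continuous_on S (H b)" ..
  show thesis
  proof (rule that[OF G _ cG])
    show "((\<lambda>z. G z \<bullet> b) has_derivative (\<lambda>h. H b z \<bullet> h)) (at z within S)" if "b \<in> Basis" "z \<in> S" for b z
      using H that by simp
    show "continuous_on S (H b)" if "b \<in> Basis" for b using H that by simp
  qed
qed

section \<open>Integration by parts on the plane and the divergence identity\<close>

text \<open>Difference quotients have integral zero by translation invariance of Lebesgue measure.
  They converge to the directional derivative and are dominated by a Lipschitz constant times the
  indicator of a fixed disc.\<close>

lemma integral_partial_derivative_zero:
  fixes A :: "real^2 \<Rightarrow> real"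
  assumes d: "\<And>x. (A has_derivative A' x) (at x)"
    and C: "C_on 1 UNIV A" and out: "\<And>x. 1 < norm x \<Longrightarrow> A x = 0" and e: "norm e = 1"
  shows "integrable lborel (\<lambda>x. A' x e)" "(\<integral>x. A' x e \<partial>lborel) = 0"
proof -
  obtain G where G: "\<And>x. x \<in> UNIV \<Longrightarrow> (A has_derivative (\<lambda>h. G x \<bullet> h)) (at x)"
    and cG: "continuous_on UNIV G"
    using C by (rule C_on_1_grad) blast
  have eqG: "A' x = (\<lambda>h. G x \<bullet> h)" for x
    by (rule has_derivative_unique[OF d]) (simp add: G)
  have cA: "continuous_on UNIV A" using C_on_imp_continuous_on[OF C] .
  have "compact (G ` cball 0 3)"
    by (rule compact_continuous_image[OF continuous_on_subset[OF cG]]) auto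
  from compact_imp_bounded[OF this] obtain B where B: "\<forall>x\<in>G ` cball 0 3. norm x \<le> B"
    unfolding bounded_iff by (elim exE)
  \<comment> \<open>Radius 3 is room for a point of \<open>cball 0 2\<close> moved by a step of
    length at most 1. Outside \<open>cball 0 2\<close> both points of the quotient lie where A
    vanishes.\<close>
  have lip: "\<bar>A x - A y\<bar> \<le> B * norm (x - y)" if "x \<in> cball 0 3" "y \<in> cball 0 3" for x y
  proof -
    have "norm (A x - A y) \<le> B * norm (x - y)"
    proof (rule differentiable_bound[where S="cball 0 3" and f'="\<lambda>x h. G x \<bullet> h"])
      show "(A has_derivative (\<lambda>h. G x \<bullet> h)) (at x within cball 0 3)" if "x \<in> cball 0 3" for x
        by (rule has_derivative_at_withinI) (simp add: G)
      show "onorm (\<lambda>h. G x \<bullet> h) \<le> B" if "x \<in> cball 0 3" for x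
      proof (rule onorm_le)
        fix h
        have "norm (G x) \<le> B" using B that by blast
        then show "norm (G x \<bullet> h) \<le> B * norm h"
          using Cauchy_Schwarz_ineq2[of "G x" h] mult_right_mono[of "norm (G x)" B "norm h"] by simp
      qed
    qed (use that in auto)
    then show ?thesis by simp
  qed
  have B0: "0 \<le> B" using lip[of 0 e] e by auto
  define S where "S n x = real (Suc n) * (A (x + (1 / real (Suc n)) *\<^sub>R e) - A x)" for n x
  have mA [measurable]: "A \<in> borel_measurable borel"
    by (rule borel_measurable_continuous_onI[OF cA])
  have mS: "S n \<in> borel_measurable lborel" for n
    unfolding S_def by measurable
  have mA': "(\<lambda>x. A' x e) \<in> borel_measurable lborel"
    unfolding eqG using cG by (simp add: borel_measurable_continuous_onI continuous_on_inner)
  have lim: "(\<lambda>n. S n x) \<longlonglongrightarrow> A' x e" for x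
  proof -
    have 1: "((\<lambda>t. x + t *\<^sub>R e) has_derivative (\<lambda>t. t *\<^sub>R e)) (at 0)"
      by (auto intro!: derivative_eq_intros)
    have 2: "(A has_derivative (\<lambda>h. G x \<bullet> h)) (at (x + 0 *\<^sub>R e))" using G[of x] by simp
    have "((\<lambda>t. A (x + t *\<^sub>R e)) has_real_derivative (G x \<bullet> e)) (at 0)"
      using has_derivative_compose[OF 1 2] by (simp add: has_field_derivative_def mult_commute_abs)
    then have 1: "((\<lambda>t. (A (x + t *\<^sub>R e) - A x) / t) \<longlongrightarrow> G x \<bullet> e) (at 0)"
      by (simp add: has_field_derivative_iff)
    have 2: "filterlim (\<lambda>n. 1 / real (Suc n)) (at 0) sequentially"
      using LIMSEQ_Suc[OF lim_1_over_n] by (simp add: filterlim_at)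
    from filterlim_compose[OF 1 2] show ?thesis
      by (simp add: eqG S_def mult.commute)
  qed
  have bnd: "norm (S n x) \<le> B * indicator (cball 0 2) x" for n x
  proof -
    define y where "y = (1 / real (Suc n)) *\<^sub>R e"
    have ny: "norm y = 1 / real (Suc n)" using e by (simp add: y_def)
    have ny1: "norm y \<le> 1" unfolding ny by simp
    show ?thesis
    proof (cases "norm x \<le> 2")
      case True
      have "norm (x + y) \<le> 3" using norm_triangle_ineq[of x y] True ny1 by linarith
      then have "\<bar>A (x + y) - A x\<bar> \<le> B * norm y" using lip[of "x + y" x] True by simp
      then have "real (Suc n) * \<bar>A (x + y) - A x\<bar> \<le> B"
        unfolding ny by (simp add: pos_le_divide_eq mult.commute)
      then show ?thesis using True by (simp add: S_def y_def abs_mult)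
    next
      case False
      then have "1 < norm (x + y)" using norm_diff_ineq[of x y] ny1 by linarith
      moreover have "1 < norm x" using False by linarith
      ultimately show ?thesis using False out by (simp add: S_def y_def)
    qed
  qed
  have w: "integrable lborel (\<lambda>x::real^2. B * indicator (cball 0 2) x)"
    by (intro integrable_mult_right integrable_real_indicator) (auto simp: emeasure_cball)
  have dc1: "integrable lborel (\<lambda>x. A' x e)"
    by (rule integrable_dominated_convergence[OF mA' mS w AE_I2 AE_I2]) (rule lim, rule bnd)
  have dc2: "(\<lambda>n. \<integral>x. S n x \<partial>lborel) \<longlonglongrightarrow> (\<integral>x. A' x e \<partial>lborel)"
    by (rule integral_dominated_convergence[OF mA' mS w AE_I2 AE_I2]) (rule lim, rule bnd)
  have iA: "integrable lborel A"
  proof -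
    have "integrable lborel (\<lambda>x. indicator (cball 0 1) x *\<^sub>R A x)"
      by (rule borel_integrable_compact[OF compact_cball continuous_on_subset[OF cA subset_UNIV]])
    also have "(\<lambda>x. indicator (cball 0 1) x *\<^sub>R A x) = A"
      using out by (auto simp: fun_eq_iff indicator_def)
    finally show ?thesis .
  qed
  have tr: "integrable lborel (\<lambda>x. A (x + c))" "(\<integral>x. A (x + c) \<partial>lborel) = (\<integral>x. A x \<partial>lborel)" for c
  proof -
    have "integrable (distr lborel borel ((+) c)) A" using iA lborel_distr_plus[of c] by simp
    then show "integrable lborel (\<lambda>x. A (x + c))"
      by (subst (asm) integrable_distr_eq) (auto simp: add.commute)
    have "(\<integral>x. A x \<partial>lborel) = (\<integral>x. A x \<partial>(distr lborel borel ((+) c)))"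
      using lborel_distr_plus[of c] by simp
    also have "\<dots> = (\<integral>x. A (x + c) \<partial>lborel)"
      by (subst integral_distr) (auto simp: add.commute)
    finally show "(\<integral>x. A (x + c) \<partial>lborel) = (\<integral>x. A x \<partial>lborel)" by simp
  qed
  have "(\<integral>x. S n x \<partial>lborel) = 0" for n
    unfolding S_def using tr iA by simp
  with dc2 show "(\<integral>x. A' x e \<partial>lborel) = 0" by (simp add: LIMSEQ_const_iff)
  show "integrable lborel (\<lambda>x. A' x e)" by (rule dc1)
qed

text \<open>A C^1 substitute for \<open>1 / sqrt s\<close> that vanishes for s \<le> 0. For s > 0
  and \<delta> tending to 0 it tends to s^2 * s^(-5/2) = s^(-1/2), and the squared truncation makes
  the junction at 0 smooth enough.\<close>

definition reg :: "real \<Rightarrow> real \<Rightarrow> real" where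
  "reg \<delta> s = (max 0 s) ^ 2 * (s\<^sup>2 + \<delta>\<^sup>2) powr (-5/4)"

definition reg' :: "real \<Rightarrow> real \<Rightarrow> real" where
  "reg' \<delta> s = 2 * max 0 s * (s\<^sup>2 + \<delta>\<^sup>2) powr (-5/4) + (max 0 s) ^ 2 * (-5/4 * (s\<^sup>2 + \<delta>\<^sup>2) powr (-9/4) * (2 * s))"

lemma reg_base_pos: "0 < \<delta> \<Longrightarrow> 0 < s\<^sup>2 + (\<delta>::real)\<^sup>2"
  by (simp add: add_nonneg_pos)

lemma reg_deriv:
  assumes "0 < \<delta>"
  shows "(reg \<delta> has_real_derivative reg' \<delta> s) (at s)"
proof -
  have a: "((\<lambda>s. (max 0 s) ^ 2) has_real_derivative 2 * max 0 s) (at s)"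
    using has_real_derivative_max_power[of 0 s] by (simp add: numeral_2_eq_2)
  have b: "((\<lambda>s. (s\<^sup>2 + \<delta>\<^sup>2) powr (-5/4)) has_real_derivative (-5/4 * (s\<^sup>2 + \<delta>\<^sup>2) powr (-9/4) * (2 * s))) (at s)"
    using reg_base_pos[OF assms, of s] by (auto intro!: derivative_eq_intros)
  show ?thesis unfolding reg_def reg'_def using DERIV_mult[OF a b] by (simp add: mult.commute add.commute)
qed

lemma reg_C1:
  assumes "0 < \<delta>"
  shows "C_on 1 UNIV (reg \<delta>)"
  unfolding One_nat_def
proof (rule C_on_real_SucI[where f'="reg' \<delta>"])
  show "C_on 0 UNIV (reg' \<delta>)"
    using reg_base_pos[OF assms] unfolding C_on.simps reg'_def
    by (intro continuous_intros) (use assms in simp_all)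
qed (use reg_deriv[OF assms] in simp)

lemma powr_minus_half: "0 < s \<Longrightarrow> s powr (-1/2) = 1 / sqrt (s::real)"
  by (simp add: powr_minus powr_half_sqrt inverse_eq_divide)

text \<open>The base \<open>s\<^sup>2 + \<delta>\<^sup>2\<close> has negative exponents, so dropping
  \<delta> only increases the powers. The product \<open>2 * s * reg' \<delta> s\<close> consists of
  a term with coefficient 4 and one with coefficient -5, both comparable to
  \<open>1 / sqrt s\<close>: the absolute values give the uniform bound 9, the signed sum gives the
  limit -1.\<close>

lemma reg_bounds:
  assumes "0 < s"
  shows "0 \<le> reg \<delta> s" "reg \<delta> s \<le> 1 / sqrt s" "\<bar>2 * s * reg' \<delta> s\<bar> \<le> 9 / sqrt s"
proof -
  have sq: "(s\<^sup>2) powr a = s powr (2 * a)" for a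
    using assms by (simp add: powr_powr flip: powr_numeral)
  have sp: "s ^ n * s powr a = s powr (real n + a)" for n a
    using assms by (simp add: powr_add powr_realpow)
  have 1: "(s\<^sup>2 + \<delta>\<^sup>2) powr (-5/4) \<le> s powr (-5/2)"
    using powr_mono2'[of "-5/4" "s\<^sup>2" "s\<^sup>2 + \<delta>\<^sup>2"] assms sq[of "-5/4"] by simp
  have 2: "(s\<^sup>2 + \<delta>\<^sup>2) powr (-9/4) \<le> s powr (-9/2)"
    using powr_mono2'[of "-9/4" "s\<^sup>2" "s\<^sup>2 + \<delta>\<^sup>2"] assms sq[of "-9/4"] by simp
  show "0 \<le> reg \<delta> s" by (simp add: reg_def)
  have "reg \<delta> s \<le> s ^ 2 * s powr (-5/2)"
    unfolding reg_def using 1 assms by (simp add: mult_left_mono)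
  also have "\<dots> = 1 / sqrt s" using sp[of 2 "-5/2"] powr_minus_half[OF assms] by simp
  finally show "reg \<delta> s \<le> 1 / sqrt s" .
  have "\<bar>2 * s * reg' \<delta> s\<bar> = \<bar>4 * (s ^ 2 * (s\<^sup>2 + \<delta>\<^sup>2) powr (-5/4)) - 5 * (s ^ 4 * (s\<^sup>2 + \<delta>\<^sup>2) powr (-9/4))\<bar>"
    using assms by (simp add: reg'_def algebra_simps power2_eq_square power4_eq_xxxx)
  also have "\<dots> \<le> \<bar>4 * (s ^ 2 * (s\<^sup>2 + \<delta>\<^sup>2) powr (-5/4))\<bar> + \<bar>5 * (s ^ 4 * (s\<^sup>2 + \<delta>\<^sup>2) powr (-9/4))\<bar>"
    by (rule abs_triangle_ineq4)
  also have "\<dots> = 4 * (s ^ 2 * (s\<^sup>2 + \<delta>\<^sup>2) powr (-5/4)) + 5 * (s ^ 4 * (s\<^sup>2 + \<delta>\<^sup>2) powr (-9/4))"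
    by simp
  also have "\<dots> \<le> 4 * (s ^ 2 * s powr (-5/2)) + 5 * (s ^ 4 * s powr (-9/2))"
    using 1 2 assms by (intro add_mono mult_left_mono) auto
  also have "\<dots> = 9 / sqrt s" using sp[of 2 "-5/2"] sp[of 4 "-9/2"] powr_minus_half[OF assms] by simp
  finally show "\<bar>2 * s * reg' \<delta> s\<bar> \<le> 9 / sqrt s" .
qed

lemma reg_limits:
  assumes "0 < s" and "d \<longlonglongrightarrow> 0"
  shows "(\<lambda>n. reg (d n) s) \<longlonglongrightarrow> 1 / sqrt s" "(\<lambda>n. 2 * s * reg' (d n) s) \<longlonglongrightarrow> - 1 / sqrt s"
proof -
  have sq: "(s\<^sup>2 + 0\<^sup>2) powr a = s powr (2 * a)" for a
    using assms by (simp add: powr_powr flip: powr_numeral)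
  have sp: "s ^ n * s powr a = s powr (real n + a)" for n a
    using assms by (simp add: powr_add powr_realpow)
  have l: "(\<lambda>n. (s\<^sup>2 + (d n)\<^sup>2) powr a) \<longlonglongrightarrow> (s\<^sup>2 + 0\<^sup>2) powr a" for a
    using assms by (intro tendsto_intros) auto
  have "(\<lambda>n. reg (d n) s) \<longlonglongrightarrow> (max 0 s) ^ 2 * (s\<^sup>2 + 0\<^sup>2) powr (-5/4)"
    unfolding reg_def by (intro tendsto_intros l)
  then show "(\<lambda>n. reg (d n) s) \<longlonglongrightarrow> 1 / sqrt s"
    using sp[of 2 "-5/2"] powr_minus_half[OF assms(1)] assms(1) unfolding sq by simp
  have "(\<lambda>n. 2 * s * reg' (d n) s) \<longlonglongrightarrow> 2 * s * (2 * max 0 s * (s\<^sup>2 + 0\<^sup>2) powr (-5/4) + (max 0 s) ^ 2 * (-5/4 * (s\<^sup>2 + 0\<^sup>2) powr (-9/4) * (2 * s)))"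
    unfolding reg'_def by (intro tendsto_intros l)
  also have "2 * s * (2 * max 0 s * (s\<^sup>2 + 0\<^sup>2) powr (-5/4) + (max 0 s) ^ 2 * (-5/4 * (s\<^sup>2 + 0\<^sup>2) powr (-9/4) * (2 * s)))
    = 4 * (s ^ 2 * s powr (-5/2)) - 5 * (s ^ 4 * s powr (-9/2))"
    using assms(1) unfolding sq by (simp add: algebra_simps power2_eq_square power4_eq_xxxx)
  also have "\<dots> = - 1 / sqrt s" using sp[of 2 "-5/2"] sp[of 4 "-9/2"] powr_minus_half[OF assms(1)] by simp
  finally show "(\<lambda>n. 2 * s * reg' (d n) s) \<longlonglongrightarrow> - 1 / sqrt s" .
qed

lemma integrable_inv_sqrt_ball:
  "integrable lborel (\<lambda>\<xi>::real^2. indicator (ball 0 1) \<xi> / sqrt (1 - (norm \<xi>)\<^sup>2) :: real)"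
proof (rule integrableI_nonneg)
  show "AE \<xi> in lborel. 0 \<le> (indicator (ball 0 1) (\<xi>::real^2) / sqrt (1 - (norm \<xi>)\<^sup>2) :: real)"
    by (intro AE_I2) (simp add: indicator_def abs_square_le_1)
qed (use borel_measurable_disk_weight(1) in \<open>simp_all add: nn_integral_inv_sqrt_ball\<close>)

text \<open>
  The field \<open>(G - (G \<bullet> x) x) / sqrt (1 - |x|\<^sup>2)\<close> has normal component vanishing on the
  unit circle, and its divergence is the integrand below times the weight of the disc measure.
  The weight is regularised so that the field becomes \<open>C\<^sup>1\<close> on the plane.  For a gradient field
  \<open>G\<close> the identity is the Euler--Poisson--Darboux equation.
\<close>

lemma disk_divergence_identity:
  fixes G :: "real^2 \<Rightarrow> real^2" and H :: "real^2 \<Rightarrow> real^2 \<Rightarrow> real^2"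
  assumes Hd: "\<And>b x. b \<in> Basis \<Longrightarrow> ((\<lambda>x. G x \<bullet> b) has_derivative (\<lambda>h. H b x \<bullet> h)) (at x)"
    and Hc: "\<And>b. b \<in> Basis \<Longrightarrow> continuous_on UNIV (H b)"
  shows "(\<integral>\<xi>. (\<Sum>b\<in>Basis. H b \<xi> \<bullet> b) - (\<Sum>b\<in>Basis. (\<xi> \<bullet> b) * (H b \<xi> \<bullet> \<xi>)) - 2 * (G \<xi> \<bullet> \<xi>) \<partial>disk) = 0"
proof -
  \<comment> \<open>The radial component of G, written through coordinates so that its smoothness
    follows from that of the components.\<close>
  define q where "q x = (\<Sum>c\<in>Basis. (G x \<bullet> c) * (x \<bullet> c))" for x
  have q: "q x = G x \<bullet> x" for x unfolding q_def by (rule euclidean_inner[symmetric])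
  define L where "L x = (\<Sum>b\<in>Basis. H b x \<bullet> b)" for x
  define E where "E x = (\<Sum>b\<in>Basis. (x \<bullet> b) * (H b x \<bullet> x))" for x
  define V where "V \<delta> b x = reg \<delta> (1 - x \<bullet> x) * (G x \<bullet> b - (x \<bullet> b) * q x)" for \<delta> b x
  define V' where "V' \<delta> b x h = reg' \<delta> (1 - x \<bullet> x) * (-2 * (x \<bullet> h)) * (G x \<bullet> b - (x \<bullet> b) * q x)
      + reg \<delta> (1 - x \<bullet> x) * (H b x \<bullet> h - ((h \<bullet> b) * q x + (x \<bullet> b) * (\<Sum>c\<in>Basis. (x \<bullet> c) * (H c x \<bullet> h) + (h \<bullet> c) * (G x \<bullet> c))))" for \<delta> b x h
  have cG: "continuous_on UNIV G"
    by (subst continuous_on_componentwise) (intro ballI has_derivative_continuous_on, rule Hd)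
  have C1G: "C_on 1 UNIV (\<lambda>x. G x \<bullet> b)" if "b \<in> Basis" for b
    unfolding One_nat_def
    by (rule C_on_SucI[OF Hd[OF that]]) (use Hc[OF that] in \<open>simp add: continuous_on_inner\<close>)
  have C1x: "C_on 1 UNIV (\<lambda>x::real^2. x \<bullet> b)" for b
    by (rule C_on_linear) (rule bounded_linear_inner_left)
  have C1q: "C_on 1 UNIV q"
    unfolding q_def by (intro C_on_sum C_on_mult C1G C1x)
  have C1s: "C_on 1 UNIV (\<lambda>x::real^2. 1 - x \<bullet> x)"
  proof -
    have eq: "(\<lambda>x::real^2. 1 - x \<bullet> x) = (\<lambda>x. 1 - (\<Sum>b\<in>Basis. (x \<bullet> b) * (x \<bullet> b)))"
      by (intro ext arg_cong[where f="\<lambda>y. 1 - y"] euclidean_inner)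
    show ?thesis unfolding eq by (intro C_on_diff C_on_const C_on_sum C_on_mult C1x)
  qed
  have C1V: "C_on 1 UNIV (V \<delta> b)" if "0 < \<delta>" "b \<in> Basis" for \<delta> b
    unfolding V_def
    by (rule C_on_mult[OF C_on_compose_real[OF reg_C1[OF that(1)] C1s subset_UNIV]])
      (intro C_on_diff C_on_mult C1G that C1q C1x)
  have dq: "(q has_derivative (\<lambda>h. \<Sum>c\<in>Basis. (x \<bullet> c) * (H c x \<bullet> h) + (h \<bullet> c) * (G x \<bullet> c))) (at x)" for x
    unfolding q_def
    by (rule has_derivative_eq_rhs, rule has_derivative_sum, rule has_derivative_mult, rule Hd, assumption,
        rule has_derivative_inner_left, rule has_derivative_ident)
      (auto simp: mult.commute add.commute)
  have ds: "((\<lambda>x. reg \<delta> (1 - x \<bullet> x)) has_derivative (\<lambda>h. reg' \<delta> (1 - x \<bullet> x) * (-2 * (x \<bullet> h)))) (at x)"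
    if "0 < \<delta>" for \<delta> and x :: "real^2"
  proof -
    have 1: "((\<lambda>x::real^2. 1 - x \<bullet> x) has_derivative (\<lambda>h. -2 * (x \<bullet> h))) (at x)"
      by (auto intro!: derivative_eq_intros simp: inner_commute)
    have 2: "(reg \<delta> has_derivative (\<lambda>h. reg' \<delta> (1 - x \<bullet> x) * h)) (at (1 - x \<bullet> x))"
      using reg_deriv[OF that] by (simp add: has_field_derivative_def)
    show ?thesis using has_derivative_compose[OF 1 2] .
  qed
  have dV: "(V \<delta> b has_derivative V' \<delta> b x) (at x)" if "0 < \<delta>" "b \<in> Basis" for \<delta> b x
  proof -
    have "((\<lambda>x. G x \<bullet> b - (x \<bullet> b) * q x) has_derivative
       (\<lambda>h. H b x \<bullet> h - ((h \<bullet> b) * q x + (x \<bullet> b) * (\<Sum>c\<in>Basis. (x \<bullet> c) * (H c x \<bullet> h) + (h \<bullet> c) * (G x \<bullet> c))))) (at x)"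
      by (rule has_derivative_eq_rhs, rule has_derivative_diff[OF Hd[OF that(2)]],
          rule has_derivative_mult[OF has_derivative_inner_left[OF has_derivative_ident] dq])
        (simp add: add.commute)
    from has_derivative_mult[OF ds[OF that(1)] this] show ?thesis
      unfolding V_def[abs_def] V'_def[abs_def] by (simp add: add.commute)
  qed
  \<comment> \<open>In the coefficient 3, two units come from the divergence of x in the plane and
    one from differentiating G in G \<bullet> x along x. The derivative of the weight meets the
    field only through its radial part, which carries the factor 1 - |x|^2 that tames it.\<close>
  have divV: "(\<Sum>b\<in>Basis. V' \<delta> b x b) = reg \<delta> (1 - x \<bullet> x) * (L x - E x - 3 * q x) - (2 * (1 - x \<bullet> x) * reg' \<delta> (1 - x \<bullet> x)) * q x" for \<delta> x
  proof -
    have s1: "(\<Sum>b\<in>Basis. (x \<bullet> b) * (G x \<bullet> b - (x \<bullet> b) * q x)) = (1 - x \<bullet> x) * q x"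
    proof -
      have "(\<Sum>b\<in>Basis. (x \<bullet> b) * (G x \<bullet> b - (x \<bullet> b) * q x)) = q x - (\<Sum>b\<in>Basis. (x \<bullet> b) * (x \<bullet> b)) * q x"
        by (simp add: q_def[of x] right_diff_distrib sum_subtractf sum_distrib_right mult_ac)
      also have "\<dots> = q x - (x \<bullet> x) * q x" by (simp only: euclidean_inner[symmetric])
      finally show ?thesis by (simp add: algebra_simps)
    qed
    have s2: "(\<Sum>b\<in>Basis. (x \<bullet> b) * (\<Sum>c\<in>Basis. (x \<bullet> c) * (H c x \<bullet> b) + (b \<bullet> c) * (G x \<bullet> c))) = E x + q x"
    proof -
      have "(\<Sum>b\<in>Basis. (x \<bullet> b) * (\<Sum>c\<in>Basis. (x \<bullet> c) * (H c x \<bullet> b) + (b \<bullet> c) * (G x \<bullet> c)))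
        = (\<Sum>b\<in>Basis. \<Sum>c\<in>Basis. (x \<bullet> c) * ((H c x \<bullet> b) * (x \<bullet> b))) + (\<Sum>b\<in>Basis. (x \<bullet> b) * (\<Sum>c\<in>Basis. (b \<bullet> c) * (G x \<bullet> c)))"
        by (simp add: sum.distrib distrib_left sum_distrib_left mult_ac)
      also have "(\<Sum>b\<in>Basis. \<Sum>c\<in>Basis. (x \<bullet> c) * ((H c x \<bullet> b) * (x \<bullet> b))) = E x"
        unfolding E_def by (subst sum.swap) (simp add: sum_distrib_left[symmetric] euclidean_inner[symmetric])
      also have "(\<Sum>b\<in>Basis. (x \<bullet> b) * (\<Sum>c\<in>Basis. (b \<bullet> c) * (G x \<bullet> c))) = (\<Sum>b\<in>Basis. (x \<bullet> b) * (G x \<bullet> b))"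
        by (intro sum.cong refl) (simp only: euclidean_inner[symmetric], simp only: inner_commute)
      also have "\<dots> = q x" by (simp add: q_def mult.commute)
      finally show ?thesis .
    qed
    have s3: "(\<Sum>b\<in>(Basis::(real^2) set). (b \<bullet> b) * q x) = 2 * q x"
      by (simp add: inner_Basis)
    have "(\<Sum>b\<in>Basis. V' \<delta> b x b) = (\<Sum>b\<in>Basis. (-2 * reg' \<delta> (1 - x \<bullet> x)) * ((x \<bullet> b) * (G x \<bullet> b - (x \<bullet> b) * q x))
      + reg \<delta> (1 - x \<bullet> x) * (H b x \<bullet> b - ((b \<bullet> b) * q x + (x \<bullet> b) * (\<Sum>c\<in>Basis. (x \<bullet> c) * (H c x \<bullet> b) + (b \<bullet> c) * (G x \<bullet> c)))))"
      unfolding V'_def by (intro sum.cong refl) (simp add: mult_ac)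
    also have "\<dots> = (-2 * reg' \<delta> (1 - x \<bullet> x)) * ((1 - x \<bullet> x) * q x)
      + reg \<delta> (1 - x \<bullet> x) * (L x - (2 * q x + (E x + q x)))"
      unfolding s1[symmetric] s2[symmetric] s3[symmetric] L_def
      by (simp only: sum.distrib[of _ _ Basis] sum_subtractf sum_distrib_left[symmetric, of _ _ Basis])
    also have "\<dots> = reg \<delta> (1 - x \<bullet> x) * (L x - E x - 3 * q x) - (2 * (1 - x \<bullet> x) * reg' \<delta> (1 - x \<bullet> x)) * q x"
      by (simp add: algebra_simps)
    finally show ?thesis .
  qed
  define I where "I n x = reg (1 / real (Suc n)) (1 - x \<bullet> x) * (L x - E x - 3 * q x)
      - (2 * (1 - x \<bullet> x) * reg' (1 / real (Suc n)) (1 - x \<bullet> x)) * q x" for n x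
  have norm_sq: "x \<bullet> x = (norm x)\<^sup>2" for x :: "real^2" by (simp add: power2_norm_eq_inner)
  have intV: "integrable lborel (\<lambda>x. V' (1 / real (Suc n)) b x b)" "(\<integral>x. V' (1 / real (Suc n)) b x b \<partial>lborel) = 0"
    if "b \<in> Basis" for n b
  proof -
    have out: "V (1 / real (Suc n)) b x = 0" if "1 < norm x" for x
    proof -
      have "1 - x \<bullet> x \<le> 0" unfolding norm_sq using that by (simp add: one_le_power)
      then show ?thesis by (simp add: V_def reg_def)
    qed
    show "integrable lborel (\<lambda>x. V' (1 / real (Suc n)) b x b)" "(\<integral>x. V' (1 / real (Suc n)) b x b \<partial>lborel) = 0"
      by (rule integral_partial_derivative_zero[OF dV C1V out]; use that in simp)+
  qed
  have int0: "(\<integral>x. I n x \<partial>lborel) = 0" "I n \<in> borel_measurable lborel" for n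
  proof -
    have "I n = (\<lambda>x. \<Sum>b\<in>Basis. V' (1 / real (Suc n)) b x b)" unfolding I_def divV ..
    then show "(\<integral>x. I n x \<partial>lborel) = 0" "I n \<in> borel_measurable lborel"
      using intV by (simp_all add: borel_measurable_integrable)
  qed
  have cq: "continuous_on UNIV q" unfolding q by (intro continuous_intros cG)
  have cL: "continuous_on UNIV L" unfolding L_def by (intro continuous_intros Hc)
  have cE: "continuous_on UNIV E" unfolding E_def by (intro continuous_intros Hc)
  have cP: "continuous_on UNIV (\<lambda>x. \<bar>L x - E x - 3 * q x\<bar> + \<bar>q x\<bar>)"
    by (intro continuous_intros cq cL cE)
  have "compact ((\<lambda>x. \<bar>L x - E x - 3 * q x\<bar> + \<bar>q x\<bar>) ` cball 0 1)"
    by (rule compact_continuous_image[OF continuous_on_subset[OF cP]]) auto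
  from compact_imp_bounded[OF this] obtain B
    where "\<forall>y\<in>(\<lambda>x. \<bar>L x - E x - 3 * q x\<bar> + \<bar>q x\<bar>) ` cball 0 1. norm y \<le> B"
    unfolding bounded_iff by (elim exE)
  then have B: "\<bar>L x - E x - 3 * q x\<bar> \<le> B" "\<bar>q x\<bar> \<le> B" if "norm x \<le> 1" for x
    using that by (fastforce dest: bspec)+
  define w where "w x = indicator (ball 0 1) x / sqrt (1 - (norm x)\<^sup>2)" for x :: "real^2"
  \<comment> \<open>The constant 10 is 1 + 9, the two constants of
    \<open>reg_bounds\<close>.\<close>
  have bnd: "norm (I n x) \<le> 10 * B * w x" for n x
  proof (cases "norm x < 1")
    case True
    then have s: "0 < 1 - x \<bullet> x" unfolding norm_sq by (simp add: abs_square_less_1)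
    note rb = reg_bounds[OF s, of "1 / real (Suc n)"]
    have Bp: "0 \<le> B" using B(2)[of x] True by simp
    have "norm (I n x) \<le> \<bar>reg (1 / real (Suc n)) (1 - x \<bullet> x)\<bar> * \<bar>L x - E x - 3 * q x\<bar>
      + \<bar>2 * (1 - x \<bullet> x) * reg' (1 / real (Suc n)) (1 - x \<bullet> x)\<bar> * \<bar>q x\<bar>"
      unfolding I_def real_norm_def abs_mult[symmetric] by (rule abs_triangle_ineq4)
    also have "\<dots> \<le> 1 / sqrt (1 - x \<bullet> x) * B + 9 / sqrt (1 - x \<bullet> x) * B"
      using rb B[of x] True s Bp by (intro add_mono mult_mono) auto
    also have "\<dots> = 10 * B * w x" using True by (simp add: w_def norm_sq field_simps)
    finally show ?thesis .
  next
    case False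
    then have "1 - x \<bullet> x \<le> 0" unfolding norm_sq by (simp add: one_le_power)
    then have "I n x = 0" by (simp add: I_def reg_def reg'_def)
    then show ?thesis using False by (simp add: w_def)
  qed
  \<comment> \<open>The differentiated weight contributes + q in the limit, which lowers the
    coefficient of q from 3 to 2.\<close>
  have lim: "(\<lambda>n. I n x) \<longlonglongrightarrow> w x * (L x - E x - 2 * q x)" for x
  proof (cases "norm x < 1")
    case True
    then have s: "0 < 1 - x \<bullet> x" unfolding norm_sq by (simp add: abs_square_less_1)
    have "(\<lambda>n. I n x) \<longlonglongrightarrow> 1 / sqrt (1 - x \<bullet> x) * (L x - E x - 3 * q x) - (- 1 / sqrt (1 - x \<bullet> x)) * q x"
      unfolding I_def by (intro tendsto_intros reg_limits[OF s] LIMSEQ_Suc[OF lim_1_over_n])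
    also have "1 / sqrt (1 - x \<bullet> x) * (L x - E x - 3 * q x) - (- 1 / sqrt (1 - x \<bullet> x)) * q x = w x * (L x - E x - 2 * q x)"
      using True by (simp add: w_def norm_sq algebra_simps diff_divide_distrib add_divide_distrib)
    finally show ?thesis .
  next
    case False
    then have "1 - x \<bullet> x \<le> 0" unfolding norm_sq by (simp add: one_le_power)
    then have "I n x = 0" for n by (simp add: I_def reg_def reg'_def)
    then show ?thesis using False by (simp add: w_def)
  qed
  have iw: "integrable lborel (\<lambda>x. 10 * B * w x)"
    unfolding w_def by (intro integrable_mult_right integrable_inv_sqrt_ball)
  have mlim: "(\<lambda>x. w x * (L x - E x - 2 * q x)) \<in> borel_measurable lborel"
    unfolding w_def using borel_measurable_disk_weight(1) cq cL cE
    by (intro borel_measurable_times borel_measurable_diff borel_measurable_const)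
      (simp_all add: borel_measurable_continuous_onI)
  have "(\<lambda>n. \<integral>x. I n x \<partial>lborel) \<longlonglongrightarrow> (\<integral>x. w x * (L x - E x - 2 * q x) \<partial>lborel)"
    by (rule integral_dominated_convergence[OF mlim int0(2) iw AE_I2 AE_I2]) (rule lim, rule bnd)
  then have z: "(\<integral>x. w x * (L x - E x - 2 * q x) \<partial>lborel) = 0"
    unfolding int0 by (simp add: LIMSEQ_const_iff)
  have "(\<integral>x. L x - E x - 2 * q x \<partial>disk)
      = (\<integral>x. (indicator (cball 0 1) x / (2 * pi * sqrt (1 - (norm x)\<^sup>2))) *\<^sub>R (L x - E x - 2 * q x) \<partial>lborel)"
    by (rule disk_integral_density) (intro borel_measurable_continuous_onI continuous_intros cq cL cE)
  also have "\<dots> = (\<integral>x. (1 / (2 * pi)) * (w x * (L x - E x - 2 * q x)) \<partial>lborel)"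
    by (intro Bochner_Integration.integral_cong refl) (unfold disk_weight_eq w_def real_scaleR_def, rule mult.assoc)
  also have "\<dots> = 0" by (simp only: Bochner_Integration.integral_mult_right_zero z mult_zero_right)
  finally show ?thesis by (simp add: L_def E_def q)
qed

section \<open>Retarded potentials\<close>

lemma mem_spacetime [simp]: "z \<in> spacetime T \<longleftrightarrow> 0 \<le> snd z \<and> snd z < T"
  by (cases z) (simp add: spacetime_def)

lemma convex_spacetime: "convex (spacetime T)"
  unfolding spacetime_def by (intro convex_Times convex_UNIV convex_real_interval)

lemma integral_rescale_unit:
  fixes f :: "real \<Rightarrow> 'b::euclidean_space"
  assumes "0 \<le> t" and "continuous_on {0..t} f"
  shows "integral {0..t} f = t *\<^sub>R integral {0..1} (\<lambda>\<theta>. f (t * \<theta>))"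
proof (cases "t = 0")
  case False
  then have t: "0 < t" using assms(1) by simp
  have "f integrable_on {0..t}" by (rule integrable_continuous_real) (rule assms(2))
  then have "(f has_integral integral {0..t} f) {0..t}" by (rule integrable_integral)
  from has_integral_stretch_real[OF this False]
  have "((\<lambda>\<theta>. f (t * \<theta>)) has_integral (1 / \<bar>t\<bar>) *\<^sub>R integral {0..t} f) ((\<lambda>x. x / t) ` {0..t})" .
  moreover have "(\<lambda>x. x / t) ` {0..t} = {0..1}" using t by (simp add: image_divide_atLeastAtMost)
  ultimately have "integral {0..1} (\<lambda>\<theta>. f (t * \<theta>)) = (1 / t) *\<^sub>R integral {0..t} f"
    using t by (simp add: integral_unique)
  then show ?thesis using t by simp
qed simp

text \<open>Substituting \<tau> = t \<theta> moves the variable endpoint into the integrand and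
  leaves a parameter integral over the fixed interval [0, 1].\<close>

lemma continuous_on_volterra:
  fixes m :: "(real^2) \<times> real \<Rightarrow> real \<Rightarrow> 'b::euclidean_space"
  assumes "continuous_on (spacetime T \<times> {0..<T}) (\<lambda>p. m (fst p) (snd p))"
  shows "continuous_on (spacetime T) (\<lambda>z. integral {0..snd z} (m z))"
proof -
  have sub: "0 \<le> s * \<theta>" "s * \<theta> < T" if "0 \<le> s" "s < T" "0 \<le> \<theta>" "\<theta> \<le> 1" for s \<theta>
    using that mult_left_le[of \<theta> s] by (simp_all add: order_le_less_trans)
  have c: "continuous_on (spacetime T \<times> cbox 0 1) (\<lambda>p. m (fst p) (snd (fst p) * snd p))"
  proof -
    have "continuous_on (spacetime T \<times> cbox 0 1) (\<lambda>p. (\<lambda>p. m (fst p) (snd p)) (fst p, snd (fst p) * snd p))"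
      by (rule continuous_on_compose2[OF assms]) (auto intro!: continuous_intros sub)
    then show ?thesis by simp
  qed
  have "continuous_on (spacetime T) (\<lambda>z. integral (cbox 0 1) (\<lambda>\<theta>. m z (snd z * \<theta>)))"
    by (rule integral_continuous_on_param) (use c in \<open>simp add: case_prod_beta\<close>)
  then have "continuous_on (spacetime T) (\<lambda>z. snd z *\<^sub>R integral (cbox 0 1) (\<lambda>\<theta>. m z (snd z * \<theta>)))"
    by (intro continuous_intros)
  then show ?thesis
  proof (rule continuous_on_eq)
    fix z assume z: "z \<in> spacetime T"
    have "continuous_on {0..<T} (m z)"
      by (rule continuous_on_slice[OF assms z])
    then have "continuous_on {0..snd z} (m z)"
      by (rule continuous_on_subset) (use z in auto)
    then show "snd z *\<^sub>R integral (cbox 0 1) (\<lambda>\<theta>. m z (snd z * \<theta>)) = integral {0..snd z} (m z)"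
      using z by (subst integral_rescale_unit) auto
  qed
qed

text \<open>The endpoint is first treated as an independent variable a: the integral over [0, a] has
  one partial derivative by differentiation under the integral and the other by the fundamental
  theorem. Restriction to a = \<open>snd z\<close> gives the claim, which is why m is considered for
  all \<tau> below T and not only up to \<open>snd z\<close>.\<close>

lemma has_derivative_volterra:
  fixes m :: "(real^2) \<times> real \<Rightarrow> real \<Rightarrow> real" and gm :: "(real^2) \<times> real \<Rightarrow> real \<Rightarrow> (real^2) \<times> real"
  assumes cm: "continuous_on (spacetime T \<times> {0..<T}) (\<lambda>p. m (fst p) (snd p))"
    and cg: "continuous_on (spacetime T \<times> {0..<T}) (\<lambda>p. gm (fst p) (snd p))"
    and d: "\<And>z \<tau>. z \<in> spacetime T \<Longrightarrow> \<tau> \<in> {0..<T} \<Longrightarrow>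
      ((\<lambda>z. m z \<tau>) has_derivative (\<lambda>h. gm z \<tau> \<bullet> h)) (at z within spacetime T)"
    and z: "z \<in> spacetime T"
  shows "((\<lambda>z. integral {0..snd z} (m z)) has_derivative
     (\<lambda>h. integral {0..snd z} (gm z) \<bullet> h + m z (snd z) * snd h)) (at z within spacetime T)"
proof -
  define \<Phi> where "\<Phi> z a = integral {0..a} (m z)" for z a
  have a: "snd z \<in> {0..<T}" using z by simp
  have cmz: "continuous_on {0..a} (m z)" if "z \<in> spacetime T" "a < T" for z a
    by (rule continuous_on_subset[OF continuous_on_slice[OF cm that(1)]]) (use that in auto)
  have cgz: "continuous_on {0..a} (gm z)" if "z \<in> spacetime T" "a < T" for z a
    by (rule continuous_on_subset[OF continuous_on_slice[OF cg that(1)]]) (use that in auto)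
  have fx: "((\<lambda>z. \<Phi> z (snd z0)) has_derivative (\<lambda>h. integral {0..snd z0} (gm z0) \<bullet> h)) (at z0 within spacetime T)"
    if z0: "z0 \<in> spacetime T" for z0
  proof -
    have "((\<lambda>z. integral (cbox 0 (snd z0)) (m z)) has_derivative
        integral (cbox 0 (snd z0)) (\<lambda>\<tau>. blinfun_inner_right (gm z0 \<tau>))) (at z0 within spacetime T)"
    proof (rule leibniz_rule)
      show "((\<lambda>z. m z t) has_derivative blinfun_apply (blinfun_inner_right (gm x t))) (at x within spacetime T)"
        if "x \<in> spacetime T" "t \<in> cbox 0 (snd z0)" for x t
        using d[OF that(1), of t] that(2) z0 by simp
      show "m x integrable_on cbox 0 (snd z0)" if "x \<in> spacetime T" for x
        using integrable_continuous_real[OF cmz[OF that, of "snd z0"]] z0 by simp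
      have "continuous_on (spacetime T \<times> cbox 0 (snd z0)) (\<lambda>p. gm (fst p) (snd p))"
        by (rule continuous_on_subset[OF cg]) (use z0 in auto)
      then show "continuous_on (spacetime T \<times> cbox 0 (snd z0)) (\<lambda>(x, t). blinfun_inner_right (gm x t))"
        unfolding case_prod_beta by (intro bounded_linear.continuous_on[OF bounded_linear_blinfun_inner_right])
    qed (use z0 convex_spacetime in auto)
    moreover have "integral (cbox 0 (snd z0)) (\<lambda>\<tau>. blinfun_inner_right (gm z0 \<tau>)) = blinfun_inner_right (integral {0..snd z0} (gm z0))"
    proof -
      have "gm z0 integrable_on {0..snd z0}"
        by (rule integrable_continuous_real[OF cgz]) (use z0 in auto)
      from integral_linear[OF this bounded_linear_blinfun_inner_right] show ?thesis
        by (simp add: o_def)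
    qed
    ultimately show ?thesis by (simp add: \<Phi>_def)
  qed
  have fy: "((\<lambda>a. \<Phi> z a) has_derivative blinfun_apply (blinfun_inner_right (m z a))) (at a within {0..<T})"
    if z: "z \<in> spacetime T" and a: "a \<in> {0..<T}" for z a
  proof -
    \<comment> \<open>A compact interval around a inside [0, T); it defines the same one-sided
      neighbourhoods of a as the half-open interval.\<close>
    define b where "b = (a + T) / 2"
    have b: "a < b" "b < T" using a by (auto simp: b_def)
    have "((\<lambda>u. integral {0..u} (m z)) has_vector_derivative m z a) (at a within {0..b})"
      by (rule integral_has_vector_derivative[OF cmz[OF z b(2)]]) (use a b in auto)
    moreover have "at a within {0..b} = at a within {0..<T}"
      by (rule at_within_nhd[of a "{..<b}"]) (use a b in auto)
    ultimately show ?thesis by (simp add: \<Phi>_def has_vector_derivative_def mult_commute_abs)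
  qed
  have "((\<lambda>(z, a). \<Phi> z a) has_derivative (\<lambda>(tx, ty). integral {0..snd z} (gm z) \<bullet> tx + blinfun_apply (blinfun_inner_right (m z (snd z))) ty))
     (at (z, snd z) within spacetime T \<times> {0..<T})"
  proof (rule has_derivative_partialsI[OF fx[OF z] fy])
    have "continuous_on (spacetime T \<times> {0..<T}) (\<lambda>p. blinfun_inner_right (m (fst p) (snd p)))"
      by (intro bounded_linear.continuous_on[OF bounded_linear_blinfun_inner_right] cm)
    then show "continuous (at (z, snd z) within spacetime T \<times> {0..<T}) (\<lambda>(z, a). blinfun_inner_right (m z a))"
      using z a by (simp add: continuous_on_eq_continuous_within case_prod_unfold)
    show "snd z \<in> {0..<T}" by (rule a)
    show "convex {0..<T}" by (rule convex_real_interval)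
  qed
  then have "((\<lambda>p. \<Phi> (fst p) (snd p)) has_derivative (\<lambda>h. integral {0..snd z} (gm z) \<bullet> fst h + m z (snd z) * snd h))
     (at (z, snd z) within spacetime T \<times> {0..<T})"
    by (simp add: case_prod_unfold)
  then have 2: "((\<lambda>p. \<Phi> (fst p) (snd p)) has_derivative (\<lambda>h. integral {0..snd z} (gm z) \<bullet> fst h + m z (snd z) * snd h))
     (at (z, snd z) within (\<lambda>z. (z, snd z)) ` spacetime T)"
    by (rule has_derivative_subset) auto
  have 1: "((\<lambda>z. (z, snd z)) has_derivative (\<lambda>h. (h, snd h))) (at z within spacetime T)"
    by (auto intro!: derivative_eq_intros)
  show ?thesis using has_derivative_in_compose[OF 1 2] by (simp add: \<Phi>_def)
qed

text \<open>The form in which potentials are differentiated: \<open>gx\<close> and \<open>gt\<close>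
  are the space and time parts of the gradient of the integrand in z, and the last summand of the
  time coefficient is the contribution of the moving endpoint.\<close>

lemma volterra_disk:
  fixes k :: "(real^2) \<times> real \<Rightarrow> real \<Rightarrow> real^2 \<Rightarrow> real"
    and gx :: "(real^2) \<times> real \<Rightarrow> real \<Rightarrow> real^2 \<Rightarrow> real^2" and gt :: "(real^2) \<times> real \<Rightarrow> real \<Rightarrow> real^2 \<Rightarrow> real"
  assumes ck: "continuous_on ((spacetime T \<times> {0..<T}) \<times> UNIV) (\<lambda>p. k (fst (fst p)) (snd (fst p)) (snd p))"
    and cx: "continuous_on ((spacetime T \<times> {0..<T}) \<times> UNIV) (\<lambda>p. gx (fst (fst p)) (snd (fst p)) (snd p))"
    and ct: "continuous_on ((spacetime T \<times> {0..<T}) \<times> UNIV) (\<lambda>p. gt (fst (fst p)) (snd (fst p)) (snd p))"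
    and d: "\<And>z \<tau> \<xi>. z \<in> spacetime T \<Longrightarrow> \<tau> \<in> {0..<T} \<Longrightarrow>
      ((\<lambda>z. k z \<tau> \<xi>) has_derivative (\<lambda>h. gx z \<tau> \<xi> \<bullet> fst h + gt z \<tau> \<xi> * snd h)) (at z within spacetime T)"
    and z: "z \<in> spacetime T"
  shows "((\<lambda>z. integral {0..snd z} (\<lambda>\<tau>. \<integral>\<xi>. k z \<tau> \<xi> \<partial>disk)) has_derivative
     (\<lambda>h. integral {0..snd z} (\<lambda>\<tau>. \<integral>\<xi>. gx z \<tau> \<xi> \<partial>disk) \<bullet> fst h
       + (integral {0..snd z} (\<lambda>\<tau>. \<integral>\<xi>. gt z \<tau> \<xi> \<partial>disk) + (\<integral>\<xi>. k z (snd z) \<xi> \<partial>disk)) * snd h)) (at z within spacetime T)"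
proof -
  note cdi = continuous_on_disk_integral[where Z="spacetime T \<times> {0..<T}"]
  have cm: "continuous_on (spacetime T \<times> {0..<T}) (\<lambda>p. \<integral>\<xi>. k (fst p) (snd p) \<xi> \<partial>disk)"
    by (rule cdi[of "\<lambda>p. k (fst p) (snd p)"]) (rule ck)
  have cX: "continuous_on (spacetime T \<times> {0..<T}) (\<lambda>p. \<integral>\<xi>. gx (fst p) (snd p) \<xi> \<partial>disk)"
    by (rule cdi[of "\<lambda>p. gx (fst p) (snd p)"]) (rule cx)
  have cT: "continuous_on (spacetime T \<times> {0..<T}) (\<lambda>p. \<integral>\<xi>. gt (fst p) (snd p) \<xi> \<partial>disk)"
    by (rule cdi[of "\<lambda>p. gt (fst p) (snd p)"]) (rule ct)
  define gm where "gm z \<tau> = ((\<integral>\<xi>. gx z \<tau> \<xi> \<partial>disk), (\<integral>\<xi>. gt z \<tau> \<xi> \<partial>disk))" for z \<tau>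
  have cgm: "continuous_on (spacetime T \<times> {0..<T}) (\<lambda>p. gm (fst p) (snd p))"
    unfolding gm_def by (intro continuous_on_Pair cX cT)
  have ckz: "continuous_on UNIV (k z \<tau>)" "continuous_on UNIV (gx z \<tau>)" "continuous_on UNIV (gt z \<tau>)"
    if "z \<in> spacetime T" "\<tau> \<in> {0..<T}" for z \<tau>
  proof -
    have m: "(z, \<tau>) \<in> spacetime T \<times> {0..<T}" using that by (intro SigmaI)
    show "continuous_on UNIV (k z \<tau>)" "continuous_on UNIV (gx z \<tau>)" "continuous_on UNIV (gt z \<tau>)"
      using continuous_on_slice[of _ UNIV "\<lambda>p. k (fst p) (snd p)", OF ck m]
        continuous_on_slice[of _ UNIV "\<lambda>p. gx (fst p) (snd p)", OF cx m]
        continuous_on_slice[of _ UNIV "\<lambda>p. gt (fst p) (snd p)", OF ct m] by simp_all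
  qed
  have dm: "((\<lambda>z. \<integral>\<xi>. k z \<tau> \<xi> \<partial>disk) has_derivative (\<lambda>h. gm z \<tau> \<bullet> h)) (at z within spacetime T)"
    if z: "z \<in> spacetime T" and t: "\<tau> \<in> {0..<T}" for z \<tau>
  proof -
    have "((\<lambda>z. \<integral>\<xi>. k z \<tau> \<xi> \<partial>disk) has_derivative (\<lambda>h. (\<integral>\<xi>. (gx z \<tau> \<xi>, gt z \<tau> \<xi>) \<partial>disk) \<bullet> h)) (at z within spacetime T)"
    proof (rule has_derivative_disk_integral[where g="\<lambda>z \<xi>. (gx z \<tau> \<xi>, gt z \<tau> \<xi>)" and Z="spacetime T"])
      show "((\<lambda>z. k z \<tau> \<xi>) has_derivative (\<lambda>h. (gx z \<tau> \<xi>, gt z \<tau> \<xi>) \<bullet> h)) (at z within spacetime T)"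
        if "z \<in> spacetime T" for z \<xi>
        using d[OF that t] by (simp add: inner_prod_def)
      show "continuous_on UNIV (k z \<tau>)" if "z \<in> spacetime T" for z by (rule ckz[OF that t])
      have e: "continuous_on (spacetime T \<times> UNIV) (\<lambda>p::((real^2) \<times> real) \<times> (real^2). ((fst p, \<tau>), snd p))"
        by (intro continuous_intros)
      have s: "(\<lambda>p. ((fst p, \<tau>), snd p)) ` (spacetime T \<times> UNIV) \<subseteq> (spacetime T \<times> {0..<T}) \<times> UNIV"
        using t by auto
      show "continuous_on (spacetime T \<times> UNIV) (\<lambda>p. (gx (fst p) \<tau> (snd p), gt (fst p) \<tau> (snd p)))"
        using continuous_on_compose2[OF cx e s] continuous_on_compose2[OF ct e s]
        by (intro continuous_on_Pair) simp_all
      show "convex (spacetime T)" by (rule convex_spacetime)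
      show "z \<in> spacetime T" by (rule z)
    qed
    moreover have "(\<integral>\<xi>. (gx z \<tau> \<xi>, gt z \<tau> \<xi>) \<partial>disk) = gm z \<tau>"
    proof -
      have i: "integrable disk (\<lambda>\<xi>. (gx z \<tau> \<xi>, gt z \<tau> \<xi>))"
        by (intro integrable_disk continuous_on_Pair ckz z t)
      show ?thesis
        using integral_bounded_linear[OF bounded_linear_fst i] integral_bounded_linear[OF bounded_linear_snd i]
        by (simp add: gm_def prod_eq_iff)
    qed
    ultimately show ?thesis by simp
  qed
  have "((\<lambda>z. integral {0..snd z} (\<lambda>\<tau>. \<integral>\<xi>. k z \<tau> \<xi> \<partial>disk)) has_derivative
     (\<lambda>h. integral {0..snd z} (gm z) \<bullet> h + (\<integral>\<xi>. k z (snd z) \<xi> \<partial>disk) * snd h)) (at z within spacetime T)"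
    by (rule has_derivative_volterra[OF cm cgm dm z])
  moreover have "integral {0..snd z} (gm z) = (integral {0..snd z} (\<lambda>\<tau>. \<integral>\<xi>. gx z \<tau> \<xi> \<partial>disk), integral {0..snd z} (\<lambda>\<tau>. \<integral>\<xi>. gt z \<tau> \<xi> \<partial>disk))"
  proof -
    have "continuous_on {0..snd z} (gm z)"
      by (rule continuous_on_subset[OF continuous_on_slice[OF cgm z]]) (use z in auto)
    then have i: "gm z integrable_on {0..snd z}" by (rule integrable_continuous_real)
    show ?thesis
      using integral_linear[OF i bounded_linear_fst] integral_linear[OF i bounded_linear_snd]
      by (simp add: gm_def prod_eq_iff o_def)
  qed
  ultimately show ?thesis by (simp add: inner_prod_def algebra_simps)
qed

lemma continuous_on_volterra_disk:
  fixes k :: "(real^2) \<times> real \<Rightarrow> real \<Rightarrow> real^2 \<Rightarrow> 'b::euclidean_space"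
  assumes ck: "continuous_on ((spacetime T \<times> {0..<T}) \<times> UNIV) (\<lambda>p. k (fst (fst p)) (snd (fst p)) (snd p))"
  shows "continuous_on (spacetime T) (\<lambda>z. integral {0..snd z} (\<lambda>\<tau>. \<integral>\<xi>. k z \<tau> \<xi> \<partial>disk))"
    and "z \<in> spacetime T \<Longrightarrow> continuous_on {0..snd z} (\<lambda>\<tau>. \<integral>\<xi>. k z \<tau> \<xi> \<partial>disk)"
proof -
  have cm: "continuous_on (spacetime T \<times> {0..<T}) (\<lambda>p. \<integral>\<xi>. k (fst p) (snd p) \<xi> \<partial>disk)"
    by (rule continuous_on_disk_integral[of "spacetime T \<times> {0..<T}" "\<lambda>p. k (fst p) (snd p)"]) (rule ck)
  then show "continuous_on (spacetime T) (\<lambda>z. integral {0..snd z} (\<lambda>\<tau>. \<integral>\<xi>. k z \<tau> \<xi> \<partial>disk))"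
    by (rule continuous_on_volterra)
  show "continuous_on {0..snd z} (\<lambda>\<tau>. \<integral>\<xi>. k z \<tau> \<xi> \<partial>disk)" if "z \<in> spacetime T"
    by (rule continuous_on_subset[OF continuous_on_slice[OF cm that]]) (use that in auto)
qed

section \<open>The Duhamel potential and its first derivatives\<close>

text \<open>Vector values are allowed so that the space gradient of \<open>duh F\<close> is
  \<open>duh\<close> applied to the space gradient of F.\<close>

definition duh :: "((real^2) \<times> real \<Rightarrow> 'b::euclidean_space) \<Rightarrow> (real^2) \<times> real \<Rightarrow> 'b" where
  "duh F z = integral {0..snd z} (\<lambda>\<tau>. \<integral>\<xi>. (snd z - \<tau>) *\<^sub>R F (fst z + (snd z - \<tau>) *\<^sub>R \<xi>, \<tau>) \<partial>disk)"

text \<open>The time derivative of \<open>duh F\<close> when G is the space gradient of F. The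
  endpoint \<tau> = t contributes nothing because of the factor t - \<tau> in the potential.\<close>

definition duht :: "((real^2) \<times> real \<Rightarrow> real) \<Rightarrow> ((real^2) \<times> real \<Rightarrow> real^2) \<Rightarrow> (real^2) \<times> real \<Rightarrow> real" where
  "duht F G z = integral {0..snd z} (\<lambda>\<tau>. \<integral>\<xi>. F (fst z + (snd z - \<tau>) *\<^sub>R \<xi>, \<tau>)
     + (snd z - \<tau>) * (G (fst z + (snd z - \<tau>) *\<^sub>R \<xi>, \<tau>) \<bullet> \<xi>) \<partial>disk)"

text \<open>The regularity class on which the iteration runs: joint continuity and one continuous
  space gradient. The potential creates its own time derivatives from these data, so the class is
  preserved by \<open>duh\<close>.\<close>

definition sgrad :: "real \<Rightarrow> ((real^2) \<times> real \<Rightarrow> real) \<Rightarrow> ((real^2) \<times> real \<Rightarrow> real^2) \<Rightarrow> bool" where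
  "sgrad T F G \<longleftrightarrow> continuous_on (spacetime T) F \<and> continuous_on (spacetime T) G \<and>
     (\<forall>t\<in>{0..<T}. \<forall>x. ((\<lambda>y. F (y, t)) has_derivative (\<lambda>h. G (x, t) \<bullet> h)) (at x))"

lemma sgradD:
  assumes "sgrad T F G"
  shows "continuous_on (spacetime T) F" "continuous_on (spacetime T) G"
    "t \<in> {0..<T} \<Longrightarrow> ((\<lambda>y. F (y, t)) has_derivative (\<lambda>h. G (x, t) \<bullet> h)) (at x)"
proof -
  note a = assms[unfolded sgrad_def]
  show "continuous_on (spacetime T) F" by (rule conjunct1[OF a])
  show "continuous_on (spacetime T) G" by (rule conjunct1[OF conjunct2[OF a]])
  show "((\<lambda>y. F (y, t)) has_derivative (\<lambda>h. G (x, t) \<bullet> h)) (at x)" if "t \<in> {0..<T}"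
    by (rule conjunct2[OF conjunct2[OF a], rule_format, OF that])
qed

lemma continuous_on_time_slice:
  assumes "continuous_on (spacetime T) F" and "0 \<le> t" "t < T"
  shows "continuous_on S (\<lambda>y. F (y, t))"
  by (rule continuous_on_compose2[OF assms(1)]) (use assms in \<open>auto intro!: continuous_intros\<close>)

lemma continuous_on_kernel:
  assumes "continuous_on (spacetime T) F"
  shows "continuous_on ((spacetime T \<times> {0..<T}) \<times> UNIV)
    (\<lambda>p. F (fst (fst (fst p)) + (snd (fst (fst p)) - snd (fst p)) *\<^sub>R snd p, snd (fst p)))"
  by (rule continuous_on_compose2[OF assms]) (auto intro!: continuous_intros)

lemma continuous_on_kernel_slice:
  assumes "continuous_on (spacetime T) F" and "0 \<le> \<tau>" "\<tau> < T"
  shows "continuous_on UNIV (\<lambda>\<xi>. F (x + s *\<^sub>R \<xi>, \<tau>))"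
  by (rule continuous_on_compose2[OF assms(1)]) (use assms in \<open>auto intro!: continuous_intros\<close>)

lemma continuous_on_duh:
  assumes "continuous_on (spacetime T) F"
  shows "continuous_on (spacetime T) (duh F)"
  unfolding duh_def
  by (rule continuous_on_volterra_disk(1)) (intro continuous_intros continuous_on_kernel assms)

lemma continuous_on_duh_integrand:
  fixes F :: "(real^2) \<times> real \<Rightarrow> 'b::euclidean_space"
  assumes "continuous_on (spacetime T) F" and "z \<in> spacetime T"
  shows "continuous_on {0..snd z} (\<lambda>\<tau>. \<integral>\<xi>. (snd z - \<tau>) *\<^sub>R F (fst z + (snd z - \<tau>) *\<^sub>R \<xi>, \<tau>) \<partial>disk)"
  by (rule continuous_on_volterra_disk(2)[where k="\<lambda>z \<tau> \<xi>. (snd z - \<tau>) *\<^sub>R F (fst z + (snd z - \<tau>) *\<^sub>R \<xi>, \<tau>)", OF _ assms(2)])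
    (intro continuous_intros continuous_on_kernel assms)

lemma has_derivative_retarded:
  assumes "sgrad T F G" and "\<tau> \<in> {0..<T}"
  shows "((\<lambda>z. F (fst z + (snd z - \<tau>) *\<^sub>R \<xi>, \<tau>)) has_derivative
    (\<lambda>h. G (fst z + (snd z - \<tau>) *\<^sub>R \<xi>, \<tau>) \<bullet> (fst h + snd h *\<^sub>R \<xi>))) (at z within S)"
proof -
  have 1: "((\<lambda>z. fst z + (snd z - \<tau>) *\<^sub>R \<xi>) has_derivative (\<lambda>h. fst h + snd h *\<^sub>R \<xi>)) (at z within S)"
    by (auto intro!: derivative_eq_intros)
  show ?thesis
    using has_derivative_compose[OF 1 sgradD(3)[OF assms]] by simp
qed

lemma has_derivative_duh:
  fixes F :: "(real^2) \<times> real \<Rightarrow> real" and G :: "(real^2) \<times> real \<Rightarrow> real^2" and z :: "(real^2) \<times> real"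
  assumes F: "sgrad T F G" and z: "z \<in> spacetime T"
  shows "(duh F has_derivative (\<lambda>h. duh G z \<bullet> fst h + duht F G z * snd h)) (at z within spacetime T)"
proof -
  note c = continuous_on_kernel[OF sgradD(1)[OF F]] continuous_on_kernel[OF sgradD(2)[OF F]]
  have "((\<lambda>z. integral {0..snd z} (\<lambda>\<tau>. \<integral>\<xi>. (snd z - \<tau>) * F (fst z + (snd z - \<tau>) *\<^sub>R \<xi>, \<tau>) \<partial>disk)) has_derivative
     (\<lambda>h. integral {0..snd z} (\<lambda>\<tau>. \<integral>\<xi>. (snd z - \<tau>) *\<^sub>R G (fst z + (snd z - \<tau>) *\<^sub>R \<xi>, \<tau>) \<partial>disk) \<bullet> fst h
       + (integral {0..snd z} (\<lambda>\<tau>. \<integral>\<xi>. F (fst z + (snd z - \<tau>) *\<^sub>R \<xi>, \<tau>)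
     + (snd z - \<tau>) * (G (fst z + (snd z - \<tau>) *\<^sub>R \<xi>, \<tau>) \<bullet> \<xi>) \<partial>disk) + (\<integral>\<xi>. (snd z - snd z) * F (fst z + (snd z - snd z) *\<^sub>R \<xi>, snd z) \<partial>disk)) * snd h)) (at z within spacetime T)"
  proof (rule volterra_disk[where k="\<lambda>z \<tau> \<xi>. (snd z - \<tau>) * F (fst z + (snd z - \<tau>) *\<^sub>R \<xi>, \<tau>)"
      and gx="\<lambda>z \<tau> \<xi>. (snd z - \<tau>) *\<^sub>R G (fst z + (snd z - \<tau>) *\<^sub>R \<xi>, \<tau>)"
      and gt="\<lambda>z \<tau> \<xi>. F (fst z + (snd z - \<tau>) *\<^sub>R \<xi>, \<tau>) + (snd z - \<tau>) * (G (fst z + (snd z - \<tau>) *\<^sub>R \<xi>, \<tau>) \<bullet> \<xi>)", OF _ _ _ _ z])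
    fix z \<tau> \<xi> assume t: "\<tau> \<in> {0..<T}"
    have "((\<lambda>z. snd z - \<tau>) has_derivative snd) (at z within spacetime T)"
      by (auto intro!: derivative_eq_intros)
    from has_derivative_mult[OF this has_derivative_retarded[OF F t]]
    show "((\<lambda>z. (snd z - \<tau>) * F (fst z + (snd z - \<tau>) *\<^sub>R \<xi>, \<tau>)) has_derivative
      (\<lambda>h. ((snd z - \<tau>) *\<^sub>R G (fst z + (snd z - \<tau>) *\<^sub>R \<xi>, \<tau>)) \<bullet> fst h
        + (F (fst z + (snd z - \<tau>) *\<^sub>R \<xi>, \<tau>) + (snd z - \<tau>) * (G (fst z + (snd z - \<tau>) *\<^sub>R \<xi>, \<tau>) \<bullet> \<xi>)) * snd h)) (at z within spacetime T)"
      by (rule has_derivative_eq_rhs) (simp add: fun_eq_iff inner_add_right algebra_simps)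
  qed (intro continuous_intros c)+
  then show ?thesis by (simp add: duh_def[abs_def] duht_def)
qed

lemma continuous_on_duht:
  assumes F: "sgrad T F G"
  shows "continuous_on (spacetime T) (duht F G)"
  unfolding duht_def
  by (rule continuous_on_volterra_disk(1))
    (intro continuous_intros continuous_on_kernel[OF sgradD(1)[OF F]] continuous_on_kernel[OF sgradD(2)[OF F]])

lemma C_on_duh_1:
  assumes "sgrad T F G"
  shows "C_on 1 (spacetime T) (duh F)"
proof (rule C_on_1I[where G="\<lambda>z. (duh G z, duht F G z)"])
  show "(duh F has_derivative (\<lambda>h. (duh G z, duht F G z) \<bullet> h)) (at z within spacetime T)"
    if "z \<in> spacetime T" for z
    using has_derivative_duh[OF assms that] by (simp add: inner_prod_def)
  show "continuous_on (spacetime T) (\<lambda>z. (duh G z, duht F G z))"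
    by (intro continuous_on_Pair continuous_on_duh continuous_on_duht[OF assms] sgradD(2)[OF assms])
qed

lemma has_derivative_space_slice:
  assumes "(f has_derivative f') (at (x, t) within spacetime T)" and "0 \<le> t" "t < T"
  shows "((\<lambda>y. f (y, t)) has_derivative (\<lambda>h. f' (h, 0))) (at x)"
proof -
  have 1: "((\<lambda>y. (y, t)) has_derivative (\<lambda>h. (h, 0))) (at x)"
    by (auto intro!: derivative_eq_intros)
  have 2: "(f has_derivative f') (at (x, t) within range (\<lambda>y. (y, t)))"
    by (rule has_derivative_subset[OF assms(1)]) (use assms in auto)
  show ?thesis using has_derivative_in_compose[OF 1 2] .
qed

lemma has_derivative_time_slice:
  assumes "(f has_derivative f') (at (x, t) within spacetime T)" and "0 \<le> t" "t < T"
  shows "((\<lambda>s. f (x, s)) has_vector_derivative f' (0, 1)) (at t within {0..<T})"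
proof -
  have 1: "((\<lambda>s. (x, s)) has_derivative (\<lambda>h. (0, h))) (at t within {0..<T})"
    by (auto intro!: derivative_eq_intros)
  have 2: "(f has_derivative f') (at (x, t) within (\<lambda>s. (x, s)) ` {0..<T})"
    by (rule has_derivative_subset[OF assms(1)]) auto
  have "((\<lambda>s. f (x, s)) has_derivative (\<lambda>h. f' (0, h))) (at t within {0..<T})"
    using has_derivative_in_compose[OF 1 2] .
  moreover have "(\<lambda>h. f' (0, h)) = (\<lambda>h. h *\<^sub>R f' (0, 1))"
  proof
    fix h :: real
    have "f' (h *\<^sub>R (0, 1)) = h *\<^sub>R f' (0, 1)"
      by (rule linear_cmul[OF has_derivative_linear[OF assms(1)]])
    then show "f' (0, h) = h *\<^sub>R f' (0, 1)"
      by (simp only: scaleR_Pair scaleR_zero_right real_scaleR_def mult_1_right)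
  qed
  ultimately show ?thesis unfolding has_vector_derivative_def by (rule has_derivative_eq_rhs)
qed

lemma sgrad_duh:
  assumes "sgrad T F G"
  shows "sgrad T (duh F) (duh G)"
  unfolding sgrad_def
proof (intro conjI ballI allI)
  show "((\<lambda>y. duh F (y, t)) has_derivative (\<lambda>h. duh G (x, t) \<bullet> h)) (at x)" if "t \<in> {0..<T}" for t x
    using has_derivative_space_slice[OF has_derivative_duh[OF assms, of "(x, t)"]] that by simp
qed (intro continuous_on_duh sgradD[OF assms])+

lemma duh_inner:
  assumes "continuous_on (spacetime T) G" and z: "z \<in> spacetime T"
  shows "duh G z \<bullet> b = duh (\<lambda>z. G z \<bullet> b) z"
proof -
  have i: "(\<lambda>\<tau>. \<integral>\<xi>. (snd z - \<tau>) *\<^sub>R G (fst z + (snd z - \<tau>) *\<^sub>R \<xi>, \<tau>) \<partial>disk) integrable_on {0..snd z}"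
    by (rule integrable_continuous_real[OF continuous_on_duh_integrand[OF assms]])
  have "duh G z \<bullet> b = integral {0..snd z} (\<lambda>\<tau>. (\<integral>\<xi>. (snd z - \<tau>) *\<^sub>R G (fst z + (snd z - \<tau>) *\<^sub>R \<xi>, \<tau>) \<partial>disk) \<bullet> b)"
    using integral_linear[OF i bounded_linear_inner_left[of b]] by (simp add: duh_def o_def)
  also have "\<dots> = integral {0..snd z} (\<lambda>\<tau>. \<integral>\<xi>. (snd z - \<tau>) *\<^sub>R (G (fst z + (snd z - \<tau>) *\<^sub>R \<xi>, \<tau>) \<bullet> b) \<partial>disk)"
  proof (rule integral_cong)
    fix \<tau> assume "\<tau> \<in> {0..snd z}"
    then have t: "0 \<le> \<tau>" "\<tau> < T" using z by auto
    have "integrable disk (\<lambda>\<xi>. (snd z - \<tau>) *\<^sub>R G (fst z + (snd z - \<tau>) *\<^sub>R \<xi>, \<tau>))"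
      by (intro integrable_disk continuous_intros continuous_on_kernel_slice[OF assms(1) t])
    from integral_bounded_linear[OF bounded_linear_inner_left[of b] this]
    show "(\<integral>\<xi>. (snd z - \<tau>) *\<^sub>R G (fst z + (snd z - \<tau>) *\<^sub>R \<xi>, \<tau>) \<partial>disk) \<bullet> b
       = (\<integral>\<xi>. (snd z - \<tau>) *\<^sub>R (G (fst z + (snd z - \<tau>) *\<^sub>R \<xi>, \<tau>) \<bullet> b) \<partial>disk)"
      by (simp only: inner_scaleR_left real_scaleR_def)
  qed
  finally show ?thesis by (simp add: duh_def)
qed

section \<open>The Euler--Poisson--Darboux equation and second derivatives of the potential\<close>

lemma disk_mean_linear_zero: "(\<integral>\<xi>. v \<bullet> \<xi> \<partial>disk) = 0"
  using disk_divergence_identity[of "\<lambda>_. v" "\<lambda>_ _. 0"] by simp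

text \<open>The divergence identity for the field
  \<open>r *\<^sub>R G (x + r *\<^sub>R \<xi>)\<close>, divided by r. For r = 0 only the mean of a
  linear function remains, which vanishes.\<close>

lemma disk_EPD:
  fixes G :: "real^2 \<Rightarrow> real^2" and H :: "real^2 \<Rightarrow> real^2 \<Rightarrow> real^2"
  assumes Hd: "\<And>b x. b \<in> Basis \<Longrightarrow> ((\<lambda>x. G x \<bullet> b) has_derivative (\<lambda>h. H b x \<bullet> h)) (at x)"
    and Hc: "\<And>b. b \<in> Basis \<Longrightarrow> continuous_on UNIV (H b)"
  shows "(\<integral>\<xi>. 2 * (G (x + r *\<^sub>R \<xi>) \<bullet> \<xi>) + r * (\<Sum>b\<in>Basis. (\<xi> \<bullet> b) * (H b (x + r *\<^sub>R \<xi>) \<bullet> \<xi>)) \<partial>disk)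
    = (\<integral>\<xi>. r * (\<Sum>b\<in>Basis. H b (x + r *\<^sub>R \<xi>) \<bullet> b) \<partial>disk)"
proof (cases "r = 0")
  case True
  then show ?thesis by (simp add: disk_mean_linear_zero)
next
  case False
  have cG: "continuous_on UNIV G"
    by (subst continuous_on_componentwise) (intro ballI has_derivative_continuous_on, rule Hd)
  have cl: "continuous_on UNIV (\<lambda>\<xi>. x + r *\<^sub>R \<xi>)" by (intro continuous_intros)
  have cG': "continuous_on UNIV (\<lambda>\<xi>. G (x + r *\<^sub>R \<xi>))"
    by (rule continuous_on_compose2[OF cG cl]) simp
  have cH': "continuous_on UNIV (\<lambda>\<xi>. H b (x + r *\<^sub>R \<xi>))" if "b \<in> Basis" for b
    by (rule continuous_on_compose2[OF Hc[OF that] cl]) simp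
  have "(\<integral>\<xi>. (\<Sum>b\<in>Basis. (r\<^sup>2 *\<^sub>R H b (x + r *\<^sub>R \<xi>)) \<bullet> b) - (\<Sum>b\<in>Basis. (\<xi> \<bullet> b) * ((r\<^sup>2 *\<^sub>R H b (x + r *\<^sub>R \<xi>)) \<bullet> \<xi>))
      - 2 * ((r *\<^sub>R G (x + r *\<^sub>R \<xi>)) \<bullet> \<xi>) \<partial>disk) = 0"
  proof (rule disk_divergence_identity)
    fix b y :: "real^2" assume b: "b \<in> Basis"
    have 1: "((\<lambda>\<xi>. x + r *\<^sub>R \<xi>) has_derivative (\<lambda>h. r *\<^sub>R h)) (at y)"
      by (auto intro!: derivative_eq_intros)
    from has_derivative_compose[OF 1 Hd[OF b]]
    have "((\<lambda>\<xi>. G (x + r *\<^sub>R \<xi>) \<bullet> b) has_derivative (\<lambda>h. H b (x + r *\<^sub>R y) \<bullet> (r *\<^sub>R h))) (at y)" .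
    from has_derivative_mult_right[OF this, of r]
    show "((\<lambda>\<xi>. (r *\<^sub>R G (x + r *\<^sub>R \<xi>)) \<bullet> b) has_derivative (\<lambda>h. (r\<^sup>2 *\<^sub>R H b (x + r *\<^sub>R y)) \<bullet> h)) (at y)"
      by (simp add: power2_eq_square mult.assoc)
    show "continuous_on UNIV (\<lambda>\<xi>. r\<^sup>2 *\<^sub>R H b (x + r *\<^sub>R \<xi>))"
      by (intro continuous_intros cH' b)
  qed
  also have "(\<lambda>\<xi>. (\<Sum>b\<in>Basis. (r\<^sup>2 *\<^sub>R H b (x + r *\<^sub>R \<xi>)) \<bullet> b) - (\<Sum>b\<in>Basis. (\<xi> \<bullet> b) * ((r\<^sup>2 *\<^sub>R H b (x + r *\<^sub>R \<xi>)) \<bullet> \<xi>))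
      - 2 * ((r *\<^sub>R G (x + r *\<^sub>R \<xi>)) \<bullet> \<xi>))
    = (\<lambda>\<xi>. r * (r * (\<Sum>b\<in>Basis. H b (x + r *\<^sub>R \<xi>) \<bullet> b) - (2 * (G (x + r *\<^sub>R \<xi>) \<bullet> \<xi>) + r * (\<Sum>b\<in>Basis. (\<xi> \<bullet> b) * (H b (x + r *\<^sub>R \<xi>) \<bullet> \<xi>)))))"
    by (simp add: fun_eq_iff sum_distrib_left power2_eq_square algebra_simps)
  finally have "(\<integral>\<xi>. r * (\<Sum>b\<in>Basis. H b (x + r *\<^sub>R \<xi>) \<bullet> b) - (2 * (G (x + r *\<^sub>R \<xi>) \<bullet> \<xi>) + r * (\<Sum>b\<in>Basis. (\<xi> \<bullet> b) * (H b (x + r *\<^sub>R \<xi>) \<bullet> \<xi>))) \<partial>disk) = 0"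
    using False by simp
  moreover have "integrable disk (\<lambda>\<xi>. r * (\<Sum>b\<in>Basis. H b (x + r *\<^sub>R \<xi>) \<bullet> b))"
    by (intro integrable_disk continuous_intros cH')
  moreover have "integrable disk (\<lambda>\<xi>. 2 * (G (x + r *\<^sub>R \<xi>) \<bullet> \<xi>) + r * (\<Sum>b\<in>Basis. (\<xi> \<bullet> b) * (H b (x + r *\<^sub>R \<xi>) \<bullet> \<xi>)))"
    by (intro integrable_disk continuous_intros cG' cH')
  ultimately show ?thesis by (subst (asm) Bochner_Integration.integral_diff) simp_all
qed

text \<open>The space gradient of \<open>duht F G\<close>, where \<open>H b\<close> is the space
  gradient of the component of G in direction b.\<close>

definition duhtx :: "((real^2) \<times> real \<Rightarrow> real^2) \<Rightarrow> (real^2 \<Rightarrow> (real^2) \<times> real \<Rightarrow> real^2) \<Rightarrow> (real^2) \<times> real \<Rightarrow> real^2" where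
  "duhtx G H z = integral {0..snd z} (\<lambda>\<tau>. \<integral>\<xi>. G (fst z + (snd z - \<tau>) *\<^sub>R \<xi>, \<tau>)
     + (snd z - \<tau>) *\<^sub>R (\<Sum>b\<in>Basis. (\<xi> \<bullet> b) *\<^sub>R H b (fst z + (snd z - \<tau>) *\<^sub>R \<xi>, \<tau>)) \<partial>disk)"

text \<open>The wave equation enters in the time coefficient. Differentiating \<open>duht\<close>
  produces second radial derivatives of F, whose disc mean \<open>disk_EPD\<close> converts into
  that of the Laplacian; the moving endpoint adds F itself.\<close>

lemma has_derivative_duht:
  assumes F: "sgrad T F G" and H: "\<And>b. b \<in> Basis \<Longrightarrow> sgrad T (\<lambda>z. G z \<bullet> b) (H b)" and z: "z \<in> spacetime T"
  shows "(duht F G has_derivative (\<lambda>h. duhtx G H z \<bullet> fst h + (duh (\<lambda>z. \<Sum>b\<in>Basis. H b z \<bullet> b) z + F z) * snd h)) (at z within spacetime T)"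
proof -
  note c = continuous_on_kernel[OF sgradD(1)[OF F]] continuous_on_kernel[OF sgradD(2)[OF F]]
  note cH = continuous_on_kernel[OF sgradD(2)[OF H]]
  let ?y = "\<lambda>z \<tau> \<xi>. (fst z + (snd z - \<tau>) *\<^sub>R \<xi>, \<tau>)"
  let ?gt = "\<lambda>z \<tau> \<xi>. 2 * (G (?y z \<tau> \<xi>) \<bullet> \<xi>) + (snd z - \<tau>) * (\<Sum>b\<in>Basis. (\<xi> \<bullet> b) * (H b (?y z \<tau> \<xi>) \<bullet> \<xi>))"
  have D: "((\<lambda>z. integral {0..snd z} (\<lambda>\<tau>. \<integral>\<xi>. F (?y z \<tau> \<xi>) + (snd z - \<tau>) * (G (?y z \<tau> \<xi>) \<bullet> \<xi>) \<partial>disk)) has_derivative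
     (\<lambda>h. integral {0..snd z} (\<lambda>\<tau>. \<integral>\<xi>. G (?y z \<tau> \<xi>) + (snd z - \<tau>) *\<^sub>R (\<Sum>b\<in>Basis. (\<xi> \<bullet> b) *\<^sub>R H b (?y z \<tau> \<xi>)) \<partial>disk) \<bullet> fst h
       + (integral {0..snd z} (\<lambda>\<tau>. \<integral>\<xi>. ?gt z \<tau> \<xi> \<partial>disk)
         + (\<integral>\<xi>. F (?y z (snd z) \<xi>) + (snd z - snd z) * (G (?y z (snd z) \<xi>) \<bullet> \<xi>) \<partial>disk)) * snd h)) (at z within spacetime T)"
  proof (rule volterra_disk[where k="\<lambda>z \<tau> \<xi>. F (?y z \<tau> \<xi>) + (snd z - \<tau>) * (G (?y z \<tau> \<xi>) \<bullet> \<xi>)"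
      and gx="\<lambda>z \<tau> \<xi>. G (?y z \<tau> \<xi>) + (snd z - \<tau>) *\<^sub>R (\<Sum>b\<in>Basis. (\<xi> \<bullet> b) *\<^sub>R H b (?y z \<tau> \<xi>))" and gt="?gt", OF _ _ _ _ z])
    fix z \<tau> \<xi> assume t: "\<tau> \<in> {0..<T}"
    have d0: "((\<lambda>z. snd z - \<tau>) has_derivative snd) (at z within spacetime T)"
      by (auto intro!: derivative_eq_intros)
    have d1: "((\<lambda>z. (G (?y z \<tau> \<xi>) \<bullet> b) * (\<xi> \<bullet> b)) has_derivative (\<lambda>h. (H b (?y z \<tau> \<xi>) \<bullet> (fst h + snd h *\<^sub>R \<xi>)) * (\<xi> \<bullet> b))) (at z within spacetime T)"
      if "b \<in> Basis" for b
      by (rule has_derivative_mult_left[OF has_derivative_retarded[OF H[OF that] t]])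
    have d2: "((\<lambda>z. G (?y z \<tau> \<xi>) \<bullet> \<xi>) has_derivative (\<lambda>h. \<Sum>b\<in>Basis. (H b (?y z \<tau> \<xi>) \<bullet> (fst h + snd h *\<^sub>R \<xi>)) * (\<xi> \<bullet> b))) (at z within spacetime T)"
      by (subst euclidean_inner) (rule has_derivative_sum[OF d1])
    have s: "(\<Sum>b\<in>Basis. (H b (?y z \<tau> \<xi>) \<bullet> (h + s *\<^sub>R \<xi>)) * (\<xi> \<bullet> b))
       = (\<Sum>b\<in>Basis. (\<xi> \<bullet> b) *\<^sub>R H b (?y z \<tau> \<xi>)) \<bullet> h + s * (\<Sum>b\<in>Basis. (\<xi> \<bullet> b) * (H b (?y z \<tau> \<xi>) \<bullet> \<xi>))" for h s
      by (simp add: inner_sum_left inner_add_right sum.distrib sum_distrib_left algebra_simps)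
    from has_derivative_add[OF has_derivative_retarded[OF F t] has_derivative_mult[OF d0 d2]]
    show "((\<lambda>z. F (?y z \<tau> \<xi>) + (snd z - \<tau>) * (G (?y z \<tau> \<xi>) \<bullet> \<xi>)) has_derivative
      (\<lambda>h. (G (?y z \<tau> \<xi>) + (snd z - \<tau>) *\<^sub>R (\<Sum>b\<in>Basis. (\<xi> \<bullet> b) *\<^sub>R H b (?y z \<tau> \<xi>))) \<bullet> fst h + ?gt z \<tau> \<xi> * snd h)) (at z within spacetime T)"
      by (rule has_derivative_eq_rhs) (unfold s, simp add: fun_eq_iff inner_add_left inner_add_right algebra_simps)
  qed (intro continuous_intros c cH; assumption?)+
  have "integral {0..snd z} (\<lambda>\<tau>. \<integral>\<xi>. ?gt z \<tau> \<xi> \<partial>disk) = duh (\<lambda>z. \<Sum>b\<in>Basis. H b z \<bullet> b) z"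
    unfolding duh_def
  proof (rule integral_cong)
    fix \<tau> assume "\<tau> \<in> {0..snd z}"
    then have t: "\<tau> \<in> {0..<T}" using z by auto
    have "(\<integral>\<xi>. ?gt z \<tau> \<xi> \<partial>disk) = (\<integral>\<xi>. (snd z - \<tau>) * (\<Sum>b\<in>Basis. H b (?y z \<tau> \<xi>) \<bullet> b) \<partial>disk)"
    proof (rule disk_EPD[where G="\<lambda>x. G (x, \<tau>)" and H="\<lambda>b x. H b (x, \<tau>)"])
      show "((\<lambda>x. G (x, \<tau>) \<bullet> b) has_derivative (\<lambda>h. H b (x, \<tau>) \<bullet> h)) (at x)" if "b \<in> Basis" for b x
        by (rule sgradD(3)[OF H[OF that] t])
      show "continuous_on UNIV (\<lambda>x. H b (x, \<tau>))" if "b \<in> Basis" for b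
        by (rule continuous_on_time_slice[OF sgradD(2)[OF H[OF that]]]) (use t in auto)
    qed
    then show "(\<integral>\<xi>. ?gt z \<tau> \<xi> \<partial>disk) = (\<integral>\<xi>. (snd z - \<tau>) *\<^sub>R (\<Sum>b\<in>Basis. H b (?y z \<tau> \<xi>) \<bullet> b) \<partial>disk)"
      by simp
  qed
  then show ?thesis using D by (simp add: duht_def[abs_def] duhtx_def)
qed

lemma continuous_on_duhtx:
  assumes F: "sgrad T F G" and H: "\<And>b. b \<in> Basis \<Longrightarrow> sgrad T (\<lambda>z. G z \<bullet> b) (H b)"
  shows "continuous_on (spacetime T) (duhtx G H)"
  unfolding duhtx_def
  by (rule continuous_on_volterra_disk(1))
    (intro continuous_intros continuous_on_kernel[OF sgradD(2)[OF F]] continuous_on_kernel[OF sgradD(2)[OF H]])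

text \<open>In a space direction the derivative is the potential of a component of G, which is C^1
  again. In the time direction it is \<open>duht F G\<close>, whose gradient is expressed by F and
  its first and second space derivatives.\<close>

lemma C_on_duh_2:
  assumes F: "sgrad T F G" and H: "\<And>b. b \<in> Basis \<Longrightarrow> sgrad T (\<lambda>z. G z \<bullet> b) (H b)"
  shows "C_on 2 (spacetime T) (duh F)"
  unfolding numeral_2_eq_2 One_nat_def[symmetric]
proof (rule C_on_SucI[OF has_derivative_duh[OF F]])
  fix b :: "(real^2) \<times> real" assume "b \<in> Basis"
  then consider c where "c \<in> Basis" "b = (c, 0)" | "b = (0, 1)"
    by (auto simp: Basis_prod_def)
  then show "C_on 1 (spacetime T) (\<lambda>z. duh G z \<bullet> fst b + duht F G z * snd b)"
  proof cases
    case 1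
    have "C_on 1 (spacetime T) (duh (\<lambda>z. G z \<bullet> c))" by (rule C_on_duh_1[OF H[OF 1(1)]])
    then have "C_on 1 (spacetime T) (\<lambda>z. duh G z \<bullet> c)"
      by (rule C_on_cong) (rule duh_inner[OF sgradD(2)[OF F]])
    then show ?thesis using 1 by simp
  next
    case 2
    have "C_on 1 (spacetime T) (duht F G)"
    proof (rule C_on_1I[where G="\<lambda>z. (duhtx G H z, duh (\<lambda>z. \<Sum>b\<in>Basis. H b z \<bullet> b) z + F z)"])
      show "(duht F G has_derivative (\<lambda>h. (duhtx G H z, duh (\<lambda>z. \<Sum>b\<in>Basis. H b z \<bullet> b) z + F z) \<bullet> h)) (at z within spacetime T)"
        if "z \<in> spacetime T" for z
        using has_derivative_duht[OF F H that] by (simp add: inner_prod_def)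
      show "continuous_on (spacetime T) (\<lambda>z. (duhtx G H z, duh (\<lambda>z. \<Sum>b\<in>Basis. H b z \<bullet> b) z + F z))"
        by (intro continuous_on_Pair continuous_intros continuous_on_duh continuous_on_duhtx[OF F H] sgradD(1)[OF F] sgradD(2)[OF H])
    qed
    then show ?thesis using 2 by simp
  qed
qed

section \<open>The wave operator and the representation formula\<close>

lemma space_Basis: "b \<in> Basis \<Longrightarrow> (b::real^2, 0::real) \<in> Basis"
  and time_Basis: "((0::real^2), (1::real)) \<in> Basis"
  unfolding Basis_prod_def Basis_real_def by blast+

definition dalem :: "real \<Rightarrow> ((real^2) \<times> real \<Rightarrow> real) \<Rightarrow> (real^2) \<times> real \<Rightarrow> real" where
  "dalem T u z = dt T (dt T u) z - laplacian u z"

text \<open>One-sided derivatives are unique only at limit points of the time interval; points to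
  the right of t provide this even at t = 0. Every evaluation of \<open>dt\<close> rests on
  it.\<close>

lemma at_within_Ico_neq_bot:
  fixes t :: real
  assumes "0 \<le> t" and "t < T"
  shows "at t within {0..<T} \<noteq> bot"
proof
  assume "at t within {0..<T} = bot"
  moreover have "at t within {t..(t + T) / 2} \<le> at t within {0..<T}"
    by (rule at_le) (use assms in auto)
  ultimately have "at t within {t..(t + T) / 2} = bot" by (simp add: bot_unique)
  moreover have "at t within {t..(t + T) / 2} = at_right t"
    by (rule at_within_Icc_at_right) (use assms in simp)
  ultimately show False using trivial_limit_at_right_real[of t] by simp
qed

lemma dt_eq:
  assumes "((\<lambda>s. u (x, s)) has_vector_derivative d) (at t within {0..<T})" and "0 \<le> t" "t < T"
  shows "dt T u (x, t) = d"
  unfolding dt_def using vector_derivative_within[OF at_within_Ico_neq_bot[OF assms(2,3)] assms(1)] by simp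

lemma dx_eq:
  assumes "((\<lambda>y. u (y, t)) has_derivative (\<lambda>h. G \<bullet> h)) (at x)"
  shows "dx i u (x, t) = G \<bullet> axis i 1"
proof -
  have 1: "((\<lambda>h. x + h *\<^sub>R axis i 1) has_derivative (\<lambda>h. h *\<^sub>R axis i 1)) (at 0)"
    by (auto intro!: derivative_eq_intros)
  have 2: "((\<lambda>y. u (y, t)) has_derivative (\<lambda>h. G \<bullet> h)) (at (x + 0 *\<^sub>R axis i 1))" using assms by simp
  have "((\<lambda>h. u (x + h *\<^sub>R axis i 1, t)) has_real_derivative (G \<bullet> axis i 1)) (at 0)"
    using has_derivative_compose[OF 1 2] by (simp add: has_field_derivative_def mult_commute_abs)
  then show ?thesis by (simp add: dx_def DERIV_imp_deriv)
qed

lemma sum_Basis_axis: "(\<Sum>b\<in>Basis. f b) = (\<Sum>i\<in>(UNIV::2 set). f (axis i (1::real)))"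
proof -
  have B: "(Basis :: (real^2) set) = range (\<lambda>i. axis i 1)" by (auto simp: Basis_vec_def)
  have "inj (\<lambda>i::2. axis i (1::real))" by (auto simp: inj_def axis_eq_axis)
  then show ?thesis unfolding B by (simp add: sum.reindex)
qed

text \<open>\<open>dt\<close> and \<open>dx\<close> are choice operators. Explicit derivatives on
  the whole slab pin down their first application as functions, so that the second application can
  be evaluated as well.\<close>

lemma dalem_eq:
  assumes G: "\<And>x t. 0 \<le> t \<Longrightarrow> t < T \<Longrightarrow> ((\<lambda>y. u (y, t)) has_derivative (\<lambda>h. G (x, t) \<bullet> h)) (at x)"
    and U: "\<And>x t. 0 \<le> t \<Longrightarrow> t < T \<Longrightarrow> ((\<lambda>s. u (x, s)) has_vector_derivative Ut (x, t)) (at t within {0..<T})"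
    and H: "\<And>x t b. b \<in> Basis \<Longrightarrow> 0 \<le> t \<Longrightarrow> t < T \<Longrightarrow> ((\<lambda>y. G (y, t) \<bullet> b) has_derivative (\<lambda>h. H b (x, t) \<bullet> h)) (at x)"
    and V: "\<And>x t. 0 \<le> t \<Longrightarrow> t < T \<Longrightarrow> ((\<lambda>s. Ut (x, s)) has_vector_derivative Utt (x, t)) (at t within {0..<T})"
    and z: "z \<in> spacetime T"
  shows "dt T u z = Ut z" "dalem T u z = Utt z - (\<Sum>b\<in>Basis. H b z \<bullet> b)"
proof -
  obtain x t where zt: "z = (x, t)" "0 \<le> t" "t < T" using z by (cases z) auto
  have dtu: "dt T u (x, s) = Ut (x, s)" if "0 \<le> s" "s < T" for x s
    by (rule dt_eq[OF U[OF that] that])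
  show "dt T u z = Ut z" using dtu zt by simp
  have "((\<lambda>s. dt T u (x, s)) has_vector_derivative Utt (x, t)) (at t within {0..<T})"
    by (rule has_vector_derivative_transform[OF _ _ V[OF zt(2,3)]]) (use zt dtu in auto)
  then have 1: "dt T (dt T u) z = Utt z" unfolding zt(1) by (rule dt_eq[OF _ zt(2,3)])
  have 2: "dx i (dx i u) z = H (axis i 1) z \<bullet> axis i 1" for i
  proof -
    have "dx i u (y, t) = G (y, t) \<bullet> axis i 1" for y by (rule dx_eq[OF G[OF zt(2,3)]])
    moreover have "((\<lambda>y. G (y, t) \<bullet> axis i 1) has_derivative (\<lambda>h. H (axis i 1) (x, t) \<bullet> h)) (at x)"
      by (rule H[OF _ zt(2,3)]) simp
    ultimately have "((\<lambda>y. dx i u (y, t)) has_derivative (\<lambda>h. H (axis i 1) (x, t) \<bullet> h)) (at x)" by simp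
    then show ?thesis unfolding zt(1) by (rule dx_eq)
  qed
  show "dalem T u z = Utt z - (\<Sum>b\<in>Basis. H b z \<bullet> b)"
    by (simp add: dalem_def laplacian_def 1 2 sum_Basis_axis)
qed

lemma dalem_hessian:
  fixes G :: "(real^2) \<times> real \<Rightarrow> (real^2) \<times> real"
  assumes G: "\<And>z. z \<in> spacetime T \<Longrightarrow> (u has_derivative (\<lambda>h. G z \<bullet> h)) (at z within spacetime T)"
    and H: "\<And>b z. b \<in> Basis \<Longrightarrow> z \<in> spacetime T \<Longrightarrow> ((\<lambda>z. G z \<bullet> b) has_derivative (\<lambda>h. H b z \<bullet> h)) (at z within spacetime T)"
    and z: "z \<in> spacetime T"
  shows "dt T u z = G z \<bullet> (0, 1)"
    "dalem T u z = H (0, 1) z \<bullet> (0, 1) - (\<Sum>b\<in>Basis. H (b, 0) z \<bullet> (b, 0))"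
proof -
  note Bas = space_Basis and B1 = time_Basis
  have g: "((\<lambda>y. u (y, t)) has_derivative (\<lambda>h. fst (G (x, t)) \<bullet> h)) (at x)" if "0 \<le> t" "t < T" for x t
    using has_derivative_space_slice[OF G[of "(x, t)"] that] that by (simp add: inner_prod_def)
  have ut: "((\<lambda>s. u (x, s)) has_vector_derivative G (x, t) \<bullet> (0, 1)) (at t within {0..<T})" if "0 \<le> t" "t < T" for x t
    using has_derivative_time_slice[OF G[of "(x, t)"] that] that by simp
  have h: "((\<lambda>y. fst (G (y, t)) \<bullet> b) has_derivative (\<lambda>h. fst (H (b, 0) (x, t)) \<bullet> h)) (at x)"
    if "b \<in> Basis" "0 \<le> t" "t < T" for x t b
    using has_derivative_space_slice[OF H[OF Bas[OF that(1)], of "(x, t)"] that(2,3)] that(2,3) by (simp add: inner_prod_def)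
  have utt: "((\<lambda>s. G (x, s) \<bullet> (0, 1)) has_vector_derivative H (0, 1) (x, t) \<bullet> (0, 1)) (at t within {0..<T})"
    if "0 \<le> t" "t < T" for x t
    using has_derivative_time_slice[OF H[OF B1, of "(x, t)"] that] that by simp
  note d = dalem_eq[where G="\<lambda>z. fst (G z)" and Ut="\<lambda>z. G z \<bullet> (0, 1)" and H="\<lambda>b z. fst (H (b, 0) z)"
      and Utt="\<lambda>z. H (0, 1) z \<bullet> (0, 1)", OF g ut h utt z]
  show "dt T u z = G z \<bullet> (0, 1)" by (rule d(1))
  show "dalem T u z = H (0, 1) z \<bullet> (0, 1) - (\<Sum>b\<in>Basis. H (b, 0) z \<bullet> (b, 0))"
    using d(2) by (simp add: inner_prod_def)
qed

section \<open>Symmetry of mixed derivatives and the representation formula\<close>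

text \<open>A version up to the boundary t = 0. Along a segment in direction b, u is the integral of
  its space derivative; differentiating under that integral in t and then taking the one-sided
  derivative at the start of the segment gives one order of differentiation, while direct
  differentiation gives the other.\<close>

lemma mixed_derivatives_eq:
  fixes G :: "(real^2) \<times> real \<Rightarrow> (real^2) \<times> real"
  assumes G: "\<And>z. z \<in> spacetime T \<Longrightarrow> (u has_derivative (\<lambda>h. G z \<bullet> h)) (at z within spacetime T)"
    and H: "\<And>b z. b \<in> Basis \<Longrightarrow> z \<in> spacetime T \<Longrightarrow> ((\<lambda>z. G z \<bullet> b) has_derivative (\<lambda>h. H b z \<bullet> h)) (at z within spacetime T)"
    and cG: "continuous_on (spacetime T) G" and cH: "\<And>b. b \<in> Basis \<Longrightarrow> continuous_on (spacetime T) (H b)"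
    and z: "z \<in> spacetime T" and b: "b \<in> Basis"
  shows "H (b, 0) z \<bullet> (0, 1) = H (0, 1) z \<bullet> (b, 0)"
proof -
  obtain x t where zt: "z = (x, t)" "0 \<le> t" "t < T" using z by (cases z) auto
  note B = space_Basis[OF b] time_Basis
  have line: "((\<lambda>a. x + a *\<^sub>R b) has_derivative (\<lambda>h. h *\<^sub>R b)) (at a within {0..1})" for a
    by (auto intro!: derivative_eq_intros)
  have along: "((\<lambda>a. f (x + a *\<^sub>R b, s)) has_vector_derivative D \<bullet> (b, 0)) (at a within {0..1})"
    if "0 \<le> s" "s < T" "(f has_derivative (\<lambda>h. D \<bullet> h)) (at (x + a *\<^sub>R b, s) within spacetime T)" for f D s a
  proof -
    have "((\<lambda>y. f (y, s)) has_derivative (\<lambda>h. D \<bullet> (h, 0))) (at (x + a *\<^sub>R b))"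
      by (rule has_derivative_space_slice[OF that(3,1,2)])
    from has_derivative_compose[OF line this]
    have "((\<lambda>a. f (x + a *\<^sub>R b, s)) has_derivative (\<lambda>h. D \<bullet> (h *\<^sub>R b, 0))) (at a within {0..1})" .
    then show ?thesis by (simp add: has_vector_derivative_def inner_prod_def)
  qed
  have u_int: "u (x + a *\<^sub>R b, s) = u (x, s) + integral {0..a} (\<lambda>c. G (x + c *\<^sub>R b, s) \<bullet> (b, 0))"
    if a: "0 \<le> a" "a \<le> 1" and s: "0 \<le> s" "s < T" for a s
  proof -
    have "((\<lambda>c. G (x + c *\<^sub>R b, s) \<bullet> (b, 0)) has_integral u (x + a *\<^sub>R b, s) - u (x + 0 *\<^sub>R b, s)) {0..a}"
    proof (rule fundamental_theorem_of_calculus)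
      show "((\<lambda>a. u (x + a *\<^sub>R b, s)) has_vector_derivative G (x + c *\<^sub>R b, s) \<bullet> (b, 0)) (at c within {0..a})"
        if "c \<in> {0..a}" for c
        by (rule has_vector_derivative_within_subset[OF along[OF s G]]) (use s a in auto)
    qed (use a in simp)
    from integral_unique[OF this] show ?thesis by simp
  qed
  have cpath: "continuous_on ({0..<T} \<times> {0..a}) (\<lambda>p. (x + snd p *\<^sub>R b, fst p))" for a
    by (intro continuous_intros)
  have im: "(\<lambda>p. (x + snd p *\<^sub>R b, fst p)) ` ({0..<T} \<times> {0..a}) \<subseteq> spacetime T" for a by auto
  have t_der: "G (x + a *\<^sub>R b, t) \<bullet> (0, 1) = G (x, t) \<bullet> (0, 1) + integral {0..a} (\<lambda>c. H (b, 0) (x + c *\<^sub>R b, t) \<bullet> (0, 1))"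
    if a: "0 \<le> a" "a \<le> 1" for a
  proof -
    have L: "((\<lambda>s. u (x + a *\<^sub>R b, s)) has_vector_derivative G (x + a *\<^sub>R b, t) \<bullet> (0, 1)) (at t within {0..<T})"
      by (rule has_derivative_time_slice[OF G zt(2,3)]) (use zt in simp)
    have L0: "((\<lambda>s. u (x, s)) has_vector_derivative G (x, t) \<bullet> (0, 1)) (at t within {0..<T})"
      by (rule has_derivative_time_slice[OF G zt(2,3)]) (use zt in simp)
    have "((\<lambda>s. integral (cbox 0 a) (\<lambda>c. G (x + c *\<^sub>R b, s) \<bullet> (b, 0))) has_vector_derivative
       integral (cbox 0 a) (\<lambda>c. H (b, 0) (x + c *\<^sub>R b, t) \<bullet> (0, 1))) (at t within {0..<T})"
    proof (rule leibniz_rule_vector_derivative)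
      show "((\<lambda>s. G (x + c *\<^sub>R b, s) \<bullet> (b, 0)) has_vector_derivative H (b, 0) (x + c *\<^sub>R b, s) \<bullet> (0, 1)) (at s within {0..<T})"
        if "s \<in> {0..<T}" for s c
        using that by (intro has_derivative_time_slice[OF H[OF B(1)]]) auto
      show "(\<lambda>c. G (x + c *\<^sub>R b, s) \<bullet> (b, 0)) integrable_on cbox 0 a" if "s \<in> {0..<T}" for s
        unfolding cbox_interval
        by (intro integrable_continuous_real continuous_on_inner continuous_on_const continuous_on_compose2[OF cG])
          (use that in \<open>auto intro!: continuous_intros\<close>)
      show "continuous_on ({0..<T} \<times> cbox 0 a) (\<lambda>(s, c). H (b, 0) (x + c *\<^sub>R b, s) \<bullet> (0, 1))"
        unfolding cbox_interval case_prod_unfold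
        by (intro continuous_on_inner continuous_on_const continuous_on_compose2[OF cH[OF B(1)] cpath im])
    qed (use zt in auto)
    then have "((\<lambda>s. u (x, s) + integral {0..a} (\<lambda>c. G (x + c *\<^sub>R b, s) \<bullet> (b, 0))) has_vector_derivative
       G (x, t) \<bullet> (0, 1) + integral {0..a} (\<lambda>c. H (b, 0) (x + c *\<^sub>R b, t) \<bullet> (0, 1))) (at t within {0..<T})"
      unfolding cbox_interval by (rule has_vector_derivative_add[OF L0])
    then have "((\<lambda>s. u (x + a *\<^sub>R b, s)) has_vector_derivative
       G (x, t) \<bullet> (0, 1) + integral {0..a} (\<lambda>c. H (b, 0) (x + c *\<^sub>R b, t) \<bullet> (0, 1))) (at t within {0..<T})"
      by (rule has_vector_derivative_transform[rotated 2]) (use zt u_int[OF a] in auto)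
    from vector_derivative_unique_within[OF at_within_Ico_neq_bot[OF zt(2,3)] L this] show ?thesis .
  qed
  have cH1: "continuous_on {0..1} (\<lambda>c. H (b, 0) (x + c *\<^sub>R b, t) \<bullet> (0, 1))"
    by (intro continuous_on_inner continuous_on_const continuous_on_compose2[OF cH[OF B(1)]])
      (use zt in \<open>auto intro!: continuous_intros\<close>)
  have R: "((\<lambda>a. G (x, t) \<bullet> (0, 1) + integral {0..a} (\<lambda>c. H (b, 0) (x + c *\<^sub>R b, t) \<bullet> (0, 1))) has_vector_derivative
      0 + H (b, 0) (x + 0 *\<^sub>R b, t) \<bullet> (0, 1)) (at 0 within {0..1})"
    by (intro has_vector_derivative_add has_vector_derivative_const integral_has_vector_derivative[OF cH1]) simp
  have L: "((\<lambda>a. G (x + a *\<^sub>R b, t) \<bullet> (0, 1)) has_vector_derivative H (0, 1) (x + 0 *\<^sub>R b, t) \<bullet> (b, 0)) (at 0 within {0..1})"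
    by (rule along[OF zt(2,3) H[OF B(2)]]) (use zt in simp)
  have L': "((\<lambda>a. G (x, t) \<bullet> (0, 1) + integral {0..a} (\<lambda>c. H (b, 0) (x + c *\<^sub>R b, t) \<bullet> (0, 1))) has_vector_derivative
     H (0, 1) (x + 0 *\<^sub>R b, t) \<bullet> (b, 0)) (at 0 within {0..1})"
    by (rule has_vector_derivative_transform[OF _ _ L]) (use t_der in auto)
  have "at (0::real) within {0..1} \<noteq> bot"
    by (simp add: at_within_Icc_at_right trivial_limit_at_right_real)
  from vector_derivative_unique_within[OF this R L'] show ?thesis by (simp add: zt)
qed

text \<open>
  For fixed \<open>(x, t\<^sub>0)\<close> the disc mean of \<open>u + (t\<^sub>0 - t) (\<xi> \<bullet> \<nabla>u + u\<^sub>t)\<close> at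
  \<open>(x + (t\<^sub>0 - t) \<xi>, t)\<close> has \<open>t\<close>-derivative \<open>(t\<^sub>0 - t)\<close> times the disc mean of the wave operator
  applied to \<open>u\<close>.
\<close>

lemma wave_representation:
  fixes G :: "(real^2) \<times> real \<Rightarrow> (real^2) \<times> real"
  assumes G: "\<And>z. z \<in> spacetime T \<Longrightarrow> (u has_derivative (\<lambda>h. G z \<bullet> h)) (at z within spacetime T)"
    and H: "\<And>b z. b \<in> Basis \<Longrightarrow> z \<in> spacetime T \<Longrightarrow> ((\<lambda>z. G z \<bullet> b) has_derivative (\<lambda>h. H b z \<bullet> h)) (at z within spacetime T)"
    and cG: "continuous_on (spacetime T) G" and cH: "\<And>b. b \<in> Basis \<Longrightarrow> continuous_on (spacetime T) (H b)"
    and z: "z \<in> spacetime T"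
  shows "u z = (\<integral>\<xi>. u (fst z + snd z *\<^sub>R \<xi>, 0) + snd z * (G (fst z + snd z *\<^sub>R \<xi>, 0) \<bullet> (\<xi>, 1)) \<partial>disk) + duh (dalem T u) z"
proof -
  obtain x t0 where zt: "z = (x, t0)" "0 \<le> t0" "t0 < T" using z by (cases z) auto
  note Bas = space_Basis and B1 = time_Basis
  define c where "c t \<xi> = (x + (t0 - t) *\<^sub>R \<xi>, t)" for t and \<xi> :: "real^2"
  define \<psi> where "\<psi> t \<xi> = u (c t \<xi>) + (t0 - t) * (G (c t \<xi>) \<bullet> (\<xi>, 1))" for t \<xi>
  define \<psi>' where "\<psi>' t \<xi> = (t0 - t) * (H (0, 1) (c t \<xi>) \<bullet> (0, 1))
     - (2 * (fst (G (c t \<xi>)) \<bullet> \<xi>) + (t0 - t) * (\<Sum>b\<in>Basis. (\<xi> \<bullet> b) * (fst (H (b, 0) (c t \<xi>)) \<bullet> \<xi>)))" for t \<xi>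
  have cS: "c t \<xi> \<in> spacetime T" if "t \<in> {0..t0}" for t \<xi> using that zt by (auto simp: c_def)
  have dc: "((\<lambda>t. c t \<xi>) has_derivative (\<lambda>h. h *\<^sub>R (- \<xi>, 1))) (at t within {0..t0})" for t \<xi>
    unfolding c_def by (auto intro!: derivative_eq_intros)
  have comp: "((\<lambda>t. f (c t \<xi>)) has_derivative (\<lambda>h. h * (D \<bullet> (- \<xi>, 1)))) (at t within {0..t0})"
    if "t \<in> {0..t0}" "(f has_derivative (\<lambda>h. D \<bullet> h)) (at (c t \<xi>) within spacetime T)" for f D t \<xi>
  proof -
    have "(f has_derivative (\<lambda>h. D \<bullet> h)) (at (c t \<xi>) within (\<lambda>t. c t \<xi>) ` {0..t0})"
      by (rule has_derivative_subset[OF that(2)]) (use cS in auto)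
    from has_derivative_in_compose[OF dc this] show ?thesis by (simp only: inner_scaleR_right)
  qed
  have sym: "(\<Sum>b\<in>Basis. (\<xi> \<bullet> b) * (H (b, 0) w \<bullet> (0, 1))) = H (0, 1) w \<bullet> (\<xi>, 0)" if "w \<in> spacetime T" for w \<xi>
  proof -
    have "(\<Sum>b\<in>Basis. (\<xi> \<bullet> b) * (H (b, 0) w \<bullet> (0, 1))) = (\<Sum>b\<in>Basis. (fst (H (0, 1) w) \<bullet> b) * (\<xi> \<bullet> b))"
      by (intro sum.cong refl) (simp only: mixed_derivatives_eq[OF G H cG cH that], simp add: inner_prod_def mult.commute)
    also have "\<dots> = fst (H (0, 1) w) \<bullet> \<xi>" by (rule euclidean_inner[symmetric])
    finally show ?thesis by (simp add: inner_prod_def)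
  qed
  \<comment> \<open>The direction of motion is (-\<xi>, 1) while G is tested against (\<xi>, 1), so
    the mixed second derivatives enter with opposite signs and cancel by symmetry.\<close>
  have dG: "((\<lambda>t. G (c t \<xi>) \<bullet> (\<xi>, 1)) has_derivative (\<lambda>h. h * (H (0, 1) (c t \<xi>) \<bullet> (0, 1)
      - (\<Sum>b\<in>Basis. (\<xi> \<bullet> b) * (fst (H (b, 0) (c t \<xi>)) \<bullet> \<xi>))))) (at t within {0..t0})"
    if t: "t \<in> {0..t0}" for t \<xi>
  proof -
    have e: "(\<lambda>t. G (c t \<xi>) \<bullet> (\<xi>, 1)) = (\<lambda>t. (\<Sum>b\<in>Basis. (\<xi> \<bullet> b) * (G (c t \<xi>) \<bullet> (b, 0))) + G (c t \<xi>) \<bullet> (0, 1))"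
    proof
      fix t
      have "fst (G (c t \<xi>)) \<bullet> \<xi> = (\<Sum>b\<in>Basis. (\<xi> \<bullet> b) * (fst (G (c t \<xi>)) \<bullet> b))"
        by (subst euclidean_inner) (simp add: mult.commute)
      then show "G (c t \<xi>) \<bullet> (\<xi>, 1) = (\<Sum>b\<in>Basis. (\<xi> \<bullet> b) * (G (c t \<xi>) \<bullet> (b, 0))) + G (c t \<xi>) \<bullet> (0, 1)"
        by (simp add: inner_prod_def)
    qed
    have "((\<lambda>t. (\<Sum>b\<in>Basis. (\<xi> \<bullet> b) * (G (c t \<xi>) \<bullet> (b, 0))) + G (c t \<xi>) \<bullet> (0, 1)) has_derivative
       (\<lambda>h. (\<Sum>b\<in>Basis. (\<xi> \<bullet> b) * (h * (H (b, 0) (c t \<xi>) \<bullet> (- \<xi>, 1)))) + h * (H (0, 1) (c t \<xi>) \<bullet> (- \<xi>, 1)))) (at t within {0..t0})"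
      by (intro has_derivative_add has_derivative_sum has_derivative_mult_right comp[OF t] H Bas B1 cS t)
    moreover have "(\<Sum>b\<in>Basis. (\<xi> \<bullet> b) * (h * (H (b, 0) (c t \<xi>) \<bullet> (- \<xi>, 1)))) + h * (H (0, 1) (c t \<xi>) \<bullet> (- \<xi>, 1))
       = h * (H (0, 1) (c t \<xi>) \<bullet> (0, 1) - (\<Sum>b\<in>Basis. (\<xi> \<bullet> b) * (fst (H (b, 0) (c t \<xi>)) \<bullet> \<xi>)))" for h
    proof -
      have "(\<Sum>b\<in>Basis. (\<xi> \<bullet> b) * (h * (H (b, 0) (c t \<xi>) \<bullet> (- \<xi>, 1))))
        = h * ((\<Sum>b\<in>Basis. (\<xi> \<bullet> b) * (H (b, 0) (c t \<xi>) \<bullet> (0, 1))) - (\<Sum>b\<in>Basis. (\<xi> \<bullet> b) * (fst (H (b, 0) (c t \<xi>)) \<bullet> \<xi>)))"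
        by (simp add: inner_prod_def sum_distrib_left sum_subtractf[symmetric] algebra_simps)
      then show ?thesis unfolding sym[OF cS[OF t]] by (simp add: inner_prod_def algebra_simps)
    qed
    ultimately show ?thesis unfolding e by simp
  qed
  have d\<psi>: "((\<lambda>t. \<psi> t \<xi>) has_derivative (\<lambda>h. \<psi>' t \<xi> \<bullet> h)) (at t within {0..t0})" if t: "t \<in> {0..t0}" for t \<xi>
  proof -
    have d0: "((\<lambda>t. t0 - t) has_derivative (\<lambda>h. - h)) (at t within {0..t0})"
      by (auto intro!: derivative_eq_intros)
    from has_derivative_add[OF comp[OF t G[OF cS[OF t]]] has_derivative_mult[OF d0 dG[OF t]]]
    show ?thesis unfolding \<psi>_def
      by (rule has_derivative_eq_rhs) (simp add: \<psi>'_def fun_eq_iff inner_prod_def algebra_simps)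
  qed
  have cc: "continuous_on ({0..t0} \<times> UNIV) (\<lambda>p. c (fst p) (snd p))"
    unfolding c_def by (intro continuous_intros)
  have ci: "(\<lambda>p. c (fst p) (snd p)) ` ({0..t0} \<times> UNIV) \<subseteq> spacetime T" using cS by auto
  note cGc = continuous_on_compose2[OF cG cc ci]
  note cHc = continuous_on_compose2[OF cH cc ci]
  have cu: "continuous_on (spacetime T) u" by (rule has_derivative_continuous_on[OF G])
  note cuc = continuous_on_compose2[OF cu cc ci]
  have c\<psi>: "continuous_on ({0..t0} \<times> UNIV) (\<lambda>p. \<psi> (fst p) (snd p))"
    unfolding \<psi>_def by (intro continuous_intros cuc cGc)
  have c\<psi>': "continuous_on ({0..t0} \<times> UNIV) (\<lambda>p. \<psi>' (fst p) (snd p))"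
    unfolding \<psi>'_def by (intro continuous_intros cGc cHc B1 Bas)
  have d\<phi>: "((\<lambda>t. \<integral>\<xi>. \<psi> t \<xi> \<partial>disk) has_vector_derivative (\<integral>\<xi>. \<psi>' t \<xi> \<partial>disk)) (at t within {0..t0})"
    if t: "t \<in> {0..t0}" for t
  proof -
    have "((\<lambda>t. \<integral>\<xi>. \<psi> t \<xi> \<partial>disk) has_derivative (\<lambda>h. (\<integral>\<xi>. \<psi>' t \<xi> \<partial>disk) \<bullet> h)) (at t within {0..t0})"
      by (rule has_derivative_disk_integral[OF d\<psi> continuous_on_slice[OF c\<psi>] c\<psi>' convex_real_interval(5) t])
    then show ?thesis by (simp add: has_vector_derivative_def mult_commute_abs)
  qed
  \<comment> \<open>The subtracted bracket of \<psi>' is the left side of \<open>disk_EPD\<close>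
    with r = t0 - t. Its mean becomes that of the Laplacian and completes the second time derivative
    to the wave operator.\<close>
  have EPD: "(\<integral>\<xi>. \<psi>' t \<xi> \<partial>disk) = (\<integral>\<xi>. (t0 - t) *\<^sub>R dalem T u (x + (t0 - t) *\<^sub>R \<xi>, t) \<partial>disk)" if t: "t \<in> {0..t0}" for t
  proof -
    have tT: "0 \<le> t" "t < T" using t zt by auto
    have "(\<integral>\<xi>. 2 * (fst (G (x + (t0 - t) *\<^sub>R \<xi>, t)) \<bullet> \<xi>) + (t0 - t) * (\<Sum>b\<in>Basis. (\<xi> \<bullet> b) * (fst (H (b, 0) (x + (t0 - t) *\<^sub>R \<xi>, t)) \<bullet> \<xi>)) \<partial>disk)
      = (\<integral>\<xi>. (t0 - t) * (\<Sum>b\<in>Basis. fst (H (b, 0) (x + (t0 - t) *\<^sub>R \<xi>, t)) \<bullet> b) \<partial>disk)"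
    proof (rule disk_EPD[where G="\<lambda>x. fst (G (x, t))" and H="\<lambda>b x. fst (H (b, 0) (x, t))"])
      show "((\<lambda>x. fst (G (x, t)) \<bullet> b) has_derivative (\<lambda>h. fst (H (b, 0) (x, t)) \<bullet> h)) (at x)" if "b \<in> Basis" for b x
        using has_derivative_space_slice[OF H[OF Bas[OF that], of "(x, t)"] tT] tT by (simp add: inner_prod_def)
      show "continuous_on UNIV (\<lambda>x. fst (H (b, 0) (x, t)))" if "b \<in> Basis" for b
        by (intro continuous_on_fst continuous_on_time_slice[OF cH[OF Bas[OF that]] tT])
    qed
    moreover have "integrable disk (\<lambda>\<xi>. (t0 - t) * (H (0, 1) (c t \<xi>) \<bullet> (0, 1)))"
      "integrable disk (\<lambda>\<xi>. 2 * (fst (G (c t \<xi>)) \<bullet> \<xi>) + (t0 - t) * (\<Sum>b\<in>Basis. (\<xi> \<bullet> b) * (fst (H (b, 0) (c t \<xi>)) \<bullet> \<xi>)))"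
      "integrable disk (\<lambda>\<xi>. (t0 - t) * (\<Sum>b\<in>Basis. fst (H (b, 0) (c t \<xi>)) \<bullet> b))"
      unfolding c_def
      by (intro integrable_disk continuous_intros continuous_on_kernel_slice[OF cG tT] continuous_on_kernel_slice[OF cH tT] B1 Bas; assumption)+
    moreover have "dalem T u (c t \<xi>) = H (0, 1) (c t \<xi>) \<bullet> (0, 1) - (\<Sum>b\<in>Basis. fst (H (b, 0) (c t \<xi>)) \<bullet> b)" for \<xi>
      using dalem_hessian(2)[OF G H cS[OF t]] by (simp add: inner_prod_def)
    ultimately show ?thesis
      unfolding \<psi>'_def c_def by (simp add: right_diff_distrib)
  qed
  \<comment> \<open>At t = t0 the disc shrinks to the apex, where \<psi> is the value of u; at t = 0
    it carries the initial data.\<close>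
  have "((\<lambda>t. \<integral>\<xi>. \<psi>' t \<xi> \<partial>disk) has_integral (\<integral>\<xi>. \<psi> t0 \<xi> \<partial>disk) - (\<integral>\<xi>. \<psi> 0 \<xi> \<partial>disk)) {0..t0}"
    by (rule fundamental_theorem_of_calculus[OF zt(2) d\<phi>])
  from integral_unique[OF this]
  have "integral {0..t0} (\<lambda>t. \<integral>\<xi>. \<psi>' t \<xi> \<partial>disk) = u z - (\<integral>\<xi>. \<psi> 0 \<xi> \<partial>disk)"
    by (simp add: \<psi>_def c_def zt)
  moreover have "integral {0..t0} (\<lambda>t. \<integral>\<xi>. \<psi>' t \<xi> \<partial>disk) = duh (dalem T u) z"
    unfolding duh_def zt fst_conv snd_conv by (rule integral_cong) (rule EPD)
  ultimately show ?thesis by (simp add: \<psi>_def c_def zt)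
qed

section \<open>The free wave\<close>

lemma disk_integral_cball:
  fixes g :: "real^2 \<Rightarrow> real"
  assumes "continuous_on UNIV g"
  shows "(LINT \<xi>:cball 0 1|lborel. g \<xi> / sqrt (1 - (norm \<xi>)\<^sup>2)) = 2 * pi * (\<integral>\<xi>. g \<xi> \<partial>disk)"
proof -
  have "(LINT \<xi>:cball 0 1|lborel. g \<xi> / sqrt (1 - (norm \<xi>)\<^sup>2))
    = (\<integral>\<xi>. (2 * pi) * ((indicator (cball 0 1) \<xi> / (2 * pi * sqrt (1 - (norm \<xi>)\<^sup>2))) *\<^sub>R g \<xi>) \<partial>lborel)"
    unfolding set_lebesgue_integral_def by (intro Bochner_Integration.integral_cong refl) simp
  also have "\<dots> = (2 * pi) * (\<integral>\<xi>. (indicator (cball 0 1) \<xi> / (2 * pi * sqrt (1 - (norm \<xi>)\<^sup>2))) *\<^sub>R g \<xi> \<partial>lborel)"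
    by (rule Bochner_Integration.integral_mult_right_zero)
  also have "(\<integral>\<xi>. (indicator (cball 0 1) \<xi> / (2 * pi * sqrt (1 - (norm \<xi>)\<^sup>2))) *\<^sub>R g \<xi> \<partial>lborel) = (\<integral>\<xi>. g \<xi> \<partial>disk)"
    by (rule disk_integral_density[symmetric]) (rule borel_measurable_continuous_onI[OF assms])
  finally show ?thesis .
qed

lemma has_derivative_disk_integral_split:
  fixes f :: "(real^2) \<times> real \<Rightarrow> real^2 \<Rightarrow> real" and gx :: "(real^2) \<times> real \<Rightarrow> real^2 \<Rightarrow> real^2"
    and gt :: "(real^2) \<times> real \<Rightarrow> real^2 \<Rightarrow> real"
  assumes d: "\<And>z \<xi>. ((\<lambda>z. f z \<xi>) has_derivative (\<lambda>h. gx z \<xi> \<bullet> fst h + gt z \<xi> * snd h)) (at z)"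
    and cf: "\<And>z. continuous_on UNIV (f z)"
    and cx: "continuous_on UNIV (\<lambda>p. gx (fst p) (snd p))" and ct: "continuous_on UNIV (\<lambda>p. gt (fst p) (snd p))"
  shows "((\<lambda>z. \<integral>\<xi>. f z \<xi> \<partial>disk) has_derivative
    (\<lambda>h. (\<integral>\<xi>. gx z \<xi> \<partial>disk) \<bullet> fst h + (\<integral>\<xi>. gt z \<xi> \<partial>disk) * snd h)) (at z)"
proof -
  have "((\<lambda>z. \<integral>\<xi>. f z \<xi> \<partial>disk) has_derivative (\<lambda>h. (\<integral>\<xi>. (gx z \<xi>, gt z \<xi>) \<partial>disk) \<bullet> h)) (at z)"
  proof (rule has_derivative_disk_integral[where g="\<lambda>z \<xi>. (gx z \<xi>, gt z \<xi>)" and Z=UNIV])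
    show "((\<lambda>z. f z \<xi>) has_derivative (\<lambda>h. (gx z \<xi>, gt z \<xi>) \<bullet> h)) (at z)" for z \<xi>
      using d[of \<xi> z] by (simp add: inner_prod_def)
    show "continuous_on (UNIV \<times> UNIV) (\<lambda>p. (gx (fst p) (snd p), gt (fst p) (snd p)))"
      using continuous_on_Pair[OF cx ct] by simp
  qed (simp_all add: cf)
  moreover have "(\<integral>\<xi>. (gx z \<xi>, gt z \<xi>) \<partial>disk) = ((\<integral>\<xi>. gx z \<xi> \<partial>disk), (\<integral>\<xi>. gt z \<xi> \<partial>disk))"
  proof -
    have "continuous_on UNIV (gx z)" "continuous_on UNIV (gt z)"
      using continuous_on_slice[of UNIV UNIV gx z] continuous_on_slice[of UNIV UNIV gt z] cx ct by simp_all
    then have i: "integrable disk (\<lambda>\<xi>. (gx z \<xi>, gt z \<xi>))"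
      by (intro integrable_disk continuous_on_Pair)
    show ?thesis
      using integral_bounded_linear[OF bounded_linear_fst i] integral_bounded_linear[OF bounded_linear_snd i]
      by (simp add: prod_eq_iff)
  qed
  ultimately show ?thesis by (simp add: inner_prod_def)
qed

section \<open>Disc means of functions on the plane\<close>

definition Rmean :: "(real^2 \<Rightarrow> 'b::euclidean_space) \<Rightarrow> (real^2) \<times> real \<Rightarrow> 'b" where
  "Rmean \<phi> z = (\<integral>\<xi>. snd z *\<^sub>R \<phi> (fst z + snd z *\<^sub>R \<xi>) \<partial>disk)"

text \<open>The time derivative of \<open>Rmean \<phi>\<close> when G is the gradient of \<phi>, so
  that the free wave with data (f, \<phi>) is \<open>Qmean f Gf z + Rmean \<phi> z\<close>.\<close>

definition Qmean :: "(real^2 \<Rightarrow> real) \<Rightarrow> (real^2 \<Rightarrow> real^2) \<Rightarrow> (real^2) \<times> real \<Rightarrow> real" where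
  "Qmean \<phi> G z = (\<integral>\<xi>. \<phi> (fst z + snd z *\<^sub>R \<xi>) + snd z * (G (fst z + snd z *\<^sub>R \<xi>) \<bullet> \<xi>) \<partial>disk)"

lemma continuous_on_sphere_arg:
  fixes f :: "real^2 \<Rightarrow> 'b::topological_space"
  assumes "continuous_on UNIV f"
  shows "continuous_on S (\<lambda>\<xi>. f (x + t *\<^sub>R \<xi>))"
    and "continuous_on S' (\<lambda>p. f (fst (fst p) + snd (fst p) *\<^sub>R snd p))"
proof -
  show "continuous_on S (\<lambda>\<xi>. f (x + t *\<^sub>R \<xi>))"
    by (rule continuous_on_compose2[OF assms]) (auto intro!: continuous_intros)
  show "continuous_on S' (\<lambda>p. f (fst (fst p) + snd (fst p) *\<^sub>R snd p))"
    by (rule continuous_on_compose2[OF assms]) (auto intro!: continuous_intros)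
qed

lemma has_derivative_sphere_arg:
  fixes f :: "real^2 \<Rightarrow> real" and z :: "(real^2) \<times> real"
  assumes "\<And>x. (f has_derivative (\<lambda>h. G x \<bullet> h)) (at x)"
  shows "((\<lambda>z. f (fst z + snd z *\<^sub>R \<xi>)) has_derivative
    (\<lambda>h. G (fst z + snd z *\<^sub>R \<xi>) \<bullet> (fst h + snd h *\<^sub>R \<xi>))) (at z)"
proof -
  have 1: "((\<lambda>z. fst z + snd z *\<^sub>R \<xi>) has_derivative (\<lambda>h. fst h + snd h *\<^sub>R \<xi>)) (at z)"
    by (auto intro!: derivative_eq_intros)
  show ?thesis by (rule has_derivative_compose[OF 1 assms])
qed

lemma has_derivative_Rmean:
  assumes d: "\<And>x. (\<phi> has_derivative (\<lambda>h. G x \<bullet> h)) (at x)" and cG: "continuous_on UNIV G"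
  shows "(Rmean \<phi> has_derivative (\<lambda>h. Rmean G z \<bullet> fst h + Qmean \<phi> G z * snd h)) (at z)"
  unfolding Rmean_def Qmean_def
proof (rule has_derivative_disk_integral_split[where f="\<lambda>z \<xi>. snd z *\<^sub>R \<phi> (fst z + snd z *\<^sub>R \<xi>)"
      and gx="\<lambda>z \<xi>. snd z *\<^sub>R G (fst z + snd z *\<^sub>R \<xi>)"
      and gt="\<lambda>z \<xi>. \<phi> (fst z + snd z *\<^sub>R \<xi>) + snd z * (G (fst z + snd z *\<^sub>R \<xi>) \<bullet> \<xi>)"])
  have c: "continuous_on UNIV \<phi>" by (rule has_derivative_continuous_on) (rule d)
  fix z :: "(real^2) \<times> real" and \<xi> :: "real^2"
  have "(snd has_derivative snd) (at z)" by (rule has_derivative_snd[OF has_derivative_ident])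
  from has_derivative_mult[OF this has_derivative_sphere_arg[OF d]]
  show "((\<lambda>z. snd z *\<^sub>R \<phi> (fst z + snd z *\<^sub>R \<xi>)) has_derivative (\<lambda>h. (snd z *\<^sub>R G (fst z + snd z *\<^sub>R \<xi>)) \<bullet> fst h +
      (\<phi> (fst z + snd z *\<^sub>R \<xi>) + snd z * (G (fst z + snd z *\<^sub>R \<xi>) \<bullet> \<xi>)) * snd h)) (at z)"
    unfolding real_scaleR_def by (rule has_derivative_eq_rhs) (simp add: fun_eq_iff inner_add_right algebra_simps)
  show "continuous_on UNIV (\<lambda>\<xi>. snd z *\<^sub>R \<phi> (fst z + snd z *\<^sub>R \<xi>))"
    by (intro continuous_intros continuous_on_sphere_arg c)
  show "continuous_on UNIV (\<lambda>p. snd (fst p) *\<^sub>R G (fst (fst p) + snd (fst p) *\<^sub>R snd p))"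
    by (intro continuous_intros continuous_on_sphere_arg cG)
  show "continuous_on UNIV (\<lambda>p. \<phi> (fst (fst p) + snd (fst p) *\<^sub>R snd p) + snd (fst p) * (G (fst (fst p) + snd (fst p) *\<^sub>R snd p) \<bullet> snd p))"
    by (intro continuous_intros continuous_on_sphere_arg cG c)
qed

text \<open>Reduced to the space-time statement by pulling \<phi> back under (x, t) \<mapsto> x + t
  c: the time derivative of the pullback is the derivative of \<phi> along c.\<close>

lemma hessian_symmetric:
  fixes G :: "real^2 \<Rightarrow> real^2"
  assumes G: "\<And>x. (\<phi> has_derivative (\<lambda>h. G x \<bullet> h)) (at x)"
    and H: "\<And>b x. b \<in> Basis \<Longrightarrow> ((\<lambda>x. G x \<bullet> b) has_derivative (\<lambda>h. H b x \<bullet> h)) (at x)"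
    and cH: "\<And>b. b \<in> Basis \<Longrightarrow> continuous_on UNIV (H b)"
    and b: "b \<in> Basis" and c: "c \<in> Basis"
  shows "H b x \<bullet> c = H c x \<bullet> b"
proof -
  have cG: "continuous_on UNIV G"
    by (subst continuous_on_componentwise) (intro ballI has_derivative_continuous_on, rule H)
  define y where "y z = fst z + snd z *\<^sub>R c" for z :: "(real^2) \<times> real"
  \<comment> \<open>Among basis vectors, a vanishing first component marks the time direction (0,
    1), which acts as differentiation along c.\<close>
  define H' where "H' B z = (let e = (if fst B = 0 then c else fst B) in (H e (y z), H e (y z) \<bullet> c))"
    for B :: "(real^2) \<times> real" and z :: "(real^2) \<times> real"
  have cy: "continuous_on S y" for S unfolding y_def by (intro continuous_intros)
  have b0: "b \<noteq> 0" using b by auto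
  have lift: "((\<lambda>z. f (y z)) has_derivative (\<lambda>h. (D (y z), D (y z) \<bullet> c) \<bullet> h)) (at z within S)"
    if "\<And>x. (f has_derivative (\<lambda>h. D x \<bullet> h)) (at x)" for f :: "real^2 \<Rightarrow> real" and D z S
    unfolding y_def
    by (rule has_derivative_at_withinI, rule has_derivative_eq_rhs, rule has_derivative_sphere_arg[OF that])
      (simp add: fun_eq_iff inner_prod_def inner_add_right mult.commute)
  have "H' (b, 0) (x, 0) \<bullet> (0, 1) = H' (0, 1) (x, 0) \<bullet> (b, 0)"
  proof (rule mixed_derivatives_eq[where T=1 and u="\<lambda>z. \<phi> (y z)" and G="\<lambda>z. (G (y z), G (y z) \<bullet> c)"])
    show "((\<lambda>z. \<phi> (y z)) has_derivative (\<lambda>h. (G (y z), G (y z) \<bullet> c) \<bullet> h)) (at z within spacetime 1)" for z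
      by (rule lift[OF G])
    show "((\<lambda>z. (G (y z), G (y z) \<bullet> c) \<bullet> B) has_derivative (\<lambda>h. H' B z \<bullet> h)) (at z within spacetime 1)"
      if "B \<in> Basis" for B z
    proof -
      from that consider e where "e \<in> Basis" "B = (e, 0)" | "B = (0, 1)" by (auto simp: Basis_prod_def)
      then show ?thesis
      proof cases
        case 1
        then have "e \<noteq> 0" by auto
        then show ?thesis using lift[OF H[OF 1(1)], of z "spacetime 1"] 1 by (simp add: H'_def inner_prod_def)
      next
        case 2
        then show ?thesis using lift[OF H[OF c], of z "spacetime 1"] by (simp add: H'_def inner_prod_def)
      qed
    qed
    show "continuous_on (spacetime 1) (\<lambda>z. (G (y z), G (y z) \<bullet> c))"
      by (intro continuous_intros continuous_on_compose2[OF cG cy]) auto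
    show "continuous_on (spacetime 1) (H' B)" if "B \<in> Basis" for B
    proof -
      have e: "(if fst B = 0 then c else fst B) \<in> Basis" using that c by (auto simp: Basis_prod_def)
      show ?thesis unfolding H'_def Let_def
        by (intro continuous_intros continuous_on_compose2[OF cH[OF e] cy]) auto
    qed
  qed (use b in auto)
  then show ?thesis using b0 by (simp add: H'_def inner_prod_def y_def)
qed

text \<open>The time part is the Euler--Poisson--Darboux equation, which leaves the disc mean of the
  Laplacian. Symmetry of the Hessian brings the space part into the form of means of the components
  of G.\<close>

lemma has_derivative_Qmean:
  fixes G :: "real^2 \<Rightarrow> real^2"
  assumes G: "\<And>x. (\<phi> has_derivative (\<lambda>h. G x \<bullet> h)) (at x)"
    and H: "\<And>b x. b \<in> Basis \<Longrightarrow> ((\<lambda>x. G x \<bullet> b) has_derivative (\<lambda>h. H b x \<bullet> h)) (at x)"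
    and cH: "\<And>b. b \<in> Basis \<Longrightarrow> continuous_on UNIV (H b)"
  shows "(Qmean \<phi> G has_derivative (\<lambda>h. (\<Sum>b\<in>Basis. Qmean (\<lambda>x. G x \<bullet> b) (H b) z *\<^sub>R b) \<bullet> fst h
      + Rmean (\<lambda>x. \<Sum>b\<in>Basis. H b x \<bullet> b) z * snd h)) (at z)"
proof -
  let ?y = "\<lambda>z \<xi>. fst z + snd z *\<^sub>R \<xi>"
  let ?gx = "\<lambda>z \<xi>. \<Sum>b\<in>Basis. (G (?y z \<xi>) \<bullet> b + snd z * (H b (?y z \<xi>) \<bullet> \<xi>)) *\<^sub>R b"
  let ?gt = "\<lambda>z \<xi>. 2 * (G (?y z \<xi>) \<bullet> \<xi>) + snd z * (\<Sum>b\<in>Basis. (\<xi> \<bullet> b) * (H b (?y z \<xi>) \<bullet> \<xi>))"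
  have cG: "continuous_on UNIV G"
    by (subst continuous_on_componentwise) (intro ballI has_derivative_continuous_on, rule H)
  have c: "continuous_on UNIV \<phi>" by (rule has_derivative_continuous_on) (rule G)
  have sym: "(\<Sum>b\<in>Basis. (\<xi> \<bullet> b) * (H b y \<bullet> h)) = (\<Sum>b\<in>Basis. (H b y \<bullet> \<xi>) * (h \<bullet> b))" for \<xi> y h
  proof -
    have "(\<Sum>b\<in>Basis. (\<xi> \<bullet> b) * (H b y \<bullet> h)) = (\<Sum>b\<in>Basis. \<Sum>e\<in>Basis. (\<xi> \<bullet> b) * (H b y \<bullet> e) * (h \<bullet> e))"
      by (intro sum.cong refl, subst euclidean_inner[of "H _ y" h]) (simp add: sum_distrib_left mult.assoc)
    also have "\<dots> = (\<Sum>b\<in>Basis. \<Sum>e\<in>Basis. (\<xi> \<bullet> b) * (H e y \<bullet> b) * (h \<bullet> e))"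
      by (intro sum.cong refl) (simp add: hessian_symmetric[OF G H cH])
    also have "\<dots> = (\<Sum>e\<in>Basis. \<Sum>b\<in>Basis. (H e y \<bullet> b) * (\<xi> \<bullet> b) * (h \<bullet> e))"
      by (subst sum.swap) (simp add: mult.commute mult.left_commute)
    also have "\<dots> = (\<Sum>e\<in>Basis. (H e y \<bullet> \<xi>) * (h \<bullet> e))"
      by (simp only: sum_distrib_right[symmetric] euclidean_inner[symmetric])
    finally show ?thesis .
  qed
  have D: "((\<lambda>z. \<integral>\<xi>. \<phi> (?y z \<xi>) + snd z * (G (?y z \<xi>) \<bullet> \<xi>) \<partial>disk) has_derivative
    (\<lambda>h. (\<integral>\<xi>. ?gx z \<xi> \<partial>disk) \<bullet> fst h + (\<integral>\<xi>. ?gt z \<xi> \<partial>disk) * snd h)) (at z)"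
  proof (rule has_derivative_disk_integral_split[where f="\<lambda>z \<xi>. \<phi> (?y z \<xi>) + snd z * (G (?y z \<xi>) \<bullet> \<xi>)"
      and gx="?gx" and gt="?gt"])
    fix z :: "(real^2) \<times> real" and \<xi> :: "real^2"
    have d0: "(snd has_derivative snd) (at z)" by (rule has_derivative_snd[OF has_derivative_ident])
    have d1: "((\<lambda>z. (G (?y z \<xi>) \<bullet> b) * (\<xi> \<bullet> b)) has_derivative (\<lambda>h. (H b (?y z \<xi>) \<bullet> (fst h + snd h *\<^sub>R \<xi>)) * (\<xi> \<bullet> b))) (at z)"
      if "b \<in> Basis" for b
      by (rule has_derivative_mult_left[OF has_derivative_sphere_arg[OF H[OF that]]])
    have d2: "((\<lambda>z. G (?y z \<xi>) \<bullet> \<xi>) has_derivative (\<lambda>h. \<Sum>b\<in>Basis. (H b (?y z \<xi>) \<bullet> (fst h + snd h *\<^sub>R \<xi>)) * (\<xi> \<bullet> b))) (at z)"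
      by (subst euclidean_inner) (rule has_derivative_sum[OF d1])
    have s: "(\<Sum>b\<in>Basis. (H b (?y z \<xi>) \<bullet> (h + s *\<^sub>R \<xi>)) * (\<xi> \<bullet> b))
       = (\<Sum>b\<in>Basis. (H b (?y z \<xi>) \<bullet> \<xi>) * (h \<bullet> b)) + s * (\<Sum>b\<in>Basis. (\<xi> \<bullet> b) * (H b (?y z \<xi>) \<bullet> \<xi>))" for h s
    proof -
      have "(\<Sum>b\<in>Basis. (H b (?y z \<xi>) \<bullet> (h + s *\<^sub>R \<xi>)) * (\<xi> \<bullet> b))
        = (\<Sum>b\<in>Basis. (\<xi> \<bullet> b) * (H b (?y z \<xi>) \<bullet> h)) + s * (\<Sum>b\<in>Basis. (\<xi> \<bullet> b) * (H b (?y z \<xi>) \<bullet> \<xi>))"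
        by (simp add: inner_add_right sum.distrib sum_distrib_left algebra_simps)
      then show ?thesis unfolding sym .
    qed
    have gxh: "?gx z \<xi> \<bullet> h = G (?y z \<xi>) \<bullet> h + snd z * (\<Sum>b\<in>Basis. (H b (?y z \<xi>) \<bullet> \<xi>) * (h \<bullet> b))" for h
    proof -
      have "G (?y z \<xi>) \<bullet> h = (\<Sum>b\<in>Basis. (G (?y z \<xi>) \<bullet> b) * (h \<bullet> b))" by (rule euclidean_inner)
      then show ?thesis
        by (simp add: inner_sum_left sum.distrib sum_distrib_left inner_commute[of h] algebra_simps)
    qed
    from has_derivative_add[OF has_derivative_sphere_arg[OF G] has_derivative_mult[OF d0 d2]]
    show "((\<lambda>z. \<phi> (?y z \<xi>) + snd z * (G (?y z \<xi>) \<bullet> \<xi>)) has_derivative (\<lambda>h. ?gx z \<xi> \<bullet> fst h + ?gt z \<xi> * snd h)) (at z)"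
      by (rule has_derivative_eq_rhs) (unfold s gxh, simp add: fun_eq_iff inner_add_right algebra_simps)
    show "continuous_on UNIV (\<lambda>\<xi>. \<phi> (?y z \<xi>) + snd z * (G (?y z \<xi>) \<bullet> \<xi>))"
      by (intro continuous_intros continuous_on_sphere_arg c cG)
    show "continuous_on UNIV (\<lambda>p. ?gx (fst p) (snd p))" "continuous_on UNIV (\<lambda>p. ?gt (fst p) (snd p))"
      by (intro continuous_intros continuous_on_sphere_arg cG cH; assumption)+
  qed
  have "(\<integral>\<xi>. ?gx z \<xi> \<partial>disk) = (\<Sum>b\<in>Basis. Qmean (\<lambda>x. G x \<bullet> b) (H b) z *\<^sub>R b)"
  proof -
    have i: "integrable disk (\<lambda>\<xi>. G (?y z \<xi>) \<bullet> b + snd z * (H b (?y z \<xi>) \<bullet> \<xi>))" if "b \<in> Basis" for b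
      by (intro integrable_disk continuous_intros continuous_on_sphere_arg cG cH that)
    have "(\<integral>\<xi>. ?gx z \<xi> \<partial>disk) = (\<Sum>b\<in>Basis. \<integral>\<xi>. (G (?y z \<xi>) \<bullet> b + snd z * (H b (?y z \<xi>) \<bullet> \<xi>)) *\<^sub>R b \<partial>disk)"
      by (rule Bochner_Integration.integral_sum) (intro integrable_scaleR_left i)
    also have "\<dots> = (\<Sum>b\<in>Basis. Qmean (\<lambda>x. G x \<bullet> b) (H b) z *\<^sub>R b)"
      unfolding Qmean_def by (intro sum.cong refl integral_scaleR_left i)
    finally show ?thesis .
  qed
  moreover have "(\<integral>\<xi>. ?gt z \<xi> \<partial>disk) = Rmean (\<lambda>x. \<Sum>b\<in>Basis. H b x \<bullet> b) z"
    unfolding Rmean_def real_scaleR_def by (rule disk_EPD[OF H cH])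
  ultimately show ?thesis using D unfolding Qmean_def[abs_def] by simp
qed

lemma continuous_on_Rmean:
  assumes "continuous_on UNIV \<phi>"
  shows "continuous_on S (Rmean \<phi>)"
proof -
  have "continuous_on UNIV (\<lambda>z. \<integral>\<xi>. snd z *\<^sub>R \<phi> (fst z + snd z *\<^sub>R \<xi>) \<partial>disk)"
    by (rule continuous_on_disk_integral) (intro continuous_intros continuous_on_sphere_arg assms)
  then show ?thesis unfolding Rmean_def[abs_def] by (rule continuous_on_subset) simp
qed

lemma continuous_on_Qmean:
  assumes "continuous_on UNIV \<phi>" and "continuous_on UNIV G"
  shows "continuous_on S (Qmean \<phi> G)"
proof -
  have "continuous_on UNIV (\<lambda>z. \<integral>\<xi>. \<phi> (fst z + snd z *\<^sub>R \<xi>) + snd z * (G (fst z + snd z *\<^sub>R \<xi>) \<bullet> \<xi>) \<partial>disk)"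
    by (rule continuous_on_disk_integral) (intro continuous_intros continuous_on_sphere_arg assms)
  then show ?thesis unfolding Qmean_def[abs_def] by (rule continuous_on_subset) simp
qed

lemma continuous_on_of_grad:
  fixes f :: "real^2 \<Rightarrow> real"
  assumes "\<And>x. (f has_derivative (\<lambda>h. G x \<bullet> h)) (at x)"
  shows "continuous_on UNIV f"
  by (rule has_derivative_continuous_on) (rule assms)

lemma continuous_on_of_component_grad:
  fixes G :: "real^2 \<Rightarrow> real^2"
  assumes "\<And>b x. b \<in> Basis \<Longrightarrow> ((\<lambda>x. G x \<bullet> b) has_derivative (\<lambda>h. H b x \<bullet> h)) (at x)"
  shows "continuous_on UNIV G"
  by (subst continuous_on_componentwise) (intro ballI has_derivative_continuous_on, rule assms)

lemma C1_Rmean: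
  assumes d: "\<And>x. (\<phi> has_derivative (\<lambda>h. G x \<bullet> h)) (at x)" and cG: "continuous_on UNIV G"
  shows "C_on 1 UNIV (Rmean \<phi>)"
proof (rule C_on_1I[where G="\<lambda>z. (Rmean G z, Qmean \<phi> G z)"])
  show "(Rmean \<phi> has_derivative (\<lambda>h. (Rmean G z, Qmean \<phi> G z) \<bullet> h)) (at z)" for z
    using has_derivative_Rmean[OF d cG, of z] by (simp add: inner_prod_def)
qed (intro continuous_on_Pair continuous_on_Rmean continuous_on_Qmean cG continuous_on_of_grad[OF d])

lemma C1_Qmean:
  fixes G :: "real^2 \<Rightarrow> real^2"
  assumes G: "\<And>x. (\<phi> has_derivative (\<lambda>h. G x \<bullet> h)) (at x)"
    and H: "\<And>b x. b \<in> Basis \<Longrightarrow> ((\<lambda>x. G x \<bullet> b) has_derivative (\<lambda>h. H b x \<bullet> h)) (at x)"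
    and cH: "\<And>b. b \<in> Basis \<Longrightarrow> continuous_on UNIV (H b)"
  shows "C_on 1 UNIV (Qmean \<phi> G)"
proof (rule C_on_1I[where G="\<lambda>z. (\<Sum>b\<in>Basis. Qmean (\<lambda>x. G x \<bullet> b) (H b) z *\<^sub>R b, Rmean (\<lambda>x. \<Sum>b\<in>Basis. H b x \<bullet> b) z)"])
  show "(Qmean \<phi> G has_derivative (\<lambda>h. (\<Sum>b\<in>Basis. Qmean (\<lambda>x. G x \<bullet> b) (H b) z *\<^sub>R b, Rmean (\<lambda>x. \<Sum>b\<in>Basis. H b x \<bullet> b) z) \<bullet> h)) (at z)" for z
    using has_derivative_Qmean[OF G H cH, of z] by (simp add: inner_prod_def)
qed (intro continuous_on_Pair continuous_on_Rmean continuous_on_Qmean continuous_intros cH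
    continuous_on_of_component_grad[OF H]; assumption)

lemma Rmean_inner:
  assumes "continuous_on UNIV G"
  shows "Rmean G z \<bullet> b = Rmean (\<lambda>x. G x \<bullet> b) z"
proof -
  have "integrable disk (\<lambda>\<xi>. snd z *\<^sub>R G (fst z + snd z *\<^sub>R \<xi>))"
    by (intro integrable_disk continuous_intros continuous_on_sphere_arg assms)
  from integral_bounded_linear[OF bounded_linear_inner_left[of b] this]
  show ?thesis unfolding Rmean_def by (simp only: inner_scaleR_left real_scaleR_def)
qed

lemma Rmean_sum:
  assumes "\<And>b. b \<in> I \<Longrightarrow> continuous_on UNIV (\<phi> b)"
  shows "Rmean (\<lambda>x. \<Sum>b\<in>I. \<phi> b x) z = (\<Sum>b\<in>I. Rmean (\<phi> b) z)"
  unfolding Rmean_def scaleR_sum_right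
  by (rule Bochner_Integration.integral_sum) (intro integrable_disk continuous_intros continuous_on_sphere_arg assms)

lemma Qmean_sum:
  assumes "\<And>b. b \<in> I \<Longrightarrow> continuous_on UNIV (\<phi> b)" and "\<And>b. b \<in> I \<Longrightarrow> continuous_on UNIV (G b)"
  shows "Qmean (\<lambda>x. \<Sum>b\<in>I. \<phi> b x) (\<lambda>x. \<Sum>b\<in>I. G b x) z = (\<Sum>b\<in>I. Qmean (\<phi> b) (G b) z)"
  unfolding Qmean_def inner_sum_left sum_distrib_left sum.distrib[symmetric]
  by (rule Bochner_Integration.integral_sum) (intro integrable_disk continuous_intros continuous_on_sphere_arg assms)

text \<open>Finite propagation speed: the backward disc of a point outside the forward cone meets
  only points outside the support.\<close>

lemma outside_cone:
  fixes x \<xi> :: "'a::real_normed_vector"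
  assumes "norm \<xi> \<le> 1" and "0 \<le> s" and "s + c < norm x"
  shows "c < norm (x + s *\<^sub>R \<xi>)"
proof -
  have "norm (s *\<^sub>R \<xi>) \<le> s" using assms(1,2) by (simp add: mult_left_le)
  moreover have "norm x - norm (s *\<^sub>R \<xi>) \<le> norm (x + s *\<^sub>R \<xi>)" by (rule norm_diff_ineq)
  ultimately show ?thesis using assms(3) by linarith
qed

lemma Rmean_outside:
  fixes \<phi> :: "real^2 \<Rightarrow> 'b::euclidean_space"
  assumes "continuous_on UNIV \<phi>" and "\<And>x. k < norm x \<Longrightarrow> \<phi> x = 0" and "0 \<le> snd z" "snd z + k < norm (fst z)"
  shows "Rmean \<phi> z = 0"
proof -
  have "Rmean \<phi> z = (\<integral>\<xi>. 0 \<partial>disk)" unfolding Rmean_def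
    by (rule disk_integral_cong) (use assms outside_cone[OF _ assms(3,4)] in \<open>auto intro!: continuous_intros continuous_on_sphere_arg\<close>)
  then show ?thesis by simp
qed

lemma Qmean_outside:
  assumes "continuous_on UNIV \<phi>" and "continuous_on UNIV G"
    and "\<And>x. k < norm x \<Longrightarrow> \<phi> x = 0" "\<And>x. k < norm x \<Longrightarrow> G x = 0" and "0 \<le> snd z" "snd z + k < norm (fst z)"
  shows "Qmean \<phi> G z = 0"
proof -
  have "Qmean \<phi> G z = (\<integral>\<xi>. 0 \<partial>disk)" unfolding Qmean_def
    by (rule disk_integral_cong) (use assms outside_cone[OF _ assms(5,6)] in \<open>auto intro!: continuous_intros continuous_on_sphere_arg\<close>)
  then show ?thesis by simp
qed

lemma grad_outside:
  fixes f :: "real^2 \<Rightarrow> real"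
  assumes "\<And>x. (f has_derivative (\<lambda>h. G x \<bullet> h)) (at x)" and "\<And>x. k < norm x \<Longrightarrow> f x = 0" and "k < norm x"
  shows "G x = 0"
proof -
  have o: "open {x::real^2. k < norm x}" by (intro open_Collect_less continuous_intros)
  have "((\<lambda>_. 0) has_derivative (\<lambda>h. G x \<bullet> h)) (at x)"
    by (rule has_derivative_transform_within_open[OF assms(1) o]) (use assms(2,3) in auto)
  then have "(\<lambda>h. G x \<bullet> h) = (\<lambda>_. 0)" by (rule has_derivative_unique) simp
  then have "G x \<bullet> G x = 0" by metis
  then show ?thesis by simp
qed

section \<open>The free wave with compactly supported data\<close>

text \<open>\<phi> stands for f + g, the initial velocity without \<epsilon>. The free wave contains
  the gradient of f, so two further derivatives of it require the third derivatives
  \<open>Kf\<close>; for \<phi> second derivatives suffice.\<close>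

locale free_wave =
  fixes k :: real and f \<phi> :: "real^2 \<Rightarrow> real" and Gf Gp :: "real^2 \<Rightarrow> real^2"
    and Hf Hp :: "real^2 \<Rightarrow> real^2 \<Rightarrow> real^2" and Kf :: "real^2 \<Rightarrow> real^2 \<Rightarrow> real^2 \<Rightarrow> real^2"
  assumes k1: "1 \<le> k"
    and Gf: "\<And>x. (f has_derivative (\<lambda>h. Gf x \<bullet> h)) (at x)"
    and Hf: "\<And>b x. b \<in> Basis \<Longrightarrow> ((\<lambda>x. Gf x \<bullet> b) has_derivative (\<lambda>h. Hf b x \<bullet> h)) (at x)"
    and Kf: "\<And>b c x. b \<in> Basis \<Longrightarrow> c \<in> Basis \<Longrightarrow> ((\<lambda>x. Hf b x \<bullet> c) has_derivative (\<lambda>h. Kf b c x \<bullet> h)) (at x)"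
    and cKf: "\<And>b c. b \<in> Basis \<Longrightarrow> c \<in> Basis \<Longrightarrow> continuous_on UNIV (Kf b c)"
    and Gp: "\<And>x. (\<phi> has_derivative (\<lambda>h. Gp x \<bullet> h)) (at x)"
    and Hp: "\<And>b x. b \<in> Basis \<Longrightarrow> ((\<lambda>x. Gp x \<bullet> b) has_derivative (\<lambda>h. Hp b x \<bullet> h)) (at x)"
    and cHp: "\<And>b. b \<in> Basis \<Longrightarrow> continuous_on UNIV (Hp b)"
    and f_out: "\<And>x. k < norm x \<Longrightarrow> f x = 0" and p_out: "\<And>x. k < norm x \<Longrightarrow> \<phi> x = 0"
begin

definition UL :: "(real^2) \<times> real \<Rightarrow> real" where
  "UL z = Qmean f Gf z + Rmean \<phi> z"

definition ULx :: "(real^2) \<times> real \<Rightarrow> real^2" where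
  "ULx z = (\<Sum>b\<in>Basis. Qmean (\<lambda>x. Gf x \<bullet> b) (Hf b) z *\<^sub>R b) + Rmean Gp z"

text \<open>Time derivatives are traded for Laplacians of the data: differentiating
  \<open>Qmean f Gf\<close> in time gives the disc mean of the Laplacian of f. \<open>ULtt\<close>
  arises in the same way.\<close>

definition ULt :: "(real^2) \<times> real \<Rightarrow> real" where
  "ULt z = Rmean (\<lambda>x. \<Sum>b\<in>Basis. Hf b x \<bullet> b) z + Qmean \<phi> Gp z"

definition ULxx :: "real^2 \<Rightarrow> (real^2) \<times> real \<Rightarrow> real^2" where
  "ULxx b z = (\<Sum>c\<in>Basis. Qmean (\<lambda>x. Hf b x \<bullet> c) (Kf b c) z *\<^sub>R c) + Rmean (Hp b) z"

definition ULtt :: "(real^2) \<times> real \<Rightarrow> real" where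
  "ULtt z = Qmean (\<lambda>x. \<Sum>b\<in>Basis. Hf b x \<bullet> b) (\<lambda>x. \<Sum>b\<in>Basis. Kf b b x) z + Rmean (\<lambda>x. \<Sum>b\<in>Basis. Hp b x \<bullet> b) z"

lemma cont:
  "continuous_on UNIV f" "continuous_on UNIV \<phi>" "continuous_on UNIV Gf" "continuous_on UNIV Gp"
  "b \<in> Basis \<Longrightarrow> continuous_on UNIV (Hf b)"
  using continuous_on_of_grad[OF Gf] continuous_on_of_grad[OF Gp] continuous_on_of_component_grad[OF Hf]
    continuous_on_of_component_grad[OF Hp] continuous_on_of_component_grad[OF Kf] by simp_all

lemma cont_lap: "continuous_on UNIV (\<lambda>x. \<Sum>b\<in>Basis. Hf b x \<bullet> b)"
  by (intro continuous_intros cont(5))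

lemma lap_deriv: "((\<lambda>x. \<Sum>b\<in>Basis. Hf b x \<bullet> b) has_derivative (\<lambda>h. (\<Sum>b\<in>Basis. Kf b b x) \<bullet> h)) (at x)"
  unfolding inner_sum_left by (intro has_derivative_sum Kf)

lemma cont_lap_grad: "continuous_on UNIV (\<lambda>x. \<Sum>b\<in>Basis. Kf b b x)"
  by (intro continuous_intros cKf)

lemma UL_deriv: "(UL has_derivative (\<lambda>h. ULx z \<bullet> fst h + ULt z * snd h)) (at z)"
  unfolding UL_def[abs_def]
  by (rule has_derivative_eq_rhs, rule has_derivative_add[OF has_derivative_Qmean[OF Gf Hf cont(5)] has_derivative_Rmean[OF Gp cont(4)]])
    (simp_all add: fun_eq_iff ULx_def ULt_def inner_add_left algebra_simps)

lemma ULx_component: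
  assumes "b \<in> Basis"
  shows "ULx z \<bullet> b = Qmean (\<lambda>x. Gf x \<bullet> b) (Hf b) z + Rmean (\<lambda>x. Gp x \<bullet> b) z"
  using assms unfolding ULx_def inner_add_left Rmean_inner[OF cont(4)]
  by (simp add: inner_sum_left inner_Basis if_distrib sum.delta cong: if_cong)

lemma ULx_deriv:
  assumes b: "b \<in> Basis"
  shows "((\<lambda>z. ULx z \<bullet> b) has_derivative (\<lambda>h. ULxx b z \<bullet> fst h
    + (Rmean (\<lambda>x. \<Sum>c\<in>Basis. Kf b c x \<bullet> c) z + Qmean (\<lambda>x. Gp x \<bullet> b) (Hp b) z) * snd h)) (at z)"
  unfolding ULx_component[OF b]
  by (rule has_derivative_eq_rhs, rule has_derivative_add[OF has_derivative_Qmean[OF Hf[OF b] Kf[OF b] cKf[OF b]]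
        has_derivative_Rmean[OF Hp[OF b] cHp[OF b]]])
    (simp_all add: fun_eq_iff ULxx_def inner_add_left algebra_simps)

lemma ULt_deriv:
  "(ULt has_derivative (\<lambda>h. (Rmean (\<lambda>x. \<Sum>b\<in>Basis. Kf b b x) z + (\<Sum>b\<in>Basis. Qmean (\<lambda>x. Gp x \<bullet> b) (Hp b) z *\<^sub>R b)) \<bullet> fst h + ULtt z * snd h)) (at z)"
  unfolding ULt_def[abs_def]
  by (rule has_derivative_eq_rhs, rule has_derivative_add[OF has_derivative_Rmean[OF lap_deriv cont_lap_grad] has_derivative_Qmean[OF Gp Hp cHp]])
    (simp_all add: fun_eq_iff ULtt_def inner_add_left algebra_simps)

lemma C2_UL: "C_on 2 UNIV UL"
  unfolding numeral_2_eq_2 One_nat_def[symmetric]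
proof (rule C_on_SucI[where f'="\<lambda>z h. ULx z \<bullet> fst h + ULt z * snd h"])
  show "(UL has_derivative (\<lambda>h. ULx z \<bullet> fst h + ULt z * snd h)) (at z)" for z by (rule UL_deriv)
  fix b :: "(real^2) \<times> real" assume "b \<in> Basis"
  then consider c where "c \<in> Basis" "b = (c, 0)" | "b = (0, 1)" by (auto simp: Basis_prod_def)
  then show "C_on 1 UNIV (\<lambda>z. ULx z \<bullet> fst b + ULt z * snd b)"
  proof cases
    case 1
    have "C_on 1 UNIV (\<lambda>z. ULx z \<bullet> c)"
      unfolding ULx_component[OF 1(1)]
      by (rule C_on_add[OF C1_Qmean[OF Hf[OF 1(1)] Kf[OF 1(1)] cKf[OF 1(1)]] C1_Rmean[OF Hp[OF 1(1)] cHp[OF 1(1)]]])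
    then show ?thesis using 1 by simp
  next
    case 2
    have "C_on 1 UNIV ULt"
      unfolding ULt_def[abs_def]
      by (rule C_on_add[OF C1_Rmean[OF lap_deriv cont_lap_grad] C1_Qmean[OF Gp Hp cHp]])
    then show ?thesis using 2 by simp
  qed
qed

lemma UL_space_deriv: "((\<lambda>y. UL (y, t)) has_derivative (\<lambda>h. ULx (x, t) \<bullet> h)) (at x)"
  and ULx_space_deriv: "b \<in> Basis \<Longrightarrow> ((\<lambda>y. ULx (y, t) \<bullet> b) has_derivative (\<lambda>h. ULxx b (x, t) \<bullet> h)) (at x)"
proof -
  have 1: "((\<lambda>y. (y, t)) has_derivative (\<lambda>h. (h, 0))) (at x)" by (auto intro!: derivative_eq_intros)
  show "((\<lambda>y. UL (y, t)) has_derivative (\<lambda>h. ULx (x, t) \<bullet> h)) (at x)"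
    using has_derivative_compose[OF 1 UL_deriv] by simp
  show "((\<lambda>y. ULx (y, t) \<bullet> b) has_derivative (\<lambda>h. ULxx b (x, t) \<bullet> h)) (at x)" if "b \<in> Basis"
    using has_derivative_compose[OF 1 ULx_deriv[OF that]] by simp
qed

lemma UL_time_deriv: "((\<lambda>s. UL (x, s)) has_vector_derivative ULt (x, t)) (at t within S)"
  and ULt_time_deriv: "((\<lambda>s. ULt (x, s)) has_vector_derivative ULtt (x, t)) (at t within S)"
proof -
  have 1: "((\<lambda>s. (x, s)) has_derivative (\<lambda>h. (0, h))) (at t within S)" by (auto intro!: derivative_eq_intros)
  show "((\<lambda>s. UL (x, s)) has_vector_derivative ULt (x, t)) (at t within S)"
    using has_derivative_compose[OF 1 UL_deriv] by (simp add: has_vector_derivative_def mult.commute mult_commute_abs)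
  show "((\<lambda>s. ULt (x, s)) has_vector_derivative ULtt (x, t)) (at t within S)"
    using has_derivative_compose[OF 1 ULt_deriv] by (simp add: has_vector_derivative_def mult.commute mult_commute_abs)
qed

text \<open>Both sides are disc means of the Laplacians of the data, since space derivatives commute
  with the means.\<close>

lemma UL_wave: "ULtt z = (\<Sum>b\<in>Basis. ULxx b z \<bullet> b)"
proof -
  have "ULxx b z \<bullet> b = Qmean (\<lambda>x. Hf b x \<bullet> b) (Kf b b) z + Rmean (\<lambda>x. Hp b x \<bullet> b) z" if "b \<in> Basis" for b
    using that unfolding ULxx_def inner_add_left Rmean_inner[OF cHp[OF that]]
    by (simp add: inner_sum_left inner_Basis if_distrib sum.delta cong: if_cong)
  then have "(\<Sum>b\<in>Basis. ULxx b z \<bullet> b) = (\<Sum>b\<in>Basis. Qmean (\<lambda>x. Hf b x \<bullet> b) (Kf b b) z) + (\<Sum>b\<in>Basis. Rmean (\<lambda>x. Hp b x \<bullet> b) z)"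
    by (simp add: sum.distrib)
  also have "(\<Sum>b\<in>Basis. Qmean (\<lambda>x. Hf b x \<bullet> b) (Kf b b) z) = Qmean (\<lambda>x. \<Sum>b\<in>Basis. Hf b x \<bullet> b) (\<lambda>x. \<Sum>b\<in>Basis. Kf b b x) z"
    by (rule Qmean_sum[symmetric]) (intro continuous_intros cont(5) cKf; assumption)+
  also have "(\<Sum>b\<in>Basis. Rmean (\<lambda>x. Hp b x \<bullet> b) z) = Rmean (\<lambda>x. \<Sum>b\<in>Basis. Hp b x \<bullet> b) z"
    by (rule Rmean_sum[symmetric]) (intro continuous_intros cHp)
  finally show ?thesis by (simp add: ULtt_def)
qed

lemma UL_init: "UL (x, 0) = f x" "ULt (x, 0) = \<phi> x"
  by (simp_all add: UL_def ULt_def Qmean_def Rmean_def)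

lemma UL_outside:
  assumes "0 \<le> snd z" "snd z + k < norm (fst z)"
  shows "UL z = 0" "ULt z = 0"
proof -
  have Gf0: "Gf x = 0" if "k < norm x" for x by (rule grad_outside[OF Gf f_out that])
  have Gp0: "Gp x = 0" if "k < norm x" for x by (rule grad_outside[OF Gp p_out that])
  have Hf0: "Hf b x = 0" if "k < norm x" "b \<in> Basis" for x b
    by (rule grad_outside[OF Hf[OF that(2)] _ that(1)]) (simp add: Gf0)
  have "Qmean f Gf z = 0" by (rule Qmean_outside[OF cont(1,3) f_out Gf0 assms])
  moreover have "Rmean \<phi> z = 0" by (rule Rmean_outside[OF cont(2) p_out assms])
  ultimately show "UL z = 0" by (simp add: UL_def)
  have "Qmean \<phi> Gp z = 0" by (rule Qmean_outside[OF cont(2,4) p_out Gp0 assms])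
  moreover have "Rmean (\<lambda>x. \<Sum>b\<in>Basis. Hf b x \<bullet> b) z = 0"
    by (rule Rmean_outside[OF cont_lap _ assms]) (simp add: Hf0)
  ultimately show "ULt z = 0" by (simp add: ULt_def)
qed

lemma wave_R_eq: "continuous_on UNIV \<psi> \<Longrightarrow> wave_R \<psi> x t = Rmean \<psi> (x, t)"
  unfolding wave_R_def Rmean_def
  by (subst disk_integral_cball) (simp_all add: continuous_on_sphere_arg)

lemma u_L_eq:
  assumes "\<phi> = (\<lambda>x. f x + g x)"
  shows "u_L f g x t = UL (x, t)"
proof -
  have 1: "((\<lambda>s. (x, s)) has_derivative (\<lambda>h. (0, h))) (at t)" by (auto intro!: derivative_eq_intros)
  have "((\<lambda>s. Rmean f (x, s)) has_real_derivative Qmean f Gf (x, t)) (at t)"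
    using has_derivative_compose[OF 1 has_derivative_Rmean[OF Gf cont(3)]] by (simp add: has_field_derivative_def mult.commute mult_commute_abs)
  then show ?thesis
    unfolding u_L_def UL_def wave_R_eq[OF cont(1)] assms[symmetric] wave_R_eq[OF cont(2)]
    by (simp add: DERIV_imp_deriv)
qed

end

text \<open>The passage from the formulas of (I) to \<open>duh\<close>: the factor 2 \<pi> is
  absorbed by the normalisation of \<open>disk\<close>, and the outer Lebesgue integral of a
  continuous function becomes a gauge integral.\<close>

lemma wave_L_eq:
  assumes F: "continuous_on (spacetime T) F" and t: "0 \<le> t" "t < T"
  shows "wave_L p F x t = duh (\<lambda>z. F z / (1 + snd z) powr (p - 1)) (x, t)"
proof -
  have cF: "continuous_on (spacetime T) (\<lambda>z. F z / (1 + snd z) powr (p - 1))"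
    by (intro continuous_intros F) (auto simp: powr_eq_0_iff)
  have e: "(t - \<tau>) / (1 + \<tau>) powr (p - 1) * (LINT \<xi>:cball 0 1|lborel. F (x + (t - \<tau>) *\<^sub>R \<xi>, \<tau>) / sqrt (1 - (norm \<xi>)\<^sup>2))
    = 2 * pi * (\<integral>\<xi>. (t - \<tau>) *\<^sub>R (F (x + (t - \<tau>) *\<^sub>R \<xi>, \<tau>) / (1 + \<tau>) powr (p - 1)) \<partial>disk)" if "\<tau> \<in> {0..t}" for \<tau>
  proof -
    have "continuous_on UNIV (\<lambda>\<xi>. F (x + (t - \<tau>) *\<^sub>R \<xi>, \<tau>))"
      by (rule continuous_on_kernel_slice[OF F]) (use that t in auto)
    then show ?thesis by (simp add: disk_integral_cball)
  qed
  have "continuous_on {0..t} (\<lambda>\<tau>. \<integral>\<xi>. (t - \<tau>) *\<^sub>R (F (x + (t - \<tau>) *\<^sub>R \<xi>, \<tau>) / (1 + \<tau>) powr (p - 1)) \<partial>disk)"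
    using continuous_on_duh_integrand[OF cF, of "(x, t)"] t by simp
  then have c: "continuous_on {0..t} (\<lambda>\<tau>. 2 * pi * (\<integral>\<xi>. (t - \<tau>) *\<^sub>R (F (x + (t - \<tau>) *\<^sub>R \<xi>, \<tau>) / (1 + \<tau>) powr (p - 1)) \<partial>disk))"
    by (intro continuous_intros)
  have "wave_L p F x t = 1 / (2 * pi) * (LINT \<tau>:{0..t}|lborel. 2 * pi * (\<integral>\<xi>. (t - \<tau>) *\<^sub>R (F (x + (t - \<tau>) *\<^sub>R \<xi>, \<tau>) / (1 + \<tau>) powr (p - 1)) \<partial>disk))"
    unfolding wave_L_def
  proof (rule arg_cong[where f="\<lambda>y. 1 / (2 * pi) * y"], rule set_lebesgue_integral_cong)
    show "{0..t} \<in> sets lborel" by simp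
  qed (use e in blast)
  also have "(LINT \<tau>:{0..t}|lborel. 2 * pi * (\<integral>\<xi>. (t - \<tau>) *\<^sub>R (F (x + (t - \<tau>) *\<^sub>R \<xi>, \<tau>) / (1 + \<tau>) powr (p - 1)) \<partial>disk))
    = integral {0..t} (\<lambda>\<tau>. 2 * pi * (\<integral>\<xi>. (t - \<tau>) *\<^sub>R (F (x + (t - \<tau>) *\<^sub>R \<xi>, \<tau>) / (1 + \<tau>) powr (p - 1)) \<partial>disk))"
    by (rule set_borel_integral_eq_integral(2)) (rule borel_integrable_atLeastAtMost'[OF c])
  also have "\<dots> = 2 * pi * duh (\<lambda>z. F z / (1 + snd z) powr (p - 1)) (x, t)"
    unfolding duh_def fst_conv snd_conv by (rule Henstock_Kurzweil_Integration.integral_mult_right)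
  finally show ?thesis by simp
qed

section \<open>Comparison and decay estimates\<close>

text \<open>The gradient of u at time 0 is determined by the data: its space part is the gradient of
  a by uniqueness of derivatives, its time part is b. The representation formula then splits into
  the two means and the potential.\<close>

lemma wave_representation_data:
  assumes C: "C_on 2 (spacetime T) u" and a: "\<And>x. u (x, 0) = a x"
    and Ga: "\<And>x. (a has_derivative (\<lambda>h. Ga x \<bullet> h)) (at x)" and b: "\<And>x. dt T u (x, 0) = b x"
    and z: "z \<in> spacetime T"
  shows "u z = Qmean a Ga z + Rmean b z + duh (dalem T u) z"
proof -
  from C obtain G H where G: "\<And>z. z \<in> spacetime T \<Longrightarrow> (u has_derivative (\<lambda>h. G z \<bullet> h)) (at z within spacetime T)"
    and H: "\<And>b z. b \<in> Basis \<Longrightarrow> z \<in> spacetime T \<Longrightarrow> ((\<lambda>z. G z \<bullet> b) has_derivative (\<lambda>h. H b z \<bullet> h)) (at z within spacetime T)"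
    and cG: "continuous_on (spacetime T) G" and cH: "\<And>b. b \<in> Basis \<Longrightarrow> continuous_on (spacetime T) (H b)"
    by (rule C_on_2_grad) blast
  have T: "0 < T" using z by simp
  have in0: "(x, 0) \<in> spacetime T" for x using T by simp
  have fG: "fst (G (x, 0)) = Ga x" for x
  proof -
    have "((\<lambda>y. u (y, 0)) has_derivative (\<lambda>h. G (x, 0) \<bullet> (h, 0))) (at x)"
      by (rule has_derivative_space_slice[OF G[OF in0]]) (use T in simp_all)
    then have "(a has_derivative (\<lambda>h. fst (G (x, 0)) \<bullet> h)) (at x)" by (simp add: a inner_prod_def)
    from has_derivative_unique[OF this Ga] have "fst (G (x, 0)) \<bullet> h = Ga x \<bullet> h" for h by metis
    then have "(fst (G (x, 0)) - Ga x) \<bullet> (fst (G (x, 0)) - Ga x) = 0" by (simp add: inner_diff_left)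
    then show ?thesis by simp
  qed
  have sG: "snd (G (x, 0)) = b x" for x
    using dalem_hessian(1)[OF G H in0] b by (simp add: inner_prod_def)
  have cg: "continuous_on UNIV (\<lambda>y. G (y, 0))" by (rule continuous_on_time_slice[OF cG]) (use T in simp_all)
  have cGa: "continuous_on UNIV Ga" using continuous_on_fst[OF cg] by (simp add: fG)
  have cb: "continuous_on UNIV b" using continuous_on_snd[OF cg] by (simp add: sG)
  have ca: "continuous_on UNIV a" by (rule continuous_on_of_grad[OF Ga])
  have "(\<integral>\<xi>. u (fst z + snd z *\<^sub>R \<xi>, 0) + snd z * (G (fst z + snd z *\<^sub>R \<xi>, 0) \<bullet> (\<xi>, 1)) \<partial>disk)
    = (\<integral>\<xi>. (a (fst z + snd z *\<^sub>R \<xi>) + snd z * (Ga (fst z + snd z *\<^sub>R \<xi>) \<bullet> \<xi>)) + snd z *\<^sub>R b (fst z + snd z *\<^sub>R \<xi>) \<partial>disk)"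
    by (simp add: a inner_prod_def fG sG algebra_simps)
  also have "\<dots> = Qmean a Ga z + Rmean b z"
    unfolding Qmean_def Rmean_def
    by (rule Bochner_Integration.integral_add) (intro integrable_disk continuous_intros continuous_on_sphere_arg ca cGa cb)+
  finally show ?thesis using wave_representation[OF G H cG cH z] by simp
qed

lemma continuous_on_dalem:
  assumes C: "C_on 2 (spacetime T) u"
  shows "continuous_on (spacetime T) (dalem T u)"
proof -
  from C obtain G H where G: "\<And>z. z \<in> spacetime T \<Longrightarrow> (u has_derivative (\<lambda>h. G z \<bullet> h)) (at z within spacetime T)"
    and H: "\<And>b z. b \<in> Basis \<Longrightarrow> z \<in> spacetime T \<Longrightarrow> ((\<lambda>z. G z \<bullet> b) has_derivative (\<lambda>h. H b z \<bullet> h)) (at z within spacetime T)"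
    and cG: "continuous_on (spacetime T) G" and cH: "\<And>b. b \<in> Basis \<Longrightarrow> continuous_on (spacetime T) (H b)"
    by (rule C_on_2_grad) blast
  have "continuous_on (spacetime T) (\<lambda>z. H (0, 1) z \<bullet> (0, 1) - (\<Sum>b\<in>Basis. H (b, 0) z \<bullet> (b, 0)))"
    by (intro continuous_intros cH time_Basis space_Basis)
  then show ?thesis
    by (rule continuous_on_eq) (simp only: dalem_hessian(2)[OF G H])
qed

lemma dalem_lincomb:
  assumes u: "C_on 2 (spacetime T) u" and v: "C_on 2 (spacetime T) v" and z: "z \<in> spacetime T"
  shows "dalem T (\<lambda>z. a * u z + b * v z) z = a * dalem T u z + b * dalem T v z"
    and "dt T (\<lambda>z. a * u z + b * v z) z = a * dt T u z + b * dt T v z"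
proof -
  from u obtain G H where G: "\<And>z. z \<in> spacetime T \<Longrightarrow> (u has_derivative (\<lambda>h. G z \<bullet> h)) (at z within spacetime T)"
    and H: "\<And>b z. b \<in> Basis \<Longrightarrow> z \<in> spacetime T \<Longrightarrow> ((\<lambda>z. G z \<bullet> b) has_derivative (\<lambda>h. H b z \<bullet> h)) (at z within spacetime T)"
    by (rule C_on_2_grad) blast
  from v obtain G' H' where G': "\<And>z. z \<in> spacetime T \<Longrightarrow> (v has_derivative (\<lambda>h. G' z \<bullet> h)) (at z within spacetime T)"
    and H': "\<And>b z. b \<in> Basis \<Longrightarrow> z \<in> spacetime T \<Longrightarrow> ((\<lambda>z. G' z \<bullet> b) has_derivative (\<lambda>h. H' b z \<bullet> h)) (at z within spacetime T)"
    by (rule C_on_2_grad) blast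
  have d1: "((\<lambda>z. a * u z + b * v z) has_derivative (\<lambda>h. (a *\<^sub>R G z + b *\<^sub>R G' z) \<bullet> h)) (at z within spacetime T)"
    if "z \<in> spacetime T" for z
    using has_derivative_add[OF has_derivative_mult_right[OF G[OF that], of a] has_derivative_mult_right[OF G'[OF that], of b]]
    by (simp add: inner_add_left)
  have d2: "((\<lambda>z. (a *\<^sub>R G z + b *\<^sub>R G' z) \<bullet> e) has_derivative (\<lambda>h. (a *\<^sub>R H e z + b *\<^sub>R H' e z) \<bullet> h)) (at z within spacetime T)"
    if "e \<in> Basis" "z \<in> spacetime T" for e z
    using has_derivative_add[OF has_derivative_mult_right[OF H[OF that], of a] has_derivative_mult_right[OF H'[OF that], of b]]
    by (simp add: inner_add_left)
  show "dalem T (\<lambda>z. a * u z + b * v z) z = a * dalem T u z + b * dalem T v z"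
  proof -
    have "dalem T (\<lambda>z. a * u z + b * v z) z = (a *\<^sub>R H (0, 1) z + b *\<^sub>R H' (0, 1) z) \<bullet> (0, 1)
      - (\<Sum>c\<in>Basis. (a *\<^sub>R H (c, 0) z + b *\<^sub>R H' (c, 0) z) \<bullet> (c, 0))"
      by (rule dalem_hessian(2)[OF d1 d2 z])
    moreover have "dalem T u z = H (0, 1) z \<bullet> (0, 1) - (\<Sum>c\<in>Basis. H (c, 0) z \<bullet> (c, 0))"
      by (rule dalem_hessian(2)[OF G H z])
    moreover have "dalem T v z = H' (0, 1) z \<bullet> (0, 1) - (\<Sum>c\<in>Basis. H' (c, 0) z \<bullet> (c, 0))"
      by (rule dalem_hessian(2)[OF G' H' z])
    ultimately show ?thesis
      by (simp add: inner_add_left sum.distrib sum_distrib_left right_diff_distrib)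
  qed
  show "dt T (\<lambda>z. a * u z + b * v z) z = a * dt T u z + b * dt T v z"
  proof -
    have "dt T (\<lambda>z. a * u z + b * v z) z = (a *\<^sub>R G z + b *\<^sub>R G' z) \<bullet> (0, 1)"
      by (rule dalem_hessian(1)[OF d1 d2 z])
    moreover have "dt T u z = G z \<bullet> (0, 1)" by (rule dalem_hessian(1)[OF G H z])
    moreover have "dt T v z = G' z \<bullet> (0, 1)" by (rule dalem_hessian(1)[OF G' H' z])
    ultimately show ?thesis by (simp add: inner_add_left)
  qed
qed

lemma integrable_duh_integrand:
  fixes F :: "(real^2) \<times> real \<Rightarrow> 'b::euclidean_space"
  assumes "continuous_on (spacetime T) F" and "z \<in> spacetime T"
  shows "(\<lambda>\<tau>. \<integral>\<xi>. (snd z - \<tau>) *\<^sub>R F (fst z + (snd z - \<tau>) *\<^sub>R \<xi>, \<tau>) \<partial>disk) integrable_on {0..snd z}"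
  by (rule integrable_continuous_real[OF continuous_on_duh_integrand[OF assms]])

text \<open>A function W with zero data is the potential of its own wave operator. If that is
  nonnegative, the contribution of times below \<theta> to W at time t + \<theta> may be discarded,
  and what remains is the potential of the translated source. The shift moves the slab to times
  where lower bounds on the wave operator of W are available.\<close>

lemma duh_le_shifted:
  assumes C: "C_on 2 (spacetime T') W" and W0: "\<And>x. W (x, 0) = 0" and Wt: "\<And>x. dt T' W (x, 0) = 0"
    and pos: "\<And>z. z \<in> spacetime T' \<Longrightarrow> 0 \<le> dalem T' W z"
    and \<theta>: "0 \<le> \<theta>" "T + \<theta> \<le> T'" and c: "0 \<le> c"
    and cF: "continuous_on (spacetime T) F"
    and F: "\<And>z. z \<in> spacetime T \<Longrightarrow> F z \<le> c * dalem T' W (fst z, snd z + \<theta>)"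
    and z: "z \<in> spacetime T"
  shows "duh F z \<le> c * W (fst z, snd z + \<theta>)"
proof -
  obtain x t where zt: "z = (x, t)" "0 \<le> t" "t < T" using z by (cases z) auto
  define D where "D = dalem T' W"
  have cD: "continuous_on (spacetime T') D" unfolding D_def by (rule continuous_on_dalem[OF C])
  have z': "(x, t + \<theta>) \<in> spacetime T'" using zt \<theta> by simp
  have "W (x, t + \<theta>) = Qmean (\<lambda>_. 0) (\<lambda>_. 0) (x, t + \<theta>) + Rmean (\<lambda>_. 0) (x, t + \<theta>) + duh D (x, t + \<theta>)"
    unfolding D_def by (rule wave_representation_data[OF C W0 _ Wt z']) simp
  then have rep: "W (x, t + \<theta>) = duh D (x, t + \<theta>)" by (simp add: Qmean_def Rmean_def)
  define d where "d \<tau> = (\<integral>\<xi>. (t + \<theta> - \<tau>) *\<^sub>R D (x + (t + \<theta> - \<tau>) *\<^sub>R \<xi>, \<tau>) \<partial>disk)" for \<tau>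
  have cd: "continuous_on {0..t + \<theta>} d"
    unfolding d_def using continuous_on_duh_integrand[OF cD z'] by simp
  have d0: "0 \<le> d \<tau>" if "\<tau> \<in> {0..t + \<theta>}" for \<tau>
  proof -
    have "(\<integral>\<xi>. 0 \<partial>disk) \<le> d \<tau>" unfolding d_def
      using that \<theta> zt pos
      by (intro disk_integral_mono continuous_intros continuous_on_kernel_slice[OF cD]) (auto simp: D_def)
    then show ?thesis by simp
  qed
  have sub: "{\<theta>..t + \<theta>} \<subseteq> {0..t + \<theta>}" using \<theta> by auto
  have i1: "d integrable_on {\<theta>..t + \<theta>}" "d integrable_on {0..t + \<theta>}"
    using integrable_continuous_real[OF continuous_on_subset[OF cd sub]] integrable_continuous_real[OF cd] by auto
  have cs: "continuous_on {0 + \<theta>..t + \<theta>} d" using continuous_on_subset[OF cd sub] by simp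
  have shift: "integral {0..t} (\<lambda>\<tau>. d (\<tau> + \<theta>)) = integral {\<theta>..t + \<theta>} d"
    using integral_shift[OF cs] by (simp add: o_def)
  have ish: "(\<lambda>\<tau>. d (\<tau> + \<theta>)) integrable_on {0..t}"
    by (rule integrable_continuous_real, rule continuous_on_compose2[OF cd]) (use \<theta> in \<open>auto intro!: continuous_intros\<close>)
  have "duh F z \<le> integral {0..snd z} (\<lambda>\<tau>. c * d (\<tau> + \<theta>))"
    unfolding duh_def
  proof (rule integral_le)
    show "(\<lambda>\<tau>. \<integral>\<xi>. (snd z - \<tau>) *\<^sub>R F (fst z + (snd z - \<tau>) *\<^sub>R \<xi>, \<tau>) \<partial>disk) integrable_on {0..snd z}"
      by (rule integrable_duh_integrand[OF cF z])
    show "(\<lambda>\<tau>. c * d (\<tau> + \<theta>)) integrable_on {0..snd z}"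
      using integrable_cmul[OF ish, of c] by (simp add: zt)
    fix \<tau> assume t: "\<tau> \<in> {0..snd z}"
    have cc: "c * d (\<tau> + \<theta>) = (\<integral>\<xi>. c * ((t - \<tau>) *\<^sub>R D (x + (t - \<tau>) *\<^sub>R \<xi>, \<tau> + \<theta>)) \<partial>disk)"
      unfolding d_def by simp
    show "(\<integral>\<xi>. (snd z - \<tau>) *\<^sub>R F (fst z + (snd z - \<tau>) *\<^sub>R \<xi>, \<tau>) \<partial>disk) \<le> c * d (\<tau> + \<theta>)"
      unfolding cc
    proof (rule disk_integral_mono)
      show "continuous_on UNIV (\<lambda>\<xi>. (snd z - \<tau>) *\<^sub>R F (fst z + (snd z - \<tau>) *\<^sub>R \<xi>, \<tau>))"
        by (intro continuous_intros continuous_on_kernel_slice[OF cF]) (use t zt in auto)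
      show "continuous_on UNIV (\<lambda>\<xi>. c * ((t - \<tau>) *\<^sub>R D (x + (t - \<tau>) *\<^sub>R \<xi>, \<tau> + \<theta>)))"
        by (intro continuous_intros continuous_on_kernel_slice[OF cD]) (use t zt \<theta> in auto)
      fix \<xi> :: "real^2"
      have "F (x + (t - \<tau>) *\<^sub>R \<xi>, \<tau>) \<le> c * D (x + (t - \<tau>) *\<^sub>R \<xi>, \<tau> + \<theta>)"
        using F[of "(x + (t - \<tau>) *\<^sub>R \<xi>, \<tau>)"] t zt by (simp add: D_def)
      then have "(t - \<tau>) * F (x + (t - \<tau>) *\<^sub>R \<xi>, \<tau>) \<le> (t - \<tau>) * (c * D (x + (t - \<tau>) *\<^sub>R \<xi>, \<tau> + \<theta>))"
        by (rule mult_left_mono) (use t zt in simp)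
      then show "(snd z - \<tau>) *\<^sub>R F (fst z + (snd z - \<tau>) *\<^sub>R \<xi>, \<tau>) \<le> c * ((t - \<tau>) *\<^sub>R D (x + (t - \<tau>) *\<^sub>R \<xi>, \<tau> + \<theta>))"
        by (simp add: zt mult.left_commute)
    qed
  qed
  also have "\<dots> = c * integral {\<theta>..t + \<theta>} d"
    unfolding shift[symmetric] zt snd_conv by (rule Henstock_Kurzweil_Integration.integral_mult_right)
  also have "\<dots> \<le> c * integral {0..t + \<theta>} d"
    by (intro mult_left_mono integral_subset_le[OF sub i1] ballI d0 c)
  also have "integral {0..t + \<theta>} d = W (x, t + \<theta>)"
    unfolding rep duh_def d_def by simp
  finally show ?thesis by (simp add: zt)
qed

lemma duh_minus: "duh (\<lambda>z. - F z) z = - duh F z"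
  unfolding duh_def by simp

lemma duh_abs_le_shifted:
  assumes C: "C_on 2 (spacetime T') W" and W0: "\<And>x. W (x, 0) = 0" and Wt: "\<And>x. dt T' W (x, 0) = 0"
    and pos: "\<And>z. z \<in> spacetime T' \<Longrightarrow> 0 \<le> dalem T' W z"
    and \<theta>: "0 \<le> \<theta>" "T + \<theta> \<le> T'" and c: "0 \<le> c"
    and cF: "continuous_on (spacetime T) F"
    and F: "\<And>z. z \<in> spacetime T \<Longrightarrow> \<bar>F z\<bar> \<le> c * dalem T' W (fst z, snd z + \<theta>)"
    and z: "z \<in> spacetime T"
  shows "\<bar>duh F z\<bar> \<le> c * W (fst z, snd z + \<theta>)"
proof -
  have "duh F z \<le> c * W (fst z, snd z + \<theta>)"
  proof (rule duh_le_shifted[OF C W0 Wt _ \<theta> c cF _ z])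
    show "0 \<le> dalem T' W z" if "z \<in> spacetime T'" for z by (rule pos[OF that])
    show "F z \<le> c * dalem T' W (fst z, snd z + \<theta>)" if "z \<in> spacetime T" for z
      by (rule order_trans[OF abs_ge_self F[OF that]])
  qed
  moreover have "duh (\<lambda>z. - F z) z \<le> c * W (fst z, snd z + \<theta>)"
  proof (rule duh_le_shifted[OF C W0 Wt _ \<theta> c _ _ z])
    show "0 \<le> dalem T' W z" if "z \<in> spacetime T'" for z by (rule pos[OF that])
    show "continuous_on (spacetime T) (\<lambda>z. - F z)" by (rule continuous_on_minus[OF cF])
    show "- F z \<le> c * dalem T' W (fst z, snd z + \<theta>)" if "z \<in> spacetime T" for z
      by (rule order_trans[OF abs_ge_minus_self F[OF that]])
  qed
  ultimately show ?thesis by (simp add: duh_minus abs_le_iff)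
qed

section \<open>Profiles in the variables q and \<tau>, and supersolutions built from them\<close>

text \<open>Truncation at q = 1, not at q = 0, keeps the power of q away from its singularity; with
  n = 3 the function is C^2.\<close>

definition pw :: "nat \<Rightarrow> real \<Rightarrow> real \<Rightarrow> real" where
  "pw n \<gamma> q = (max 0 (q - 1)) ^ n * q powr \<gamma>"

lemma pw_zero: "q \<le> 1 \<Longrightarrow> 0 < n \<Longrightarrow> pw n \<gamma> q = 0"
  by (simp add: pw_def)

lemma pw_deriv:
  "(pw (Suc (Suc n)) \<gamma> has_real_derivative (real (Suc (Suc n)) * pw (Suc n) \<gamma> q + \<gamma> * pw (Suc (Suc n)) (\<gamma> - 1) q)) (at q)"
proof (cases "q < 1")
  case True
  have "\<forall>\<^sub>F y in nhds q. pw (Suc (Suc n)) \<gamma> y = 0"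
    using eventually_nhds_in_open[of "{..<1}" q] True by (auto elim!: eventually_mono simp: pw_zero)
  then have "(pw (Suc (Suc n)) \<gamma> has_real_derivative 0) (at q)"
    by (subst DERIV_cong_ev[OF refl _ refl, where g="\<lambda>_. 0"]) simp_all
  then show ?thesis using True by (simp add: pw_zero)
next
  case False
  then have q: "0 < q" by simp
  have 1: "((\<lambda>q. (max 0 (q - 1)) ^ Suc (Suc n)) has_real_derivative real (Suc (Suc n)) * (max 0 (q - 1)) ^ Suc n * 1) (at q)"
    by (rule DERIV_chain2[OF has_real_derivative_max_power]) (auto intro!: derivative_eq_intros)
  have 2: "((\<lambda>q. q powr \<gamma>) has_real_derivative \<gamma> * q powr (\<gamma> - 1)) (at q)"
    by (rule has_real_derivative_powr[OF q])
  show ?thesis unfolding pw_def[abs_def]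
    by (rule DERIV_cong[OF DERIV_mult[OF 1 2]]) (simp add: algebra_simps)
qed

lemma continuous_on_pw: "continuous_on UNIV (pw (Suc n) \<gamma>)"
proof -
  have "isCont (pw (Suc n) \<gamma>) q" for q
  proof (cases "q < 1")
    case True
    have "\<forall>\<^sub>F y in nhds q. pw (Suc n) \<gamma> y = 0"
      using eventually_nhds_in_open[of "{..<1}" q] True by (auto elim!: eventually_mono simp: pw_zero)
    then show ?thesis by (subst isCont_cong[where g="\<lambda>_. 0"]) simp_all
  next
    case False
    then have "q \<noteq> 0" by simp
    then show ?thesis unfolding pw_def[abs_def] by (intro continuous_intros) auto
  qed
  then show ?thesis by (simp add: continuous_at_imp_continuous_on)
qed

text \<open>\<open>pw1 \<gamma>\<close> and \<open>pw2 \<gamma>\<close> are the first two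
  derivatives of \<open>pw 3 \<gamma>\<close>, expanded by the product rule.\<close>

definition pw1 :: "real \<Rightarrow> real \<Rightarrow> real" where
  "pw1 \<gamma> q = 3 * pw 2 \<gamma> q + \<gamma> * pw 3 (\<gamma> - 1) q"

definition pw2 :: "real \<Rightarrow> real \<Rightarrow> real" where
  "pw2 \<gamma> q = 6 * pw 1 \<gamma> q + 6 * \<gamma> * pw 2 (\<gamma> - 1) q + \<gamma> * (\<gamma> - 1) * pw 3 (\<gamma> - 2) q"

lemma pw3_deriv: "(pw 3 \<gamma> has_real_derivative pw1 \<gamma> q) (at q)"
  using pw_deriv[of 1 \<gamma> q] by (simp add: pw1_def numeral_3_eq_3 numeral_2_eq_2)

lemma pw1_deriv: "(pw1 \<gamma> has_real_derivative pw2 \<gamma> q) (at q)"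
proof -
  have 2: "(pw 2 \<gamma> has_real_derivative (2 * pw 1 \<gamma> q + \<gamma> * pw 2 (\<gamma> - 1) q)) (at q)"
    using pw_deriv[of 0 \<gamma> q] by (simp add: numeral_2_eq_2)
  have 3: "(pw 3 (\<gamma> - 1) has_real_derivative (3 * pw 2 (\<gamma> - 1) q + (\<gamma> - 1) * pw 3 (\<gamma> - 2) q)) (at q)"
    using pw3_deriv[of "\<gamma> - 1" q] by (simp add: pw1_def)
  show ?thesis unfolding pw1_def[abs_def]
    by (rule DERIV_cong[OF DERIV_add[OF DERIV_cmult[OF 2] DERIV_cmult[OF 3]]]) (simp add: pw2_def algebra_simps)
qed

lemma C2_pw: "C_on 2 UNIV (pw 3 \<gamma>)"
  unfolding numeral_2_eq_2
proof (rule C_on_real_SucI[where f'="pw1 \<gamma>"])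
  show "C_on (Suc 0) UNIV (pw1 \<gamma>)"
  proof (rule C_on_real_SucI[where f'="pw2 \<gamma>"])
    show "C_on 0 UNIV (pw2 \<gamma>)"
      unfolding pw2_def[abs_def] C_on.simps
      using continuous_on_pw[of 0] continuous_on_pw[of 1] continuous_on_pw[of 2]
      by (intro continuous_intros) (simp_all add: numeral_3_eq_3 numeral_2_eq_2)
  qed (rule pw1_deriv)
qed (rule pw3_deriv)

definition qq :: "(real^2) \<times> real \<Rightarrow> real" where
  "qq z = (1 + snd z) - (fst z \<bullet> fst z) / (1 + snd z)"

definition prof :: "real \<Rightarrow> real \<Rightarrow> (real^2) \<times> real \<Rightarrow> real" where
  "prof \<gamma> n z = pw 3 \<gamma> (qq z) * (1 + snd z) powr n"

lemma C2_prof: "C_on 2 (spacetime T) (prof \<gamma> n)"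
proof -
  have s: "C_on 2 (spacetime T) (\<lambda>z. 1 + snd z)"
    by (intro C_on_add C_on_const C_on_linear bounded_linear_snd)
  have im: "(\<lambda>z. 1 + snd z) ` spacetime T \<subseteq> {x. 0 < x}" by auto
  have x: "C_on 2 (spacetime T) (\<lambda>z. fst z \<bullet> b)" for b :: "real^2"
    by (rule C_on_linear) (intro bounded_linear_compose[OF bounded_linear_inner_left bounded_linear_fst])
  have "C_on 2 (spacetime T) (\<lambda>z. (1 + snd z) - (\<Sum>b\<in>Basis. (fst z \<bullet> b) * (fst z \<bullet> b)) * inverse (1 + snd z))"
    by (intro C_on_diff s C_on_mult C_on_sum x C_on_compose_real[OF C_on_inverse s im])
  then have q: "C_on 2 (spacetime T) qq"
    by (rule C_on_cong) (simp add: qq_def divide_inverse euclidean_inner[of "fst _" "fst _"])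
  show ?thesis unfolding prof_def[abs_def]
    by (intro C_on_mult C_on_compose_real[OF C2_pw q] C_on_compose_real[OF C_on_powr s im]) simp
qed

text \<open>With r = |x|^2 one has q_t = 1 + r / \<tau>^2 and |\<nabla>q|^2 = 4 r / \<tau>^2, so
  q_t^2 - |\<nabla>q|^2 = (1 - r / \<tau>^2)^2 = (q / \<tau>)^2: the wave operator becomes an Euler
  operator in q, plus one first-order term with coefficient 4 n + 2. That coefficient vanishes
  exactly for n = -1/2, the decay rate of the free wave on the cone.\<close>

lemma prof_wave:
  assumes z: "z \<in> spacetime T"
  shows "dt T (prof \<gamma> n) z = pw1 \<gamma> (qq z) * (1 + (fst z \<bullet> fst z) / (1 + snd z)\<^sup>2) * (1 + snd z) powr n + n * pw 3 \<gamma> (qq z) * (1 + snd z) powr (n - 1)" (is ?A)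
    and "dalem T (prof \<gamma> n) z = (1 + snd z) powr (n - 2) * ((qq z)\<^sup>2 * pw2 \<gamma> (qq z) + (2 - 2 * n) * qq z * pw1 \<gamma> (qq z) + n * (n - 1) * pw 3 \<gamma> (qq z))
      + (4 * n + 2) * (1 + snd z) powr (n - 1) * pw1 \<gamma> (qq z)" (is ?B)
proof -
  define \<rho> where "\<rho> z = 1 + (fst z \<bullet> fst z) / (1 + snd z)\<^sup>2" for z :: "(real^2) \<times> real"
  define G where "G z = (-2 * pw1 \<gamma> (qq z) * (1 + snd z) powr (n - 1)) *\<^sub>R fst z" for z :: "(real^2) \<times> real"
  define Ut where "Ut z = pw1 \<gamma> (qq z) * \<rho> z * (1 + snd z) powr n + n * pw 3 \<gamma> (qq z) * (1 + snd z) powr (n - 1)" for z :: "(real^2) \<times> real"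
  define H where "H b z = (4 * pw2 \<gamma> (qq z) * (1 + snd z) powr (n - 2) * (fst z \<bullet> b)) *\<^sub>R fst z - (2 * pw1 \<gamma> (qq z) * (1 + snd z) powr (n - 1)) *\<^sub>R b" for b and z :: "(real^2) \<times> real"
  define Utt where "Utt z = pw2 \<gamma> (qq z) * (\<rho> z)\<^sup>2 * (1 + snd z) powr n
     + pw1 \<gamma> (qq z) * (2 * n * \<rho> z * (1 + snd z) powr (n - 1) - 2 * (fst z \<bullet> fst z) * (1 + snd z) powr (n - 3))
     + n * (n - 1) * pw 3 \<gamma> (qq z) * (1 + snd z) powr (n - 2)" for z :: "(real^2) \<times> real"
  have pr: "s powr (a - 1) = s powr a / s" "s powr (a - 2) = s powr a / s\<^sup>2" "s powr (a - 3) = s powr a / s ^ 3"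
    if "0 < s" for s a :: real
    using that by (simp_all add: powr_diff powr_numeral)
  have dq: "((\<lambda>y. qq (y, t)) has_derivative (\<lambda>h. - (2 / (1 + t)) * (x \<bullet> h))) (at x)" if "0 \<le> t" for x t
    unfolding qq_def using that by (auto intro!: derivative_eq_intros simp: inner_commute)
  have dfq: "((\<lambda>y. g (qq (y, t))) has_derivative (\<lambda>h. g' (qq (x, t)) * (- (2 / (1 + t)) * (x \<bullet> h)))) (at x)"
    if "0 \<le> t" "\<And>q. (g has_real_derivative g' q) (at q)" for x t g g'
    using has_derivative_compose[OF dq[OF that(1)]  that(2)[unfolded has_field_derivative_def]] .
  have g: "((\<lambda>y. prof \<gamma> n (y, t)) has_derivative (\<lambda>h. G (x, t) \<bullet> h)) (at x)" if t: "0 \<le> t" "t < T" for x t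
    unfolding prof_def snd_conv
    by (rule has_derivative_eq_rhs[OF has_derivative_mult_left[OF dfq[OF t(1) pw3_deriv]]])
      (use t in \<open>simp add: G_def fun_eq_iff pr\<close>)
  have h: "((\<lambda>y. G (y, t) \<bullet> b) has_derivative (\<lambda>h. H b (x, t) \<bullet> h)) (at x)" if "b \<in> Basis" and t: "0 \<le> t" "t < T" for x t b
  proof -
    define s where "s = 1 + t"
    have s: "0 < s" using t by (simp add: s_def)
    have e: "(-2 * (1 + t) powr (n - 1)) * (pw1 \<gamma> (qq (x, t)) * (h \<bullet> b) + pw2 \<gamma> (qq (x, t)) * (- (2 / (1 + t)) * (x \<bullet> h)) * (x \<bullet> b)) = H b (x, t) \<bullet> h" for h
      unfolding H_def fst_conv snd_conv s_def[symmetric] pr[OF s] inner_diff_left inner_scaleR_left inner_commute[of b h]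
      using s by (simp add: field_simps power2_eq_square)
    have "((\<lambda>y. pw1 \<gamma> (qq (y, t)) * (y \<bullet> b)) has_derivative
      (\<lambda>h. pw1 \<gamma> (qq (x, t)) * (h \<bullet> b) + pw2 \<gamma> (qq (x, t)) * (- (2 / (1 + t)) * (x \<bullet> h)) * (x \<bullet> b))) (at x)"
      by (rule has_derivative_mult[OF dfq[OF t(1) pw1_deriv] has_derivative_inner_left[OF has_derivative_ident]])
    from has_derivative_mult_right[OF this, of "-2 * (1 + t) powr (n - 1)"]
    have "((\<lambda>y. (-2 * (1 + t) powr (n - 1)) * (pw1 \<gamma> (qq (y, t)) * (y \<bullet> b))) has_derivative (\<lambda>h. H b (x, t) \<bullet> h)) (at x)"
      unfolding e .
    then show ?thesis by (simp add: G_def mult_ac)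
  qed
  have tq: "((\<lambda>s. qq (x, s)) has_real_derivative \<rho> (x, t)) (at t within S)" if "0 \<le> t" for x t S
    unfolding qq_def \<rho>_def using that by (auto intro!: derivative_eq_intros simp: power2_eq_square)
  have tg: "((\<lambda>s. g (qq (x, s))) has_real_derivative g' (qq (x, t)) * \<rho> (x, t)) (at t within S)"
    if "0 \<le> t" "\<And>q. (g has_real_derivative g' q) (at q)" for x t g g' S
    by (rule DERIV_chain2[OF that(2) tq[OF that(1)]])
  have tp: "((\<lambda>s. (1 + s) powr a) has_real_derivative a * (1 + t) powr (a - 1)) (at t within S)" if "0 \<le> t" for t a S
    using that by (auto intro!: derivative_eq_intros)
  have tr: "((\<lambda>s. \<rho> (x, s)) has_real_derivative - 2 * (x \<bullet> x) / (1 + t) ^ 3) (at t within S)" if "0 \<le> t" for x t S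
  proof -
    define s where "s = 1 + t"
    have s: "0 < s" using that by (simp add: s_def)
    have "((\<lambda>s. \<rho> (x, s)) has_real_derivative - (x \<bullet> x) * (2 * (1 + t)) / ((1 + t)\<^sup>2 * (1 + t)\<^sup>2)) (at t within S)"
      unfolding \<rho>_def fst_conv snd_conv
      by (rule DERIV_cong, (rule derivative_intros)+) (use that in simp_all)
    then show ?thesis
      by (rule DERIV_cong) (unfold s_def[symmetric], use s in \<open>simp add: field_simps power2_eq_square power3_eq_cube\<close>)
  qed
  have ut: "((\<lambda>s. prof \<gamma> n (x, s)) has_vector_derivative Ut (x, t)) (at t within {0..<T})" if t: "0 \<le> t" "t < T" for x t
    unfolding prof_def snd_conv has_real_derivative_iff_has_vector_derivative[symmetric]
    by (rule DERIV_cong[OF DERIV_mult[OF tg[OF t(1) pw3_deriv] tp[OF t(1)]]]) (simp add: Ut_def algebra_simps)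
  have utt: "((\<lambda>s. Ut (x, s)) has_vector_derivative Utt (x, t)) (at t within {0..<T})" if t: "0 \<le> t" "t < T" for x t
  proof -
    define s where "s = 1 + t"
    have s: "0 < s" using t by (simp add: s_def)
    show ?thesis
      unfolding Ut_def snd_conv has_real_derivative_iff_has_vector_derivative[symmetric]
      by (rule DERIV_cong[OF DERIV_add[OF DERIV_mult[OF DERIV_mult[OF tg[OF t(1) pw1_deriv] tr[OF t(1)]] tp[OF t(1)]]
          DERIV_mult[OF DERIV_cmult[OF tg[OF t(1) pw3_deriv]] tp[OF t(1)]]]])
        (unfold Utt_def fst_conv snd_conv s_def[symmetric] diff_diff_eq one_add_one pr[OF s],
          use s in \<open>simp add: field_simps power2_eq_square power3_eq_cube\<close>)
  qed
  note D = dalem_eq[OF g ut h utt z]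
  show ?A using D(1) by (simp add: Ut_def \<rho>_def)
  define s where "s = 1 + snd z"
  have s: "0 < s" using z by (simp add: s_def)
  define r where "r = fst z \<bullet> fst z"
  have qs: "qq z = s - r / s" by (simp add: qq_def s_def r_def)
  have sumH: "(\<Sum>b\<in>Basis. H b z \<bullet> b) = 4 * pw2 \<gamma> (qq z) * s powr (n - 2) * r - 4 * pw1 \<gamma> (qq z) * s powr (n - 1)"
  proof -
    have "(\<Sum>b\<in>Basis. H b z \<bullet> b) = (\<Sum>b\<in>Basis. (4 * pw2 \<gamma> (qq z) * s powr (n - 2)) * ((fst z \<bullet> b) * (fst z \<bullet> b)) - (2 * pw1 \<gamma> (qq z) * s powr (n - 1)) * (b \<bullet> b))"
      by (simp add: H_def s_def inner_diff_left mult_ac)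
    also have "\<dots> = (4 * pw2 \<gamma> (qq z) * s powr (n - 2)) * (\<Sum>b\<in>Basis. (fst z \<bullet> b) * (fst z \<bullet> b)) - (2 * pw1 \<gamma> (qq z) * s powr (n - 1)) * (\<Sum>b\<in>(Basis::(real^2) set). b \<bullet> b)"
      by (simp only: sum_subtractf sum_distrib_left)
    also have "(\<Sum>b\<in>Basis. (fst z \<bullet> b) * (fst z \<bullet> b)) = r" unfolding r_def by (rule euclidean_inner[symmetric])
    also have "(\<Sum>b\<in>(Basis::(real^2) set). b \<bullet> b) = 2" by (simp add: inner_Basis)
    finally show ?thesis by simp
  qed
  have "dalem T (prof \<gamma> n) z = Utt z - (4 * pw2 \<gamma> (qq z) * s powr (n - 2) * r - 4 * pw1 \<gamma> (qq z) * s powr (n - 1))"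
    using D(2) sumH by simp
  also have "\<dots> = s powr (n - 2) * ((qq z)\<^sup>2 * pw2 \<gamma> (qq z) + (2 - 2 * n) * qq z * pw1 \<gamma> (qq z) + n * (n - 1) * pw 3 \<gamma> (qq z))
      + (4 * n + 2) * s powr (n - 1) * pw1 \<gamma> (qq z)"
  proof -
    define P where "P = pw 3 \<gamma> (qq z)"
    define P1 where "P1 = pw1 \<gamma> (qq z)"
    define P2 where "P2 = pw2 \<gamma> (qq z)"
    define Q where "Q = s powr n"
    have e: "Utt z = P2 * (1 + r / s\<^sup>2)\<^sup>2 * Q + P1 * (2 * n * (1 + r / s\<^sup>2) * (Q / s) - 2 * r * (Q / s ^ 3)) + n * (n - 1) * P * (Q / s\<^sup>2)"
      unfolding Utt_def \<rho>_def P_def P1_def P2_def Q_def s_def[symmetric] r_def[symmetric] pr[OF s] ..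
    show ?thesis
      unfolding e P_def[symmetric] P1_def[symmetric] P2_def[symmetric] pr[OF s] Q_def[symmetric] unfolding qs
      using s by (simp add: field_simps power2_eq_square power3_eq_cube)
  qed
  finally show ?B by (simp add: s_def)
qed

lemma pw1_zero: "q \<le> 1 \<Longrightarrow> pw1 \<gamma> q = 0" and pw2_zero: "q \<le> 1 \<Longrightarrow> pw2 \<gamma> q = 0"
  by (simp_all add: pw1_def pw2_def pw_zero)

text \<open>The indicial polynomial m (m - 1) + 3 m + 3/4 factors as (m + 1/2) (m + 3/2), and the
  profile grows like \<open>q powr (\<beta> - 1/2)\<close>. At \<beta> = 0 this is an exact
  homogeneous exponent, so the cubic terms cancel and only \<open>6 * (q - 1)\<close> survives; in
  general the leading coefficient is \<beta> (\<beta> + 1).\<close>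

lemma profile_half:
  assumes "1 < q"
  shows "q\<^sup>2 * pw2 (\<beta> - 7/2) q + 3 * q * pw1 (\<beta> - 7/2) q + 3/4 * pw 3 (\<beta> - 7/2) q
    = q powr (\<beta> - 7/2) * (6 * (q - 1) + \<beta> * (6 * (q - 1)\<^sup>2 * q - 5 * (q - 1) ^ 3) + \<beta>\<^sup>2 * (q - 1) ^ 3)"
proof -
  define E where "E = q powr (\<beta> - 7/2)"
  have p: "q powr (\<beta> - 7/2 - 1) = E / q" "q powr (\<beta> - 7/2 - 2) = E / q\<^sup>2"
    unfolding E_def using assms by (simp_all only: powr_diff powr_one powr_numeral)
  define m where "m = q - 1"
  have q: "q = m + 1" "0 < m + 1" and mx: "max 0 (q - 1) = m" using assms by (auto simp: m_def)
  have "q\<^sup>2 * pw2 (\<beta> - 7/2) q + 3 * q * pw1 (\<beta> - 7/2) q + 3/4 * pw 3 (\<beta> - 7/2) q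
    = E * (6 * m * q\<^sup>2 + 6 * (\<beta> - 7/2) * m\<^sup>2 * q + (\<beta> - 7/2) * (\<beta> - 9/2) * m ^ 3
      + 3 * (3 * m\<^sup>2 * q + (\<beta> - 7/2) * m ^ 3) + 3/4 * m ^ 3)"
    unfolding pw2_def pw1_def pw_def mx p E_def[symmetric] using assms by (simp add: field_simps power2_eq_square)
  also have "6 * m * q\<^sup>2 + 6 * (\<beta> - 7/2) * m\<^sup>2 * q + (\<beta> - 7/2) * (\<beta> - 9/2) * m ^ 3
      + 3 * (3 * m\<^sup>2 * q + (\<beta> - 7/2) * m ^ 3) + 3/4 * m ^ 3
    = 6 * m + \<beta> * (6 * m\<^sup>2 * q - 5 * m ^ 3) + \<beta>\<^sup>2 * m ^ 3"
    unfolding q(1) by (simp add: algebra_simps power2_eq_square power3_eq_cube)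
  finally show ?thesis by (simp add: E_def m_def)
qed

text \<open>Here the indicial polynomial is (m + 1) (m + 2) and the growth is
  \<open>q powr \<beta>\<close>, so the leading coefficient is (\<beta> + 1) (\<beta> + 2). The
  second identity displays the positivity of the first-order term for positive \<beta>.\<close>

lemma profile_one:
  assumes "1 < q"
  shows "q\<^sup>2 * pw2 (\<beta> - 3) q + 4 * q * pw1 (\<beta> - 3) q + 2 * pw 3 (\<beta> - 3) q
    = q powr (\<beta> - 3) * (6 * (q - 1) * q + 2 * (q - 1) ^ 3 + \<beta> * (6 * (q - 1)\<^sup>2 * q - 3 * (q - 1) ^ 3) + \<beta>\<^sup>2 * (q - 1) ^ 3)"
    (is ?A)
    and "pw1 (\<beta> - 3) q = q powr (\<beta> - 4) * (q - 1)\<^sup>2 * (3 + \<beta> * (q - 1))" (is ?B)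
proof -
  define E where "E = q powr (\<beta> - 3)"
  have p: "q powr (\<beta> - 3 - 1) = E / q" "q powr (\<beta> - 3 - 2) = E / q\<^sup>2"
    unfolding E_def using assms by (simp_all only: powr_diff powr_one powr_numeral)
  have p3: "q powr (\<beta> - 4) = E / q"
    unfolding E_def using assms powr_diff[of q "\<beta> - 3" 1] by simp
  define m where "m = q - 1"
  have q: "q = m + 1" "0 < m + 1" and mx: "max 0 (q - 1) = m" using assms by (auto simp: m_def)
  have "q\<^sup>2 * pw2 (\<beta> - 3) q + 4 * q * pw1 (\<beta> - 3) q + 2 * pw 3 (\<beta> - 3) q
    = E * (6 * m * q\<^sup>2 + 6 * (\<beta> - 3) * m\<^sup>2 * q + (\<beta> - 3) * (\<beta> - 4) * m ^ 3
      + 4 * (3 * m\<^sup>2 * q + (\<beta> - 3) * m ^ 3) + 2 * m ^ 3)"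
    unfolding pw2_def pw1_def pw_def mx p E_def[symmetric] using assms by (simp add: field_simps power2_eq_square)
  also have "6 * m * q\<^sup>2 + 6 * (\<beta> - 3) * m\<^sup>2 * q + (\<beta> - 3) * (\<beta> - 4) * m ^ 3
      + 4 * (3 * m\<^sup>2 * q + (\<beta> - 3) * m ^ 3) + 2 * m ^ 3
    = 6 * m * q + 2 * m ^ 3 + \<beta> * (6 * m\<^sup>2 * q - 3 * m ^ 3) + \<beta>\<^sup>2 * m ^ 3"
    unfolding q(1) by (simp add: algebra_simps power2_eq_square power3_eq_cube)
  finally show ?A by (simp add: E_def m_def)
  have "pw1 (\<beta> - 3) q = E / q * m\<^sup>2 * (3 * q + (\<beta> - 3) * m)"
    unfolding pw1_def pw_def mx p E_def[symmetric] using assms by (simp add: field_simps power2_eq_square power3_eq_cube)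
  also have "3 * q + (\<beta> - 3) * m = 3 + \<beta> * m" unfolding q(1) by (simp add: algebra_simps)
  finally show ?B by (simp add: p3 m_def)
qed

lemma qq_le: "z \<in> spacetime T \<Longrightarrow> qq z \<le> 1 + snd z"
  by (simp add: qq_def)

lemma prof_init: "prof \<gamma> n (x, 0) = 0" and dt_prof_init: "0 < T \<Longrightarrow> dt T (prof \<gamma> n) (x, 0) = 0"
proof -
  have "qq (x, 0) \<le> 1" by (simp add: qq_def)
  then show "prof \<gamma> n (x, 0) = 0" "0 < T \<Longrightarrow> dt T (prof \<gamma> n) (x, 0) = 0"
    by (simp_all add: prof_def prof_wave(1) pw_zero pw1_zero)
qed

text \<open>
  In the variables \<open>\<tau> = 1 + t\<close> and \<open>q = \<tau> - |x|\<^sup>2 / \<tau>\<close> the function \<open>q powr (-1/2) * \<tau> powr (-1/2)\<close>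
  is an exact solution of the free wave equation.  The factor \<open>((q - 1) / q)\<^sup>3\<close> removes its singularity
  on the cone, and the resulting supersolutions vanish for \<open>q \<le> 1\<close>, in particular at \<open>t = 0\<close>.
\<close>

definition sup0 :: "(real^2) \<times> real \<Rightarrow> real" where
  "sup0 = prof (-7/2) (-1/2)"

text \<open>The useful source is the first-order term of the subtracted profile with n = -1, whose
  coefficient 4 n + 2 = -2 becomes positive. The first profile absorbs its second-order terms, and
  (\<beta> + 2) / \<beta> is the quotient of the two leading coefficients (\<beta> + 1) (\<beta> +
  2) and \<beta> (\<beta> + 1).\<close>

definition sup1 :: "real \<Rightarrow> (real^2) \<times> real \<Rightarrow> real" where
  "sup1 \<beta> z = (\<beta> + 2) / \<beta> * prof (\<beta> - 7/2) (-1/2) z + (-1) * prof (\<beta> - 3) (-1) z"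

lemma C2_sup: "C_on 2 (spacetime T) sup0" "C_on 2 (spacetime T) (sup1 \<beta>)"
  unfolding sup0_def sup1_def[abs_def]
  by (rule C2_prof, rule C_on_add[OF C_on_cmult[OF C2_prof] C_on_cmult[OF C2_prof]])

lemma sup_init: "sup0 (x, 0) = 0" "sup1 \<beta> (x, 0) = 0" "0 < T \<Longrightarrow> dt T sup0 (x, 0) = 0" "0 < T \<Longrightarrow> dt T (sup1 \<beta>) (x, 0) = 0"
proof -
  show "sup0 (x, 0) = 0" "sup1 \<beta> (x, 0) = 0" by (simp_all add: sup0_def sup1_def prof_init)
  assume T: "0 < T"
  then show "dt T sup0 (x, 0) = 0" by (simp add: sup0_def dt_prof_init)
  show "dt T (sup1 \<beta>) (x, 0) = 0"
    unfolding sup1_def[abs_def] using T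
    by (subst dalem_lincomb(2)[OF C2_prof C2_prof]) (simp_all add: dt_prof_init)
qed

text \<open>The lower bound is only compared with sources supported in t \<le> 1, so it can be
  crude: q \<le> \<tau> turns the powers -5/2 of \<tau> and -7/2 of q into
  \<open>1 / \<tau> ^ 6\<close>, and q \<ge> 2 gives q - 1 \<ge> 1.\<close>

lemma dalem_sup0:
  assumes z: "z \<in> spacetime T"
  shows "0 \<le> dalem T sup0 z" and "2 \<le> qq z \<Longrightarrow> 6 / (1 + snd z) ^ 6 \<le> dalem T sup0 z"
proof -
  define s where "s = 1 + snd z"
  have s: "1 \<le> s" using z by (simp add: s_def)
  have qs: "qq z \<le> s" using qq_le[OF z] by (simp add: s_def)
  have n: "(-1/2::real) - 2 = -5/2" "2 - 2 * (-1/2::real) = 3" "(-1/2::real) * (-1/2 - 1) = 3/4" "4 * (-1/2::real) + 2 = 0"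
    by simp_all
  have e: "dalem T sup0 z = s powr (-5/2) * ((qq z)\<^sup>2 * pw2 (-7/2) (qq z) + 3 * qq z * pw1 (-7/2) (qq z) + 3/4 * pw 3 (-7/2) (qq z))"
    unfolding sup0_def prof_wave(2)[OF z] n s_def[symmetric] by simp
  have e1: "dalem T sup0 z = s powr (-5/2) * ((qq z) powr (-7/2) * (6 * (qq z - 1)))" if "1 < qq z"
    unfolding e using profile_half[OF that, of 0] by simp
  show "0 \<le> dalem T sup0 z"
  proof (cases "1 < qq z")
    case True
    then show ?thesis by (simp add: e1)
  next
    case False
    then show ?thesis unfolding e by (simp add: pw_zero pw1_zero pw2_zero)
  qed
  show "6 / (1 + snd z) ^ 6 \<le> dalem T sup0 z" if q: "2 \<le> qq z"
  proof -
    have s0: "0 < s" using s by simp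
    have "s powr (-5/2) * s powr (-7/2) = s powr (- 6)" by (simp flip: powr_add)
    also have "\<dots> = 1 / s ^ 6" by (simp only: powr_minus_divide powr_numeral[OF less_imp_le[OF s0]])
    finally have "6 / s ^ 6 = s powr (-5/2) * s powr (-7/2) * 6" by simp
    also have "\<dots> = s powr (-5/2) * (s powr (-7/2) * 6)" by (rule mult.assoc)
    also have "\<dots> \<le> s powr (-5/2) * ((qq z) powr (-7/2) * (6 * (qq z - 1)))"
      using q qs s by (intro mult_left_mono mult_mono powr_mono2') auto
    also have "\<dots> = dalem T sup0 z" using e1 q by simp
    finally show ?thesis by (simp add: s_def)
  qed
qed

text \<open>The second-order terms of the two profiles combine to a nonnegative remainder, which
  leaves at least the first-order source of the second profile. For q \<ge> 2 the estimate q - 1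
  \<ge> q / 2, cubed and doubled, gives the factor \<beta> / 4.\<close>

lemma dalem_sup1:
  assumes z: "z \<in> spacetime T" and \<beta>: "0 < \<beta>"
  shows "0 \<le> dalem T (sup1 \<beta>) z"
    and "2 \<le> qq z \<Longrightarrow> \<beta> / 4 * qq z powr (\<beta> - 1) / (1 + snd z)\<^sup>2 \<le> dalem T (sup1 \<beta>) z"
proof -
  define s where "s = 1 + snd z"
  define q where "q = qq z"
  have s: "1 \<le> s" using z by (simp add: s_def)
  have qs: "q \<le> s" using qq_le[OF z] by (simp add: s_def q_def)
  have n: "(-1/2::real) - 2 = -5/2" "2 - 2 * (-1/2::real) = 3" "(-1/2::real) * (-1/2 - 1) = 3/4" "4 * (-1/2::real) + 2 = 0"
    "(-1::real) - 2 = -3" "2 - 2 * (-1::real) = 4" "(-1::real) * (-1 - 1) = 2" "4 * (-1::real) + 2 = -2" "(-1::real) - 1 = -2"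
    by simp_all
  have e: "dalem T (sup1 \<beta>) z = (\<beta> + 2) / \<beta> * (s powr (-5/2) * (q\<^sup>2 * pw2 (\<beta> - 7/2) q + 3 * q * pw1 (\<beta> - 7/2) q + 3/4 * pw 3 (\<beta> - 7/2) q))
    - s powr (-3) * (q\<^sup>2 * pw2 (\<beta> - 3) q + 4 * q * pw1 (\<beta> - 3) q + 2 * pw 3 (\<beta> - 3) q) + 2 * s powr (-2) * pw1 (\<beta> - 3) q"
    unfolding sup1_def[abs_def] dalem_lincomb(1)[OF C2_prof C2_prof z] prof_wave(2)[OF z] n s_def[symmetric] q_def[symmetric] by simp
  have main: "2 * s powr (-2) * pw1 (\<beta> - 3) q \<le> dalem T (sup1 \<beta>) z" if q1: "1 < q"
  proof -
    define m where "m = q - 1"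
    have m: "0 < m" "q = m + 1" using q1 by (simp_all add: m_def)
    define LA where "LA = 6 * m + \<beta> * (6 * m\<^sup>2 * q - 5 * m ^ 3) + \<beta>\<^sup>2 * m ^ 3"
    define LB where "LB = 6 * m * q + 2 * m ^ 3 + \<beta> * (6 * m\<^sup>2 * q - 3 * m ^ 3) + \<beta>\<^sup>2 * m ^ 3"
    have LA: "LA = 6 * m + \<beta> * (m ^ 3 + 6 * m\<^sup>2) + \<beta>\<^sup>2 * m ^ 3"
      unfolding LA_def m(2) by (simp add: algebra_simps power2_eq_square power3_eq_cube)
    have LA0: "0 \<le> LA" unfolding LA using m \<beta> by simp
    \<comment> \<open>All cubic terms cancel by the choice of the coefficient in
      \<open>sup1\<close>.\<close>
    have "(\<beta> + 2) / \<beta> * LA - LB = 12 * m / \<beta> + 6 * m\<^sup>2"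
      unfolding LA LB_def m(2) using \<beta> by (simp add: field_simps power2_eq_square power3_eq_cube)
    moreover have "0 \<le> 12 * m / \<beta> + 6 * m\<^sup>2" using m \<beta> by simp
    ultimately have LAB: "LB \<le> (\<beta> + 2) / \<beta> * LA" by linarith
    \<comment> \<open>The two profiles carry different powers of \<tau> and q; q \<le> \<tau> trades
      half a power to make them comparable.\<close>
    have "s powr (-3) * q powr (\<beta> - 3) = s powr (-5/2) * (s powr (-1/2) * q powr (\<beta> - 3))"
      using s powr_add[of s "-5/2" "-1/2"] by simp
    also have "\<dots> \<le> s powr (-5/2) * (q powr (-1/2) * q powr (\<beta> - 3))"
      using q1 qs by (intro mult_left_mono mult_right_mono powr_mono2') auto
    also have "\<dots> = s powr (-5/2) * q powr (\<beta> - 7/2)"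
      using q1 powr_add[of q "-1/2" "\<beta> - 3"] by simp
    finally have sq: "s powr (-3) * q powr (\<beta> - 3) \<le> s powr (-5/2) * q powr (\<beta> - 7/2)" .
    have "s powr (-3) * (q powr (\<beta> - 3) * LB) \<le> s powr (-3) * q powr (\<beta> - 3) * ((\<beta> + 2) / \<beta> * LA)"
      using mult_left_mono[OF LAB, of "s powr (-3) * q powr (\<beta> - 3)"] by (simp only: mult.assoc) simp
    also have "\<dots> \<le> s powr (-5/2) * q powr (\<beta> - 7/2) * ((\<beta> + 2) / \<beta> * LA)"
      using sq LA0 \<beta> by (intro mult_right_mono) auto
    finally have "s powr (-3) * (q powr (\<beta> - 3) * LB) \<le> (\<beta> + 2) / \<beta> * (s powr (-5/2) * (q powr (\<beta> - 7/2) * LA))"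
      by (simp add: mult_ac)
    then show ?thesis
      unfolding e profile_half[OF q1] profile_one(1)[OF q1] LA_def LB_def m_def by linarith
  qed
  have nn: "0 \<le> 2 * s powr (-2) * pw1 (\<beta> - 3) q" if "1 < q"
    unfolding profile_one(2)[OF that] using that \<beta> by simp
  show "0 \<le> dalem T (sup1 \<beta>) z"
  proof (cases "1 < q")
    case True
    then show ?thesis using main nn by (meson order_trans)
  next
    case False
    then show ?thesis unfolding e by (simp add: pw_zero pw1_zero pw2_zero)
  qed
  show "\<beta> / 4 * qq z powr (\<beta> - 1) / (1 + snd z)\<^sup>2 \<le> dalem T (sup1 \<beta>) z" if "2 \<le> qq z"
  proof -
    have q2: "2 \<le> q" using that by (simp add: q_def)
    have E: "q powr (\<beta> - 1) = q powr (\<beta> - 4) * q ^ 3"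
      using q2 powr_add[of q "\<beta> - 4" 3] by (simp add: powr_numeral)
    have "(q / 2) ^ 3 \<le> (q - 1) ^ 3" using q2 by (intro power_mono) auto
    then have "\<beta> * (q / 2) ^ 3 \<le> \<beta> * (q - 1) ^ 3" using \<beta> by simp
    also have "\<dots> \<le> (q - 1)\<^sup>2 * (3 + \<beta> * (q - 1))"
    proof -
      have "(q - 1)\<^sup>2 * (3 + \<beta> * (q - 1)) = \<beta> * (q - 1) ^ 3 + 3 * (q - 1)\<^sup>2"
        by (simp add: algebra_simps power2_eq_square power3_eq_cube)
      then show ?thesis by simp
    qed
    finally have b: "\<beta> * (q / 2) ^ 3 \<le> (q - 1)\<^sup>2 * (3 + \<beta> * (q - 1))" .
    have "\<beta> / 4 * q powr (\<beta> - 1) / s\<^sup>2 = 2 * s powr (-2) * (q powr (\<beta> - 4) * (\<beta> * (q / 2) ^ 3))"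
    proof -
      have s0: "0 \<le> s" using s by simp
      have "s powr (- 2) = 1 / s\<^sup>2" by (simp only: powr_minus_divide powr_numeral[OF s0])
      then show ?thesis unfolding E by (simp add: power_divide)
    qed
    also have "\<dots> \<le> 2 * s powr (-2) * (q powr (\<beta> - 4) * ((q - 1)\<^sup>2 * (3 + \<beta> * (q - 1))))"
      using b by (intro mult_left_mono) auto
    also have "\<dots> = 2 * s powr (-2) * pw1 (\<beta> - 3) q"
      using profile_one(2)[of q \<beta>] q2 by (simp add: mult.assoc)
    also have "\<dots> \<le> dalem T (sup1 \<beta>) z" using main q2 by simp
    finally show ?thesis by (simp add: s_def q_def)
  qed
qed

lemma prof_half_le:
  assumes z: "z \<in> spacetime T" and q: "0 < qq z"
  shows "prof (\<beta> - 7/2) (-1/2) z \<le> qq z powr \<beta> / sqrt (qq z * (1 + snd z))"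
proof -
  have s: "0 < 1 + snd z" using z by simp
  have "max 0 (qq z - 1) ^ 3 \<le> qq z ^ 3" using q by (intro power_mono) auto
  then have "prof (\<beta> - 7/2) (-1/2) z \<le> qq z ^ 3 * qq z powr (\<beta> - 7/2) * (1 + snd z) powr (-1/2)"
    unfolding prof_def pw_def by (intro mult_right_mono) auto
  also have "qq z ^ 3 * qq z powr (\<beta> - 7/2) = qq z powr \<beta> * qq z powr (-1/2)"
    using q powr_add[of "qq z" 3 "\<beta> - 7/2"] powr_add[of "qq z" \<beta> "-1/2"] by (simp add: powr_numeral)
  also have "qq z powr \<beta> * qq z powr (-1/2) * (1 + snd z) powr (-1/2) = qq z powr \<beta> / sqrt (qq z * (1 + snd z))"
    by (simp only: powr_minus_half[OF q] powr_minus_half[OF s] real_sqrt_mult) simp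
  finally show ?thesis .
qed

section \<open>Weighted bounds on the forward cone\<close>

text \<open>Estimates with this weight are made on \<open>cone k\<close>, where the radicand is q
  \<tau> and at least 6.\<close>

definition wt :: "real \<Rightarrow> (real^2) \<times> real \<Rightarrow> real" where
  "wt k z = 1 / sqrt ((snd z + (k + 2))\<^sup>2 - fst z \<bullet> fst z)"

text \<open>The shift by k + 1 turns the variable 1 + t of the profiles into t + k + 2.\<close>

definition shift :: "real \<Rightarrow> (real^2) \<times> real \<Rightarrow> (real^2) \<times> real" where
  "shift k z = (fst z, snd z + (k + 1))"

definition cone :: "real \<Rightarrow> ((real^2) \<times> real) set" where
  "cone k = {z. 0 \<le> snd z \<and> norm (fst z) \<le> snd z + k}"

text \<open>On the cone |x| \<le> \<tau> - 2, hence q \<ge> \<tau> - (\<tau> - 2)^2 / \<tau> = 4 - 4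
  / \<tau> \<ge> 2. The extra 2 in \<tau> thus places the whole cone in the region where the lower
  bounds for the supersolutions hold.\<close>

lemma cone_qq:
  assumes k: "1 \<le> k" and z: "z \<in> cone k"
  shows "2 \<le> qq (shift k z)" "qq (shift k z) \<le> snd z + (k + 2)"
    "qq (shift k z) * (1 + snd (shift k z)) = (snd z + (k + 2))\<^sup>2 - fst z \<bullet> fst z"
proof -
  define s where "s = snd z + (k + 2)"
  have s: "2 \<le> s" using k z by (simp add: s_def cone_def)
  have e: "1 + (snd z + (k + 1)) = s" by (simp add: s_def)
  have q: "qq (shift k z) = s - fst z \<bullet> fst z / s" by (simp add: qq_def shift_def e)
  have "norm (fst z) \<le> s - 2" using z by (simp add: cone_def s_def)
  then have "(norm (fst z))\<^sup>2 \<le> (s - 2)\<^sup>2" by (intro power_mono) auto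
  then have r: "fst z \<bullet> fst z \<le> (s - 2)\<^sup>2" by (simp add: power2_norm_eq_inner)
  have "fst z \<bullet> fst z / s \<le> (s - 2)\<^sup>2 / s" using r s by (intro divide_right_mono) auto
  also have "\<dots> \<le> s - 2" using s by (simp add: field_simps power2_eq_square)
  finally show "2 \<le> qq (shift k z)" unfolding q by simp
  show "qq (shift k z) \<le> snd z + (k + 2)" unfolding q using s by (simp add: s_def[symmetric])
  show "qq (shift k z) * (1 + snd (shift k z)) = (snd z + (k + 2))\<^sup>2 - fst z \<bullet> fst z"
  proof -
    have "1 + snd (shift k z) = s" by (simp add: shift_def s_def)
    then show ?thesis unfolding q s_def[symmetric] using s by (simp add: field_simps power2_eq_square)
  qed
qed

lemma sup_le_wt:
  assumes k: "1 \<le> k" and z: "z \<in> cone k"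
  shows "sup0 (shift k z) \<le> wt k z"
    and "0 < \<beta> \<Longrightarrow> sup1 \<beta> (shift k z) \<le> (\<beta> + 2) / \<beta> * (qq (shift k z) powr \<beta> * wt k z)"
proof -
  have sz: "shift k z \<in> spacetime (snd z + k + 2)" using k z by (simp add: shift_def cone_def)
  note q = cone_qq[OF k z]
  have q0: "0 < qq (shift k z)" using q(1) by simp
  have p: "prof (\<beta> - 7/2) (-1/2) (shift k z) \<le> qq (shift k z) powr \<beta> * wt k z" for \<beta>
    using prof_half_le[OF sz q0, of \<beta>] unfolding q(3) wt_def by simp
  show "sup0 (shift k z) \<le> wt k z" using p[of 0] q0 by (simp add: sup0_def)
  assume \<beta>: "0 < \<beta>"
  have "0 \<le> prof (\<beta> - 3) (-1) (shift k z)" by (simp add: prof_def pw_def)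
  then show "sup1 \<beta> (shift k z) \<le> (\<beta> + 2) / \<beta> * (qq (shift k z) powr \<beta> * wt k z)"
    unfolding sup1_def using mult_left_mono[OF p[of \<beta>], of "(\<beta> + 2) / \<beta>"] \<beta> by simp
qed

text \<open>Comparison with a multiple of \<open>sup1 \<beta>\<close> shifted by k + 1. The factor 4
  / \<beta> inverts the lower bound of \<open>dalem_sup1\<close>, and (\<beta> + 2) / \<beta> is the
  amplitude of the dominant profile: for small \<beta> the total loss is of order 1 /
  \<beta>^2.\<close>

lemma duh_weighted:
  assumes k: "1 \<le> k" and \<beta>: "0 < \<beta>" and M: "0 \<le> M" and cF: "continuous_on (spacetime T) F"
    and out: "\<And>z. z \<in> spacetime T \<Longrightarrow> z \<notin> cone k \<Longrightarrow> F z = 0"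
    and F: "\<And>z. z \<in> spacetime T \<Longrightarrow> z \<in> cone k \<Longrightarrow> \<bar>F z\<bar> \<le> M * (qq (shift k z) powr (\<beta> - 1) / (snd z + (k + 2))\<^sup>2)"
    and z: "z \<in> spacetime T" "z \<in> cone k"
  shows "\<bar>duh F z\<bar> \<le> 4 * M / \<beta> * ((\<beta> + 2) / \<beta> * (qq (shift k z) powr \<beta> * wt k z))"
proof -
  have T: "0 < T" using z by simp
  have "\<bar>duh F z\<bar> \<le> 4 * M / \<beta> * sup1 \<beta> (fst z, snd z + (k + 1))"
  proof (rule duh_abs_le_shifted[where T'="T + (k + 1)", OF C2_sup(2) sup_init(2) sup_init(4) _ _ _ _ cF _ z(1)])
    show "0 \<le> dalem (T + (k + 1)) (sup1 \<beta>) z" if "z \<in> spacetime (T + (k + 1))" for z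
      by (rule dalem_sup1(1)[OF that \<beta>])
    fix z assume z: "z \<in> spacetime T"
    have sz: "shift k z \<in> spacetime (T + (k + 1))" using z k by (simp add: shift_def)
    show "\<bar>F z\<bar> \<le> 4 * M / \<beta> * dalem (T + (k + 1)) (sup1 \<beta>) (fst z, snd z + (k + 1))"
    proof (cases "z \<in> cone k")
      case True
      have "\<bar>F z\<bar> \<le> 4 * M / \<beta> * (\<beta> / 4 * qq (shift k z) powr (\<beta> - 1) / (1 + snd (shift k z))\<^sup>2)"
        using F[OF z True] \<beta> by (simp add: shift_def add.commute add.left_commute)
      also have "\<dots> \<le> 4 * M / \<beta> * dalem (T + (k + 1)) (sup1 \<beta>) (shift k z)"
        using M \<beta> by (intro mult_left_mono dalem_sup1(2)[OF sz \<beta>] cone_qq(1)[OF k True]) auto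
      finally show ?thesis by (simp add: shift_def)
    next
      case False
      then show ?thesis using out[OF z False] M \<beta> dalem_sup1(1)[OF sz \<beta>] by (simp add: shift_def)
    qed
  qed (use T k M \<beta> in auto)
  also have "\<dots> \<le> 4 * M / \<beta> * ((\<beta> + 2) / \<beta> * (qq (shift k z) powr \<beta> * wt k z))"
    using sup_le_wt(2)[OF k z(2) \<beta>] M \<beta> by (intro mult_left_mono) (auto simp: shift_def)
  finally show ?thesis .
qed

section \<open>Decay of the free wave\<close>

text \<open>The inner cube joins the constant 1 at t = 1 in class C^2; the outer cube makes value
  and first two derivatives vanish at t = 0, where the inner expression behaves like 3 t.\<close>

definition cut :: "real \<Rightarrow> real" where
  "cut t = (1 - (max 0 (1 - t)) ^ 3) ^ 3"

definition cut1 :: "real \<Rightarrow> real" where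
  "cut1 t = 9 * (1 - (max 0 (1 - t)) ^ 3)\<^sup>2 * (max 0 (1 - t))\<^sup>2"

definition cut2 :: "real \<Rightarrow> real" where
  "cut2 t = 54 * (1 - (max 0 (1 - t)) ^ 3) * (max 0 (1 - t)) ^ 4 - 18 * (1 - (max 0 (1 - t)) ^ 3)\<^sup>2 * max 0 (1 - t)"

lemma cut_deriv: "(cut has_real_derivative cut1 t) (at t within S)" "(cut1 has_real_derivative cut2 t) (at t within S)"
proof -
  have m: "((\<lambda>t. max 0 (1 - t) ^ Suc (Suc n)) has_real_derivative real (Suc (Suc n)) * max 0 (1 - t) ^ Suc n * (-1)) (at t within S)" for n
    by (rule DERIV_chain2[OF has_real_derivative_max_power]) (auto intro!: derivative_eq_intros)
  have m3: "((\<lambda>t. max 0 (1 - t) ^ 3) has_real_derivative - 3 * (max 0 (1 - t))\<^sup>2) (at t within S)"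
    using m[of 1] by (simp add: numeral_3_eq_3 numeral_2_eq_2)
  have m2: "((\<lambda>t. (max 0 (1 - t))\<^sup>2) has_real_derivative - 2 * max 0 (1 - t)) (at t within S)"
    using m[of 0] by (simp add: numeral_2_eq_2)
  show "(cut has_real_derivative cut1 t) (at t within S)"
    unfolding cut_def[abs_def] cut1_def
    by (rule DERIV_cong[OF DERIV_power[OF DERIV_diff[OF DERIV_const m3], where n=3]]) simp
  show "(cut1 has_real_derivative cut2 t) (at t within S)"
    unfolding cut1_def[abs_def] cut2_def
    by (rule DERIV_cong[OF DERIV_mult[OF DERIV_cmult[OF DERIV_power[OF DERIV_diff[OF DERIV_const m3], where n=2]] m2]])
      (simp add: algebra_simps power2_eq_square power4_eq_xxxx)
qed

lemma C2_cut: "C_on 2 UNIV cut"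
  unfolding numeral_2_eq_2
proof (rule C_on_real_SucI[OF cut_deriv(1)])
  show "C_on (Suc 0) UNIV cut1"
  proof (rule C_on_real_SucI[OF cut_deriv(2)])
    show "C_on 0 UNIV cut2" unfolding C_on.simps cut2_def[abs_def] by (intro continuous_intros)
  qed
qed

context free_wave
begin

text \<open>
  \<open>cut t * UL\<close> has zero data, its image under the wave operator is supported in \<open>t \<le> 1\<close>, and it equals \<open>UL\<close> for \<open>t \<ge> 1\<close>.
\<close>

lemma UL_decay: "\<exists>A>0. \<forall>z\<in>cone k. \<bar>UL z\<bar> \<le> A * wt k z"
proof -
  define u where "u z = cut (snd z) * UL z" for z :: "(real^2) \<times> real"
  \<comment> \<open>The commutator of the wave operator with the cutoff; the remaining term is the
    cutoff times the wave operator of \<open>UL\<close>, which is zero.\<close>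
  define S where "S z = cut2 (snd z) * UL z + 2 * cut1 (snd z) * ULt z" for z :: "(real^2) \<times> real"
  have C2u: "C_on 2 (spacetime T) u" for T
    unfolding u_def[abs_def]
    by (rule C_on_mult[OF C_on_compose_real[OF C2_cut C_on_linear[OF bounded_linear_snd] subset_UNIV] C_on_subset[OF C2_UL subset_UNIV]])
  have cUL: "continuous_on UNIV UL" by (rule C_on_imp_continuous_on[OF C2_UL])
  have cULt: "continuous_on UNIV ULt" by (rule has_derivative_continuous_on) (rule ULt_deriv)
  have cS: "continuous_on UNIV S" unfolding S_def cut1_def cut2_def by (intro continuous_intros cUL cULt)
  have d: "dt T u z = cut1 (snd z) * UL z + cut (snd z) * ULt z" "dalem T u z = S z" if z: "z \<in> spacetime T" for T z
  proof -
    have 1: "((\<lambda>y. u (y, t)) has_derivative (\<lambda>h. (cut t *\<^sub>R ULx (x, t)) \<bullet> h)) (at x)" for x t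
      unfolding u_def snd_conv inner_scaleR_left by (rule has_derivative_mult_right[OF UL_space_deriv])
    have 2: "((\<lambda>s. u (x, s)) has_vector_derivative (cut1 (snd (x, t)) * UL (x, t) + cut (snd (x, t)) * ULt (x, t))) (at t within {0..<T})" for x t
      using DERIV_mult[OF cut_deriv(1) UL_time_deriv[unfolded has_real_derivative_iff_has_vector_derivative[symmetric]]]
      unfolding u_def has_real_derivative_iff_has_vector_derivative[symmetric] snd_conv
      by (rule DERIV_cong) (simp add: algebra_simps)
    have 3: "((\<lambda>y. (cut t *\<^sub>R ULx (y, t)) \<bullet> b) has_derivative (\<lambda>h. (cut t *\<^sub>R ULxx b (x, t)) \<bullet> h)) (at x)" if "b \<in> Basis" for b x t
      unfolding inner_scaleR_left by (rule has_derivative_mult_right[OF ULx_space_deriv[OF that]])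
    have 4: "((\<lambda>s. cut1 (snd (x, s)) * UL (x, s) + cut (snd (x, s)) * ULt (x, s)) has_vector_derivative (S (x, t) + cut t * ULtt (x, t))) (at t within {0..<T})" for x t
      using DERIV_add[OF DERIV_mult[OF cut_deriv(2) UL_time_deriv[unfolded has_real_derivative_iff_has_vector_derivative[symmetric]]]
          DERIV_mult[OF cut_deriv(1) ULt_time_deriv[unfolded has_real_derivative_iff_has_vector_derivative[symmetric]]]]
      unfolding has_real_derivative_iff_has_vector_derivative[symmetric] snd_conv
      by (rule DERIV_cong) (simp add: S_def algebra_simps)
    note D = dalem_eq[where u=u and T=T and G="\<lambda>z. cut (snd z) *\<^sub>R ULx z" and Ut="\<lambda>z. cut1 (snd z) * UL z + cut (snd z) * ULt z"
        and H="\<lambda>b z. cut (snd z) *\<^sub>R ULxx b z" and Utt="\<lambda>z. S z + cut (snd z) * ULtt z", unfolded snd_conv, OF 1 2[unfolded snd_conv] 3 4[unfolded snd_conv] z]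
    show "dt T u z = cut1 (snd z) * UL z + cut (snd z) * ULt z" by (rule D(1))
    show "dalem T u z = S z" using D(2) by (simp add: UL_wave sum_distrib_left)
  qed
  have cSU: "continuous_on UNIV (\<lambda>z. \<bar>S z\<bar> + \<bar>UL z\<bar>)"
    by (intro continuous_on_add continuous_on_rabs cS cUL)
  have "compact (cball (0::real^2) (k + 1) \<times> {0..1::real})" by (intro compact_Times compact_cball compact_Icc)
  then have "compact ((\<lambda>z. \<bar>S z\<bar> + \<bar>UL z\<bar>) ` (cball 0 (k + 1) \<times> {0..1}))"
    by (rule compact_continuous_image[OF continuous_on_subset[OF cSU subset_UNIV]])
  from compact_imp_bounded[OF this] obtain B where B0: "\<forall>y\<in>(\<lambda>z. \<bar>S z\<bar> + \<bar>UL z\<bar>) ` (cball 0 (k + 1) \<times> {0..1}). norm y \<le> B"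
    unfolding bounded_iff by (elim exE)
  have B: "\<bar>S z\<bar> \<le> B" "\<bar>UL z\<bar> \<le> B" if "z \<in> cone k" "snd z \<le> 1" for z
  proof -
    have "z \<in> cball 0 (k + 1) \<times> {0..1}" using that by (cases z) (simp add: cone_def)
    then have "norm (\<bar>S z\<bar> + \<bar>UL z\<bar>) \<le> B" using B0 by blast
    then show "\<bar>S z\<bar> \<le> B" "\<bar>UL z\<bar> \<le> B" by auto
  qed
  have Bp: "0 \<le> B" using B(2)[of "(0, 0)"] k1 by (simp add: cone_def)
  \<comment> \<open>The source S lives at t \<le> 1, where \<tau> \<le> k + 3, so the wave operator
    of the shifted \<open>sup0\<close> is at least \<open>6 / (k + 3) ^ 6\<close> there.\<close>
  have late: "\<bar>UL z\<bar> \<le> B * (k + 3) ^ 6 / 6 * wt k z" if z: "z \<in> cone k" "1 \<le> snd z" for z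
  proof -
    define T where "T = snd z + 1"
    have zT: "z \<in> spacetime T" and T: "0 < T" using z by (auto simp: T_def)
    have "u z = Qmean (\<lambda>_. 0) (\<lambda>_. 0) z + Rmean (\<lambda>_. 0) z + duh (dalem T u) z"
    proof (rule wave_representation_data[OF C2u _ _ _ zT])
      show "u (x, 0) = 0" for x by (simp add: u_def cut_def)
      show "dt T u (x, 0) = 0" for x using d(1)[of "(x, 0)" T] T by (simp add: cut_def cut1_def)
    qed simp
    then have u: "u z = duh (dalem T u) z" by (simp add: Qmean_def Rmean_def)
    have "\<bar>duh (dalem T u) z\<bar> \<le> B * (k + 3) ^ 6 / 6 * sup0 (fst z, snd z + (k + 1))"
    proof (rule duh_abs_le_shifted[where T'="T + (k + 1)", OF C2_sup(1) sup_init(1) sup_init(3) _ _ _ _ continuous_on_dalem[OF C2u] _ zT])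
      show "0 \<le> dalem (T + (k + 1)) sup0 z" if "z \<in> spacetime (T + (k + 1))" for z
        by (rule dalem_sup0(1)[OF that])
      fix z assume zT: "z \<in> spacetime T"
      have sz: "shift k z \<in> spacetime (T + (k + 1))" using zT k1 by (simp add: shift_def)
      show "\<bar>dalem T u z\<bar> \<le> B * (k + 3) ^ 6 / 6 * dalem (T + (k + 1)) sup0 (fst z, snd z + (k + 1))"
      proof (cases "z \<in> cone k \<and> snd z \<le> 1")
        case True
        then have t: "0 \<le> snd z" "snd z \<le> 1" by (auto simp: cone_def)
        have "6 / (k + 3) ^ 6 \<le> 6 / (1 + snd (shift k z)) ^ 6"
          using t k1 by (intro divide_left_mono power_mono mult_pos_pos zero_less_power) (auto simp: shift_def)
        also have "\<dots> \<le> dalem (T + (k + 1)) sup0 (shift k z)"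
          by (rule dalem_sup0(2)[OF sz]) (rule cone_qq(1)[OF k1], use True in simp)
        finally have "B * (k + 3) ^ 6 / 6 * (6 / (k + 3) ^ 6) \<le> B * (k + 3) ^ 6 / 6 * dalem (T + (k + 1)) sup0 (shift k z)"
          using Bp k1 by (intro mult_left_mono) auto
        moreover have "B * (k + 3) ^ 6 / 6 * (6 / (k + 3) ^ 6) = B" using k1 by simp
        ultimately show ?thesis using B(1)[of z] True d(2)[OF zT] by (simp add: shift_def)
      next
        case False
        have "S z = 0"
        proof (cases "snd z \<le> 1")
          case True
          then have "snd z + k < norm (fst z)" using False zT by (auto simp: cone_def)
          then show ?thesis using UL_outside[of z] zT by (simp add: S_def)
        next
          case False
          then show ?thesis by (simp add: S_def cut1_def cut2_def)
        qed
        then show ?thesis using d(2)[OF zT] Bp k1 dalem_sup0(1)[OF sz] by (simp add: shift_def)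
      qed
    qed (use T k1 Bp in auto)
    also have "\<dots> \<le> B * (k + 3) ^ 6 / 6 * wt k z"
      using sup_le_wt(1)[OF k1 z(1)] Bp k1 by (intro mult_left_mono) (auto simp: shift_def)
    finally show ?thesis using z u by (simp add: u_def cut_def)
  qed
  have wt_pos: "0 < wt k z" "1 / (snd z + (k + 2)) \<le> wt k z" if z: "z \<in> cone k" for z
  proof -
    have q: "0 < (snd z + (k + 2))\<^sup>2 - fst z \<bullet> fst z"
    proof -
      have "0 < qq (shift k z) * (1 + snd (shift k z))"
        using cone_qq(1)[OF k1 z] z k1 by (intro mult_pos_pos) (auto simp: shift_def cone_def)
      then show ?thesis by (simp only: cone_qq(3)[OF k1 z])
    qed
    then show "0 < wt k z" by (simp add: wt_def)
    have "sqrt ((snd z + (k + 2))\<^sup>2 - fst z \<bullet> fst z) \<le> sqrt ((snd z + (k + 2))\<^sup>2)" by (rule real_sqrt_le_mono) simp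
    also have "\<dots> = snd z + (k + 2)" using z k1 by (simp add: cone_def)
    finally show "1 / (snd z + (k + 2)) \<le> wt k z"
      unfolding wt_def using q z k1 by (intro divide_left_mono mult_pos_pos) (auto simp: cone_def)
  qed
  \<comment> \<open>The first summand serves times t \<ge> 1, the second serves t < 1 through w
    \<ge> 1 / (t + k + 2), and 1 makes A positive.\<close>
  define A where "A = B * (k + 3) ^ 6 / 6 + B * (k + 3) + 1"
  have A: "0 < A" "B * (k + 3) ^ 6 / 6 \<le> A" "B * (k + 3) \<le> A"
    using Bp k1 by (auto simp: A_def add_nonneg_pos)
  have "\<bar>UL z\<bar> \<le> A * wt k z" if z: "z \<in> cone k" for z
  proof (cases "1 \<le> snd z")
    case True
    have "\<bar>UL z\<bar> \<le> B * (k + 3) ^ 6 / 6 * wt k z" by (rule late[OF z True])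
    also have "\<dots> \<le> A * wt k z" by (rule mult_right_mono[OF A(2)]) (use wt_pos[OF z] in simp)
    finally show ?thesis .
  next
    case False
    have t: "0 \<le> snd z" using z by (simp add: cone_def)
    have "\<bar>UL z\<bar> \<le> B" using B(2)[OF z] False by simp
    also have "\<dots> = B * (k + 3) * (1 / (k + 3))" using k1 by simp
    also have "\<dots> \<le> B * (k + 3) * (1 / (snd z + (k + 2)))"
      using Bp k1 t False by (intro mult_left_mono divide_left_mono) auto
    also have "\<dots> \<le> B * (k + 3) * wt k z" using wt_pos(2)[OF z] Bp k1 by (intro mult_left_mono) auto
    also have "\<dots> \<le> A * wt k z" by (rule mult_right_mono[OF A(3)]) (use wt_pos[OF z] in simp)
    finally show ?thesis .
  qed
  then show ?thesis using A(1) by blast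
qed

end

section \<open>Fixed points of the retarded potential\<close>

text \<open>The integral of (t - \<tau>) exp (\<gamma> \<tau>) over [0, t] is at most exp (\<gamma>
  t) / \<gamma>^2. In the norm weighted by exp (-\<gamma> t) the potential therefore has norm at
  most 1 / \<gamma>^2, which beats any Lipschitz constant once \<gamma> is large.\<close>

lemma duh_bound_exp:
  fixes F :: "(real^2) \<times> real \<Rightarrow> 'b::euclidean_space"
  assumes cF: "continuous_on (spacetime T) F" and z: "z \<in> spacetime T" and g: "0 < \<gamma>" and E: "0 \<le> E"
    and F: "\<And>\<tau> \<xi>. 0 \<le> \<tau> \<Longrightarrow> \<tau> \<le> snd z \<Longrightarrow> norm \<xi> \<le> 1 \<Longrightarrow>
      norm (F (fst z + (snd z - \<tau>) *\<^sub>R \<xi>, \<tau>)) \<le> E * exp (\<gamma> * \<tau>)"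
  shows "norm (duh F z) \<le> E * exp (\<gamma> * snd z) / \<gamma>\<^sup>2"
proof -
  define t where "t = snd z"
  have t: "0 \<le> t" "t < T" using z by (auto simp: t_def)
  define a where "a = 1 / \<gamma>"
  have a: "\<gamma> * a = 1" "0 < a" using g by (auto simp: a_def)
  \<comment> \<open>An antiderivative of the majorant, found by parts; at \<tau> = t it is the
    claimed bound.\<close>
  define \<Phi> where "\<Phi> \<tau> = E * (((t - \<tau>) * a + a * a) * exp (\<gamma> * \<tau>))" for \<tau>
  have d: "(\<Phi> has_real_derivative (t - \<tau>) * (E * exp (\<gamma> * \<tau>))) (at \<tau> within {0..t})" for \<tau>
  proof -
    have "(\<Phi> has_real_derivative E * (exp (\<gamma> * \<tau>) * \<gamma> * ((t - \<tau>) * a + a * a) - a * exp (\<gamma> * \<tau>))) (at \<tau> within {0..t})"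
      unfolding \<Phi>_def by (auto intro!: derivative_eq_intros)
    moreover have "E * (exp (\<gamma> * \<tau>) * \<gamma> * ((t - \<tau>) * a + a * a) - a * exp (\<gamma> * \<tau>))
      = E * exp (\<gamma> * \<tau>) * ((\<gamma> * a) * (t - \<tau> + a) - a)"
      by (simp only: algebra_simps)
    ultimately show ?thesis by (simp only: a mult_1_left add_diff_cancel mult_ac)
  qed
  have I: "((\<lambda>\<tau>. (t - \<tau>) * (E * exp (\<gamma> * \<tau>))) has_integral \<Phi> t - \<Phi> 0) {0..t}"
    by (rule fundamental_theorem_of_calculus[OF t(1)])
      (simp add: d has_real_derivative_iff_has_vector_derivative[symmetric])
  have "norm (duh F z) \<le> integral {0..t} (\<lambda>\<tau>. (t - \<tau>) * (E * exp (\<gamma> * \<tau>)))"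
    unfolding duh_def t_def[symmetric]
  proof (rule Henstock_Kurzweil_Integration.integral_norm_bound_integral)
    show "(\<lambda>\<tau>. \<integral>\<xi>. (t - \<tau>) *\<^sub>R F (fst z + (t - \<tau>) *\<^sub>R \<xi>, \<tau>) \<partial>disk) integrable_on {0..t}"
      using integrable_duh_integrand[OF cF z] by (simp add: t_def)
    show "(\<lambda>\<tau>. (t - \<tau>) * (E * exp (\<gamma> * \<tau>))) integrable_on {0..t}"
      using I by (rule has_integral_integrable)
    fix \<tau> assume \<tau>: "\<tau> \<in> {0..t}"
    show "norm (\<integral>\<xi>. (t - \<tau>) *\<^sub>R F (fst z + (t - \<tau>) *\<^sub>R \<xi>, \<tau>) \<partial>disk) \<le> (t - \<tau>) * (E * exp (\<gamma> * \<tau>))"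
    proof (rule disk_integral_norm_le)
      show "continuous_on UNIV (\<lambda>\<xi>. (t - \<tau>) *\<^sub>R F (fst z + (t - \<tau>) *\<^sub>R \<xi>, \<tau>))"
        by (intro continuous_intros continuous_on_kernel_slice[OF cF]) (use \<tau> t in auto)
      show "norm ((t - \<tau>) *\<^sub>R F (fst z + (t - \<tau>) *\<^sub>R \<xi>, \<tau>)) \<le> (t - \<tau>) * (E * exp (\<gamma> * \<tau>))" if "norm \<xi> \<le> 1" for \<xi>
        using F[of \<tau> \<xi>] \<tau> that by (simp add: t_def mult_left_mono)
    qed
  qed
  also have "\<dots> = \<Phi> t - \<Phi> 0" by (rule integral_unique[OF I])
  also have "\<dots> \<le> \<Phi> t" unfolding \<Phi>_def using t a E by simp
  also have "\<Phi> t = E * exp (\<gamma> * snd z) / \<gamma>\<^sup>2" by (simp add: \<Phi>_def t_def a_def power2_eq_square)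
  finally show ?thesis .
qed

lemma duh_diff:
  fixes F1 F2 :: "(real^2) \<times> real \<Rightarrow> 'b::euclidean_space"
  assumes c1: "continuous_on (spacetime T) F1" and c2: "continuous_on (spacetime T) F2" and z: "z \<in> spacetime T"
  shows "duh F1 z - duh F2 z = duh (\<lambda>z. F1 z - F2 z) z"
proof -
  have "duh F1 z - duh F2 z = integral {0..snd z} (\<lambda>\<tau>. (\<integral>\<xi>. (snd z - \<tau>) *\<^sub>R F1 (fst z + (snd z - \<tau>) *\<^sub>R \<xi>, \<tau>) \<partial>disk)
      - (\<integral>\<xi>. (snd z - \<tau>) *\<^sub>R F2 (fst z + (snd z - \<tau>) *\<^sub>R \<xi>, \<tau>) \<partial>disk))"
    unfolding duh_def
    by (rule Henstock_Kurzweil_Integration.integral_diff[symmetric])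
      (rule integrable_duh_integrand[OF c1 z], rule integrable_duh_integrand[OF c2 z])
  also have "\<dots> = duh (\<lambda>z. F1 z - F2 z) z"
    unfolding duh_def
  proof (rule integral_cong)
    fix \<tau> assume "\<tau> \<in> {0..snd z}"
    then have t: "0 \<le> \<tau>" "\<tau> < T" using z by auto
    have "integrable disk (\<lambda>\<xi>. (snd z - \<tau>) *\<^sub>R F1 (fst z + (snd z - \<tau>) *\<^sub>R \<xi>, \<tau>))"
      "integrable disk (\<lambda>\<xi>. (snd z - \<tau>) *\<^sub>R F2 (fst z + (snd z - \<tau>) *\<^sub>R \<xi>, \<tau>))"
      by (intro integrable_disk continuous_intros continuous_on_kernel_slice[OF c1 t] continuous_on_kernel_slice[OF c2 t])+
    from Bochner_Integration.integral_diff[OF this]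
    show "(\<integral>\<xi>. (snd z - \<tau>) *\<^sub>R F1 (fst z + (snd z - \<tau>) *\<^sub>R \<xi>, \<tau>) \<partial>disk) - (\<integral>\<xi>. (snd z - \<tau>) *\<^sub>R F2 (fst z + (snd z - \<tau>) *\<^sub>R \<xi>, \<tau>) \<partial>disk)
      = (\<integral>\<xi>. (snd z - \<tau>) *\<^sub>R (F1 (fst z + (snd z - \<tau>) *\<^sub>R \<xi>, \<tau>) - F2 (fst z + (snd z - \<tau>) *\<^sub>R \<xi>, \<tau>)) \<partial>disk)"
      by (simp only: scaleR_diff_right)
  qed
  finally show ?thesis .
qed

section \<open>Backward cones and uniqueness\<close>

text \<open>The domain of dependence of z0. It is compact, so continuous functions are bounded on it
  whatever their behaviour at spatial infinity.\<close>

definition bcone :: "(real^2) \<times> real \<Rightarrow> ((real^2) \<times> real) set" where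
  "bcone z0 = {z. 0 \<le> snd z \<and> snd z \<le> snd z0 \<and> norm (fst z - fst z0) \<le> snd z0 - snd z}"

lemma compact_bcone: "compact (bcone z0)"
proof -
  have c: "closed (bcone z0)"
    unfolding bcone_def by (intro closed_Collect_conj closed_Collect_le continuous_intros)
  have "bcone z0 \<subseteq> cball (fst z0) (snd z0) \<times> {0..snd z0}"
    by (auto simp: bcone_def dist_norm norm_minus_commute)
  moreover have "bounded (cball (fst z0) (snd z0) \<times> {0..snd z0})"
    by (intro bounded_Times bounded_cball bounded_closed_interval)
  ultimately have "bounded (bcone z0)" using bounded_subset by blast
  with c show ?thesis by (simp add: compact_eq_bounded_closed)
qed

lemma bcone_trans:
  assumes z: "z \<in> bcone z0" and "0 \<le> \<tau>" "\<tau> \<le> snd z" "norm \<xi> \<le> 1"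
  shows "(fst z + (snd z - \<tau>) *\<^sub>R \<xi>, \<tau>) \<in> bcone z0"
proof -
  have "norm ((snd z - \<tau>) *\<^sub>R \<xi>) \<le> snd z - \<tau>" using assms by (simp add: mult_left_le)
  moreover have "norm (fst z + (snd z - \<tau>) *\<^sub>R \<xi> - fst z0) \<le> norm (fst z - fst z0) + norm ((snd z - \<tau>) *\<^sub>R \<xi>)"
    using norm_triangle_ineq[of "fst z - fst z0" "(snd z - \<tau>) *\<^sub>R \<xi>"] by (simp add: algebra_simps)
  ultimately show ?thesis using assms by (auto simp: bcone_def)
qed

text \<open>The weighted difference h attains its maximum over the compact backward cone, and the
  backward disc of the maximiser stays inside. The equation there yields max h \<le> (B /
  \<gamma>^2) max h with B / \<gamma>^2 \<le> 1/2, so h vanishes.\<close>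

lemma duh_unique:
  fixes w1 w2 :: "(real^2) \<times> real \<Rightarrow> 'b::euclidean_space"
  assumes c: "continuous_on (spacetime T) w1" "continuous_on (spacetime T) w2"
    and cN: "continuous_on (spacetime T) N1" "continuous_on (spacetime T) N2"
    and w1: "\<And>z. z \<in> spacetime T \<Longrightarrow> w1 z = g z + duh N1 z"
    and w2: "\<And>z. z \<in> spacetime T \<Longrightarrow> w2 z = g z + duh N2 z"
    and z0: "z0 \<in> spacetime T" and B: "0 \<le> B"
    and lip: "\<And>z. z \<in> bcone z0 \<Longrightarrow> norm (N1 z - N2 z) \<le> B * norm (w1 z - w2 z)"
  shows "w1 z0 = w2 z0"
proof -
  define \<gamma> where "\<gamma> = B + 2"
  have g: "0 < \<gamma>" "2 * B \<le> \<gamma>\<^sup>2" using B by (auto simp: \<gamma>_def power2_eq_square algebra_simps)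
  have sub: "bcone z0 \<subseteq> spacetime T" using z0 by (auto simp: bcone_def)
  have in0: "z0 \<in> bcone z0" using z0 by (simp add: bcone_def)
  define h where "h z = norm (w1 z - w2 z) * exp (- (\<gamma> * snd z))" for z
  have ch: "continuous_on (bcone z0) h"
    unfolding h_def by (intro continuous_intros continuous_on_subset[OF c(1) sub] continuous_on_subset[OF c(2) sub])
  obtain zm where zm: "zm \<in> bcone z0" "\<And>z. z \<in> bcone z0 \<Longrightarrow> h z \<le> h zm"
    using continuous_attains_sup[OF compact_bcone _ ch] in0 by blast
  have h0: "0 \<le> h zm" by (simp add: h_def)
  have zmS: "zm \<in> spacetime T" using zm(1) sub by blast
  have cd: "continuous_on (spacetime T) (\<lambda>z. N1 z - N2 z)" by (intro continuous_intros cN)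
  have "w1 zm - w2 zm = duh (\<lambda>z. N1 z - N2 z) zm"
    using w1[OF zmS] w2[OF zmS] duh_diff[OF cN zmS] by simp
  also have "norm \<dots> \<le> (B * h zm) * exp (\<gamma> * snd zm) / \<gamma>\<^sup>2"
  proof (rule duh_bound_exp[OF cd zmS g(1)])
    fix \<tau> :: real and \<xi> :: "real^2" assume a: "0 \<le> \<tau>" "\<tau> \<le> snd zm" "norm \<xi> \<le> 1"
    let ?y = "(fst zm + (snd zm - \<tau>) *\<^sub>R \<xi>, \<tau>)"
    have y: "?y \<in> bcone z0" by (rule bcone_trans[OF zm(1) a])
    have "norm (w1 ?y - w2 ?y) = h ?y * exp (\<gamma> * \<tau>)" by (simp add: h_def exp_minus)
    also have "\<dots> \<le> h zm * exp (\<gamma> * \<tau>)" using zm(2)[OF y] by (intro mult_right_mono) auto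
    finally have "B * norm (w1 ?y - w2 ?y) \<le> B * (h zm * exp (\<gamma> * \<tau>))" using B by (intro mult_left_mono)
    then show "norm (N1 ?y - N2 ?y) \<le> B * h zm * exp (\<gamma> * \<tau>)" using lip[OF y] by simp
  qed (use B h0 in simp)
  finally have "norm (w1 zm - w2 zm) \<le> B * h zm * exp (\<gamma> * snd zm) / \<gamma>\<^sup>2" .
  then have "norm (w1 zm - w2 zm) * exp (- (\<gamma> * snd zm)) \<le> B * h zm * exp (\<gamma> * snd zm) / \<gamma>\<^sup>2 * exp (- (\<gamma> * snd zm))"
    by (rule mult_right_mono) simp
  then have "h zm \<le> B * h zm / \<gamma>\<^sup>2" unfolding h_def[of zm, symmetric] by (simp add: exp_minus field_simps)
  then have "\<gamma>\<^sup>2 * h zm \<le> B * h zm" using g(1) by (simp add: field_simps)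
  moreover have "2 * B * h zm \<le> \<gamma>\<^sup>2 * h zm" using g(2) h0 by (rule mult_right_mono)
  ultimately have "\<gamma>\<^sup>2 * h zm \<le> 0" by simp
  moreover have "0 < \<gamma>\<^sup>2" using g(1) by simp
  ultimately have "h zm \<le> 0" by (simp add: mult_le_0_iff)
  then have "h z0 \<le> 0" using zm(2)[OF in0] by linarith
  then have "norm (w1 z0 - w2 z0) \<le> 0" by (simp add: h_def mult_le_0_iff)
  then show ?thesis by simp
qed

lemma exp_ge_one_time: "0 \<le> \<gamma> \<Longrightarrow> z \<in> spacetime T \<Longrightarrow> 1 \<le> exp (\<gamma> * snd z)"
  by simp

section \<open>Bounds and geometric convergence for iterates of integral equations\<close>

text \<open>Increments are bounded by \<open>E * \<rho> ^ n * exp (\<gamma> * t)\<close>: the rate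
  \<gamma> is so large that the Lipschitz part contributes at most half of the factor \<rho>, and E
  so large that the forcing \<open>D * \<rho> ^ n\<close> fits into the other half. The forcing is
  what lets gradients inherit the error of the values. The weight is finally bounded on the slab by
  exp (\<gamma> T).\<close>

lemma geometric_increments:
  fixes w N :: "nat \<Rightarrow> (real^2) \<times> real \<Rightarrow> 'b::euclidean_space"
  assumes cN: "\<And>n. continuous_on (spacetime T) (N n)"
    and w: "\<And>n z. z \<in> spacetime T \<Longrightarrow> w (Suc n) z = g z + duh (N n) z"
    and pos: "0 \<le> B" "0 \<le> D" "0 \<le> D0" "0 < \<rho>"
    and step: "\<And>n z. z \<in> spacetime T \<Longrightarrow> norm (N (Suc n) z - N n z) \<le> B * norm (w (Suc n) z - w n z) + D * \<rho> ^ n"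
    and base: "\<And>z. z \<in> spacetime T \<Longrightarrow> norm (w 1 z - w 0 z) \<le> D0"
  shows "\<exists>D'\<ge>0. \<forall>n. \<forall>z\<in>spacetime T. norm (w (Suc n) z - w n z) \<le> D' * \<rho> ^ n"
proof -
  define \<gamma> where "\<gamma> = 1 + 2 * B / \<rho>"
  have g: "1 \<le> \<gamma>" using pos by (simp add: \<gamma>_def)
  have "2 * B / \<rho> \<le> \<gamma> * 1" by (simp add: \<gamma>_def)
  also have "\<dots> \<le> \<gamma> * \<gamma>" using g by (intro mult_left_mono) auto
  finally have gB: "B \<le> \<rho> / 2 * \<gamma>\<^sup>2" using pos by (simp add: field_simps power2_eq_square)
  define E where "E = D0 + 2 * D / \<rho>"
  have E: "0 \<le> E" "D0 \<le> E" "D \<le> \<rho> / 2 * E" using pos by (auto simp: E_def field_simps)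
  have g2: "1 \<le> \<gamma>\<^sup>2" using g by (simp add: one_le_power)
  have "D * 1 \<le> \<rho> / 2 * E * \<gamma>\<^sup>2" using E(3) g2 pos E(1) by (intro mult_mono) auto
  moreover have "B * E \<le> \<rho> / 2 * \<gamma>\<^sup>2 * E" by (rule mult_right_mono[OF gB E(1)])
  ultimately have key: "B * E + D \<le> \<rho> * E * \<gamma>\<^sup>2" by (simp add: algebra_simps)
  have ind: "\<forall>z\<in>spacetime T. norm (w (Suc n) z - w n z) \<le> E * \<rho> ^ n * exp (\<gamma> * snd z)" for n
  proof (induction n)
    case 0
    show ?case
    proof
      fix z assume z: "z \<in> spacetime T"
      have "norm (w (Suc 0) z - w 0 z) \<le> E * 1" using base[OF z] E(2) by simp
      also have "\<dots> \<le> E * exp (\<gamma> * snd z)" using exp_ge_one_time[OF _ z, of \<gamma>] g E(1) by (intro mult_left_mono) auto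
      finally show "norm (w (Suc 0) z - w 0 z) \<le> E * \<rho> ^ 0 * exp (\<gamma> * snd z)" by simp
    qed
  next
    case (Suc n)
    show ?case
    proof
      fix z assume z: "z \<in> spacetime T"
      have "w (Suc (Suc n)) z - w (Suc n) z = duh (\<lambda>z. N (Suc n) z - N n z) z"
        unfolding w[OF z] using duh_diff[OF cN cN z] by simp
      also have "norm \<dots> \<le> ((B * E + D) * \<rho> ^ n) * exp (\<gamma> * snd z) / \<gamma>\<^sup>2"
      proof (rule duh_bound_exp[OF _ z])
        show "continuous_on (spacetime T) (\<lambda>z. N (Suc n) z - N n z)" by (intro continuous_intros cN)
        fix \<tau> :: real and \<xi> :: "real^2" assume a: "0 \<le> \<tau>" "\<tau> \<le> snd z" "norm \<xi> \<le> 1"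
        let ?y = "(fst z + (snd z - \<tau>) *\<^sub>R \<xi>, \<tau>)"
        have y: "?y \<in> spacetime T" using a z by simp
        have "norm (N (Suc n) ?y - N n ?y) \<le> B * norm (w (Suc n) ?y - w n ?y) + D * \<rho> ^ n" by (rule step[OF y])
        also have "\<dots> \<le> B * (E * \<rho> ^ n * exp (\<gamma> * \<tau>)) + D * \<rho> ^ n * exp (\<gamma> * \<tau>)"
        proof (rule add_mono)
          show "B * norm (w (Suc n) ?y - w n ?y) \<le> B * (E * \<rho> ^ n * exp (\<gamma> * \<tau>))"
            using bspec[OF Suc.IH y] pos by (simp add: mult_left_mono)
          have "D * \<rho> ^ n * 1 \<le> D * \<rho> ^ n * exp (\<gamma> * \<tau>)"
            using pos g a by (intro mult_left_mono) auto
          then show "D * \<rho> ^ n \<le> D * \<rho> ^ n * exp (\<gamma> * \<tau>)" by simp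
        qed
        finally show "norm (N (Suc n) ?y - N n ?y) \<le> (B * E + D) * \<rho> ^ n * exp (\<gamma> * \<tau>)"
          by (simp add: algebra_simps)
      qed (use g pos E in auto)
      also have "\<dots> \<le> (\<rho> * E * \<gamma>\<^sup>2 * \<rho> ^ n) * exp (\<gamma> * snd z) / \<gamma>\<^sup>2"
        using key pos by (intro divide_right_mono mult_right_mono) auto
      also have "\<dots> = E * \<rho> ^ Suc n * exp (\<gamma> * snd z)" using g by simp
      finally show "norm (w (Suc (Suc n)) z - w (Suc n) z) \<le> E * \<rho> ^ Suc n * exp (\<gamma> * snd z)" .
    qed
  qed
  have "norm (w (Suc n) z - w n z) \<le> (E * exp (\<gamma> * T)) * \<rho> ^ n" if z: "z \<in> spacetime T" for n z
  proof -
    have "exp (\<gamma> * snd z) \<le> exp (\<gamma> * T)" using z g by simp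
    then have "E * \<rho> ^ n * exp (\<gamma> * snd z) \<le> E * \<rho> ^ n * exp (\<gamma> * T)" using E pos by (intro mult_left_mono) auto
    then show ?thesis using ind[of n] z by (force simp: mult_ac)
  qed
  moreover have "0 \<le> E * exp (\<gamma> * T)" using E by simp
  ultimately show ?thesis by blast
qed

lemma bounded_iterates:
  fixes w N :: "nat \<Rightarrow> (real^2) \<times> real \<Rightarrow> 'b::euclidean_space"
  assumes cN: "\<And>n. continuous_on (spacetime T) (N n)"
    and w: "\<And>n z. z \<in> spacetime T \<Longrightarrow> w (Suc n) z = g z + duh (N n) z"
    and pos: "0 \<le> B" "0 \<le> D" "0 \<le> D0"
    and step: "\<And>n z. z \<in> spacetime T \<Longrightarrow> norm (N n z) \<le> B * norm (w n z) + D"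
    and base: "\<And>z. z \<in> spacetime T \<Longrightarrow> norm (w 0 z) \<le> D0" "\<And>z. z \<in> spacetime T \<Longrightarrow> norm (g z) \<le> D0"
  shows "\<exists>M\<ge>0. \<forall>n. \<forall>z\<in>spacetime T. norm (w n z) \<le> M"
proof -
  define \<gamma> where "\<gamma> = 1 + 2 * B"
  have g: "1 \<le> \<gamma>" using pos by (simp add: \<gamma>_def)
  have "2 * B \<le> \<gamma> * 1" by (simp add: \<gamma>_def)
  also have "\<dots> \<le> \<gamma> * \<gamma>" using g by (intro mult_left_mono) auto
  finally have gB: "B \<le> 1 / 2 * \<gamma>\<^sup>2" by (simp add: power2_eq_square)
  have g2: "1 \<le> \<gamma>\<^sup>2" using g by (simp add: one_le_power)
  \<comment> \<open>One half of E covers the constants D0 and D, the other half is what B /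
    \<gamma>^2 \<le> 1/2 leaves of E.\<close>
  define E where "E = 2 * (D0 + D)"
  have E: "0 \<le> E" "D0 \<le> E" using pos by (auto simp: E_def)
  have "D * 1 \<le> D * \<gamma>\<^sup>2" using g2 pos by (intro mult_left_mono) auto
  moreover have "B * E \<le> 1 / 2 * \<gamma>\<^sup>2 * E" by (rule mult_right_mono[OF gB E(1)])
  ultimately have key: "B * E + D \<le> (E / 2 + D) * \<gamma>\<^sup>2" by (simp add: algebra_simps)
  have ind: "\<forall>z\<in>spacetime T. norm (w n z) \<le> E * exp (\<gamma> * snd z)" for n
  proof (induction n)
    case 0
    show ?case
    proof
      fix z assume z: "z \<in> spacetime T"
      have "norm (w 0 z) \<le> E * 1" using base(1)[OF z] E(2) by simp
      also have "\<dots> \<le> E * exp (\<gamma> * snd z)" using exp_ge_one_time[OF _ z, of \<gamma>] g E(1) by (intro mult_left_mono) auto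
      finally show "norm (w 0 z) \<le> E * exp (\<gamma> * snd z)" .
    qed
  next
    case (Suc n)
    show ?case
    proof
      fix z assume z: "z \<in> spacetime T"
      have e1: "1 \<le> exp (\<gamma> * snd z)" using exp_ge_one_time[OF _ z, of \<gamma>] g by simp
      have "norm (duh (N n) z) \<le> (B * E + D) * exp (\<gamma> * snd z) / \<gamma>\<^sup>2"
      proof (rule duh_bound_exp[OF cN z])
        fix \<tau> :: real and \<xi> :: "real^2" assume a: "0 \<le> \<tau>" "\<tau> \<le> snd z" "norm \<xi> \<le> 1"
        let ?y = "(fst z + (snd z - \<tau>) *\<^sub>R \<xi>, \<tau>)"
        have y: "?y \<in> spacetime T" using a z by simp
        have "norm (N n ?y) \<le> B * norm (w n ?y) + D" by (rule step[OF y])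
        also have "\<dots> \<le> B * (E * exp (\<gamma> * \<tau>)) + D * exp (\<gamma> * \<tau>)"
        proof (rule add_mono)
          show "B * norm (w n ?y) \<le> B * (E * exp (\<gamma> * \<tau>))"
            using bspec[OF Suc.IH y] pos by (simp add: mult_left_mono)
          have "D * 1 \<le> D * exp (\<gamma> * \<tau>)" using pos g a by (intro mult_left_mono) auto
          then show "D \<le> D * exp (\<gamma> * \<tau>)" by simp
        qed
        finally show "norm (N n ?y) \<le> (B * E + D) * exp (\<gamma> * \<tau>)" by (simp add: algebra_simps)
      qed (use g pos E in auto)
      also have "\<dots> \<le> ((E / 2 + D) * \<gamma>\<^sup>2) * exp (\<gamma> * snd z) / \<gamma>\<^sup>2"
        using key by (intro divide_right_mono mult_right_mono) auto
      also have "\<dots> = (E / 2 + D) * exp (\<gamma> * snd z)" using g by simp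
      finally have 1: "norm (duh (N n) z) \<le> (E / 2 + D) * exp (\<gamma> * snd z)" .
      have "D0 * 1 \<le> D0 * exp (\<gamma> * snd z)" using e1 pos by (intro mult_left_mono) auto
      then have 2: "norm (g z) \<le> D0 * exp (\<gamma> * snd z)" using base(2)[OF z] by simp
      have "norm (w (Suc n) z) \<le> norm (g z) + norm (duh (N n) z)" unfolding w[OF z] by (rule norm_triangle_ineq)
      also have "\<dots> \<le> D0 * exp (\<gamma> * snd z) + (E / 2 + D) * exp (\<gamma> * snd z)" using 1 2 by (rule add_mono[rotated])
      also have "\<dots> = E * exp (\<gamma> * snd z)" by (simp add: E_def algebra_simps)
      finally show "norm (w (Suc n) z) \<le> E * exp (\<gamma> * snd z)" .
    qed
  qed
  have "norm (w n z) \<le> E * exp (\<gamma> * T)" if z: "z \<in> spacetime T" for n z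
  proof -
    have "exp (\<gamma> * snd z) \<le> exp (\<gamma> * T)" using z g by simp
    then have "E * exp (\<gamma> * snd z) \<le> E * exp (\<gamma> * T)" using E by (intro mult_left_mono) auto
    then show ?thesis using ind[of n] z by force
  qed
  moreover have "0 \<le> E * exp (\<gamma> * T)" using E by simp
  ultimately show ?thesis by blast
qed

lemma geometric_limit:
  fixes w :: "nat \<Rightarrow> 'a \<Rightarrow> 'b::banach"
  assumes "\<And>n z. z \<in> S \<Longrightarrow> norm (w (Suc n) z - w n z) \<le> D * \<rho> ^ n" and "0 < \<rho>" "\<rho> < 1"
  shows "\<exists>l. \<forall>n. \<forall>z\<in>S. norm (w n z - l z) \<le> D / (1 - \<rho>) * \<rho> ^ n"
proof -
  define d where "d z n = w (Suc n) z - w n z" for z n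
  have geo: "summable (\<lambda>n. D * \<rho> ^ n)" using assms(2,3) by (intro summable_mult summable_geometric) simp
  have tail: "norm (w n z - (w 0 z + suminf (d z))) \<le> D / (1 - \<rho>) * \<rho> ^ n" if z: "z \<in> S" for n z
  proof -
    have dn: "norm (d z i) \<le> D * \<rho> ^ i" for i using assms(1)[OF z] by (simp add: d_def)
    have s: "summable (d z)" by (rule summable_comparison_test'[OF geo, of 0]) (rule dn)
    have tel: "(\<Sum>i<n. d z i) = w n z - w 0 z" unfolding d_def by (rule sum_lessThan_telescope)
    have "w 0 z + suminf (d z) - w n z = (\<Sum>i. d z (i + n))"
      using suminf_minus_initial_segment[OF s, of n] tel by simp
    also have "norm \<dots> \<le> (\<Sum>i. D * \<rho> ^ n * \<rho> ^ i)"
    proof (rule norm_suminf_le)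
      show "norm (d z (i + n)) \<le> D * \<rho> ^ n * \<rho> ^ i" for i using dn[of "i + n"] by (simp add: power_add mult_ac)
      show "summable (\<lambda>i. D * \<rho> ^ n * \<rho> ^ i)" using assms(2,3) by (intro summable_mult summable_geometric) simp
    qed
    also have "\<dots> = D * \<rho> ^ n * (1 / (1 - \<rho>))"
      using assms(2,3) by (subst suminf_mult) (simp_all add: suminf_geometric summable_geometric)
    finally show ?thesis by (simp add: norm_minus_commute)
  qed
  then show ?thesis by (intro exI[of _ "\<lambda>z. w 0 z + suminf (d z)"]) blast
qed

section \<open>Calculus of space gradients and passage to the limit\<close>

lemma sgrad_add:
  assumes "sgrad T f F" and "sgrad T g G"
  shows "sgrad T (\<lambda>z. f z + g z) (\<lambda>z. F z + G z)"
  unfolding sgrad_def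
proof (intro conjI ballI allI)
  show "((\<lambda>y. f (y, t) + g (y, t)) has_derivative (\<lambda>h. (F (x, t) + G (x, t)) \<bullet> h)) (at x)" if "t \<in> {0..<T}" for t x
    unfolding inner_add_left by (rule has_derivative_add[OF sgradD(3)[OF assms(1) that] sgradD(3)[OF assms(2) that]])
qed (intro continuous_intros sgradD[OF assms(1)] sgradD[OF assms(2)])+

lemma sgrad_mult:
  assumes "sgrad T f F" and "sgrad T g G"
  shows "sgrad T (\<lambda>z. f z * g z) (\<lambda>z. g z *\<^sub>R F z + f z *\<^sub>R G z)"
  unfolding sgrad_def
proof (intro conjI ballI allI)
  show "((\<lambda>y. f (y, t) * g (y, t)) has_derivative (\<lambda>h. (g (x, t) *\<^sub>R F (x, t) + f (x, t) *\<^sub>R G (x, t)) \<bullet> h)) (at x)"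
    if "t \<in> {0..<T}" for t x
    using has_derivative_mult[OF sgradD(3)[OF assms(1) that] sgradD(3)[OF assms(2) that]]
    by (rule has_derivative_eq_rhs) (simp add: fun_eq_iff inner_add_left mult.commute add.commute)
qed (intro continuous_intros sgradD[OF assms(1)] sgradD[OF assms(2)])+

lemma sgrad_time:
  assumes "continuous_on {0..<T} a"
  shows "sgrad T (\<lambda>z. a (snd z)) (\<lambda>_. 0)"
  unfolding sgrad_def
proof (intro conjI ballI allI)
  show "continuous_on (spacetime T) (\<lambda>z. a (snd z))"
    by (rule continuous_on_compose2[OF assms]) (auto intro!: continuous_intros)
  show "((\<lambda>y. a (snd (y, t))) has_derivative (\<lambda>h. 0 \<bullet> h)) (at x)" for t and x :: "real^2" by simp
qed (rule continuous_on_const)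

lemma sgrad_const: "sgrad T (\<lambda>z. c) (\<lambda>_. 0)"
  by (rule sgrad_time[where a="\<lambda>_. c"]) (rule continuous_on_const)

lemma sgrad_real:
  assumes "sgrad T w G" and d: "\<And>a. (\<phi> has_real_derivative \<phi>' a) (at a)" and c: "continuous_on UNIV \<phi>'"
  shows "sgrad T (\<lambda>z. \<phi> (w z)) (\<lambda>z. \<phi>' (w z) *\<^sub>R G z)"
  unfolding sgrad_def
proof (intro conjI ballI allI)
  have cp: "continuous_on UNIV \<phi>" by (rule continuous_at_imp_continuous_on) (simp add: DERIV_isCont[OF d])
  show "continuous_on (spacetime T) (\<lambda>z. \<phi> (w z))"
    by (rule continuous_on_compose2[OF cp sgradD(1)[OF assms(1)]]) simp
  have "continuous_on (spacetime T) (\<lambda>z. \<phi>' (w z))"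
    by (rule continuous_on_compose2[OF c sgradD(1)[OF assms(1)]]) simp
  then show "continuous_on (spacetime T) (\<lambda>z. \<phi>' (w z) *\<^sub>R G z)"
    by (intro continuous_intros sgradD(2)[OF assms(1)])
  show "((\<lambda>y. \<phi> (w (y, t))) has_derivative (\<lambda>h. (\<phi>' (w (x, t)) *\<^sub>R G (x, t)) \<bullet> h)) (at x)" if "t \<in> {0..<T}" for t x
    using has_derivative_compose[OF sgradD(3)[OF assms(1) that] d[unfolded has_field_derivative_def]] by simp
qed

lemma sgrad_cong:
  assumes "sgrad T f F" and "\<And>z. z \<in> spacetime T \<Longrightarrow> g z = f z" and "\<And>z. z \<in> spacetime T \<Longrightarrow> G z = F z"
  shows "sgrad T g G"
  unfolding sgrad_def
proof (intro conjI ballI allI)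
  show "continuous_on (spacetime T) g" using sgradD(1)[OF assms(1)] by (rule continuous_on_eq) (simp add: assms(2))
  show "continuous_on (spacetime T) G" using sgradD(2)[OF assms(1)] by (rule continuous_on_eq) (simp add: assms(3))
  show "((\<lambda>y. g (y, t)) has_derivative (\<lambda>h. G (x, t) \<bullet> h)) (at x)" if "t \<in> {0..<T}" for t x
  proof -
    have "(\<lambda>y. g (y, t)) = (\<lambda>y. f (y, t))" "G (x, t) = F (x, t)" using that assms(2,3) by auto
    then show ?thesis using sgradD(3)[OF assms(1) that] by simp
  qed
qed

text \<open>The rates give uniform convergence of values and gradients. At each fixed time the
  theorem on sequences of derivatives produces a differentiable limit, which coincides with w by
  uniqueness of limits.\<close>

lemma sgrad_limit:
  assumes s: "\<And>n. sgrad T (u n) (v n)"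
    and u: "\<And>n z. z \<in> spacetime T \<Longrightarrow> norm (u n z - w z) \<le> C * \<rho> ^ n"
    and v: "\<And>n z. z \<in> spacetime T \<Longrightarrow> norm (v n z - G z) \<le> C * \<rho> ^ n"
    and \<rho>: "0 < \<rho>" "\<rho> < 1"
  shows "sgrad T w G"
proof -
  have z: "(\<lambda>n. C * \<rho> ^ n) \<longlonglongrightarrow> 0" using \<rho> by (intro tendsto_mult_right_zero LIMSEQ_realpow_zero) auto
  have small: "\<forall>\<^sub>F n in sequentially. C * \<rho> ^ n < e" if "0 < e" for e
    using order_tendstoD(2)[OF z that] .
  have ulu: "uniform_limit (spacetime T) u w sequentially"
  proof (rule uniform_limitI)
    fix e :: real assume "0 < e"
    show "\<forall>\<^sub>F n in sequentially. \<forall>z\<in>spacetime T. dist (u n z) (w z) < e"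
      using small[OF \<open>0 < e\<close>]
    proof eventually_elim
      case (elim n)
      show ?case
      proof
        fix z assume "z \<in> spacetime T"
        from le_less_trans[OF u[OF this, of n] elim] show "dist (u n z) (w z) < e" by (simp add: dist_norm)
      qed
    qed
  qed
  have ulv: "uniform_limit (spacetime T) v G sequentially"
  proof (rule uniform_limitI)
    fix e :: real assume "0 < e"
    show "\<forall>\<^sub>F n in sequentially. \<forall>z\<in>spacetime T. dist (v n z) (G z) < e"
      using small[OF \<open>0 < e\<close>]
    proof eventually_elim
      case (elim n)
      show ?case
      proof
        fix z assume "z \<in> spacetime T"
        from le_less_trans[OF v[OF this, of n] elim] show "dist (v n z) (G z) < e" by (simp add: dist_norm)
      qed
    qed
  qed
  show ?thesis unfolding sgrad_def
  proof (intro conjI ballI allI)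
    show "continuous_on (spacetime T) w"
      by (rule uniform_limit_theorem[OF _ ulu]) (simp_all add: sgradD(1)[OF s])
    show "continuous_on (spacetime T) G"
      by (rule uniform_limit_theorem[OF _ ulv]) (simp_all add: sgradD(2)[OF s])
    fix t x assume t: "t \<in> {0..<T}"
    have tS: "(y, t) \<in> spacetime T" for y using t by simp
    have lim: "(\<lambda>n. u n (y, t)) \<longlonglongrightarrow> w (y, t)" for y
      by (rule tendsto_uniform_limitI[OF ulu tS])
    have "\<exists>g. \<forall>y\<in>UNIV. (\<lambda>n. u n (y, t)) \<longlonglongrightarrow> g y \<and> (g has_derivative (\<lambda>h. G (y, t) \<bullet> h)) (at y within UNIV)"
    proof (rule has_derivative_sequence[where f'="\<lambda>n y h. v n (y, t) \<bullet> h"])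
      show "((\<lambda>y. u n (y, t)) has_derivative (\<lambda>h. v n (y, t) \<bullet> h)) (at y within UNIV)" for n y
        by (rule sgradD(3)[OF s t])
      fix e :: real assume "0 < e"
      show "\<forall>\<^sub>F n in sequentially. \<forall>y\<in>UNIV. \<forall>h. norm (v n (y, t) \<bullet> h - G (y, t) \<bullet> h) \<le> e * norm h"
        using small[OF \<open>0 < e\<close>]
      proof eventually_elim
        case (elim n)
        have "norm (v n (y, t) \<bullet> h - G (y, t) \<bullet> h) \<le> e * norm h" for y h
        proof -
          have "norm (v n (y, t) - G (y, t)) \<le> e" using v[OF tS, of n y] elim by linarith
          then have "norm (v n (y, t) - G (y, t)) * norm h \<le> e * norm h" by (rule mult_right_mono) simp
          then show ?thesis using Cauchy_Schwarz_ineq2[of "v n (y, t) - G (y, t)" h] by (simp add: inner_diff_left)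
        qed
        then show ?case by blast
      qed
    next
      show "(\<lambda>n. u n (x, t)) \<longlonglongrightarrow> w (x, t)" by (rule lim)
    qed simp_all
    then obtain g where "\<forall>y\<in>UNIV. (\<lambda>n. u n (y, t)) \<longlonglongrightarrow> g y \<and> (g has_derivative (\<lambda>h. G (y, t) \<bullet> h)) (at y within UNIV)" ..
    then have g: "(\<lambda>n. u n (y, t)) \<longlonglongrightarrow> g y" "(g has_derivative (\<lambda>h. G (y, t) \<bullet> h)) (at y)" for y
      by simp_all
    have "g = (\<lambda>y. w (y, t))" by (rule ext) (rule LIMSEQ_unique[OF g(1) lim])
    then show "((\<lambda>y. w (y, t)) has_derivative (\<lambda>h. G (x, t) \<bullet> h)) (at x)" using g(2)[of x] by simp
  qed
qed

text \<open>The uniform rate passes through the potential by \<open>duh_bound_exp\<close> with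
  \<gamma> = 1, at the cost of the factor exp T.\<close>

lemma duh_limit:
  fixes w :: "nat \<Rightarrow> (real^2) \<times> real \<Rightarrow> 'b::euclidean_space"
  assumes cN: "\<And>n. continuous_on (spacetime T) (N n)" "continuous_on (spacetime T) Nl"
    and w: "\<And>n z. z \<in> spacetime T \<Longrightarrow> w (Suc n) z = g z + duh (N n) z"
    and lim: "\<And>z. z \<in> spacetime T \<Longrightarrow> (\<lambda>n. w n z) \<longlonglongrightarrow> l z"
    and N: "\<And>n z. z \<in> spacetime T \<Longrightarrow> norm (N n z - Nl z) \<le> C * \<rho> ^ n"
    and \<rho>: "0 < \<rho>" "\<rho> < 1" and C: "0 \<le> C" and z: "z \<in> spacetime T"
  shows "l z = g z + duh Nl z"
proof -
  have b: "norm (w (Suc n) z - (g z + duh Nl z)) \<le> C * exp T * \<rho> ^ n" for n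
  proof -
    have "w (Suc n) z - (g z + duh Nl z) = duh (\<lambda>z. N n z - Nl z) z"
      using w[OF z] duh_diff[OF cN z] by simp
    also have "norm \<dots> \<le> (C * \<rho> ^ n) * exp (1 * snd z) / 1\<^sup>2"
    proof (rule duh_bound_exp[OF _ z])
      show "continuous_on (spacetime T) (\<lambda>z. N n z - Nl z)" by (intro continuous_intros cN)
      fix \<tau> :: real and \<xi> :: "real^2" assume a: "0 \<le> \<tau>" "\<tau> \<le> snd z" "norm \<xi> \<le> 1"
      let ?y = "(fst z + (snd z - \<tau>) *\<^sub>R \<xi>, \<tau>)"
      have "norm (N n ?y - Nl ?y) \<le> C * \<rho> ^ n * 1" using N[of ?y n] a z by simp
      also have "\<dots> \<le> C * \<rho> ^ n * exp (1 * \<tau>)" using a C \<rho> by (intro mult_left_mono) auto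
      finally show "norm (N n ?y - Nl ?y) \<le> C * \<rho> ^ n * exp (1 * \<tau>)" .
    qed (use C \<rho> in auto)
    also have "\<dots> \<le> C * \<rho> ^ n * exp T" using z C \<rho> by (simp add: mult_left_mono)
    finally show ?thesis by (simp add: mult_ac)
  qed
  have "(\<lambda>n. C * exp T * \<rho> ^ n) \<longlonglongrightarrow> 0" using \<rho> by (intro tendsto_mult_right_zero LIMSEQ_realpow_zero) auto
  then have "(\<lambda>n. w (Suc n) z - (g z + duh Nl z)) \<longlonglongrightarrow> 0"
    by (rule Lim_null_comparison[rotated]) (use b in auto)
  then have "(\<lambda>n. w (Suc n) z) \<longlonglongrightarrow> g z + duh Nl z" by (simp add: LIM_zero_iff)
  moreover have "(\<lambda>n. w (Suc n) z) \<longlonglongrightarrow> l z" by (rule LIMSEQ_Suc[OF lim[OF z]])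
  ultimately show ?thesis using LIMSEQ_unique by blast
qed

section \<open>Picard iteration for values and gradients\<close>

fun picard_u :: "((real^2) \<times> real \<Rightarrow> real) \<Rightarrow> ((real^2) \<times> real \<Rightarrow> real \<Rightarrow> real) \<Rightarrow> nat \<Rightarrow> (real^2) \<times> real \<Rightarrow> real" where
  "picard_u g Nl 0 = (\<lambda>z. 0)"
| "picard_u g Nl (Suc n) = (\<lambda>z. g z + duh (\<lambda>z. Nl z (picard_u g Nl n z)) z)"

text \<open>The differentiated iteration: \<open>Nx\<close> and \<open>Nw\<close> stand for the
  space gradient of the nonlinearity at fixed argument and its derivative in that argument.\<close>

fun picard_v :: "((real^2) \<times> real \<Rightarrow> real^2) \<Rightarrow> ((real^2) \<times> real \<Rightarrow> real \<Rightarrow> real^2) \<Rightarrow> ((real^2) \<times> real \<Rightarrow> real \<Rightarrow> real)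
    \<Rightarrow> (nat \<Rightarrow> (real^2) \<times> real \<Rightarrow> real) \<Rightarrow> nat \<Rightarrow> (real^2) \<times> real \<Rightarrow> real^2" where
  "picard_v g' Nx Nw u 0 = (\<lambda>z. 0)"
| "picard_v g' Nx Nw u (Suc n) = (\<lambda>z. g' z + duh (\<lambda>z. Nx z (u n z) + Nw z (u n z) *\<^sub>R picard_v g' Nx Nw u n z) z)"

text \<open>Values converge at ratio 1/2 in the weighted norm. The equation for the gradients is
  affine in v, but its coefficient \<open>Nw\<close> is only Hoelder in u; the error it inherits
  from the values has ratio \<open>(1/2) powr \<alpha>\<close>, and gradients converge at that rate.
  The invariant ball is assumed here: its proof belongs to the weighted estimates. The equation for
  G is part of the conclusion because second derivatives are drawn from it.\<close>

lemma picard: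
  fixes g :: "(real^2) \<times> real \<Rightarrow> real"
  assumes g: "sgrad T g g'" and g': "\<And>z. z \<in> spacetime T \<Longrightarrow> norm (g' z) \<le> b0"
    and sg: "\<And>w G. sgrad T w G \<Longrightarrow> sgrad T (\<lambda>z. Nl z (w z)) (\<lambda>z. Nx z (w z) + Nw z (w z) *\<^sub>R G z)"
    and inv: "\<And>n z. z \<in> spacetime T \<Longrightarrow> \<bar>picard_u g Nl n z\<bar> \<le> B0"
    and pos: "0 \<le> B0" "0 \<le> B" "0 \<le> b0" and \<alpha>: "0 < \<alpha>" "\<alpha> \<le> 1"
    and lip: "\<And>z a b. z \<in> spacetime T \<Longrightarrow> \<bar>a\<bar> \<le> B0 \<Longrightarrow> \<bar>b\<bar> \<le> B0 \<Longrightarrow> \<bar>Nl z a - Nl z b\<bar> \<le> B * \<bar>a - b\<bar>"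
    and lipx: "\<And>z a b. z \<in> spacetime T \<Longrightarrow> \<bar>a\<bar> \<le> B0 \<Longrightarrow> \<bar>b\<bar> \<le> B0 \<Longrightarrow> norm (Nx z a - Nx z b) \<le> B * \<bar>a - b\<bar>"
    and hoelder: "\<And>z a b. z \<in> spacetime T \<Longrightarrow> \<bar>a\<bar> \<le> B0 \<Longrightarrow> \<bar>b\<bar> \<le> B0 \<Longrightarrow> \<bar>Nw z a - Nw z b\<bar> \<le> B * \<bar>a - b\<bar> powr \<alpha>"
    and bx: "\<And>z a. z \<in> spacetime T \<Longrightarrow> \<bar>a\<bar> \<le> B0 \<Longrightarrow> norm (Nx z a) \<le> B"
    and bw: "\<And>z a. z \<in> spacetime T \<Longrightarrow> \<bar>a\<bar> \<le> B0 \<Longrightarrow> \<bar>Nw z a\<bar> \<le> B"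
  shows "\<exists>w G M. sgrad T w G \<and> (\<forall>z\<in>spacetime T. w z = g z + duh (\<lambda>z. Nl z (w z)) z \<and> \<bar>w z\<bar> \<le> B0 \<and> norm (G z) \<le> M
    \<and> G z = g' z + duh (\<lambda>z. Nx z (w z) + Nw z (w z) *\<^sub>R G z) z)"
proof -
  define u where "u = picard_u g Nl"
  define v where "v = picard_v g' Nx Nw u"
  define N where "N n z = Nl z (u n z)" for n z
  define N' where "N' n z = Nx z (u n z) + Nw z (u n z) *\<^sub>R v n z" for n z
  have uS: "u (Suc n) z = g z + duh (N n) z" for n z unfolding u_def N_def[abs_def] by simp
  have vS: "v (Suc n) z = g' z + duh (N' n) z" for n z unfolding v_def N'_def[abs_def] by simp
  have suv: "sgrad T (u n) (v n)" for n
  proof (induction n)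
    case 0
    then show ?case using sgrad_const[of T 0] by (simp add: u_def v_def)
  next
    case (Suc n)
    have "sgrad T (\<lambda>z. g z + duh (N n) z) (\<lambda>z. g' z + duh (N' n) z)"
      unfolding N_def N'_def by (rule sgrad_add[OF g sgrad_duh[OF sg[OF Suc.IH]]])
    then show ?case unfolding uS[symmetric] vS[symmetric] by simp
  qed
  have sN: "sgrad T (N n) (N' n)" for n unfolding N_def[abs_def] N'_def[abs_def] by (rule sg[OF suv])
  note cN = sgradD(1)[OF sN] and cN' = sgradD(2)[OF sN]
  have ub: "\<bar>u n z\<bar> \<le> B0" if "z \<in> spacetime T" for n z using inv[OF that] by (simp add: u_def)
  have "\<exists>D'\<ge>0. \<forall>n. \<forall>z\<in>spacetime T. norm (u (Suc n) z - u n z) \<le> D' * (1/2) ^ n"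
  proof (rule geometric_increments[where N=N and B=B and D=0 and ?D0.0="2 * B0", OF cN uS])
    show "norm (N (Suc n) z - N n z) \<le> B * norm (u (Suc n) z - u n z) + 0 * (1/2) ^ n" if z: "z \<in> spacetime T" for n z
      using lip[OF z ub[OF z] ub[OF z], of "Suc n" n] by (simp add: N_def)
    show "norm (u 1 z - u 0 z) \<le> 2 * B0" if z: "z \<in> spacetime T" for z
      using ub[OF z, of 1] ub[OF z, of 0] by (simp add: abs_if split: if_splits)
  qed (use pos in auto)
  then obtain D1 where D1: "0 \<le> D1" "\<And>n z. z \<in> spacetime T \<Longrightarrow> norm (u (Suc n) z - u n z) \<le> D1 * (1/2) ^ n" by blast
  \<comment> \<open>Increments of the coefficient \<open>Nw\<close> multiply v itself, so the
    gradients must be bounded before their increments can be estimated.\<close>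
  have "\<exists>M\<ge>0. \<forall>n. \<forall>z\<in>spacetime T. norm (v n z) \<le> M"
  proof (rule bounded_iterates[where N=N' and B=B and D=B and ?D0.0=b0, OF cN' vS])
    show "norm (N' n z) \<le> B * norm (v n z) + B" if z: "z \<in> spacetime T" for n z
    proof -
      have "norm (N' n z) \<le> norm (Nx z (u n z)) + norm (Nw z (u n z) *\<^sub>R v n z)"
        unfolding N'_def by (rule norm_triangle_ineq)
      also have "\<dots> \<le> B + B * norm (v n z)"
        using bx[OF z ub[OF z]] bw[OF z ub[OF z]] by (intro add_mono) (auto intro: mult_right_mono)
      finally show ?thesis by simp
    qed
    show "norm (v 0 z) \<le> b0" for z using pos by (simp add: v_def)
  qed (use pos g' in auto)
  then obtain M where M: "0 \<le> M" "\<And>n z. z \<in> spacetime T \<Longrightarrow> norm (v n z) \<le> M" by blast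
  define \<rho> where "\<rho> = (1/2::real) powr \<alpha>"
  have \<rho>: "0 < \<rho>" "\<rho> < 1" unfolding \<rho>_def using \<alpha> powr_less_mono2[of \<alpha> "1/2" 1] by simp_all
  have half: "(1/2) ^ n \<le> \<rho> ^ n" for n
  proof (rule power_mono)
    show "1/2 \<le> \<rho>" unfolding \<rho>_def using powr_mono'[of \<alpha> 1 "1/2::real"] \<alpha> by simp
  qed simp
  have rho_pow: "((1/2::real) ^ n) powr \<alpha> = \<rho> ^ n" for n
    unfolding \<rho>_def by (simp add: powr_powr powr_realpow[symmetric] mult.commute)
  have Nw_step: "\<bar>Nw z (u (Suc n) z) - Nw z (u n z)\<bar> \<le> B * (D1 powr \<alpha> * \<rho> ^ n)" if z: "z \<in> spacetime T" for n z
  proof -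
    have "\<bar>Nw z (u (Suc n) z) - Nw z (u n z)\<bar> \<le> B * \<bar>u (Suc n) z - u n z\<bar> powr \<alpha>"
      by (rule hoelder[OF z ub[OF z] ub[OF z]])
    also have "\<dots> \<le> B * (D1 * (1/2) ^ n) powr \<alpha>"
      using D1(2)[OF z, of n] pos \<alpha> by (intro mult_left_mono powr_mono2) auto
    also have "(D1 * (1/2) ^ n) powr \<alpha> = D1 powr \<alpha> * \<rho> ^ n"
      unfolding rho_pow[symmetric] using D1(1) by (subst powr_mult) auto
    finally show ?thesis .
  qed
  \<comment> \<open>The forcing on the gradients: a Lipschitz change of \<open>Nx\<close> and a
    Hoelder change of \<open>Nw\<close> against the gradient bound M.\<close>
  define D where "D = B * D1 + B * D1 powr \<alpha> * M"
  have "\<exists>D'\<ge>0. \<forall>n. \<forall>z\<in>spacetime T. norm (v (Suc n) z - v n z) \<le> D' * \<rho> ^ n"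
  proof (rule geometric_increments[where N=N' and B=B and D=D and ?D0.0="2 * M", OF cN' vS])
    show "norm (N' (Suc n) z - N' n z) \<le> B * norm (v (Suc n) z - v n z) + D * \<rho> ^ n" if z: "z \<in> spacetime T" for n z
    proof -
      have e: "N' (Suc n) z - N' n z = (Nx z (u (Suc n) z) - Nx z (u n z)) + Nw z (u (Suc n) z) *\<^sub>R (v (Suc n) z - v n z)
        + (Nw z (u (Suc n) z) - Nw z (u n z)) *\<^sub>R v n z"
        unfolding N'_def by (simp add: algebra_simps)
      have "norm (N' (Suc n) z - N' n z) \<le> norm (Nx z (u (Suc n) z) - Nx z (u n z)) + norm (Nw z (u (Suc n) z) *\<^sub>R (v (Suc n) z - v n z))
        + norm ((Nw z (u (Suc n) z) - Nw z (u n z)) *\<^sub>R v n z)"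
        unfolding e by (rule order_trans[OF norm_triangle_ineq]) (rule add_right_mono[OF norm_triangle_ineq])
      also have "\<dots> \<le> B * (D1 * \<rho> ^ n) + B * norm (v (Suc n) z - v n z) + B * (D1 powr \<alpha> * \<rho> ^ n) * M"
      proof (intro add_mono)
        have "norm (Nx z (u (Suc n) z) - Nx z (u n z)) \<le> B * \<bar>u (Suc n) z - u n z\<bar>" by (rule lipx[OF z ub[OF z] ub[OF z]])
        also have "\<dots> \<le> B * (D1 * (1/2) ^ n)" using D1(2)[OF z, of n] pos by (intro mult_left_mono) auto
        also have "\<dots> \<le> B * (D1 * \<rho> ^ n)" using half pos D1 by (intro mult_left_mono) auto
        finally show "norm (Nx z (u (Suc n) z) - Nx z (u n z)) \<le> B * (D1 * \<rho> ^ n)" .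
        show "norm (Nw z (u (Suc n) z) *\<^sub>R (v (Suc n) z - v n z)) \<le> B * norm (v (Suc n) z - v n z)"
          using bw[OF z ub[OF z], of "Suc n"] by (simp add: mult_right_mono)
        show "norm ((Nw z (u (Suc n) z) - Nw z (u n z)) *\<^sub>R v n z) \<le> B * (D1 powr \<alpha> * \<rho> ^ n) * M"
          using Nw_step[OF z, of n] M(2)[OF z, of n] pos \<rho> by (simp only: norm_scaleR real_norm_def) (intro mult_mono, auto)
      qed
      also have "\<dots> = B * norm (v (Suc n) z - v n z) + D * \<rho> ^ n" by (simp add: D_def algebra_simps)
      finally show ?thesis .
    qed
    show "norm (v 1 z - v 0 z) \<le> 2 * M" if z: "z \<in> spacetime T" for z
      using norm_triangle_ineq4[of "v 1 z" "v 0 z"] M(2)[OF z, of 1] M(2)[OF z, of 0] by linarith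
    show "0 \<le> D" using pos D1(1) M(1) by (simp add: D_def)
  qed (use pos M \<rho> in auto)
  then obtain D2 where D2: "0 \<le> D2" "\<And>n z. z \<in> spacetime T \<Longrightarrow> norm (v (Suc n) z - v n z) \<le> D2 * \<rho> ^ n" by blast
  obtain w where w0: "\<forall>n. \<forall>z\<in>spacetime T. norm (u n z - w z) \<le> D1 / (1 - 1/2) * (1/2) ^ n"
    using geometric_limit[of "spacetime T" u D1 "1/2"] D1(2) by auto
  obtain G where G0: "\<forall>n. \<forall>z\<in>spacetime T. norm (v n z - G z) \<le> D2 / (1 - \<rho>) * \<rho> ^ n"
    using geometric_limit[of "spacetime T" v D2 \<rho>] D2(2) \<rho> by auto
  define C where "C = 2 * D1 + D2 / (1 - \<rho>)"
  have C: "0 \<le> C" using D1 D2 \<rho> by (simp add: C_def)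
  have w: "norm (u n z - w z) \<le> 2 * D1 * (1/2) ^ n" if "z \<in> spacetime T" for n z
    using bspec[OF spec[OF w0, of n] that] by (simp add: mult.commute)
  have wC: "norm (u n z - w z) \<le> C * \<rho> ^ n" if z: "z \<in> spacetime T" for n z
  proof -
    have "2 * D1 * (1/2) ^ n \<le> C * \<rho> ^ n"
      using half[of n] D1 D2 \<rho> by (intro mult_mono) (auto simp: C_def)
    then show ?thesis using w[OF z, of n] by linarith
  qed
  have GC: "norm (v n z - G z) \<le> C * \<rho> ^ n" if z: "z \<in> spacetime T" for n z
  proof -
    have "D2 / (1 - \<rho>) * \<rho> ^ n \<le> C * \<rho> ^ n" using D1 \<rho> by (intro mult_right_mono) (auto simp: C_def)
    then show ?thesis using bspec[OF spec[OF G0, of n] z] by linarith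
  qed
  have swG: "sgrad T w G" by (rule sgrad_limit[OF suv wC GC \<rho>])
  have zero: "(\<lambda>n. C * \<rho> ^ n) \<longlonglongrightarrow> 0" using \<rho> by (intro tendsto_mult_right_zero LIMSEQ_realpow_zero) auto
  have limu: "(\<lambda>n. u n z) \<longlonglongrightarrow> w z" if z: "z \<in> spacetime T" for z
    by (rule LIM_zero_cancel, rule Lim_null_comparison[OF _ zero]) (use wC[OF z] in auto)
  have limv: "(\<lambda>n. v n z) \<longlonglongrightarrow> G z" if z: "z \<in> spacetime T" for z
    by (rule LIM_zero_cancel, rule Lim_null_comparison[OF _ zero]) (use GC[OF z] in auto)
  have wb: "\<bar>w z\<bar> \<le> B0" if z: "z \<in> spacetime T" for z
    by (rule LIMSEQ_le_const2[OF tendsto_rabs[OF limu[OF z]]]) (use ub[OF z] in auto)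
  have Gb: "norm (G z) \<le> M" if z: "z \<in> spacetime T" for z
    by (rule LIMSEQ_le_const2[OF tendsto_norm[OF limv[OF z]]]) (use M(2)[OF z] in auto)
  have sNl: "sgrad T (\<lambda>z. Nl z (w z)) (\<lambda>z. Nx z (w z) + Nw z (w z) *\<^sub>R G z)" by (rule sg[OF swG])
  have eq1: "w z = g z + duh (\<lambda>z. Nl z (w z)) z" if z: "z \<in> spacetime T" for z
  proof (rule duh_limit[where N=N and w=u and C="B * C" and \<rho>=\<rho>, OF cN sgradD(1)[OF sNl] uS limu _ \<rho> _ z])
    show "norm (N n z - Nl z (w z)) \<le> B * C * \<rho> ^ n" if z: "z \<in> spacetime T" for n z
    proof -
      have "norm (N n z - Nl z (w z)) \<le> B * \<bar>u n z - w z\<bar>" unfolding N_def using lip[OF z ub[OF z] wb[OF z]] by simp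
      also have "\<dots> \<le> B * (C * \<rho> ^ n)" using wC[OF z, of n] pos by (intro mult_left_mono) auto
      finally show ?thesis by simp
    qed
  qed (use C pos in auto)
  define C2 where "C2 = B * C + B * C + B * (2 * D1) powr \<alpha> * M"
  have eq2: "G z = g' z + duh (\<lambda>z. Nx z (w z) + Nw z (w z) *\<^sub>R G z) z" if z: "z \<in> spacetime T" for z
  proof (rule duh_limit[where N=N' and w=v and C=C2 and \<rho>=\<rho>, OF cN' sgradD(2)[OF sNl] vS limv _ \<rho> _ z])
    show "norm (N' n z - (Nx z (w z) + Nw z (w z) *\<^sub>R G z)) \<le> C2 * \<rho> ^ n" if z: "z \<in> spacetime T" for n z
    proof -
      have e: "N' n z - (Nx z (w z) + Nw z (w z) *\<^sub>R G z) = (Nx z (u n z) - Nx z (w z)) + Nw z (u n z) *\<^sub>R (v n z - G z)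
        + (Nw z (u n z) - Nw z (w z)) *\<^sub>R G z"
        unfolding N'_def by (simp add: algebra_simps)
      have "norm (N' n z - (Nx z (w z) + Nw z (w z) *\<^sub>R G z)) \<le> norm (Nx z (u n z) - Nx z (w z)) + norm (Nw z (u n z) *\<^sub>R (v n z - G z))
        + norm ((Nw z (u n z) - Nw z (w z)) *\<^sub>R G z)"
        unfolding e by (rule order_trans[OF norm_triangle_ineq]) (rule add_right_mono[OF norm_triangle_ineq])
      also have "\<dots> \<le> B * (C * \<rho> ^ n) + B * (C * \<rho> ^ n) + B * ((2 * D1) powr \<alpha> * \<rho> ^ n) * M"
      proof (intro add_mono)
        have "norm (Nx z (u n z) - Nx z (w z)) \<le> B * \<bar>u n z - w z\<bar>" by (rule lipx[OF z ub[OF z] wb[OF z]])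
        also have "\<dots> \<le> B * (C * \<rho> ^ n)" using wC[OF z, of n] pos by (intro mult_left_mono) auto
        finally show "norm (Nx z (u n z) - Nx z (w z)) \<le> B * (C * \<rho> ^ n)" .
        show "norm (Nw z (u n z) *\<^sub>R (v n z - G z)) \<le> B * (C * \<rho> ^ n)"
          using bw[OF z ub[OF z], of n] GC[OF z, of n] pos by (simp only: norm_scaleR real_norm_def) (intro mult_mono, auto)
        have "\<bar>Nw z (u n z) - Nw z (w z)\<bar> \<le> B * \<bar>u n z - w z\<bar> powr \<alpha>" by (rule hoelder[OF z ub[OF z] wb[OF z]])
        also have "\<dots> \<le> B * (2 * D1 * (1/2) ^ n) powr \<alpha>"
          using w[OF z, of n] pos \<alpha> by (intro mult_left_mono powr_mono2) auto
        also have "(2 * D1 * (1/2) ^ n) powr \<alpha> = (2 * D1) powr \<alpha> * \<rho> ^ n"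
          unfolding rho_pow[symmetric] using D1(1) by (subst powr_mult) auto
        finally show "norm ((Nw z (u n z) - Nw z (w z)) *\<^sub>R G z) \<le> B * ((2 * D1) powr \<alpha> * \<rho> ^ n) * M"
          using Gb[OF z] pos \<rho> by (simp only: norm_scaleR real_norm_def) (intro mult_mono, auto)
      qed
      also have "\<dots> = C2 * \<rho> ^ n" by (simp add: C2_def algebra_simps)
      finally show ?thesis .
    qed
    show "0 \<le> C2" using C pos M by (simp add: C2_def)
  qed
  show ?thesis
    by (intro exI[of _ w] exI[of _ G] exI[of _ M] conjI ballI swG eq1 wb Gb eq2; assumption)
qed

section \<open>The nonlinearity and the a priori bound\<close>

definition sgp :: "real \<Rightarrow> real \<Rightarrow> real" where
  "sgp \<alpha> a = sgn a * \<bar>a\<bar> powr \<alpha>"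

text \<open>For u in [0, s] the ratio u / s lies in [0, 1] and is at most its \<alpha>-th power;
  adding this for x and y with s = x + y gives the claim.\<close>

lemma powr_subadditive:
  fixes x y :: real
  assumes "0 \<le> x" "0 \<le> y" and \<alpha>: "0 < \<alpha>" "\<alpha> \<le> 1"
  shows "(x + y) powr \<alpha> \<le> x powr \<alpha> + y powr \<alpha>"
proof (cases "x + y = 0")
  case True
  then show ?thesis using assms by simp
next
  case False
  define s where "s = x + y"
  have s: "0 < s" using False assms by (simp add: s_def)
  have le: "u / s \<le> u powr \<alpha> / s powr \<alpha>" if "0 \<le> u" "u \<le> s" for u
  proof -
    have "(u / s) powr 1 \<le> (u / s) powr \<alpha>" using that s \<alpha> by (intro powr_mono') auto
    then show ?thesis using that s by (simp add: powr_divide)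
  qed
  have "1 = x / s + y / s" using s by (simp add: s_def add_divide_distrib[symmetric])
  also have "\<dots> \<le> (x powr \<alpha> + y powr \<alpha>) / s powr \<alpha>"
    using le[of x] le[of y] assms by (simp add: s_def add_divide_distrib)
  finally show ?thesis using s by (simp add: s_def[symmetric] field_simps)
qed

text \<open>For equal signs this is subadditivity. For opposite signs |a - b| is the sum of the
  absolute values and dominates each of them, which costs the factor 2.\<close>

lemma sgp_hoelder:
  assumes \<alpha>: "0 < \<alpha>" "\<alpha> \<le> 1"
  shows "\<bar>sgp \<alpha> a - sgp \<alpha> b\<bar> \<le> 2 * \<bar>a - b\<bar> powr \<alpha>"
proof -
  have d1: "\<bar>x powr \<alpha> - y powr \<alpha>\<bar> \<le> (x - y) powr \<alpha>" if "0 \<le> y" "y \<le> x" for x y :: real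
    using powr_subadditive[of y "x - y" \<alpha>] powr_mono2[of \<alpha> y x] that \<alpha> by simp
  have d2: "\<bar>x powr \<alpha> - y powr \<alpha>\<bar> \<le> \<bar>x - y\<bar> powr \<alpha>" if "0 \<le> y" "0 \<le> x" for x y :: real
  proof (cases "y \<le> x")
    case True
    then show ?thesis using d1[of y x] that by simp
  next
    case False
    then show ?thesis using d1[of x y] that by (simp add: abs_minus_commute)
  qed
  have mixed: "x powr \<alpha> + y powr \<alpha> \<le> 2 * (x + y) powr \<alpha>" if "0 \<le> y" "0 \<le> x" for x y :: real
    using powr_mono2[of \<alpha> x "x + y"] powr_mono2[of \<alpha> y "x + y"] that \<alpha> by simp
  have pos: "sgp \<alpha> x = x powr \<alpha>" if "0 \<le> x" for x using that by (cases "x = 0") (auto simp: sgp_def)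
  have neg: "sgp \<alpha> x = - ((- x) powr \<alpha>)" if "x \<le> 0" for x using that by (cases "x = 0") (auto simp: sgp_def)
  consider "0 \<le> a" "0 \<le> b" | "a \<le> 0" "b \<le> 0" | "0 \<le> a" "b \<le> 0" | "a \<le> 0" "0 \<le> b" by linarith
  then show ?thesis
  proof cases
    case 1
    have "0 \<le> \<bar>a - b\<bar> powr \<alpha>" by simp
    with d2[OF 1(2) 1(1)] show ?thesis unfolding pos[OF 1(1)] pos[OF 1(2)] by linarith
  next
    case 2
    have "0 \<le> \<bar>a - b\<bar> powr \<alpha>" by simp
    moreover have "\<bar>- a - - b\<bar> = \<bar>a - b\<bar>" by simp
    ultimately show ?thesis using d2[of "- b" "- a"] 2 unfolding neg[OF 2(1)] neg[OF 2(2)] by simp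
  next
    case 3
    then have "\<bar>a - b\<bar> = a + - b" by simp
    with mixed[of "- b" a] 3 show ?thesis unfolding pos[OF 3(1)] neg[OF 3(2)] by simp
  next
    case 4
    then have "(- a) powr \<alpha> + b powr \<alpha> \<le> 2 * \<bar>a - b\<bar> powr \<alpha>" using mixed[of b "- a"] by simp
    moreover have "0 \<le> (- a) powr \<alpha>" "0 \<le> b powr \<alpha>" by simp_all
    ultimately show ?thesis unfolding neg[OF 4(1)] pos[OF 4(2)] by linarith
  qed
qed

lemma continuous_on_sgp:
  assumes \<alpha>: "0 < \<alpha>" "\<alpha> \<le> 1"
  shows "continuous_on UNIV (sgp \<alpha>)"
proof (rule continuous_at_imp_continuous_on, rule ballI)
  fix b
  have "((\<lambda>a. 2 * \<bar>a - b\<bar> powr \<alpha>) \<longlongrightarrow> 2 * 0) (at b)"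
    by (intro tendsto_intros tendsto_zero_powrI[OF _ tendsto_const] tendsto_rabs_zero LIM_zero) (use \<alpha> in auto)
  then have z: "((\<lambda>a. 2 * \<bar>a - b\<bar> powr \<alpha>) \<longlongrightarrow> 0) (at b)" by simp
  have "((\<lambda>a. sgp \<alpha> a - sgp \<alpha> b) \<longlongrightarrow> 0) (at b)"
    by (rule Lim_null_comparison[OF _ z]) (simp add: sgp_hoelder[OF \<alpha>])
  then show "isCont (sgp \<alpha>) b" unfolding isCont_def by (rule LIM_zero_cancel)
qed

lemma abs_powr_deriv:
  assumes p: "1 < p"
  shows "((\<lambda>a. \<bar>a\<bar> powr p) has_real_derivative p * sgp (p - 1) a) (at a)"
proof -
  consider "0 < a" | "a < 0" | "a = 0" by linarith
  then show ?thesis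
  proof cases
    case 1
    have "((\<lambda>a. a powr p) has_real_derivative p * sgp (p - 1) a) (at a)"
      using has_real_derivative_powr[OF 1, of p] 1 by (simp add: sgp_def)
    then show ?thesis
      by (rule has_field_derivative_transform_within_open[where S="{0<..}"]) (use 1 in auto)
  next
    case 2
    have "((\<lambda>a. (- a) powr p) has_real_derivative p * sgp (p - 1) a) (at a)"
      using DERIV_chain2[OF has_real_derivative_powr[of "- a" p] DERIV_minus[OF DERIV_ident]] 2 by (simp add: sgp_def)
    then show ?thesis
      by (rule has_field_derivative_transform_within_open[where S="{..<0}"]) (use 2 in auto)
  next
    case 3
    have z: "((\<lambda>h::real. \<bar>h\<bar> powr (p - 1)) \<longlongrightarrow> 0) (at 0)"
      by (intro tendsto_zero_powrI[OF _ tendsto_const] tendsto_rabs_zero tendsto_ident_at) (use p in auto)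
    have "((\<lambda>h. \<bar>h\<bar> powr p / h) \<longlongrightarrow> 0) (at (0::real))"
    proof (rule Lim_null_comparison[OF _ z])
      have "norm (\<bar>h\<bar> powr p / h) \<le> \<bar>h\<bar> powr (p - 1)" for h :: real
        by (cases "h = 0") (auto simp: powr_diff)
      then show "\<forall>\<^sub>F h in at (0::real). norm (\<bar>h\<bar> powr p / h) \<le> \<bar>h\<bar> powr (p - 1)" by simp
    qed
    then show ?thesis unfolding 3 has_field_derivative_iff by (simp add: sgp_def)
  qed
qed

lemma abs_powr_lipschitz:
  fixes a b B p :: real
  assumes p: "1 < p" and a: "\<bar>a\<bar> \<le> B" and b: "\<bar>b\<bar> \<le> B"
  shows "\<bar>\<bar>a\<bar> powr p - \<bar>b\<bar> powr p\<bar> \<le> p * B powr (p - 1) * \<bar>a - b\<bar>"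
proof -
  have "norm (\<bar>a\<bar> powr p - \<bar>b\<bar> powr p) \<le> p * B powr (p - 1) * norm (a - b)"
  proof (rule field_differentiable_bound[where S="{-B..B}" and f="\<lambda>a. \<bar>a\<bar> powr p" and f'="\<lambda>a. p * sgp (p - 1) a"])
    show "((\<lambda>a. \<bar>a\<bar> powr p) has_field_derivative p * sgp (p - 1) z) (at z within {-B..B})" for z
      by (rule has_field_derivative_at_within[OF abs_powr_deriv[OF p]])
    show "norm (p * sgp (p - 1) z) \<le> p * B powr (p - 1)" if "z \<in> {-B..B}" for z
    proof -
      have "\<bar>z\<bar> powr (p - 1) \<le> B powr (p - 1)" using that p by (intro powr_mono2) auto
      then show ?thesis using p by (auto simp: sgp_def abs_mult sgn_if)
    qed
  qed (use a b in auto)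
  then show ?thesis by simp
qed

section \<open>The source term on the cone and the invariant bound\<close>

definition nlin :: "real \<Rightarrow> (real^2) \<times> real \<Rightarrow> real \<Rightarrow> real" where
  "nlin p z a = \<bar>a\<bar> powr p / (1 + snd z) powr (p - 1)"

lemma wt_cone:
  assumes k: "1 \<le> k" and z: "z \<in> cone k"
  shows "0 < wt k z" "wt k z \<le> 1" "wt k z = (qq (shift k z) * (snd z + (k + 2))) powr (-1/2)"
proof -
  have t: "0 \<le> snd z" using z by (simp add: cone_def)
  have "2 * 3 \<le> qq (shift k z) * (snd z + (k + 2))"
    using cone_qq(1)[OF k z] t k by (intro mult_mono) auto
  then have b: "6 \<le> qq (shift k z) * (snd z + (k + 2))" by simp
  have e: "(snd z + (k + 2))\<^sup>2 - fst z \<bullet> fst z = qq (shift k z) * (snd z + (k + 2))"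
    using cone_qq(3)[OF k z] by (simp add: shift_def add_ac)
  show "0 < wt k z" using b by (simp add: wt_def e)
  have "1 \<le> sqrt (qq (shift k z) * (snd z + (k + 2)))" using b by simp
  then show "wt k z \<le> 1" by (simp add: wt_def e)
  show "wt k z = (qq (shift k z) * (snd z + (k + 2))) powr (-1/2)"
    unfolding wt_def e using powr_minus_half[of "qq (shift k z) * (snd z + (k + 2))"] b by simp
qed

text \<open>For |a| \<le> E w the p-th power is bounded by
  \<open>E powr p * (q * \<tau>) powr (- p / 2)\<close>, and 1 + t is comparable to \<tau> up to k +
  2. The total power of \<tau> is -p/2 + 1 - p = 3 (2 - p) / 2 - 2, whose excess over -2 is paid at
  the final time. The power -p/2 of q is at most \<beta> - 1 by the condition on \<beta>, since q
  \<ge> 2.\<close>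

lemma nlin_cone_bound:
  assumes k: "1 \<le> k" and z: "z \<in> cone k" and p: "1 < p" "p \<le> 2" and \<beta>: "2 - p \<le> 2 * \<beta>"
    and E: "0 \<le> E" and a: "\<bar>a\<bar> \<le> E * wt k z" and T: "snd z \<le> T"
  shows "\<bar>nlin p z a\<bar> \<le> (E powr p * (k + 2) * (T + (k + 2)) powr (3 * (2 - p) / 2))
    * (qq (shift k z) powr (\<beta> - 1) / (snd z + (k + 2))\<^sup>2)"
proof -
  define q \<tau> where "q = qq (shift k z)" and "\<tau> = snd z + (k + 2)"
  have t: "0 \<le> snd z" using z by (simp add: cone_def)
  have q: "2 \<le> q" using cone_qq(1)[OF k z] by (simp add: q_def)
  have \<tau>: "3 \<le> \<tau>" "\<tau> \<le> T + (k + 2)" using t k T by (auto simp: \<tau>_def)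
  have "\<bar>a\<bar> powr p \<le> (E * wt k z) powr p" using a p by (intro powr_mono2) auto
  also have "\<dots> = E powr p * wt k z powr p" using E wt_cone(1)[OF k z] by (simp add: powr_mult)
  also have "wt k z powr p = q powr (- p / 2) * \<tau> powr (- p / 2)"
    unfolding wt_cone(3)[OF k z] q_def[symmetric] \<tau>_def[symmetric] using q \<tau> by (simp add: powr_powr powr_mult)
  finally have 1: "\<bar>a\<bar> powr p \<le> E powr p * (q powr (- p / 2) * \<tau> powr (- p / 2))" .
  have "\<tau> \<le> (k + 2) * (1 + snd z)" using t k by (simp add: \<tau>_def algebra_simps)
  then have "\<tau> powr (p - 1) \<le> ((k + 2) * (1 + snd z)) powr (p - 1)" using p \<tau> by (intro powr_mono2) auto
  also have "\<dots> = (k + 2) powr (p - 1) * (1 + snd z) powr (p - 1)" using k t by (simp add: powr_mult)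
  also have "\<dots> \<le> (k + 2) * (1 + snd z) powr (p - 1)"
    using powr_mono[of "p - 1" 1 "k + 2"] k p by (intro mult_right_mono) auto
  finally have "\<tau> powr (p - 1) \<le> (k + 2) * (1 + snd z) powr (p - 1)" .
  then have "1 / (1 + snd z) powr (p - 1) \<le> (k + 2) / \<tau> powr (p - 1)"
    using \<tau> t by (simp add: field_simps)
  also have "\<dots> = (k + 2) * \<tau> powr (1 - p)" using powr_minus_divide[of \<tau> "p - 1"] by simp
  finally have 2: "1 / (1 + snd z) powr (p - 1) \<le> (k + 2) * \<tau> powr (1 - p)" .
  have "q powr (- p / 2) = q powr (\<beta> - 1) * q powr (1 - p / 2 - \<beta>)" by (simp add: powr_add[symmetric])
  also have "\<dots> \<le> q powr (\<beta> - 1) * 1"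
    using powr_mono[of "1 - p / 2 - \<beta>" 0 q] q \<beta> by (intro mult_left_mono) auto
  finally have 3: "q powr (- p / 2) \<le> q powr (\<beta> - 1)" by simp
  have "\<tau> powr (- p / 2) * \<tau> powr (1 - p) = \<tau> powr (3 * (2 - p) / 2) * \<tau> powr (- 2)"
    unfolding powr_add[symmetric] by (rule arg_cong[where f="\<lambda>e. \<tau> powr e"]) (simp add: field_simps)
  also have "\<dots> \<le> (T + (k + 2)) powr (3 * (2 - p) / 2) * \<tau> powr (- 2)"
    using \<tau> p by (intro mult_right_mono powr_mono2) auto
  also have "\<tau> powr (- 2) = 1 / \<tau>\<^sup>2" using \<tau> by (simp add: powr_minus_divide powr_numeral)
  finally have 4: "\<tau> powr (- p / 2) * \<tau> powr (1 - p) \<le> (T + (k + 2)) powr (3 * (2 - p) / 2) * (1 / \<tau>\<^sup>2)" .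
  have "\<bar>nlin p z a\<bar> = \<bar>a\<bar> powr p * (1 / (1 + snd z) powr (p - 1))" using t by (simp add: nlin_def)
  also have "\<dots> \<le> (E powr p * (q powr (- p / 2) * \<tau> powr (- p / 2))) * ((k + 2) * \<tau> powr (1 - p))"
    by (rule mult_mono[OF 1 2]) auto
  also have "\<dots> = E powr p * (k + 2) * (q powr (- p / 2) * (\<tau> powr (- p / 2) * \<tau> powr (1 - p)))" by (simp add: mult_ac)
  also have "\<dots> \<le> E powr p * (k + 2) * (q powr (\<beta> - 1) * ((T + (k + 2)) powr (3 * (2 - p) / 2) * (1 / \<tau>\<^sup>2)))"
    by (intro mult_left_mono mult_mono 3 4) (use k in auto)
  finally show ?thesis by (simp add: q_def \<tau>_def mult_ac)
qed

lemma duh_outside: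
  fixes F :: "(real^2) \<times> real \<Rightarrow> 'b::euclidean_space"
  assumes cF: "continuous_on (spacetime T) F"
    and out: "\<And>z. z \<in> spacetime T \<Longrightarrow> z \<notin> cone k \<Longrightarrow> F z = 0" and z: "z \<in> spacetime T" "z \<notin> cone k"
  shows "duh F z = 0"
proof -
  have "(\<integral>\<xi>. (snd z - \<tau>) *\<^sub>R F (fst z + (snd z - \<tau>) *\<^sub>R \<xi>, \<tau>) \<partial>disk) = (\<integral>\<xi>. 0 \<partial>disk)" if \<tau>: "\<tau> \<in> {0..snd z}" for \<tau>
  proof (rule disk_integral_cong)
    fix \<xi> :: "real^2" assume "norm \<xi> \<le> 1"
    then have "\<tau> + k < norm (fst z + (snd z - \<tau>) *\<^sub>R \<xi>)"
      by (rule outside_cone) (use \<tau> z in \<open>auto simp: cone_def\<close>)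
    then have "F (fst z + (snd z - \<tau>) *\<^sub>R \<xi>, \<tau>) = 0" using \<tau> z by (intro out) (auto simp: cone_def)
    then show "(snd z - \<tau>) *\<^sub>R F (fst z + (snd z - \<tau>) *\<^sub>R \<xi>, \<tau>) = 0" by simp
  next
    show "continuous_on UNIV (\<lambda>\<xi>. (snd z - \<tau>) *\<^sub>R F (fst z + (snd z - \<tau>) *\<^sub>R \<xi>, \<tau>))"
      by (intro continuous_intros continuous_on_kernel_slice[OF cF]) (use \<tau> z in auto)
  qed (rule continuous_on_const)
  then have "duh F z = integral {0..snd z} (\<lambda>\<tau>. 0)" unfolding duh_def by (intro integral_cong) simp
  then show ?thesis by simp
qed

text \<open>
  With \<open>\<beta> = (2 - p) / 2\<close> this is the polynomial lifespan.  For \<open>p = 2\<close> the choice \<open>\<beta> = 1 / ln (T + k + 2)\<close> makes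
  \<open>(T + k + 2) powr \<beta>\<close> equal to \<open>e\<close>, and the loss \<open>1 / \<beta>\<^sup>2\<close> becomes the squared logarithm behind
  \<open>exp (c \<epsilon> powr (-1/2))\<close>.
\<close>

definition small :: "real \<Rightarrow> real \<Rightarrow> real \<Rightarrow> real \<Rightarrow> real \<Rightarrow> bool" where
  "small p k T \<beta> E \<longleftrightarrow> 0 < \<beta> \<and> 2 - p \<le> 2 * \<beta> \<and>
    4 * (E powr p * (k + 2) * (T + (k + 2)) powr (3 * (2 - p) / 2)) / \<beta> * ((\<beta> + 2) / \<beta> * (T + (k + 2)) powr \<beta>) \<le> E / 2"

lemma continuous_on_nlin:
  assumes p: "1 < p" and c: "continuous_on (spacetime T) u"
  shows "continuous_on (spacetime T) (\<lambda>z. nlin p z (u z))"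
  unfolding nlin_def by (intro continuous_intros continuous_on_powr' c) (use p in auto)

text \<open>\<open>small\<close> is the inequality left over when the bound of
  \<open>nlin_cone_bound\<close> is fed into \<open>duh_weighted\<close> and q is replaced by its
  largest possible value T + k + 2.\<close>

lemma duh_nlin_cone:
  assumes k: "1 \<le> k" and p: "1 < p" "p \<le> 2" and E: "0 \<le> E" and s: "small p k T \<beta> E"
    and c: "continuous_on (spacetime T) u" and out: "\<And>z. z \<in> spacetime T \<Longrightarrow> z \<notin> cone k \<Longrightarrow> u z = 0"
    and u: "\<And>z. z \<in> spacetime T \<Longrightarrow> z \<in> cone k \<Longrightarrow> \<bar>u z\<bar> \<le> E * wt k z"
    and z: "z \<in> spacetime T" "z \<in> cone k"
  shows "\<bar>duh (\<lambda>z. nlin p z (u z)) z\<bar> \<le> E / 2 * wt k z"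
proof -
  have \<beta>: "0 < \<beta>" "2 - p \<le> 2 * \<beta>" using s by (auto simp: small_def)
  define M where "M = E powr p * (k + 2) * (T + (k + 2)) powr (3 * (2 - p) / 2)"
  have M: "0 \<le> M" using k by (simp add: M_def)
  have "\<bar>duh (\<lambda>z. nlin p z (u z)) z\<bar> \<le> 4 * M / \<beta> * ((\<beta> + 2) / \<beta> * (qq (shift k z) powr \<beta> * wt k z))"
  proof (rule duh_weighted[OF k \<beta>(1) M continuous_on_nlin[OF p(1) c] _ _ z])
    show "nlin p z (u z) = 0" if "z \<in> spacetime T" "z \<notin> cone k" for z
      using out[OF that] by (simp add: nlin_def)
    show "\<bar>nlin p z (u z)\<bar> \<le> M * (qq (shift k z) powr (\<beta> - 1) / (snd z + (k + 2))\<^sup>2)" if "z \<in> spacetime T" "z \<in> cone k" for z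
      unfolding M_def by (rule nlin_cone_bound[OF k that(2) p \<beta>(2) E u[OF that]]) (use that(1) in simp)
  qed
  also have "\<dots> \<le> 4 * M / \<beta> * ((\<beta> + 2) / \<beta> * ((T + (k + 2)) powr \<beta> * wt k z))"
  proof -
    have "qq (shift k z) powr \<beta> \<le> (T + (k + 2)) powr \<beta>"
      using cone_qq(1,2)[OF k z(2)] z(1) \<beta> by (intro powr_mono2) auto
    then have "qq (shift k z) powr \<beta> * wt k z \<le> (T + (k + 2)) powr \<beta> * wt k z"
      using wt_cone(1)[OF k z(2)] by (intro mult_right_mono) auto
    then show ?thesis using M \<beta> by (intro mult_left_mono) auto
  qed
  also have "\<dots> = (4 * M / \<beta> * ((\<beta> + 2) / \<beta> * (T + (k + 2)) powr \<beta>)) * wt k z" by (simp add: mult_ac)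
  also have "\<dots> \<le> E / 2 * wt k z"
    using s wt_cone(1)[OF k z(2)] unfolding small_def M_def by (intro mult_right_mono) auto
  finally show ?thesis .
qed

text \<open>With E = 2 A \<epsilon> the linear part uses one half of E w and the nonlinear response
  the other, so the bound reproduces itself; vanishing outside the cone is carried along because the
  weight controls nothing there. The weight is dropped at the end since w \<le> 1.\<close>

lemma (in free_wave) apriori:
  assumes p: "1 < p" "p \<le> 2" and e: "0 < \<epsilon>" and A: "0 < A" "\<forall>z\<in>cone k. \<bar>UL z\<bar> \<le> A * wt k z"
    and s: "small p k T \<beta> (2 * A * \<epsilon>)" and z: "z \<in> spacetime T"
  shows "\<bar>picard_u (\<lambda>z. \<epsilon> * UL z) (nlin p) n z\<bar> \<le> 2 * A * \<epsilon>"
proof -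
  let ?u = "picard_u (\<lambda>z. \<epsilon> * UL z) (nlin p)"
  have cUL: "continuous_on (spacetime T) UL"
    by (rule C_on_imp_continuous_on[OF C_on_subset[OF C2_UL]]) simp
  have ind: "continuous_on (spacetime T) (?u n) \<and> (\<forall>z\<in>spacetime T. z \<notin> cone k \<longrightarrow> ?u n z = 0)
    \<and> (\<forall>z\<in>spacetime T. z \<in> cone k \<longrightarrow> \<bar>?u n z\<bar> \<le> 2 * A * \<epsilon> * wt k z)"
  proof (induction n)
    case 0
    show ?case using wt_cone(1)[OF k1] A(1) e by (auto simp: less_imp_le)
  next
    case (Suc n)
    from Suc.IH have c: "continuous_on (spacetime T) (?u n)" by blast
    from Suc.IH have out: "?u n z = 0" if "z \<in> spacetime T" "z \<notin> cone k" for z using that by blast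
    from Suc.IH have u: "\<bar>?u n z\<bar> \<le> 2 * A * \<epsilon> * wt k z" if "z \<in> spacetime T" "z \<in> cone k" for z using that by blast
    have "continuous_on (spacetime T) (?u (Suc n))"
      unfolding picard_u.simps by (intro continuous_intros cUL continuous_on_duh continuous_on_nlin p c)
    moreover have "?u (Suc n) z = 0" if z: "z \<in> spacetime T" "z \<notin> cone k" for z
    proof -
      have "duh (\<lambda>z. nlin p z (?u n z)) z = 0"
        by (rule duh_outside[OF continuous_on_nlin[OF p(1) c] _ z]) (simp add: out nlin_def)
      moreover have "UL z = 0" by (rule UL_outside(1)) (use z in \<open>auto simp: cone_def\<close>)
      ultimately show ?thesis by simp
    qed
    moreover have "\<bar>?u (Suc n) z\<bar> \<le> 2 * A * \<epsilon> * wt k z" if z: "z \<in> spacetime T" "z \<in> cone k" for z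
    proof -
      have "0 \<le> 2 * A * \<epsilon>" using A e by simp
      from duh_nlin_cone[OF k1 p this s c out u z]
      have "\<bar>duh (\<lambda>z. nlin p z (?u n z)) z\<bar> \<le> A * \<epsilon> * wt k z" by simp
      moreover have "\<bar>\<epsilon> * UL z\<bar> \<le> A * \<epsilon> * wt k z"
        using mult_left_mono[OF bspec[OF A(2) z(2)], of \<epsilon>] e by (simp add: abs_mult mult_ac)
      ultimately show ?thesis unfolding picard_u.simps by linarith
    qed
    ultimately show ?case by blast
  qed
  show ?thesis
  proof (cases "z \<in> cone k")
    case True
    then have "\<bar>?u n z\<bar> \<le> 2 * A * \<epsilon> * wt k z" using ind z by blast
    also have "\<dots> \<le> 2 * A * \<epsilon> * 1" using wt_cone(2)[OF k1 True] A e by (intro mult_left_mono) auto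
    finally show ?thesis by simp
  next
    case False
    then show ?thesis using ind z A e by simp
  qed
qed

section \<open>The lifespan conditions\<close>

text \<open>With \<delta> = 2 - p and \<beta> = \<delta> / 2 the powers of T + k + 2 add up to 3
  \<delta> / 2 + \<delta> / 2 = 2 \<delta>, and \<open>small\<close> becomes \<open>D * \<epsilon>
  powr p * (T + (k + 2)) powr (2 * \<delta>) \<le> A * \<epsilon>\<close>.\<close>

lemma small_subcritical:
  assumes k: "1 \<le> k" and p: "1 < p" "p < 2" and A: "0 < A"
  shows "\<exists>\<epsilon>\<^sub>0>0. \<exists>c>0. \<forall>\<epsilon> T. 0 < \<epsilon> \<and> \<epsilon> \<le> \<epsilon>\<^sub>0 \<and> 0 < T \<and> T \<le> c * \<epsilon> powr (- (p - 1) / (4 - 2 * p))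
    \<longrightarrow> small p k T ((2 - p) / 2) (2 * A * \<epsilon>)"
proof -
  define \<delta> \<beta> where "\<delta> = 2 - p" and "\<beta> = \<delta> / 2"
  have d: "0 < \<delta>" "0 < \<beta>" using p by (auto simp: \<delta>_def \<beta>_def)
  define D where "D = 4 * ((2 * A) powr p * (k + 2)) / \<beta> * ((\<beta> + 2) / \<beta>)"
  have D: "0 < D" using A k d by (simp add: D_def)
  define \<eta> where "\<eta> = A / D"
  have \<eta>: "0 < \<eta>" "D * \<eta> = A" using A D by (auto simp: \<eta>_def)
  \<comment> \<open>Half of the admissible size of T + k + 2 is reserved for the summand k +
    2.\<close>
  define c where "c = \<eta> powr (1 / (2 * \<delta>)) / 2"
  have c: "0 < c" using \<eta> by (simp add: c_def)
  define r where "r = (p - 1) / (2 * \<delta>)"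
  have r: "0 < r" using p d by (simp add: r_def)
  \<comment> \<open>The threshold at which \<open>c * \<epsilon> powr (- r)\<close> equals k +
    2.\<close>
  define \<epsilon>\<^sub>0 where "\<epsilon>\<^sub>0 = ((k + 2) / c) powr (- 1 / r)"
  have e0: "0 < \<epsilon>\<^sub>0" using k c by (simp add: \<epsilon>\<^sub>0_def)
  have main: "small p k T \<beta> (2 * A * \<epsilon>)" if e: "0 < \<epsilon>" "\<epsilon> \<le> \<epsilon>\<^sub>0" and T: "0 < T" "T \<le> c * \<epsilon> powr (- r)" for \<epsilon> T
  proof -
    have "\<epsilon>\<^sub>0 powr (- r) = (k + 2) / c" using r k c by (simp add: \<epsilon>\<^sub>0_def powr_powr)
    moreover have "\<epsilon>\<^sub>0 powr (- r) \<le> \<epsilon> powr (- r)" using e r by (intro powr_mono2') auto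
    ultimately have "(k + 2) / c \<le> \<epsilon> powr (- r)" by simp
    then have "k + 2 \<le> c * \<epsilon> powr (- r)" using c by (simp add: pos_divide_le_eq mult.commute)
    with T have "T + (k + 2) \<le> 2 * c * \<epsilon> powr (- r)" by simp
    then have "(T + (k + 2)) powr (2 * \<delta>) \<le> (\<eta> powr (1 / (2 * \<delta>)) * \<epsilon> powr (- r)) powr (2 * \<delta>)"
      using d T k by (intro powr_mono2) (auto simp: c_def)
    also have "\<dots> = \<eta> * \<epsilon> powr (- (p - 1))"
      using d \<eta> by (simp add: powr_mult powr_powr r_def)
    finally have X: "(T + (k + 2)) powr (2 * \<delta>) \<le> \<eta> * \<epsilon> powr (- (p - 1))" .
    have "4 * ((2 * A * \<epsilon>) powr p * (k + 2) * (T + (k + 2)) powr (3 * (2 - p) / 2)) / \<beta> * ((\<beta> + 2) / \<beta> * (T + (k + 2)) powr \<beta>)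
      = D * \<epsilon> powr p * ((T + (k + 2)) powr (3 * (2 - p) / 2) * (T + (k + 2)) powr \<beta>)"
      using A e by (simp add: D_def powr_mult)
    also have "(T + (k + 2)) powr (3 * (2 - p) / 2) * (T + (k + 2)) powr \<beta> = (T + (k + 2)) powr (2 * \<delta>)"
      unfolding powr_add[symmetric] by (rule arg_cong[where f="\<lambda>e. (T + (k + 2)) powr e"]) (simp add: \<delta>_def \<beta>_def field_simps)
    also have "D * \<epsilon> powr p * (T + (k + 2)) powr (2 * \<delta>) \<le> D * \<epsilon> powr p * (\<eta> * \<epsilon> powr (- (p - 1)))"
      using X D by (intro mult_left_mono) auto
    also have "\<dots> = A * (\<epsilon> powr p * \<epsilon> powr (- (p - 1)))" using \<eta>(2) by (metis mult.assoc mult.commute)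
    also have "\<epsilon> powr p * \<epsilon> powr (- (p - 1)) = \<epsilon>" unfolding powr_add[symmetric] using e by simp
    finally show ?thesis unfolding small_def using d by (simp add: \<beta>_def \<delta>_def)
  qed
  have "- (p - 1) / (4 - 2 * p) = - r" by (simp add: r_def \<delta>_def minus_divide_left)
  with main e0 c show ?thesis unfolding \<beta>_def \<delta>_def by metis
qed

text \<open>With L = ln (T + k + 2) and \<beta> = 1 / L the growth factor is e and the losses are L
  and 1 + 2 L. Thus \<open>small\<close> follows from \<epsilon> L^2 being below a constant, and the
  exponential bound on T keeps sqrt \<epsilon> times L bounded.\<close>

lemma small_critical:
  assumes k: "1 \<le> k" and A: "0 < A"
  shows "\<exists>\<epsilon>\<^sub>0>0. \<exists>c>0. \<forall>\<epsilon> T. 0 < \<epsilon> \<and> \<epsilon> \<le> \<epsilon>\<^sub>0 \<and> 0 < T \<and> T \<le> exp (c * \<epsilon> powr (- 1 / 2))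
    \<longrightarrow> small 2 k T (1 / ln (T + (k + 2))) (2 * A * \<epsilon>)"
proof -
  \<comment> \<open>144 = 16 * 3 * 3: the factor 16 is 4 * 2^2 from the definition of
    \<open>small\<close> with amplitude 2 A \<epsilon>, and the two threes bound 1 + 2 L by 3 L and
    e by 3.\<close>
  define \<eta> where "\<eta> = 1 / (144 * A * (k + 2))"
  have \<eta>: "0 < \<eta>" "144 * A * (k + 2) * \<eta> = 1" using A k by (auto simp: \<eta>_def)
  define l where "l = ln (1 + (k + 2))"
  have l: "0 < l" using k by (simp add: l_def)
  define c where "c = sqrt \<eta> / 2"
  have c: "0 < c" using \<eta> by (simp add: c_def)
  \<comment> \<open>For sqrt \<epsilon> \<le> c / l the summand l in L \<le> c / sqrt \<epsilon> + l
    costs no more than the main term, so sqrt \<epsilon> L \<le> 2 c = sqrt \<eta>.\<close>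
  define \<epsilon>\<^sub>0 where "\<epsilon>\<^sub>0 = (c / l)\<^sup>2"
  have e0: "0 < \<epsilon>\<^sub>0" using c l by (simp add: \<epsilon>\<^sub>0_def)
  have "small 2 k T (1 / ln (T + (k + 2))) (2 * A * \<epsilon>)"
    if e: "0 < \<epsilon>" "\<epsilon> \<le> \<epsilon>\<^sub>0" and T: "0 < T" "T \<le> exp (c * \<epsilon> powr (- 1 / 2))" for \<epsilon> T
  proof -
    define X L where "X = T + (k + 2)" and "L = ln X"
    have X: "3 \<le> X" using T k by (simp add: X_def)
    have "exp 1 \<le> X" using exp_le X by linarith
    then have L: "1 \<le> L" unfolding L_def using X by (simp add: ln_ge_iff)
    define s where "s = sqrt \<epsilon>"
    have s: "0 < s" "s\<^sup>2 = \<epsilon>" using e by (auto simp: s_def)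
    have "s \<le> c / l" using e c l unfolding s_def \<epsilon>\<^sub>0_def by (intro real_le_lsqrt) auto
    then have sl: "s * l \<le> c" using l by (simp add: field_simps)
    have es: "\<epsilon> powr (- 1 / 2) = 1 / s" unfolding s_def using powr_minus_half[OF e(1)] by simp
    have "X \<le> exp (c / s) * 1 + 1 * (k + 2)" using T(2) unfolding es by (simp add: X_def)
    also have "\<dots> \<le> exp (c / s) * 1 + exp (c / s) * (k + 2)" using k c s by (intro add_left_mono mult_right_mono) auto
    also have "\<dots> = exp (c / s) * (1 + (k + 2))" by (simp only: distrib_left)
    finally have "L \<le> ln (exp (c / s) * (1 + (k + 2)))" unfolding L_def using X by (subst ln_le_cancel_iff) auto
    also have "\<dots> = c / s + l" using k by (simp add: ln_mult l_def)
    finally have "s * L \<le> s * (c / s + l)" using s by (intro mult_left_mono) auto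
    also have "\<dots> \<le> 2 * c" using s sl by (simp add: distrib_left)
    finally have "s * L \<le> sqrt \<eta>" by (simp add: c_def)
    then have "(s * L)\<^sup>2 \<le> (sqrt \<eta>)\<^sup>2" using s L by (intro power_mono) auto
    then have eL: "\<epsilon> * L\<^sup>2 \<le> \<eta>" using \<eta> s by (simp add: power_mult_distrib)
    have XL: "X powr (1 / L) = exp 1" using X L by (simp add: powr_def L_def)
    have "4 * ((2 * A * \<epsilon>) powr 2 * (k + 2) * X powr (3 * (2 - 2) / 2)) / (1 / L) * ((1 / L + 2) / (1 / L) * X powr (1 / L))
      = 16 * A\<^sup>2 * \<epsilon>\<^sup>2 * (k + 2) * (L * (1 + 2 * L)) * exp 1"
      unfolding XL using A e X L by (simp add: powr_numeral power_mult_distrib field_simps)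
    also have "\<dots> \<le> 16 * A\<^sup>2 * \<epsilon>\<^sup>2 * (k + 2) * (L * (3 * L)) * 3"
      using exp_le L k by (intro mult_mono mult_left_mono) auto
    also have "\<dots> = (144 * A * (k + 2) * (\<epsilon> * L\<^sup>2)) * (A * \<epsilon>)" by (simp add: power2_eq_square)
    also have "\<dots> \<le> (144 * A * (k + 2) * \<eta>) * (A * \<epsilon>)"
      using eL A k e by (intro mult_right_mono mult_left_mono) auto
    also have "\<dots> = A * \<epsilon>" unfolding \<eta>(2) by simp
    finally show ?thesis unfolding small_def X_def[symmetric] L_def[symmetric] using L by simp
  qed
  with e0 c show ?thesis by metis
qed

section \<open>Existence and uniqueness for the integral equation\<close>

definition nlin' :: "real \<Rightarrow> (real^2) \<times> real \<Rightarrow> real \<Rightarrow> real" where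
  "nlin' p z a = p * sgp (p - 1) a / (1 + snd z) powr (p - 1)"

text \<open>The damping factor divides by a number at least 1, so the constants of the pure power
  function serve at all times.\<close>

lemma nlin_bounds:
  assumes z: "z \<in> spacetime T" and p: "1 < p" and a: "\<bar>a\<bar> \<le> B"
  shows "\<bar>b\<bar> \<le> B \<Longrightarrow> \<bar>nlin p z a - nlin p z b\<bar> \<le> p * B powr (p - 1) * \<bar>a - b\<bar>"
    and "p \<le> 2 \<Longrightarrow> \<bar>nlin' p z a - nlin' p z b\<bar> \<le> 2 * p * \<bar>a - b\<bar> powr (p - 1)"
    and "\<bar>nlin' p z a\<bar> \<le> p * B powr (p - 1)"
proof -
  define \<kappa> where "\<kappa> = (1 + snd z) powr (p - 1)"
  have k: "1 \<le> \<kappa>" unfolding \<kappa>_def using z p by (intro ge_one_powr_ge_zero) auto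
  have div: "\<bar>x / \<kappa>\<bar> \<le> \<bar>x\<bar>" for x
    using k by (simp add: abs_divide divide_le_eq mult_le_cancel_left1)
  show "\<bar>nlin p z a - nlin p z b\<bar> \<le> p * B powr (p - 1) * \<bar>a - b\<bar>" if "\<bar>b\<bar> \<le> B"
    using div[of "\<bar>a\<bar> powr p - \<bar>b\<bar> powr p"] abs_powr_lipschitz[OF p a that]
    unfolding nlin_def \<kappa>_def[symmetric] diff_divide_distrib[symmetric] by linarith
  show "\<bar>nlin' p z a - nlin' p z b\<bar> \<le> 2 * p * \<bar>a - b\<bar> powr (p - 1)" if "p \<le> 2"
  proof -
    have "\<bar>nlin' p z a - nlin' p z b\<bar> \<le> \<bar>p * sgp (p - 1) a - p * sgp (p - 1) b\<bar>"
      unfolding nlin'_def \<kappa>_def[symmetric] diff_divide_distrib[symmetric] by (rule div)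
    also have "\<dots> = p * \<bar>sgp (p - 1) a - sgp (p - 1) b\<bar>"
      using p by (simp add: right_diff_distrib[symmetric] abs_mult)
    also have "\<dots> \<le> p * (2 * \<bar>a - b\<bar> powr (p - 1))"
      using sgp_hoelder[of "p - 1" a b] p that by (intro mult_left_mono) auto
    finally show ?thesis by simp
  qed
  have "\<bar>nlin' p z a\<bar> \<le> \<bar>p * sgp (p - 1) a\<bar>" unfolding nlin'_def \<kappa>_def[symmetric] by (rule div)
  also have "\<dots> \<le> p * \<bar>a\<bar> powr (p - 1)" using p by (auto simp: sgp_def abs_mult sgn_if)
  also have "\<dots> \<le> p * B powr (p - 1)" using a p by (intro mult_left_mono powr_mono2) auto
  finally show "\<bar>nlin' p z a\<bar> \<le> p * B powr (p - 1)" .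
qed

lemma sgrad_nlin:
  assumes p: "1 < p" "p \<le> 2" and s: "sgrad T w G"
  shows "sgrad T (\<lambda>z. nlin p z (w z)) (\<lambda>z. nlin' p z (w z) *\<^sub>R G z)"
proof -
  have c: "continuous_on {0..<T} (\<lambda>s. 1 / (1 + s) powr (p - 1))"
    by (intro continuous_intros) auto
  have c': "continuous_on UNIV (\<lambda>a. p * sgp (p - 1) a)"
    by (intro continuous_intros continuous_on_sgp) (use p in auto)
  have "sgrad T (\<lambda>z. \<bar>w z\<bar> powr p * (1 / (1 + snd z) powr (p - 1)))
    (\<lambda>z. (1 / (1 + snd z) powr (p - 1)) *\<^sub>R ((p * sgp (p - 1) (w z)) *\<^sub>R G z) + (\<bar>w z\<bar> powr p) *\<^sub>R 0)"
    by (rule sgrad_mult[OF sgrad_real[OF s abs_powr_deriv[OF p(1)] c'] sgrad_time[OF c]])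
  then show ?thesis by (rule sgrad_cong) (simp_all add: nlin_def nlin'_def)
qed

text \<open>Within the slab the part of the forward cone that matters lies in a compact
  cylinder.\<close>

lemma bounded_slab:
  fixes h :: "(real^2) \<times> real \<Rightarrow> 'b::real_normed_vector"
  assumes c: "continuous_on UNIV h" and out: "\<And>z. 0 \<le> snd z \<Longrightarrow> snd z + k < norm (fst z) \<Longrightarrow> h z = 0"
  shows "\<exists>b\<ge>0. \<forall>z\<in>spacetime T. norm (h z) \<le> b"
proof -
  have "compact (h ` (cball 0 (T + k) \<times> {0..T}))"
    by (intro compact_continuous_image continuous_on_subset[OF c] compact_Times compact_cball) auto
  then have "bounded (h ` (cball 0 (T + k) \<times> {0..T}))" by (rule compact_imp_bounded)
  then obtain b where b: "\<forall>y\<in>h ` (cball 0 (T + k) \<times> {0..T}). norm y \<le> b" unfolding bounded_iff ..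
  have "norm (h z) \<le> max b 0" if z: "z \<in> spacetime T" for z
  proof (cases "snd z + k < norm (fst z)")
    case True
    then show ?thesis using out[of z] z by simp
  next
    case False
    then have "z \<in> cball 0 (T + k) \<times> {0..T}" using z by (auto simp: mem_Times_iff)
    then have "norm (h z) \<le> b" using b by blast
    then show ?thesis by simp
  qed
  then show ?thesis by (intro exI[of _ "max b 0"]) auto
qed

context free_wave
begin

lemma ULx_outside:
  assumes "0 \<le> snd z" "snd z + k < norm (fst z)"
  shows "ULx z = 0" and "b \<in> Basis \<Longrightarrow> ULxx b z = 0"
proof -
  have out: "ULx (x, snd z) = 0" if "snd z + k < norm x" for x
    by (rule grad_outside[where f="\<lambda>y. UL (y, snd z)" and G="\<lambda>x. ULx (x, snd z)" and k="snd z + k", OF UL_space_deriv _ that])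
      (use UL_outside(1) assms in auto)
  from out[of "fst z"] assms show "ULx z = 0" by simp
  assume b: "b \<in> Basis"
  have "ULxx b (fst z, snd z) = 0"
    by (rule grad_outside[where f="\<lambda>y. ULx (y, snd z) \<bullet> b" and G="\<lambda>x. ULxx b (x, snd z)" and k="snd z + k", OF ULx_space_deriv[OF b] _ assms(2)])
      (simp add: out)
  then show "ULxx b z = 0" by simp
qed

lemma continuous_on_ULx: "continuous_on S ULx"
  unfolding ULx_def[abs_def]
  by (intro continuous_intros continuous_on_Qmean continuous_on_Rmean cont)

lemma continuous_on_ULxx: "b \<in> Basis \<Longrightarrow> continuous_on S (ULxx b)"
  unfolding ULxx_def[abs_def]
  by (intro continuous_intros continuous_on_Qmean continuous_on_Rmean cont cKf cHp)

lemma sgrad_UL: "sgrad T (\<lambda>z. \<epsilon> * UL z) (\<lambda>z. \<epsilon> *\<^sub>R ULx z)"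
  unfolding sgrad_def
proof (intro conjI ballI allI)
  show "continuous_on (spacetime T) (\<lambda>z. \<epsilon> * UL z)"
    by (intro continuous_intros C_on_imp_continuous_on[OF C_on_subset[OF C2_UL]]) simp
  show "continuous_on (spacetime T) (\<lambda>z. \<epsilon> *\<^sub>R ULx z)" by (intro continuous_intros continuous_on_ULx)
  show "((\<lambda>y. \<epsilon> * UL (y, t)) has_derivative (\<lambda>h. (\<epsilon> *\<^sub>R ULx (x, t)) \<bullet> h)) (at x)" for t x
    using has_derivative_mult_right[OF UL_space_deriv] by (simp only: inner_scaleR_left)
qed

lemma sgrad_ULx:
  assumes b: "b \<in> Basis"
  shows "sgrad T (\<lambda>z. \<epsilon> * (ULx z \<bullet> b)) (\<lambda>z. \<epsilon> *\<^sub>R ULxx b z)"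
  unfolding sgrad_def
proof (intro conjI ballI allI)
  show "continuous_on (spacetime T) (\<lambda>z. \<epsilon> * (ULx z \<bullet> b))" by (intro continuous_intros continuous_on_ULx)
  show "continuous_on (spacetime T) (\<lambda>z. \<epsilon> *\<^sub>R ULxx b z)" by (intro continuous_intros continuous_on_ULxx b)
  show "((\<lambda>y. \<epsilon> * (ULx (y, t) \<bullet> b)) has_derivative (\<lambda>h. (\<epsilon> *\<^sub>R ULxx b (x, t)) \<bullet> h)) (at x)" for t x
    using has_derivative_mult_right[OF ULx_space_deriv[OF b]] by (simp only: inner_scaleR_left)
qed

text \<open>The nonlinearity depends on x only through u, so \<open>Nx\<close> is 0, and its
  derivative is Hoelder of order \<alpha> = p - 1. The constant B majorises both the Lipschitz
  constant \<open>p * E powr (p - 1)\<close> on the invariant ball and the Hoelder constant 2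
  p.\<close>

lemma integral_solution:
  assumes p: "1 < p" "p \<le> 2" and e: "0 < \<epsilon>" and A: "0 < A" "\<forall>z\<in>cone k. \<bar>UL z\<bar> \<le> A * wt k z"
    and s: "small p k T \<beta> (2 * A * \<epsilon>)"
  shows "\<exists>w G M. sgrad T w G \<and> (\<forall>z\<in>spacetime T. w z = \<epsilon> * UL z + duh (\<lambda>z. nlin p z (w z)) z \<and> \<bar>w z\<bar> \<le> 2 * A * \<epsilon> \<and> norm (G z) \<le> M
    \<and> G z = \<epsilon> *\<^sub>R ULx z + duh (\<lambda>z. nlin' p z (w z) *\<^sub>R G z) z)"
proof -
  have "\<exists>b\<ge>0. \<forall>z\<in>spacetime T. norm (\<epsilon> *\<^sub>R ULx z) \<le> b"
    by (rule bounded_slab[where k=k]) (intro continuous_intros continuous_on_ULx, simp add: ULx_outside)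
  then obtain b0 where b0: "0 \<le> b0" "\<And>z. z \<in> spacetime T \<Longrightarrow> norm (\<epsilon> *\<^sub>R ULx z) \<le> b0" by blast
  define E where "E = 2 * A * \<epsilon>"
  define B where "B = p * E powr (p - 1) + 2 * p"
  have E: "0 \<le> E" using A e by (simp add: E_def)
  have B: "0 \<le> B" "p * E powr (p - 1) \<le> B" "2 * p \<le> B" using p by (auto simp: B_def)
  have ap: "\<bar>picard_u (\<lambda>z. \<epsilon> * UL z) (nlin p) n z\<bar> \<le> E" if "z \<in> spacetime T" for n z
    unfolding E_def by (rule apriori[OF p e A s that])
  have "\<exists>w G M. sgrad T w G \<and> (\<forall>z\<in>spacetime T. w z = \<epsilon> * UL z + duh (\<lambda>z. nlin p z (w z)) z \<and> \<bar>w z\<bar> \<le> E \<and> norm (G z) \<le> M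
    \<and> G z = \<epsilon> *\<^sub>R ULx z + duh (\<lambda>z. 0 + nlin' p z (w z) *\<^sub>R G z) z)"
  proof (rule picard[where g="\<lambda>z. \<epsilon> * UL z" and g'="\<lambda>z. \<epsilon> *\<^sub>R ULx z" and Nl="nlin p" and Nx="\<lambda>z a. 0" and Nw="nlin' p" and \<alpha>="p - 1" and B=B and ?b0.0=b0,
      OF sgrad_UL b0(2) _ ap E B(1) b0(1)])
    show "sgrad T (\<lambda>z. nlin p z (w z)) (\<lambda>z. 0 + nlin' p z (w z) *\<^sub>R G z)" if "sgrad T w G" for w G
      unfolding add_0_left by (rule sgrad_nlin[OF p that])
    fix z :: "(real^2) \<times> real" and a b :: real assume z: "z \<in> spacetime T" and a: "\<bar>a\<bar> \<le> E"
    show "\<bar>nlin' p z a\<bar> \<le> B" using nlin_bounds(3)[OF z p(1) a] B by linarith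
    assume b: "\<bar>b\<bar> \<le> E"
    have "p * E powr (p - 1) * \<bar>a - b\<bar> \<le> B * \<bar>a - b\<bar>" using B by (intro mult_right_mono) auto
    then show "\<bar>nlin p z a - nlin p z b\<bar> \<le> B * \<bar>a - b\<bar>" using nlin_bounds(1)[OF z p(1) a b] by linarith
    have "2 * p * \<bar>a - b\<bar> powr (p - 1) \<le> B * \<bar>a - b\<bar> powr (p - 1)" using B by (intro mult_right_mono) auto
    then show "\<bar>nlin' p z a - nlin' p z b\<bar> \<le> B * \<bar>a - b\<bar> powr (p - 1)" using nlin_bounds(2)[OF z p(1) a p(2)] by (rule order_trans[rotated])
  qed (use p B in auto)
  then show ?thesis by (simp add: E_def)
qed

end

text \<open>The source N of v is a separate function agreeing with \<open>nlin\<close> on the slab,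
  so that the lemma serves solutions of (I) and, with N the wave operator of v, solutions of (P).
  Both functions are bounded on the compact backward cone, where the power is therefore
  Lipschitz.\<close>

lemma integral_unique:
  assumes p: "1 < p" and c: "continuous_on (spacetime T) v" "continuous_on (spacetime T) w"
    and cN: "continuous_on (spacetime T) N"
    and v: "\<And>z. z \<in> spacetime T \<Longrightarrow> v z = g z + duh N z" and N: "\<And>z. z \<in> spacetime T \<Longrightarrow> N z = nlin p z (v z)"
    and w: "\<And>z. z \<in> spacetime T \<Longrightarrow> w z = g z + duh (\<lambda>z. nlin p z (w z)) z"
    and z0: "z0 \<in> spacetime T"
  shows "v z0 = w z0"
proof -
  have sub: "bcone z0 \<subseteq> spacetime T" using z0 by (auto simp: bcone_def)
  have "bounded (v ` bcone z0)" "bounded (w ` bcone z0)"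
    by (intro compact_imp_bounded compact_continuous_image compact_bcone continuous_on_subset[OF c(1) sub] continuous_on_subset[OF c(2) sub])+
  then obtain b1 b2 where b: "\<forall>y\<in>v ` bcone z0. norm y \<le> b1" "\<forall>y\<in>w ` bcone z0. norm y \<le> b2"
    unfolding bounded_iff by blast
  define R where "R = max b1 b2"
  show ?thesis
  proof (rule duh_unique[OF c cN continuous_on_nlin[OF p c(2)] v w z0, where B="p * R powr (p - 1)"])
    show "norm (N z - nlin p z (w z)) \<le> p * R powr (p - 1) * norm (v z - w z)" if z: "z \<in> bcone z0" for z
    proof -
      have zS: "z \<in> spacetime T" using z sub by blast
      have "\<bar>v z\<bar> \<le> R" "\<bar>w z\<bar> \<le> R" using b z by (auto simp: R_def le_max_iff_disj)
      then show ?thesis unfolding N[OF zS] using nlin_bounds(1)[OF zS p, of "v z" R "w z"] by simp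
    qed
  qed (use p in auto)
qed

context free_wave
begin

lemma solves_I_iff:
  assumes g: "\<phi> = (\<lambda>x. f x + g x)" and p: "1 < p" and c: "continuous_on (spacetime T) u"
  shows "solves_I p \<epsilon> f g T u \<longleftrightarrow> (\<forall>z\<in>spacetime T. u z = \<epsilon> * UL z + duh (\<lambda>z. nlin p z (u z)) z)"
proof -
  have cF: "continuous_on (spacetime T) (\<lambda>z. \<bar>u z\<bar> powr p)"
    by (intro continuous_intros continuous_on_powr' c) (use p in auto)
  have e: "\<epsilon> * u_L f g x t + wave_L p (\<lambda>z. \<bar>u z\<bar> powr p) x t = \<epsilon> * UL (x, t) + duh (\<lambda>z. nlin p z (u z)) (x, t)"
    if "0 \<le> t" "t < T" for x t
    unfolding u_L_eq[OF g] wave_L_eq[OF cF that] nlin_def by (rule refl)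
  show ?thesis unfolding solves_I_def
  proof (intro iffI ballI allI)
    fix z assume h: "\<forall>x. \<forall>t\<in>{0..<T}. u (x, t) = \<epsilon> * u_L f g x t + wave_L p (\<lambda>z. \<bar>u z\<bar> powr p) x t" and z: "z \<in> spacetime T"
    have t: "0 \<le> snd z" "snd z < T" using z by auto
    have "u (fst z, snd z) = \<epsilon> * u_L f g (fst z) (snd z) + wave_L p (\<lambda>z. \<bar>u z\<bar> powr p) (fst z) (snd z)"
      by (rule bspec[OF spec[OF h]]) (use t in simp)
    then show "u z = \<epsilon> * UL z + duh (\<lambda>z. nlin p z (u z)) z" unfolding e[OF t] by simp
  next
    fix x t assume h: "\<forall>z\<in>spacetime T. u z = \<epsilon> * UL z + duh (\<lambda>z. nlin p z (u z)) z" and t: "t \<in> {0..<T}"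
    have t': "0 \<le> t" "t < T" using t by auto
    show "u (x, t) = \<epsilon> * u_L f g x t + wave_L p (\<lambda>z. \<bar>u z\<bar> powr p) x t"
      unfolding e[OF t'] by (rule bspec[OF h]) (use t' in simp)
  qed
qed

text \<open>The competitor in the uniqueness part is an arbitrary C^1 solution, possibly large and
  not supported in the cone; local uniqueness on backward cones covers it.\<close>

lemma wellposed_I:
  assumes g: "\<phi> = (\<lambda>x. f x + g x)" and p: "1 < p" "p \<le> 2" and e: "0 < \<epsilon>"
    and A: "0 < A" "\<forall>z\<in>cone k. \<bar>UL z\<bar> \<le> A * wt k z" and s: "small p k T \<beta> (2 * A * \<epsilon>)"
  shows "ex1_on (spacetime T) (\<lambda>u. C_on 1 (spacetime T) u \<and> solves_I p \<epsilon> f g T u)"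
proof -
  obtain w G M where sw: "sgrad T w G" and w0: "\<forall>z\<in>spacetime T. w z = \<epsilon> * UL z + duh (\<lambda>z. nlin p z (w z)) z \<and> \<bar>w z\<bar> \<le> 2 * A * \<epsilon> \<and> norm (G z) \<le> M
      \<and> G z = \<epsilon> *\<^sub>R ULx z + duh (\<lambda>z. nlin' p z (w z) *\<^sub>R G z) z"
    using integral_solution[OF p e A s] by (elim exE conjE) (rule that; assumption)
  have w: "w z = \<epsilon> * UL z + duh (\<lambda>z. nlin p z (w z)) z" if "z \<in> spacetime T" for z
    using bspec[OF w0 that] by (rule conjunct1)
  note cw = sgradD(1)[OF sw]
  have "C_on 1 (spacetime T) UL" by (rule C_on_subset[OF C_on_mono[OF _ C2_UL]]) simp_all
  then have "C_on 1 (spacetime T) (\<lambda>z. \<epsilon> * UL z + duh (\<lambda>z. nlin p z (w z)) z)"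
    by (intro C_on_add C_on_cmult C_on_duh_1[OF sgrad_nlin[OF p sw]])
  then have C1: "C_on 1 (spacetime T) w" by (rule C_on_cong) (rule w)
  have sI: "solves_I p \<epsilon> f g T w" unfolding solves_I_iff[OF g p(1) cw] using w by (rule ballI)
  have "v z = w z" if v: "C_on 1 (spacetime T) v \<and> solves_I p \<epsilon> f g T v" and z: "z \<in> spacetime T" for v z
  proof -
    have cv: "continuous_on (spacetime T) v" by (rule C_on_imp_continuous_on[OF conjunct1[OF v]])
    have v': "v z = \<epsilon> * UL z + duh (\<lambda>z. nlin p z (v z)) z" if "z \<in> spacetime T" for z
      using bspec[OF iffD1[OF solves_I_iff[OF g p(1) cv] conjunct2[OF v]] that] .
    show ?thesis by (rule integral_unique[OF p(1) cv cw continuous_on_nlin[OF p(1) cv] v' refl w z])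
  qed
  with C1 sI show ?thesis unfolding ex1_on_def by (intro exI[of _ w] conjI allI impI ballI)
qed

end

section \<open>Second derivatives and the critical case\<close>

lemma linear_regularity:
  assumes sc: "sgrad T c C'" and c: "\<And>z. z \<in> spacetime T \<Longrightarrow> \<bar>c z\<bar> \<le> B" "\<And>z. z \<in> spacetime T \<Longrightarrow> norm (C' z) \<le> B"
    and sg: "sgrad T g g'" and g: "\<And>z. z \<in> spacetime T \<Longrightarrow> \<bar>g z\<bar> \<le> b" "\<And>z. z \<in> spacetime T \<Longrightarrow> norm (g' z) \<le> b"
    and pos: "0 \<le> B" "0 \<le> b"
    and cv: "continuous_on (spacetime T) v" and v: "\<And>z. z \<in> spacetime T \<Longrightarrow> v z = g z + duh (\<lambda>z. c z * v z) z"
  shows "\<exists>H. sgrad T v H"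
proof -
  \<comment> \<open>Picard iteration yields a differentiable solution, and by uniqueness it is \<open>v\<close>.\<close>
  define u where "u = picard_u g (\<lambda>z a. c z * a)"
  have uS: "u (Suc n) z = g z + duh (\<lambda>z. c z * u n z) z" for n z by (simp add: u_def)
  have cu: "continuous_on (spacetime T) (u n)" for n
  proof (induction n)
    case 0
    show ?case by (simp add: u_def)
  next
    case (Suc n)
    have "u (Suc n) = (\<lambda>z. g z + duh (\<lambda>z. c z * u n z) z)" by (rule ext) (rule uS)
    then show ?case
      by (rule ssubst) (rule continuous_on_add[OF sgradD(1)[OF sg] continuous_on_duh[OF continuous_on_mult[OF sgradD(1)[OF sc] Suc.IH]]])
  qed
  define N where "N n z = c z * u n z" for n z
  have cN: "continuous_on (spacetime T) (N n)" for n
    unfolding N_def[abs_def] by (rule continuous_on_mult[OF sgradD(1)[OF sc] cu])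
  have uN: "u (Suc n) z = g z + duh (N n) z" for n z
    unfolding N_def[abs_def] by (rule uS)
  have NB: "norm (N n z) \<le> B * norm (u n z) + 0" if "z \<in> spacetime T" for n z
    using mult_right_mono[OF c(1)[OF that], of "\<bar>u n z\<bar>"] by (simp add: abs_mult N_def)
  have u0: "norm (u 0 z) \<le> b" for z using pos by (simp add: u_def)
  have gb: "norm (g z) \<le> b" if "z \<in> spacetime T" for z using g(1)[OF that] by simp
  \<comment> \<open>For a linear equation the radius of the invariant ball of \<open>picard\<close>
    is obtained from the iterates themselves.\<close>
  have "\<exists>M\<ge>0. \<forall>n. \<forall>z\<in>spacetime T. norm (u n z) \<le> M"
    by (rule bounded_iterates[where N=N and B=B and D=0 and ?D0.0=b and g=g and w=u, OF cN uN pos(1) order_refl pos(2) NB u0 gb])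
  then obtain M where M: "0 \<le> M" "\<forall>n. \<forall>z\<in>spacetime T. norm (u n z) \<le> M" by (elim exE conjE) (rule that)
  have inv: "\<bar>picard_u g (\<lambda>z a. c z * a) n z\<bar> \<le> M" if "z \<in> spacetime T" for n z
    using bspec[OF spec[OF M(2), of n] that] by (simp add: u_def)
  define B' where "B' = B + M * B"
  have B': "0 \<le> B'" "B \<le> B'" "M * B \<le> B'" using pos M by (auto simp: B'_def)
  have "\<exists>w H M'. sgrad T w H \<and> (\<forall>z\<in>spacetime T. w z = g z + duh (\<lambda>z. c z * w z) z \<and> \<bar>w z\<bar> \<le> M \<and> norm (H z) \<le> M'
    \<and> H z = g' z + duh (\<lambda>z. w z *\<^sub>R C' z + c z *\<^sub>R H z) z)"
  \<comment> \<open>The derivative in the unknown is c, the same for all arguments, so the Hoelder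
    condition holds trivially and \<alpha> = 1 may be taken.\<close>
  proof (rule picard[where Nl="\<lambda>z a. c z * a" and Nx="\<lambda>z a. a *\<^sub>R C' z" and Nw="\<lambda>z a. c z" and \<alpha>=1 and B=B' and ?b0.0=b,
      OF sg g(2) _ inv M(1) B'(1) pos(2)])
    show "sgrad T (\<lambda>z. c z * w z) (\<lambda>z. w z *\<^sub>R C' z + c z *\<^sub>R G z)" if "sgrad T w G" for w G
      by (rule sgrad_mult[OF sc that])
    fix z :: "(real^2) \<times> real" and a a' :: real assume z: "z \<in> spacetime T" and a: "\<bar>a\<bar> \<le> M"
    have cB: "\<bar>c z\<bar> \<le> B'" "norm (C' z) \<le> B'" using c[OF z] B' by linarith+
    show "\<bar>c z\<bar> \<le> B'" by (rule cB)
    have "\<bar>a\<bar> * norm (C' z) \<le> M * B" using a c(2)[OF z] M by (intro mult_mono) auto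
    then show "norm (a *\<^sub>R C' z) \<le> B'" using B' by simp
    show "\<bar>c z * a - c z * a'\<bar> \<le> B' * \<bar>a - a'\<bar>"
      unfolding right_diff_distrib[symmetric] abs_mult using cB by (intro mult_right_mono) auto
    have "\<bar>a - a'\<bar> * norm (C' z) \<le> \<bar>a - a'\<bar> * B'" using cB by (intro mult_left_mono) auto
    then show "norm (a *\<^sub>R C' z - a' *\<^sub>R C' z) \<le> B' * \<bar>a - a'\<bar>"
      unfolding scaleR_diff_left[symmetric] by (simp add: mult.commute)
    show "\<bar>c z - c z\<bar> \<le> B' * \<bar>a - a'\<bar> powr 1" using B' by simp
  qed simp_all
  then obtain w H M' where sw: "sgrad T w H" and w: "\<forall>z\<in>spacetime T. w z = g z + duh (\<lambda>z. c z * w z) z \<and> \<bar>w z\<bar> \<le> M \<and> norm (H z) \<le> M'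
    \<and> H z = g' z + duh (\<lambda>z. w z *\<^sub>R C' z + c z *\<^sub>R H z) z"
    by (elim exE conjE) (rule that; assumption)
  have wf: "w z = g z + duh (\<lambda>z. c z * w z) z" if "z \<in> spacetime T" for z
    using bspec[OF w that] by (rule conjunct1)
  have "v z = w z" if z: "z \<in> spacetime T" for z
  proof (rule duh_unique[OF cv sgradD(1)[OF sw] _ _ v wf z pos(1)])
    show "continuous_on (spacetime T) (\<lambda>z. c z * v z)" by (intro continuous_on_mult sgradD(1)[OF sc] cv)
    show "continuous_on (spacetime T) (\<lambda>z. c z * w z)" by (intro continuous_on_mult sgradD(1)[OF sc] sgradD(1)[OF sw])
    show "norm (c y * v y - c y * w y) \<le> B * norm (v y - w y)" if "y \<in> bcone z" for y
    proof -
      have "y \<in> spacetime T" using that z by (auto simp: bcone_def)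
      from mult_right_mono[OF c(1)[OF this], of "\<bar>v y - w y\<bar>"]
      show ?thesis by (simp add: right_diff_distrib[symmetric] abs_mult)
    qed
  qed
  then have "sgrad T v H" by (rule sgrad_cong[OF sw]) simp_all
  then show ?thesis by (rule exI[of _ H])
qed

lemma duh_sum:
  fixes F :: "'i \<Rightarrow> (real^2) \<times> real \<Rightarrow> real"
  assumes "finite I" and c: "\<And>i. i \<in> I \<Longrightarrow> continuous_on (spacetime T) (F i)" and z: "z \<in> spacetime T"
  shows "duh (\<lambda>z. \<Sum>i\<in>I. F i z) z = (\<Sum>i\<in>I. duh (F i) z)"
  using assms(1) c
proof (induction I)
  case empty
  show ?case by (simp add: duh_def)
next
  case (insert i I)
  have c1: "continuous_on (spacetime T) (F i)" by (rule insert.prems) simp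
  have c2: "continuous_on (spacetime T) (\<lambda>z. - (\<Sum>i\<in>I. F i z))"
    by (intro continuous_on_minus continuous_on_sum insert.prems) simp
  have "duh (F i) z - duh (\<lambda>z. - (\<Sum>i\<in>I. F i z)) z = duh (\<lambda>z. F i z - - (\<Sum>i\<in>I. F i z)) z"
    by (rule duh_diff[OF c1 c2 z])
  moreover have "duh (\<lambda>z. \<Sum>i\<in>I. F i z) z = (\<Sum>i\<in>I. duh (F i) z)" by (rule insert.IH) (rule insert.prems, simp)
  ultimately show ?case using insert.hyps by (simp add: duh_minus)
qed

section \<open>The wave equation in the critical case\<close>

text \<open>The second time derivative of the potential is the potential of the Laplacian plus F,
  and the Laplacian of the potential is the potential of the Laplacian; only F survives the
  difference.\<close>

lemma dalem_duh:
  assumes F: "sgrad T F G" and H: "\<And>b. b \<in> Basis \<Longrightarrow> sgrad T (\<lambda>z. G z \<bullet> b) (H b)" and z: "z \<in> spacetime T"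
  shows "dt T (duh F) z = duht F G z" "dalem T (duh F) z = F z"
proof -
  let ?V = "\<lambda>z. duh (\<lambda>z. \<Sum>b\<in>Basis. H b z \<bullet> b) z + F z"
  have G1: "((\<lambda>y. duh F (y, t)) has_derivative (\<lambda>h. duh G (x, t) \<bullet> h)) (at x)" if "0 \<le> t" "t < T" for x t
    by (rule sgradD(3)[OF sgrad_duh[OF F]]) (use that in simp)
  have U1: "((\<lambda>s. duh F (x, s)) has_vector_derivative duht F G (x, t)) (at t within {0..<T})" if "0 \<le> t" "t < T" for x t
    using has_derivative_time_slice[OF has_derivative_duh[OF F] that] that by simp
  have H1: "((\<lambda>y. duh G (y, t) \<bullet> b) has_derivative (\<lambda>h. duh (H b) (x, t) \<bullet> h)) (at x)" if b: "b \<in> Basis" and t: "0 \<le> t" "t < T" for x t b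
  proof -
    have "(\<lambda>y. duh G (y, t) \<bullet> b) = (\<lambda>y. duh (\<lambda>z. G z \<bullet> b) (y, t))"
      by (rule ext) (rule duh_inner[OF sgradD(2)[OF F]], use t in simp)
    then show ?thesis using sgradD(3)[OF sgrad_duh[OF H[OF b]], of t x] t by simp
  qed
  have V1: "((\<lambda>s. duht F G (x, s)) has_vector_derivative ?V (x, t)) (at t within {0..<T})" if "0 \<le> t" "t < T" for x t
    using has_derivative_time_slice[OF has_derivative_duht[OF F H] that] that by simp
  show "dt T (duh F) z = duht F G z" by (rule dalem_eq(1)[OF G1 U1 H1 V1 z])
  have "dalem T (duh F) z = ?V z - (\<Sum>b\<in>Basis. duh (H b) z \<bullet> b)" by (rule dalem_eq(2)[OF G1 U1 H1 V1 z])
  also have "duh (\<lambda>z. \<Sum>b\<in>Basis. H b z \<bullet> b) z = (\<Sum>b\<in>Basis. duh (\<lambda>z. H b z \<bullet> b) z)"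
    by (rule duh_sum[OF finite_Basis _ z]) (intro continuous_intros sgradD(2)[OF H])
  also have "\<dots> = (\<Sum>b\<in>Basis. duh (H b) z \<bullet> b)"
    by (rule sum.cong[OF refl]) (rule duh_inner[OF sgradD(2)[OF H] z, symmetric])
  finally show "dalem T (duh F) z = F z" by simp
qed

context free_wave
begin

lemma UL_dalem:
  assumes z: "z \<in> spacetime T"
  shows "dt T UL z = ULt z" "dalem T UL z = 0"
proof -
  show "dt T UL z = ULt z"
    by (rule dalem_eq(1)[where H=ULxx, OF UL_space_deriv UL_time_deriv ULx_space_deriv ULt_time_deriv z])
  have "dalem T UL z = ULtt z - (\<Sum>b\<in>Basis. ULxx b z \<bullet> b)"
    by (rule dalem_eq(2)[where H=ULxx, OF UL_space_deriv UL_time_deriv ULx_space_deriv ULt_time_deriv z])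
  then show "dalem T UL z = 0" using UL_wave[of z] by simp
qed

lemma bounded_data:
  assumes b: "b \<in> Basis"
  shows "\<exists>B\<ge>0. \<forall>z\<in>spacetime T. \<bar>\<epsilon> * (ULx z \<bullet> b)\<bar> \<le> B \<and> norm (\<epsilon> *\<^sub>R ULxx b z) \<le> B"
proof -
  have "\<exists>B\<ge>0. \<forall>z\<in>spacetime T. norm (\<epsilon> * (ULx z \<bullet> b)) \<le> B"
    by (rule bounded_slab[where k=k]) (intro continuous_intros continuous_on_ULx, simp add: ULx_outside)
  then obtain B1 where B1: "\<forall>z\<in>spacetime T. norm (\<epsilon> * (ULx z \<bullet> b)) \<le> B1" "0 \<le> B1" by (elim exE conjE) (rule that)
  have "\<exists>B\<ge>0. \<forall>z\<in>spacetime T. norm (\<epsilon> *\<^sub>R ULxx b z) \<le> B"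
    by (rule bounded_slab[where k=k]) (intro continuous_intros continuous_on_ULxx b, simp add: ULx_outside b)
  then obtain B2 where B2: "\<forall>z\<in>spacetime T. norm (\<epsilon> *\<^sub>R ULxx b z) \<le> B2" by (elim exE conjE) (rule that)
  show ?thesis
  proof (intro exI[of _ "max B1 B2"] conjI ballI)
    show "0 \<le> max B1 B2" using B1 by simp
    fix z assume z: "z \<in> spacetime T"
    show "\<bar>\<epsilon> * (ULx z \<bullet> b)\<bar> \<le> max B1 B2" using bspec[OF B1(1) z] by simp
    show "norm (\<epsilon> *\<^sub>R ULxx b z) \<le> max B1 B2" using bspec[OF B2 z] by simp
  qed
qed

text \<open>At p = 2 sign and absolute value recombine to a, so the coefficient in the gradient
  equation is as regular in space as the solution itself.\<close>

lemma nlin'_2: "0 \<le> snd z \<Longrightarrow> nlin' 2 z a = a * (2 / (1 + snd z))"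
  using sgn_mult_abs[of a] by (simp add: nlin'_def sgp_def)

text \<open>Existence upgrades the solution of (I): the components of its gradient solve a linear
  integral equation to which \<open>linear_regularity\<close> applies, and then the potential of the
  source is C^2. Uniqueness goes the other way, from (P) back to (I).\<close>

lemma wellposed_P:
  assumes \<phi>: "\<phi> = (\<lambda>x. f x + g x)" and e: "0 < \<epsilon>" and T: "0 < T"
    and A: "0 < A" "\<forall>z\<in>cone k. \<bar>UL z\<bar> \<le> A * wt k z" and s: "small 2 k T \<beta> (2 * A * \<epsilon>)"
  shows "ex1_on (spacetime T) (\<lambda>u. C_on 2 (spacetime T) u \<and> solves_P 2 \<epsilon> f g T u)"
proof -
  have p: "(1::real) < 2" "(2::real) \<le> 2" by simp_all
  obtain w G M where sw: "sgrad T w G" and w0: "\<forall>z\<in>spacetime T. w z = \<epsilon> * UL z + duh (\<lambda>z. nlin 2 z (w z)) z \<and> \<bar>w z\<bar> \<le> 2 * A * \<epsilon> \<and> norm (G z) \<le> M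
      \<and> G z = \<epsilon> *\<^sub>R ULx z + duh (\<lambda>z. nlin' 2 z (w z) *\<^sub>R G z) z"
    using integral_solution[OF p e A s] by (elim exE conjE) (rule that; assumption)
  have w: "w z = \<epsilon> * UL z + duh (\<lambda>z. nlin 2 z (w z)) z" "\<bar>w z\<bar> \<le> 2 * A * \<epsilon>" "norm (G z) \<le> M"
    "G z = \<epsilon> *\<^sub>R ULx z + duh (\<lambda>z. nlin' 2 z (w z) *\<^sub>R G z) z" if "z \<in> spacetime T" for z
    by (rule conjunct1[OF bspec[OF w0 that]], rule conjunct1[OF conjunct2[OF bspec[OF w0 that]]],
      rule conjunct1[OF conjunct2[OF conjunct2[OF bspec[OF w0 that]]]], rule conjunct2[OF conjunct2[OF conjunct2[OF bspec[OF w0 that]]]])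
  note cw = sgradD(1)[OF sw]
  define F where "F z = nlin 2 z (w z)" for z
  define c where "c z = nlin' 2 z (w z)" for z
  define C' where "C' z = (2 / (1 + snd z)) *\<^sub>R G z" for z
  have sF: "sgrad T F (\<lambda>z. c z *\<^sub>R G z)" unfolding F_def c_def by (rule sgrad_nlin[OF p sw])
  have cont2: "continuous_on {0..<T} (\<lambda>s. 2 / (1 + s))" by (intro continuous_intros) auto
  have sc: "sgrad T c C'"
    by (rule sgrad_cong[OF sgrad_mult[OF sw sgrad_time[OF cont2]]]) (simp_all add: c_def C'_def nlin'_2)
  have "(0, 0) \<in> spacetime T" using T by simp
  then have M: "0 \<le> M" using order_trans[OF norm_ge_zero w(3)] by blast
  \<comment> \<open>The first summand bounds the coefficient \<open>c\<close>, the second its space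
    gradient \<open>C'\<close>, both by 2 / (1 + t) \<le> 2.\<close>
  define B where "B = 2 * (2 * A * \<epsilon>) + 2 * M"
  have B: "0 \<le> B" using A e M by (simp add: B_def)
  have two: "0 \<le> 2 / (1 + snd z)" "2 / (1 + snd z) \<le> 2" if "z \<in> spacetime T" for z
    using that by (auto simp: divide_le_eq)
  have cB: "\<bar>c z\<bar> \<le> B" if z: "z \<in> spacetime T" for z
  proof -
    have "\<bar>c z\<bar> = \<bar>w z\<bar> * (2 / (1 + snd z))" using z two[OF z] by (simp add: c_def nlin'_2 abs_mult)
    also have "\<dots> \<le> 2 * A * \<epsilon> * 2" using w(2)[OF z] two[OF z] A e by (intro mult_mono) auto
    finally show ?thesis using M by (simp add: B_def)
  qed
  have CB: "norm (C' z) \<le> B" if z: "z \<in> spacetime T" for z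
  proof -
    have "norm (C' z) = (2 / (1 + snd z)) * norm (G z)" using two[OF z] by (simp add: C'_def)
    also have "\<dots> \<le> 2 * M" using w(3)[OF z] two[OF z] by (intro mult_mono) auto
    finally show ?thesis using mult_pos_pos[OF A(1) e] by (simp add: B_def)
  qed
  have "\<exists>H. sgrad T (\<lambda>z. G z \<bullet> b) H" if b: "b \<in> Basis" for b
  proof -
    obtain B1 where B1: "0 \<le> B1" "\<forall>z\<in>spacetime T. \<bar>\<epsilon> * (ULx z \<bullet> b)\<bar> \<le> B1 \<and> norm (\<epsilon> *\<^sub>R ULxx b z) \<le> B1"
      using bounded_data[OF b, of T \<epsilon>] by (elim exE conjE) (rule that)
    have cG: "continuous_on (spacetime T) (\<lambda>z. c z *\<^sub>R G z)" by (rule sgradD(2)[OF sF])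
    show ?thesis
    proof (rule linear_regularity[OF sc cB CB sgrad_ULx[OF b] _ _ B B1(1)])
      show "\<bar>\<epsilon> * (ULx z \<bullet> b)\<bar> \<le> B1" if "z \<in> spacetime T" for z using bspec[OF B1(2) that] ..
      show "norm (\<epsilon> *\<^sub>R ULxx b z) \<le> B1" if "z \<in> spacetime T" for z using bspec[OF B1(2) that] ..
      show "continuous_on (spacetime T) (\<lambda>z. G z \<bullet> b)" by (intro continuous_intros sgradD(2)[OF sw])
      show "G z \<bullet> b = \<epsilon> * (ULx z \<bullet> b) + duh (\<lambda>z. c z * (G z \<bullet> b)) z" if z: "z \<in> spacetime T" for z
      proof -
        have "G z \<bullet> b = (\<epsilon> *\<^sub>R ULx z + duh (\<lambda>z. c z *\<^sub>R G z) z) \<bullet> b" using w(4)[OF z] by (simp only: c_def)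
        also have "\<dots> = \<epsilon> * (ULx z \<bullet> b) + duh (\<lambda>z. (c z *\<^sub>R G z) \<bullet> b) z"
          by (simp only: inner_add_left inner_scaleR_left duh_inner[OF cG z])
        finally show ?thesis by (simp only: inner_scaleR_left)
      qed
    qed
  qed
  then have "\<forall>b\<in>Basis. \<exists>H. sgrad T (\<lambda>z. G z \<bullet> b) H" by blast
  from bchoice[OF this] obtain H where H: "\<forall>b\<in>Basis. sgrad T (\<lambda>z. G z \<bullet> b) (H b)" ..
  have HF: "sgrad T (\<lambda>z. (c z *\<^sub>R G z) \<bullet> b) (\<lambda>z. (G z \<bullet> b) *\<^sub>R C' z + c z *\<^sub>R H b z)" if b: "b \<in> Basis" for b
    unfolding inner_scaleR_left by (rule sgrad_mult[OF sc bspec[OF H b]])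
  \<comment> \<open>Written as a linear combination of two explicit functions, with the factor 1 in
    place, so that \<open>dalem_lincomb\<close> applies; on the slab it equals w.\<close>
  define u where "u z = \<epsilon> * UL z + 1 * duh F z" for z
  have uw: "u z = w z" if "z \<in> spacetime T" for z using w(1)[OF that] by (simp add: u_def F_def[abs_def])
  have C2: "C_on 2 (spacetime T) UL" "C_on 2 (spacetime T) (duh F)"
    by (rule C_on_subset[OF C2_UL subset_UNIV], rule C_on_duh_2[OF sF HF])
  have C2u: "C_on 2 (spacetime T) u" unfolding u_def[abs_def] by (intro C_on_add C_on_cmult C2)
  have Pu: "solves_P 2 \<epsilon> f g T u" unfolding solves_P_def
  proof (intro conjI allI ballI)
    fix x t assume "t \<in> {0..<T}"
    then have z: "(x, t) \<in> spacetime T" by simp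
    have dF: "dalem T (duh F) (x, t) = F (x, t)" by (rule dalem_duh(2)[OF sF HF z])
    have "dt T (dt T u) (x, t) - laplacian u (x, t) = dalem T u (x, t)" by (simp only: dalem_def)
    also have "\<dots> = \<epsilon> * 0 + 1 * F (x, t)"
      unfolding u_def[abs_def] dalem_lincomb(1)[OF C2 z] UL_dalem(2)[OF z] by (simp only: dF)
    also have "\<dots> = F (x, t)" by simp
    also have "\<dots> = \<bar>u (x, t)\<bar> powr 2 / (1 + t) powr (2 - 1)" unfolding F_def nlin_def uw[OF z] by simp
    finally show "dt T (dt T u) (x, t) - laplacian u (x, t) = \<bar>u (x, t)\<bar> powr 2 / (1 + t) powr (2 - 1)" .
  next
    fix x
    show "u (x, 0) = \<epsilon> * f x" by (simp add: u_def UL_init duh_def)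
    have z: "(x, 0) \<in> spacetime T" using T by simp
    have "dt T (duh F) (x, 0) = duht F (\<lambda>z. c z *\<^sub>R G z) (x, 0)" by (rule dalem_duh(1)[OF sF HF z])
    then have "dt T (duh F) (x, 0) = 0" by (simp add: duht_def)
    then show "dt T u (x, 0) = \<epsilon> * (f x + g x)"
      unfolding u_def[abs_def] dalem_lincomb(2)[OF C2 z] UL_dalem(1)[OF z] UL_init by (simp add: \<phi>)
  qed
  \<comment> \<open>The representation formula turns any C^2 solution of (P) into a solution of the
    integral equation with source \<open>dalem T v\<close>.\<close>
  have "v z = u z" if v: "C_on 2 (spacetime T) v \<and> solves_P 2 \<epsilon> f g T v" and z: "z \<in> spacetime T" for v z
  proof -
    have Cv: "C_on 2 (spacetime T) v" and Pv: "\<forall>x. \<forall>t\<in>{0..<T}. dt T (dt T v) (x, t) - laplacian v (x, t) = \<bar>v (x, t)\<bar> powr 2 / (1 + t) powr (2 - 1)"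
      and v0: "v (x, 0) = \<epsilon> * f x" and v1: "dt T v (x, 0) = \<epsilon> * (f x + g x)" for x
      using v unfolding solves_P_def by simp_all
    have Gf': "((\<lambda>x. \<epsilon> * f x) has_derivative (\<lambda>h. (\<epsilon> *\<^sub>R Gf x) \<bullet> h)) (at x)" for x
      using has_derivative_mult_right[OF Gf] by (simp only: inner_scaleR_left)
    have rep: "v z = \<epsilon> * UL z + duh (dalem T v) z" if "z \<in> spacetime T" for z
    proof -
      have "v z = Qmean (\<lambda>x. \<epsilon> * f x) (\<lambda>x. \<epsilon> *\<^sub>R Gf x) z + Rmean (\<lambda>x. \<epsilon> * (f x + g x)) z + duh (dalem T v) z"
        by (rule wave_representation_data[OF Cv v0 Gf' v1 that])
      also have "Qmean (\<lambda>x. \<epsilon> * f x) (\<lambda>x. \<epsilon> *\<^sub>R Gf x) z = \<epsilon> * Qmean f Gf z"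
        unfolding Qmean_def Bochner_Integration.integral_mult_right_zero[symmetric]
        by (simp add: algebra_simps)
      also have "Rmean (\<lambda>x. \<epsilon> * (f x + g x)) z = \<epsilon> * Rmean \<phi> z"
        unfolding Rmean_def Bochner_Integration.integral_mult_right_zero[symmetric] \<phi>
        by (simp add: mult.left_commute)
      finally show ?thesis by (simp add: UL_def distrib_left)
    qed
    have Nv: "dalem T v z = nlin 2 z (v z)" if z: "z \<in> spacetime T" for z
    proof -
      have "dt T (dt T v) (fst z, snd z) - laplacian v (fst z, snd z) = \<bar>v (fst z, snd z)\<bar> powr 2 / (1 + snd z) powr (2 - 1)"
        by (rule bspec[OF spec[OF Pv]]) (use z in simp)
      then show ?thesis by (simp only: dalem_def nlin_def prod.collapse)
    qed
    have "v z = w z"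
      by (rule integral_unique[OF p(1) C_on_imp_continuous_on[OF Cv] cw continuous_on_dalem[OF Cv] rep Nv w(1) z])
    then show ?thesis using uw[OF z] by simp
  qed
  with C2u Pu show ?thesis unfolding ex1_on_def by (intro exI[of _ u] conjI allI impI ballI)
qed

end

section \<open>Admissible data and the conclusion\<close>

lemma free_wave_of_data:
  assumes k: "1 \<le> k" and f: "C0 3 f" and g: "C0 2 g" and supp: "supp (\<lambda>x. (f x, g x)) \<subseteq> {x. norm x \<le> k}"
  shows "\<exists>Gf Gp Hf Hp Kf. free_wave k f (\<lambda>x. f x + g x) Gf Gp Hf Hp Kf"
proof -
  have out: "f x = 0 \<and> g x = 0" if "k < norm x" for x
  proof (rule ccontr)
    assume "\<not> (f x = 0 \<and> g x = 0)"
    then have "x \<in> {x. (f x, g x) \<noteq> 0}" by (auto simp: zero_prod_def)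
    then have "x \<in> supp (\<lambda>x. (f x, g x))" unfolding supp_def by (rule subsetD[OF closure_subset])
    then have "x \<in> {x. norm x \<le> k}" by (rule subsetD[OF supp])
    then show False using that by simp
  qed
  have f3: "C_on (Suc 2) UNIV f" using f by (simp add: C0_def numeral_3_eq_3)
  have g2: "C_on 2 UNIV g" using g by (simp add: C0_def)
  obtain Gf where Gf: "\<And>x. x \<in> UNIV \<Longrightarrow> (f has_derivative (\<lambda>h. Gf x \<bullet> h)) (at x within UNIV)"
    and G2: "\<And>b. b \<in> Basis \<Longrightarrow> C_on 2 UNIV (\<lambda>x. Gf x \<bullet> b)"
    by (rule C_on_Suc_grad[OF f3]) (rule that)
  \<comment> \<open>Second and third derivatives are packed into one pair q so that a single choice
    over b provides matching families.\<close>
  have "\<exists>q. (\<forall>x. ((\<lambda>x. Gf x \<bullet> b) has_derivative (\<lambda>h. fst q x \<bullet> h)) (at x))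
    \<and> (\<forall>c\<in>Basis. (\<forall>x. ((\<lambda>x. fst q x \<bullet> c) has_derivative (\<lambda>h. snd q c x \<bullet> h)) (at x)) \<and> continuous_on UNIV (snd q c))"
    if b: "b \<in> Basis" for b
  proof (rule C_on_2_grad[OF G2[OF b]])
    fix G1 H1
    assume "\<And>x. x \<in> UNIV \<Longrightarrow> ((\<lambda>x. Gf x \<bullet> b) has_derivative (\<lambda>h. G1 x \<bullet> h)) (at x within UNIV)"
      and "\<And>c x. c \<in> Basis \<Longrightarrow> x \<in> UNIV \<Longrightarrow> ((\<lambda>x. G1 x \<bullet> c) has_derivative (\<lambda>h. H1 c x \<bullet> h)) (at x within UNIV)"
      and "\<And>c. c \<in> Basis \<Longrightarrow> continuous_on UNIV (H1 c)"
    then show ?thesis by (intro exI[of _ "(G1, H1)"] conjI allI ballI) simp_all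
  qed
  then have "\<forall>b\<in>Basis. \<exists>q. (\<forall>x. ((\<lambda>x. Gf x \<bullet> b) has_derivative (\<lambda>h. fst q x \<bullet> h)) (at x))
    \<and> (\<forall>c\<in>Basis. (\<forall>x. ((\<lambda>x. fst q x \<bullet> c) has_derivative (\<lambda>h. snd q c x \<bullet> h)) (at x)) \<and> continuous_on UNIV (snd q c))"
    by (rule ballI)
  from bchoice[OF this] obtain q where q: "\<forall>b\<in>Basis. (\<forall>x. ((\<lambda>x. Gf x \<bullet> b) has_derivative (\<lambda>h. fst (q b) x \<bullet> h)) (at x))
    \<and> (\<forall>c\<in>Basis. (\<forall>x. ((\<lambda>x. fst (q b) x \<bullet> c) has_derivative (\<lambda>h. snd (q b) c x \<bullet> h)) (at x)) \<and> continuous_on UNIV (snd (q b) c))" ..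
  have "C_on 2 UNIV (\<lambda>x. f x + g x)" by (intro C_on_add C_on_SucD[OF f3] g2)
  then show ?thesis
  proof (rule C_on_2_grad)
    fix Gp Hp
    assume Gp: "\<And>x. x \<in> UNIV \<Longrightarrow> ((\<lambda>x. f x + g x) has_derivative (\<lambda>h. Gp x \<bullet> h)) (at x within UNIV)"
      and Hp: "\<And>c x. c \<in> Basis \<Longrightarrow> x \<in> UNIV \<Longrightarrow> ((\<lambda>x. Gp x \<bullet> c) has_derivative (\<lambda>h. Hp c x \<bullet> h)) (at x within UNIV)"
      and cHp: "\<And>c. c \<in> Basis \<Longrightarrow> continuous_on UNIV (Hp c)"
    have "free_wave k f (\<lambda>x. f x + g x) Gf Gp (\<lambda>b. fst (q b)) Hp (\<lambda>b. snd (q b))"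
    proof
      show "1 \<le> k" by (rule k)
      show "(f has_derivative (\<lambda>h. Gf x \<bullet> h)) (at x)" for x by (rule Gf) simp
      show "((\<lambda>x. Gf x \<bullet> b) has_derivative (\<lambda>h. fst (q b) x \<bullet> h)) (at x)" if "b \<in> Basis" for b x
        using bspec[OF q that] by (elim conjE) (rule spec)
      show "((\<lambda>x. fst (q b) x \<bullet> c) has_derivative (\<lambda>h. snd (q b) c x \<bullet> h)) (at x)" if "b \<in> Basis" "c \<in> Basis" for b c x
        using bspec[OF conjunct2[OF bspec[OF q that(1)]] that(2)] by (elim conjE) (rule spec)
      show "continuous_on UNIV (snd (q b) c)" if "b \<in> Basis" "c \<in> Basis" for b c
        using bspec[OF conjunct2[OF bspec[OF q that(1)]] that(2)] by (rule conjunct2)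
      show "((\<lambda>x. f x + g x) has_derivative (\<lambda>h. Gp x \<bullet> h)) (at x)" for x by (rule Gp) simp
      show "((\<lambda>x. Gp x \<bullet> b) has_derivative (\<lambda>h. Hp b x \<bullet> h)) (at x)" if "b \<in> Basis" for b x by (rule Hp[OF that]) simp
      show "continuous_on UNIV (Hp b)" if "b \<in> Basis" for b by (rule cHp[OF that])
      show "f x = 0" "f x + g x = 0" if "k < norm x" for x using out[OF that] by simp_all
    qed
    then show ?thesis by blast
  qed
qed

theorem theorem2p1:
  fixes p k :: real and f g :: "real^2 \<Rightarrow> real"
  assumes "1 < p" and "p \<le> 2" and "1 \<le> k"
    and "C0 3 f" and "C0 2 g"
    and "supp (\<lambda>x. (f x, g x)) \<subseteq> {x. norm x \<le> k}"
  shows "\<exists>\<epsilon>\<^sub>0>0. \<exists>c>0. \<forall>\<epsilon>. 0 < \<epsilon> \<and> \<epsilon> \<le> \<epsilon>\<^sub>0 \<longrightarrow>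
    (\<forall>T>0. T \<le> (if p < 2 then c * \<epsilon> powr (- (p - 1) / (4 - 2 * p))
                 else exp (c * \<epsilon> powr (- 1 / 2))) \<longrightarrow>
       (p = 2 \<longrightarrow> ex1_on (spacetime T) (\<lambda>u. C_on 2 (spacetime T) u \<and> solves_P p \<epsilon> f g T u)) \<and>
       (p < 2 \<longrightarrow> ex1_on (spacetime T) (\<lambda>u. C_on 1 (spacetime T) u \<and> solves_I p \<epsilon> f g T u)))"
proof -
  obtain Gf Gp Hf Hp Kf where fw: "free_wave k f (\<lambda>x. f x + g x) Gf Gp Hf Hp Kf"
    using free_wave_of_data[OF assms(3-6)] by (elim exE) (rule that)
  interpret free_wave k f "\<lambda>x. f x + g x" Gf Gp Hf Hp Kf by (rule fw)
  obtain A where A: "0 < A" "\<forall>z\<in>cone k. \<bar>UL z\<bar> \<le> A * wt k z"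
    using UL_decay by (elim exE conjE) (rule that)
  show ?thesis
  proof (cases "p < 2")
    case True
    obtain \<epsilon>\<^sub>0 c where e0: "0 < \<epsilon>\<^sub>0" and c: "0 < c"
      and small: "\<forall>\<epsilon> T. 0 < \<epsilon> \<and> \<epsilon> \<le> \<epsilon>\<^sub>0 \<and> 0 < T \<and> T \<le> c * \<epsilon> powr (- (p - 1) / (4 - 2 * p)) \<longrightarrow> small p k T ((2 - p) / 2) (2 * A * \<epsilon>)"
      using small_subcritical[OF assms(3,1) True A(1)] by (elim exE conjE) (rule that)
    show ?thesis
    proof (rule exI[of _ \<epsilon>\<^sub>0], rule conjI[OF e0], rule exI[of _ c], rule conjI[OF c], intro allI impI conjI)
      fix \<epsilon> T assume e: "0 < \<epsilon> \<and> \<epsilon> \<le> \<epsilon>\<^sub>0" and T: "0 < T"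
        and "T \<le> (if p < 2 then c * \<epsilon> powr (- (p - 1) / (4 - 2 * p)) else exp (c * \<epsilon> powr (- 1 / 2)))"
      then have "0 < \<epsilon> \<and> \<epsilon> \<le> \<epsilon>\<^sub>0 \<and> 0 < T \<and> T \<le> c * \<epsilon> powr (- (p - 1) / (4 - 2 * p))" using True by simp
      then have s: "small p k T ((2 - p) / 2) (2 * A * \<epsilon>)" by (rule mp[OF spec[OF spec[OF small]]])
      show "ex1_on (spacetime T) (\<lambda>u. C_on 1 (spacetime T) u \<and> solves_I p \<epsilon> f g T u)"
        by (rule wellposed_I[OF refl assms(1,2) conjunct1[OF e] A s])
    qed (use True in simp)
  next
    case False
    then have p: "p = 2" using assms(2) by simp
    \<comment> \<open>Here \<beta> varies with T, which is harmless: A depends on the free wave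
      alone, and the thresholds \<epsilon>_0 and c are fixed before T.\<close>
    obtain \<epsilon>\<^sub>0 c where e0: "0 < \<epsilon>\<^sub>0" and c: "0 < c"
      and small: "\<forall>\<epsilon> T. 0 < \<epsilon> \<and> \<epsilon> \<le> \<epsilon>\<^sub>0 \<and> 0 < T \<and> T \<le> exp (c * \<epsilon> powr (- 1 / 2)) \<longrightarrow> small 2 k T (1 / ln (T + (k + 2))) (2 * A * \<epsilon>)"
      using small_critical[OF assms(3) A(1)] by (elim exE conjE) (rule that)
    show ?thesis
    proof (rule exI[of _ \<epsilon>\<^sub>0], rule conjI[OF e0], rule exI[of _ c], rule conjI[OF c], intro allI impI conjI)
      fix \<epsilon> T assume e: "0 < \<epsilon> \<and> \<epsilon> \<le> \<epsilon>\<^sub>0" and T: "0 < T"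
        and "T \<le> (if p < 2 then c * \<epsilon> powr (- (p - 1) / (4 - 2 * p)) else exp (c * \<epsilon> powr (- 1 / 2)))"
      then have "0 < \<epsilon> \<and> \<epsilon> \<le> \<epsilon>\<^sub>0 \<and> 0 < T \<and> T \<le> exp (c * \<epsilon> powr (- 1 / 2))" using False by simp
      then have s: "small 2 k T (1 / ln (T + (k + 2))) (2 * A * \<epsilon>)" by (rule mp[OF spec[OF spec[OF small]]])
      show "ex1_on (spacetime T) (\<lambda>u. C_on 2 (spacetime T) u \<and> solves_P p \<epsilon> f g T u)"
        unfolding p by (rule wellposed_P[OF refl conjunct1[OF e] T A s])
    qed (use False in simp)
  qed
qed

end
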